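(* Let $F$ be a field of prime characteristic $p$ and let $r$ be a positive integer. Let $G$ be a group and $V$ an $FG$-module. Let $\mathcal{J}$ be the set of $p$-equivalence classes of partitions of $r$, and let $e_J$ ($J\in\mathcal{J}$) be pairwise orthogonal primitive idempotents of the descent algebra $D_{r,F}$ such that $1=\sum_{J\in\mathcal{J}}e_J$ and, for all $J\in\mathcal{J}$ and all partitions $\lambda$ of $r$, $(c_{r,F}(e_J))(\lambda)=1$ if $\lambda\in J$ and $(c_{r,F}(e_J))(\lambda)=0$ if $\lambda\notin J$. Then the $FG$-module $T^r(V)$ is the direct sum of its submodules $e_JT^r(V)$, $J\in\mathcal{J}$. For a given $J\in\mathcal{J}$, let $\lambda(1),\dots,\lambda(s)$ be the partitions belonging to $J$ in increasing lexicographic order. Then $e_JT^r(V)$ has a filtration by $FG$-submodules $$e_JT^r(V)=U_1\geq U_2\geq\cdots\geq U_s\geq U_{s+1}=0,$$ where, for $j=1,\dots,s$, we have $U_j/U_{j+1}\cong L^{\lambda(j)}(V)$ as $FG$-modules.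
   Context: $T(V)=\bigoplus_{r\ge0}T^r(V)$ is the tensor algebra of $V$ over $F$, $L(V)$ is the Lie subalgebra of $T(V)$ (bracket $[a,b]=ab-ba$) generated by $V$, a free Lie algebra on $V$, and $L^r(V)=T^r(V)\cap L(V)$. $S(V)=\bigoplus_{r\geq 0}S^r(V)$ is the symmetric algebra (free commutative associative algebra on a basis of $V$). The (right) action of $G$ on $V$ extends to $T(V)$ and $S(V)$ by algebra automorphisms. Higher Lie modules: for a partition $\lambda=(r^{m(r)},(r-1)^{m(r-1)},\dots,1^{m(1)})$ of $r$ (having $m(i)$ parts equal to $i$), $$L^\lambda(V)=S^{m(1)}(L^1(V))\otimes_F S^{m(2)}(L^2(V))\otimes_F\cdots\otimes_F S^{m(r)}(L^r(V)).$$ Lexicographic order on partitions of $r$: $(\lambda_1,\dots,\lambda_k)<^*(\theta_1,\dots,\theta_l)$ if there exists $i$ with $\lambda_i<\theta_i$ and $\lambda_j=\theta_j$ for all $j<i$. $p$-equivalence: partitions $\lambda,\theta$ of $r$ are $p$-equivalent if, for $\sigma_\lambda,\sigma_\theta\in\mathrm{Sym}(r)$ of cycle types $\lambda,\theta$, the element $\sigma_\lambda^{p^s}$ is conjugate to $\sigma_\theta^{p^s}$ for some positive integer $s$. Descent algebra: permutations act on the right on $\{1,\dots,r\}$, with $i(\sigma\tau)=(i\sigma)\tau$. For a composition $\nu=(\nu_1,\dots,\nu_k)$ of $r$, $X^\nu\in\mathbb{Z}\mathrm{Sym}(r)$ is the sum of all $\sigma\in\mathrm{Sym}(r)$ with $i\sigma<(i+1)\sigma$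 for every $i\in\{1,\dots,r-1\}$ not in $\{\nu_1,\nu_1+\nu_2,\dots,\nu_1+\cdots+\nu_{k-1}\}$. Solomon's descent algebra $D_{r,F}$ is the $F$-subalgebra of $F\,\mathrm{Sym}(r)$ with $F$-basis the elements $X^\nu$ (interpreted over $F$), $\nu$ running over compositions of $r$. Let $\phi^\nu$ be the Young character of $\mathrm{Sym}(r)$, i.e. the characteristic-$0$ character induced from the trivial character of $\mathrm{Sym}(\nu_1)\times\cdots\times\mathrm{Sym}(\nu_k)$, and let $\phi^{\nu,F}(\sigma)=\phi^\nu(\sigma)1_F$. Let $C_{r,F}$ be the $F$-span of the $\phi^{\nu,F}$, a subalgebra of the algebra of class functions $\mathrm{Sym}(r)\to F$. The surjective algebra homomorphism $c_{r,F}:D_{r,F}\to C_{r,F}$ is given by $c_{r,F}(X^\nu)=\phi^{\nu,F}$. For $\xi\in C_{r,F}$, $\xi(\lambda)$ denotes the value of $\xi$ on elements of cycle type $\lambda$. (Idempotents $e_J$ with the stated properties are known to exist.) $\mathrm{Sym}(r)$ acts on the left on $T^r(V)$ by place permutations, $\sigma(v_1v_2\cdots v_r)=v_{1\sigma}v_{2\sigma}\cdots v_{r\sigma}$ for $v_1,\dots,v_r\in V$; this makes $T^r(V)$ a left $D_{r,F}$-module, and $e_JT^r(V)=\{e_Jw:w\in T^r(V)\}$. *)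

theory Defs
  imports
    Complex_Main
    "HOL-Computational_Algebra.Primes"
    "HOL-Library.Poly_Mapping"
    "HOL-Library.Set_Algebras"
    "HOL-Library.FuncSet"
    "HOL-Combinatorics.Permutations"
    "HOL-Combinatorics.Orbits"
    "HOL-Algebra.Group"
begin

section \<open>Free vector spaces\<close>

text \<open>
  The free \<open>'f\<close>-vector space on a type \<open>'k\<close> is \<open>'k \<Rightarrow>\<^sub>0 'f\<close>;
  \<open>Poly_Mapping.single k 1\<close> is the basis vector belonging to \<open>k\<close>.
\<close>

definition pm_scale :: "'f::field \<Rightarrow> ('k \<Rightarrow>\<^sub>0 'f) \<Rightarrow> ('k \<Rightarrow>\<^sub>0 'f)" where
  "pm_scale c x = Poly_Mapping.map ((*) c) x"

lemma lookup_pm_scale [simp]: "Poly_Mapping.lookup (pm_scale c x) k = c * Poly_Mapping.lookup x k"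
  by (simp add: pm_scale_def Poly_Mapping.map.rep_eq when_def)

global_interpretation pm: vector_space pm_scale
  by standard (auto intro!: poly_mapping_eqI simp: lookup_add algebra_simps)

text \<open>Linear extension of a map between bases.\<close>

definition pm_push :: "('k \<Rightarrow> 'l) \<Rightarrow> ('k \<Rightarrow>\<^sub>0 'f::field) \<Rightarrow> ('l \<Rightarrow>\<^sub>0 'f)" where
  "pm_push h x = (\<Sum>k\<in>Poly_Mapping.keys x. Poly_Mapping.single (h k) (Poly_Mapping.lookup x k))"

text \<open>Bilinear extension of an operation on bases.\<close>

definition pm_bilin ::
    "('k \<Rightarrow> 'l \<Rightarrow> 'm) \<Rightarrow> ('k \<Rightarrow>\<^sub>0 'f::field) \<Rightarrow> ('l \<Rightarrow>\<^sub>0 'f) \<Rightarrow> ('m \<Rightarrow>\<^sub>0 'f)" where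
  "pm_bilin h x y =
     (\<Sum>k\<in>Poly_Mapping.keys x. \<Sum>l\<in>Poly_Mapping.keys y.
        Poly_Mapping.single (h k l) (Poly_Mapping.lookup x k * Poly_Mapping.lookup y l))"

section \<open>Modules over a group algebra\<close>

text \<open>
  A right \<open>FG\<close>-module is given by its carrier, its scalar multiplication and the right action of
  \<open>G\<close>. Addition is always the type class operation \<open>+\<close>; on cosets this is the elementwise sum of
  sets. The neutral element of the carrier need therefore not be the type class constant \<open>0\<close>:
  in a quotient by \<open>N\<close> it is the coset \<open>N\<close>.
\<close>

record ('f, 'g, 'm) fgmod = "'m partial_object" +
  scl :: "'f \<Rightarrow> 'm \<Rightarrow> 'm"
  act :: "'m \<Rightarrow> 'g \<Rightarrow> 'm"

text \<open>An \<open>FG\<close>-module whose underlying set is the whole type \<open>'v\<close>.\<close>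

locale fg_module = group G + vector_space "scl V"
  for G :: "('g, 'b) monoid_scheme" (structure)
  and V :: "('f::field, 'g, 'v::ab_group_add) fgmod" +
  assumes carrier_UNIV: "carrier V = UNIV"
    and act_add: "g \<in> carrier G \<Longrightarrow> act V (u + v) g = act V u g + act V v g"
    and act_scl: "g \<in> carrier G \<Longrightarrow> act V (scl V c v) g = scl V c (act V v g)"
    and act_one: "act V v \<one> = v"
    and act_mult: "g \<in> carrier G \<Longrightarrow> h \<in> carrier G \<Longrightarrow> act V v (g \<otimes> h) = act V (act V v g) h"

definition fg_submodule ::
    "('g, 'b) monoid_scheme \<Rightarrow> 'm set \<Rightarrow> ('f, 'g, 'm::comm_monoid_add) fgmod \<Rightarrow> bool" where
  "fg_submodule G U M \<longleftrightarrow> U \<subseteq> carrier M \<and> U \<noteq> {} \<and>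
     (\<forall>x\<in>U. \<forall>y\<in>U. x + y \<in> U) \<and>
     (\<forall>c. \<forall>x\<in>U. scl M c x \<in> U) \<and>
     (\<forall>g\<in>carrier G. \<forall>x\<in>U. act M x g \<in> U)"

definition fg_iso ::
    "('g, 'b) monoid_scheme \<Rightarrow> ('f, 'g, 'm::comm_monoid_add) fgmod \<Rightarrow>
     ('f, 'g, 'n::comm_monoid_add) fgmod \<Rightarrow> bool" where
  "fg_iso G M N \<longleftrightarrow> (\<exists>f. bij_betw f (carrier M) (carrier N) \<and>
     (\<forall>x\<in>carrier M. \<forall>y\<in>carrier M. f (x + y) = f x + f y) \<and>
     (\<forall>c. \<forall>x\<in>carrier M. f (scl M c x) = scl N c (f x)) \<and>
     (\<forall>g\<in>carrier G. \<forall>x\<in>carrier M. f (act M x g) = act N (f x) g))"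

text \<open>
  The quotient of \<open>M\<close> by a submodule \<open>N\<close>, with cosets as elements. Adding \<open>N\<close> in the scalar
  multiplication only matters for the scalar \<open>0\<close>.
\<close>

definition quot_mod ::
    "('f, 'g, 'm::comm_monoid_add) fgmod \<Rightarrow> 'm set \<Rightarrow> ('f, 'g, 'm set) fgmod" where
  "quot_mod M N =
     \<lparr>carrier = (\<lambda>x. x +o N) ` carrier M,
      scl = (\<lambda>c A. scl M c ` A + N),
      act = (\<lambda>A g. (\<lambda>x. act M x g) ` A + N)\<rparr>"

text \<open>The internal direct sum \<open>M = \<Oplus>\<^sub>J\<^sub>\<in>\<^sub>I U J\<close> of submodules, for a finite
  nonempty index set \<open>I\<close>.\<close>

definition fg_direct_sum ::
    "('g, 'b) monoid_scheme \<Rightarrow> ('f, 'g, 'm::comm_monoid_add) fgmod \<Rightarrow> 'i set \<Rightarrow> ('i \<Rightarrow> 'm set) \<Rightarrow>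
     bool" where
  "fg_direct_sum G M I U \<longleftrightarrow>
     (\<forall>J\<in>I. fg_submodule G (U J) M) \<and>
     (\<forall>m\<in>carrier M. \<exists>!x. x \<in> (\<Pi>\<^sub>E J\<in>I. U J) \<and> m = (\<Sum>J\<in>I. x J))"

text \<open>The free vector space on a set \<open>X\<close> of generators on which \<open>G\<close> acts via \<open>a\<close>.\<close>

definition free_mod :: "'k set \<Rightarrow> ('k \<Rightarrow> 'g \<Rightarrow> 'k) \<Rightarrow> ('f::field, 'g, 'k \<Rightarrow>\<^sub>0 'f) fgmod" where
  "free_mod X a =
     \<lparr>carrier = {x. Poly_Mapping.keys x \<subseteq> X},
      scl = pm_scale,
      act = (\<lambda>x g. pm_push (\<lambda>k. a k g) x)\<rparr>"

text \<open>
  The relations which make a map \<open>h\<close> from \<open>M\<close> to the generators of a free vector space linear.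
\<close>

definition linear_rels ::
    "('f::field, 'g, 'm::comm_monoid_add) fgmod \<Rightarrow> ('m \<Rightarrow> 'k) \<Rightarrow> ('k \<Rightarrow>\<^sub>0 'f) set" where
  "linear_rels M h =
     {Poly_Mapping.single (h (u + v)) 1 - Poly_Mapping.single (h u) 1 - Poly_Mapping.single (h v) 1
        | u v. u \<in> carrier M \<and> v \<in> carrier M} \<union>
     {Poly_Mapping.single (h (scl M c u)) 1 - Poly_Mapping.single (h u) c
        | c u. u \<in> carrier M}"

section \<open>Tensor algebra and free Lie algebra\<close>

text \<open>
  \<open>T(V)\<close> is the free associative algebra on the set \<open>V\<close>, whose basis is the set of words over \<open>V\<close>,
  modulo the two-sided ideal generated by the relations which make \<open>V \<rightarrow> T(V)\<close> linear.
\<close>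

definition tensor_ideal :: "('f::field, 'g, 'v::ab_group_add) fgmod \<Rightarrow> ('v list \<Rightarrow>\<^sub>0 'f) set" where
  "tensor_ideal V = pm.span (\<Union>xs ys. linear_rels V (\<lambda>v. xs @ v # ys))"

definition tensor_algebra ::
    "('f::field, 'g, 'v::ab_group_add) fgmod \<Rightarrow> ('f, 'g, ('v list \<Rightarrow>\<^sub>0 'f) set) fgmod" where
  "tensor_algebra V = quot_mod (free_mod UNIV (\<lambda>w g. map (\<lambda>v. act V v g) w)) (tensor_ideal V)"

definition tensor_mult ::
    "('f::field, 'g, 'v::ab_group_add) fgmod \<Rightarrow> ('v list \<Rightarrow>\<^sub>0 'f) set \<Rightarrow> ('v list \<Rightarrow>\<^sub>0 'f) set \<Rightarrow>
     ('v list \<Rightarrow>\<^sub>0 'f) set" where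
  "tensor_mult V A B = {pm_bilin (@) x y | x y. x \<in> A \<and> y \<in> B} + tensor_ideal V"

definition homogeneous :: "nat \<Rightarrow> ('v list \<Rightarrow>\<^sub>0 'f::field) \<Rightarrow> bool" where
  "homogeneous n x \<longleftrightarrow> (\<forall>w\<in>Poly_Mapping.keys x. length w = n)"

definition tensor_power ::
    "('f::field, 'g, 'v::ab_group_add) fgmod \<Rightarrow> nat \<Rightarrow> ('f, 'g, ('v list \<Rightarrow>\<^sub>0 'f) set) fgmod" where
  "tensor_power V n =
     (tensor_algebra V)\<lparr>carrier := (\<lambda>x. x +o tensor_ideal V) ` {x. homogeneous n x}\<rparr>"

inductive_set free_lie_algebra ::
    "('f::field, 'g, 'v::ab_group_add) fgmod \<Rightarrow> ('v list \<Rightarrow>\<^sub>0 'f) set set"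
  for V :: "('f::field, 'g, 'v::ab_group_add) fgmod" where
  gen: "v \<in> carrier V \<Longrightarrow> Poly_Mapping.single [v] 1 +o tensor_ideal V \<in> free_lie_algebra V"
| add: "a \<in> free_lie_algebra V \<Longrightarrow> b \<in> free_lie_algebra V \<Longrightarrow> a + b \<in> free_lie_algebra V"
| scale: "a \<in> free_lie_algebra V \<Longrightarrow> scl (tensor_algebra V) c a \<in> free_lie_algebra V"
| bracket: "a \<in> free_lie_algebra V \<Longrightarrow> b \<in> free_lie_algebra V \<Longrightarrow>
    tensor_mult V a b + scl (tensor_algebra V) (- 1) (tensor_mult V b a) \<in> free_lie_algebra V"

definition lie_power ::
    "('f::field, 'g, 'v::ab_group_add) fgmod \<Rightarrow> nat \<Rightarrow> ('f, 'g, ('v list \<Rightarrow>\<^sub>0 'f) set) fgmod" where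
  "lie_power V n =
     (tensor_algebra V)\<lparr>carrier := carrier (tensor_power V n) \<inter> free_lie_algebra V\<rparr>"

section \<open>Symmetric powers, tensor products and higher Lie modules\<close>

text \<open>
  \<open>S\<^sup>m(M)\<close>: the degree-\<open>m\<close> component of the free commutative algebra on the set \<open>M\<close>, whose basis
  consists of the multisets over \<open>M\<close>, modulo the ideal generated by the relations which make
  \<open>M \<rightarrow> S(M)\<close> linear.
\<close>

definition sym_power ::
    "('f::field, 'g, 'm::comm_monoid_add) fgmod \<Rightarrow> nat \<Rightarrow> ('f, 'g, ('m multiset \<Rightarrow>\<^sub>0 'f) set) fgmod"
where
  "sym_power M m =
     quot_mod
       (free_mod {A. set_mset A \<subseteq> carrier M \<and> size A = m} (\<lambda>A g. image_mset (\<lambda>x. act M x g) A))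
       (pm.span (\<Union>A\<in>{A. set_mset A \<subseteq> carrier M \<and> Suc (size A) = m}.
          linear_rels M (\<lambda>u. add_mset u A)))"

text \<open>
  The tensor product over \<open>F\<close> of a list of modules, as the vector space generated by the tuples
  (lists) of elements modulo the relations which make the tuples multilinear.
\<close>

definition tensor_product ::
    "('f::field, 'g, 'm::comm_monoid_add) fgmod list \<Rightarrow> ('f, 'g, ('m list \<Rightarrow>\<^sub>0 'f) set) fgmod" where
  "tensor_product Ms =
     quot_mod
       (free_mod (listset (map carrier Ms)) (\<lambda>xs g. map2 (\<lambda>M x. act M x g) Ms xs))
       (pm.span (\<Union>xs\<in>listset (map carrier Ms). \<Union>i<length Ms.
          linear_rels (Ms ! i) (\<lambda>u. xs[i := u])))"

definition higher_lie ::
    "('f::field, 'g, 'v::ab_group_add) fgmod \<Rightarrow> nat list \<Rightarrow>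
     ('f, 'g, ((('v list \<Rightarrow>\<^sub>0 'f) set multiset \<Rightarrow>\<^sub>0 'f) set list \<Rightarrow>\<^sub>0 'f) set) fgmod" where
  "higher_lie V lam =
     tensor_product (map (\<lambda>i. sym_power (lie_power V i) (count_list lam i)) [1..<Suc (sum_list lam)])"

section \<open>Partitions, compositions and permutations\<close>

definition partitions :: "nat \<Rightarrow> nat list set" where
  "partitions r = {lam. sorted_wrt (\<ge>) lam \<and> 0 \<notin> set lam \<and> sum_list lam = r}"

definition compositions :: "nat \<Rightarrow> nat list set" where
  "compositions r = {nu. 0 \<notin> set nu \<and> sum_list nu = r}"

definition lex_less :: "nat list \<Rightarrow> nat list \<Rightarrow> bool" where
  "lex_less lam theta \<longleftrightarrow>
     (\<exists>i. i < length lam \<and> i < length theta \<and> lam ! i < theta ! i \<and> (\<forall>j<i. lam ! j = theta ! j))"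

definition perms :: "nat \<Rightarrow> (nat \<Rightarrow> nat) set" where
  "perms r = {\<sigma>. \<sigma> permutes {1..r}}"

definition cycle_type :: "nat \<Rightarrow> (nat \<Rightarrow> nat) \<Rightarrow> nat list" where
  "cycle_type r \<sigma> =
     rev (sorted_list_of_multiset (image_mset card (mset_set (orbit \<sigma> ` {1..r}))))"

definition p_equiv :: "nat \<Rightarrow> nat \<Rightarrow> nat list \<Rightarrow> nat list \<Rightarrow> bool" where
  "p_equiv p r lam theta \<longleftrightarrow>
     (\<exists>\<sigma>\<in>perms r. \<exists>\<tau>\<in>perms r. cycle_type r \<sigma> = lam \<and> cycle_type r \<tau> = theta \<and>
        (\<exists>s>0. \<exists>\<pi>\<in>perms r. \<pi> \<circ> (\<sigma> ^^ (p ^ s)) \<circ> inv_into UNIV \<pi> = \<tau> ^^ (p ^ s)))"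

definition p_classes :: "nat \<Rightarrow> nat \<Rightarrow> nat list set set" where
  "p_classes p r =
     partitions r // {(lam, theta). lam \<in> partitions r \<and> theta \<in> partitions r \<and> p_equiv p r lam theta}"

section \<open>The descent algebra\<close>

text \<open>
  Elements of \<open>F Sym(r)\<close> are elements of \<open>(nat \<Rightarrow> nat) \<Rightarrow>\<^sub>0 'f\<close> supported on \<open>perms r\<close>. Permutations act
  on the right, \<open>i(\<sigma>\<tau>) = (i\<sigma>)\<tau>\<close>, so that the product \<open>\<sigma>\<tau>\<close> is \<open>\<tau> \<circ> \<sigma>\<close>.
\<close>

definition perm_mult ::
    "((nat \<Rightarrow> nat) \<Rightarrow>\<^sub>0 'f::field) \<Rightarrow> ((nat \<Rightarrow> nat) \<Rightarrow>\<^sub>0 'f) \<Rightarrow> ((nat \<Rightarrow> nat) \<Rightarrow>\<^sub>0 'f)" where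
  "perm_mult = pm_bilin (\<lambda>\<sigma> \<tau>. \<tau> \<circ> \<sigma>)"

definition perm_one :: "(nat \<Rightarrow> nat) \<Rightarrow>\<^sub>0 'f::field" where
  "perm_one = Poly_Mapping.single id 1"

definition descent_elem :: "nat list \<Rightarrow> ((nat \<Rightarrow> nat) \<Rightarrow>\<^sub>0 'f::field)" where
  "descent_elem nu =
     (\<Sum>\<sigma> | \<sigma> \<in> perms (sum_list nu) \<and>
        (\<forall>i\<in>{1..<sum_list nu} - {sum_list (take j nu) | j. 0 < j \<and> j < length nu}. \<sigma> i < \<sigma> (Suc i)).
        Poly_Mapping.single \<sigma> 1)"

definition descent_algebra :: "nat \<Rightarrow> ((nat \<Rightarrow> nat) \<Rightarrow>\<^sub>0 'f::field) set" where
  "descent_algebra r = pm.span (descent_elem ` compositions r)"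

definition idempotent_in :: "((nat \<Rightarrow> nat) \<Rightarrow>\<^sub>0 'f::field) set \<Rightarrow> ((nat \<Rightarrow> nat) \<Rightarrow>\<^sub>0 'f) \<Rightarrow> bool" where
  "idempotent_in D e \<longleftrightarrow> e \<in> D \<and> perm_mult e e = e"

definition primitive_idempotent_in ::
    "((nat \<Rightarrow> nat) \<Rightarrow>\<^sub>0 'f::field) set \<Rightarrow> ((nat \<Rightarrow> nat) \<Rightarrow>\<^sub>0 'f) \<Rightarrow> bool" where
  "primitive_idempotent_in D e \<longleftrightarrow> idempotent_in D e \<and> e \<noteq> 0 \<and>
     (\<forall>a b. idempotent_in D a \<and> idempotent_in D b \<and> perm_mult a b = 0 \<and> perm_mult b a = 0 \<and>
        e = a + b \<longrightarrow> a = 0 \<or> b = 0)"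

definition young_subgroup :: "nat list \<Rightarrow> (nat \<Rightarrow> nat) set" where
  "young_subgroup nu =
     {\<sigma>\<in>perms (sum_list nu).
        \<forall>j<length nu. \<sigma> ` {sum_list (take j nu)<..sum_list (take (Suc j) nu)} =
          {sum_list (take j nu)<..sum_list (take (Suc j) nu)}}"

definition induced_character ::
    "(nat \<Rightarrow> nat) set \<Rightarrow> (nat \<Rightarrow> nat) set \<Rightarrow> ((nat \<Rightarrow> nat) \<Rightarrow> rat) \<Rightarrow> (nat \<Rightarrow> nat) \<Rightarrow> rat" where
  "induced_character S H \<chi> \<sigma> =
     (\<Sum>\<tau> | \<tau> \<in> S \<and> \<tau> \<circ> \<sigma> \<circ> inv_into UNIV \<tau> \<in> H. \<chi> (\<tau> \<circ> \<sigma> \<circ> inv_into UNIV \<tau>)) / of_nat (card H)"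

definition young_character :: "nat list \<Rightarrow> (nat \<Rightarrow> nat) \<Rightarrow> rat" where
  "young_character nu = induced_character (perms (sum_list nu)) (young_subgroup nu) (\<lambda>_. 1)"

text \<open>Young characters are integer-valued, so the floor only changes the type.\<close>

definition young_character_field :: "nat list \<Rightarrow> (nat \<Rightarrow> nat) \<Rightarrow> 'f::field" where
  "young_character_field nu \<sigma> = of_int \<lfloor>young_character nu \<sigma>\<rfloor>"

text \<open>
  The linear map \<open>c\<^sub>r\<^sub>,\<^sub>F\<close>, which sends the elements of the basis
  \<open>descent_elem ` compositions r\<close> to the corresponding Young characters.
\<close>

definition descent_hom :: "nat \<Rightarrow> ((nat \<Rightarrow> nat) \<Rightarrow>\<^sub>0 'f::field) \<Rightarrow> (nat \<Rightarrow> nat) \<Rightarrow> 'f" where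
  "descent_hom r a \<sigma> =
     (\<Sum>nu\<in>compositions r.
        pm.representation (descent_elem ` compositions r) a (descent_elem nu) *
        young_character_field nu \<sigma>)"

section \<open>Place permutations\<close>

definition place_perm :: "(nat \<Rightarrow> nat) \<Rightarrow> 'v list \<Rightarrow> 'v list" where
  "place_perm \<sigma> w = map (\<lambda>i. w ! (\<sigma> i - 1)) [1..<Suc (length w)]"

text \<open>
  The action of \<open>F Sym(r)\<close> on \<open>T\<^sup>r(V)\<close>. The elements of \<open>T\<^sup>r(V)\<close> are cosets in the full free algebra,
  and the action is computed on their homogeneous representatives.
\<close>

definition place_action ::
    "('f::field, 'g, 'v::ab_group_add) fgmod \<Rightarrow> nat \<Rightarrow> ((nat \<Rightarrow> nat) \<Rightarrow>\<^sub>0 'f) \<Rightarrow>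
     ('v list \<Rightarrow>\<^sub>0 'f) set \<Rightarrow> ('v list \<Rightarrow>\<^sub>0 'f) set" where
  "place_action V r a A = pm_bilin place_perm a ` {x\<in>A. homogeneous r x} + tensor_ideal V"

end

theory Submission
  imports Defs "HOL-Library.Multiset_Order" "HOL-Library.Function_Algebras"
begin

text \<open>
  \<open>T(V)\<close> acts on the polynomials in a homogeneous basis of \<open>L(V)\<close> as in Serre's proof of the
  Poincare--Birkhoff--Witt theorem, and letting \<open>w \<in> T(V)\<close> act on 1 gives a normal form \<open>N w\<close>.
  The degrees of the factors of a monomial form a partition. Swapping two factors creates their
  bracket, which merges two parts and so increases the partition lexicographically (that is, in the
  multiset order). Hence products of Lie elements of degrees \<open>\<lambda>\<close> commute modulo higher
  partitions, and the layer of \<open>\<lambda>\<close> in the resulting filtration is the higher Lie module.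

  Lie elements are primitive for the unshuffle coproduct, so \<open>X\<^sup>\<nu>\<close> maps a product of Lie elements
  of degrees \<open>\<lambda>\<close> to the sum of its rearrangements indexed by the ways of distributing the factors
  over blocks of sizes \<open>\<nu>\<close>. Their number is the Young character \<open>\<phi>\<^sup>\<nu>\<close> at \<open>\<lambda>\<close>, so \<open>d\<close> in the
  descent algebra acts on the layer of \<open>\<lambda>\<close> by the scalar \<open>c(d)(\<lambda>)\<close>. Thus \<open>e\<^sub>J\<close> is the identity on
  the layers with \<open>\<lambda> \<in> J\<close> and kills the others.
\<close>

section \<open>Linear maps between free vector spaces\<close>

text \<open>In characteristic p symmetrization would divide by factorials, so T(V) can be compared
  with the symmetric algebra of L(V) only layer by layer. For this the layers must be known not to
  collapse: \<open>N\<close> vanishes exactly on the ideal that defines T(V), so the types of the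
  monomials in \<open>N x\<close> are invariants of the tensor represented by \<open>x\<close>.

  The modules in question are iterated quotients, with cosets of cosets as elements. Computations
  are made on representatives in free vector spaces, modulo relations. Two such modules are shown
  isomorphic by mapping both to one space of polynomials, with the same image and with kernels
  exactly the relations. For the layer of \<lambda> this space consists of the polynomials of type
  \<lambda>, and G acts on it through L(V).

  An idempotent is only triangular with respect to the layers, not diagonal. That its summand meets
  just the layers of its own class follows from looking at the least type of a nonzero element that
  it fixes: were this type outside the class, the idempotent would remove it.\<close>

definition pm_linear :: "(('k \<Rightarrow>\<^sub>0 'f::field) \<Rightarrow> ('l \<Rightarrow>\<^sub>0 'f)) \<Rightarrow> bool" where
  "pm_linear f \<longleftrightarrow> (\<forall>x y. f (x + y) = f x + f y) \<and> (\<forall>c x. f (pm_scale c x) = pm_scale c (f x))"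

definition pm_lin :: "('k \<Rightarrow> ('l \<Rightarrow>\<^sub>0 'f)) \<Rightarrow> ('k \<Rightarrow>\<^sub>0 'f::field) \<Rightarrow> ('l \<Rightarrow>\<^sub>0 'f)" where
  "pm_lin h x = (\<Sum>k\<in>Poly_Mapping.keys x. pm_scale (Poly_Mapping.lookup x k) (h k))"

lemma pm_linearI:
  "(\<And>x y. f (x + y) = f x + f y) \<Longrightarrow> (\<And>c x. f (pm_scale c x) = pm_scale c (f x)) \<Longrightarrow> pm_linear f"
  by (simp add: pm_linear_def)

lemma pm_linear_add: "pm_linear f \<Longrightarrow> f (x + y) = f x + f y"
  by (simp add: pm_linear_def)

lemma pm_linear_scale: "pm_linear f \<Longrightarrow> f (pm_scale c x) = pm_scale c (f x)"
  by (simp add: pm_linear_def)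

lemma pm_linear_0: "pm_linear f \<Longrightarrow> f 0 = 0"
  using pm_linear_scale[of f 0 0] by simp

lemma pm_linear_uminus: "pm_linear f \<Longrightarrow> f (- x) = - f x"
  using pm_linear_scale[of f "-1" x] by simp

lemma pm_linear_diff: "pm_linear f \<Longrightarrow> f (x - y) = f x - f y"
  using pm_linear_add[of f x "- y"] by (simp add: pm_linear_uminus)

lemma pm_linear_sum: "pm_linear f \<Longrightarrow> f (\<Sum>i\<in>I. g i) = (\<Sum>i\<in>I. f (g i))"
  by (induction I rule: infinite_finite_induct) (auto simp: pm_linear_0 pm_linear_add)

lemma pm_linear_compose: "pm_linear f \<Longrightarrow> pm_linear g \<Longrightarrow> pm_linear (\<lambda>x. f (g x))"
  by (simp add: pm_linear_def)

lemma pm_linear_id: "pm_linear (\<lambda>x. x)"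
  by (simp add: pm_linear_def)

lemma pm_linear_zero: "pm_linear (\<lambda>x. 0)"
  by (simp add: pm_linear_def)

lemma pm_linear_plus: "pm_linear f \<Longrightarrow> pm_linear g \<Longrightarrow> pm_linear (\<lambda>x. f x + g x)"
  by (simp add: pm_linear_def pm.scale_right_distrib add_ac)

lemma pm_linear_minus: "pm_linear f \<Longrightarrow> pm_linear g \<Longrightarrow> pm_linear (\<lambda>x. f x - g x)"
  by (simp add: pm_linear_def pm.scale_right_diff_distrib)

lemma pm_linear_scaled: "pm_linear f \<Longrightarrow> pm_linear (\<lambda>x. pm_scale c (f x))"
  by (simp add: pm_linear_def pm.scale_right_distrib mult.commute)

lemma pm_linear_setsum: "(\<And>i. i \<in> I \<Longrightarrow> pm_linear (f i)) \<Longrightarrow> pm_linear (\<lambda>x. \<Sum>i\<in>I. f i x)"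
  by (induction I rule: infinite_finite_induct) (auto simp: pm_linear_zero pm_linear_plus)

lemma pm_scale_single [simp]: "pm_scale c (Poly_Mapping.single k d) = Poly_Mapping.single k (c * d)"
  by (rule poly_mapping_eqI) (simp add: lookup_single when_def)

lemma keys_pm_scale: "Poly_Mapping.keys (pm_scale c x) \<subseteq> Poly_Mapping.keys x"
  by (auto simp: in_keys_iff)

lemma pm_lin_superset:
  "finite S \<Longrightarrow> Poly_Mapping.keys x \<subseteq> S \<Longrightarrow>
     pm_lin h x = (\<Sum>k\<in>S. pm_scale (Poly_Mapping.lookup x k) (h k))"
  unfolding pm_lin_def by (rule sum.mono_neutral_left) (auto simp: in_keys_iff)

lemma pm_linear_lin: "pm_linear (pm_lin h)"
proof (rule pm_linearI)
  fix x y :: "'a \<Rightarrow>\<^sub>0 'b"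
  let ?S = "Poly_Mapping.keys x \<union> Poly_Mapping.keys y"
  have "pm_lin h (x + y) = (\<Sum>k\<in>?S. pm_scale (Poly_Mapping.lookup (x + y) k) (h k))"
    by (rule pm_lin_superset) (use keys_add[of x y] in auto)
  also have "\<dots> = pm_lin h x + pm_lin h y"
    by (simp add: pm_lin_superset[of ?S] lookup_add pm.scale_left_distrib sum.distrib)
  finally show "pm_lin h (x + y) = pm_lin h x + pm_lin h y" .
next
  fix c and x :: "'a \<Rightarrow>\<^sub>0 'b"
  show "pm_lin h (pm_scale c x) = pm_scale c (pm_lin h x)"
    using pm_lin_superset[OF finite_keys keys_pm_scale, of h c x]
    by (simp add: pm_lin_def pm.scale_sum_right)
qed

lemma pm_lin_single [simp]: "pm_lin h (Poly_Mapping.single k c) = pm_scale c (h k)"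
  by (cases "c = 0") (auto simp: pm_lin_def)

lemma pm_expand: "x = (\<Sum>k\<in>Poly_Mapping.keys x. Poly_Mapping.single k (Poly_Mapping.lookup x k))"
  by (rule poly_mapping_eqI)
     (auto simp: lookup_sum lookup_single when_def in_keys_iff if_distrib cong: if_cong)

lemma pm_linear_eq_lin:
  assumes "pm_linear f"
  shows "f x = pm_lin (\<lambda>k. f (Poly_Mapping.single k 1)) x"
proof -
  have "f x = (\<Sum>k\<in>Poly_Mapping.keys x. f (Poly_Mapping.single k (Poly_Mapping.lookup x k)))"
    by (subst pm_expand[of x]) (simp add: pm_linear_sum[OF assms])
  also have "\<dots> = pm_lin (\<lambda>k. f (Poly_Mapping.single k 1)) x"
    unfolding pm_lin_def
    by (rule sum.cong[OF refl]) (simp add: pm_linear_scale[OF assms, symmetric])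
  finally show ?thesis .
qed

lemma pm_lin_cong: "(\<And>k. k \<in> Poly_Mapping.keys x \<Longrightarrow> h k = h' k) \<Longrightarrow> pm_lin h x = pm_lin h' x"
  by (simp add: pm_lin_def)

text \<open>Testing only the basis vectors in the support of \<open>x\<close> allows maps to be
  compared that agree on homogeneous elements, or on elements supported on a given set, but not
  everywhere.\<close>

lemma pm_linear_eqI:
  assumes "pm_linear f" "pm_linear g"
    and "\<And>k. k \<in> Poly_Mapping.keys x \<Longrightarrow> f (Poly_Mapping.single k 1) = g (Poly_Mapping.single k 1)"
  shows "f x = g x"
proof -
  have "f x = pm_lin (\<lambda>k. f (Poly_Mapping.single k 1)) x"
    by (rule pm_linear_eq_lin[OF assms(1)])
  also have "\<dots> = pm_lin (\<lambda>k. g (Poly_Mapping.single k 1)) x"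
    by (rule pm_lin_cong) (rule assms(3))
  also have "\<dots> = g x"
    by (rule pm_linear_eq_lin[OF assms(2), symmetric])
  finally show ?thesis .
qed

lemma pm_linear_in_subspace:
  assumes "pm_linear f" "pm.subspace S"
    and "\<And>k. k \<in> Poly_Mapping.keys x \<Longrightarrow> f (Poly_Mapping.single k 1) \<in> S"
  shows "f x \<in> S"
  by (subst pm_linear_eq_lin[OF assms(1)], unfold pm_lin_def)
     (intro pm.subspace_sum pm.subspace_scale assms)

lemma pm_lin_id: "pm_lin (\<lambda>k. Poly_Mapping.single k 1) x = x"
  using pm_linear_eq_lin[OF pm_linear_id, of x] by simp

lemma pm_linear_subspace_vimage:
  "pm_linear f \<Longrightarrow> pm.subspace S \<Longrightarrow> pm.subspace {x. f x \<in> S}"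
  by (auto simp: pm.subspace_def pm_linear_0 pm_linear_add pm_linear_scale)

lemma pm_linear_subspace_image:
  assumes "pm_linear f" "pm.subspace S" shows "pm.subspace (f ` S)"
  unfolding pm.subspace_def
  using assms pm_linear_add[OF assms(1)] pm_linear_scale[OF assms(1)] pm_linear_0[OF assms(1)]
  by (auto simp: pm.subspace_def image_iff) metis+

lemma pm_linear_span_subset:
  assumes "pm_linear f" "pm.subspace S" "\<And>b. b \<in> B \<Longrightarrow> f b \<in> S" "x \<in> pm.span B"
  shows "f x \<in> S"
  using pm.span_minimal[of B "{x. f x \<in> S}"] pm_linear_subspace_vimage[OF assms(1,2)] assms(3,4)
  by auto

lemma pm_linear_kernel_span:
  assumes "pm_linear f" "\<And>b. b \<in> B \<Longrightarrow> f b = 0" "x \<in> pm.span B"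
  shows "f x = 0"
  using pm_linear_span_subset[OF assms(1), of "{0}" B x] assms by simp

lemma subspace_keys: "pm.subspace {x. Poly_Mapping.keys x \<subseteq> X}"
  unfolding pm.subspace_def
  by (auto dest!: subsetD[OF keys_add] subsetD[OF keys_pm_scale])

lemma pm_push_lin: "pm_push h = pm_lin (\<lambda>k. Poly_Mapping.single (h k) 1)"
  by (rule ext) (simp add: pm_push_def pm_lin_def)

lemma pm_linear_push: "pm_linear (pm_push h)"
  by (simp add: pm_push_lin pm_linear_lin)

lemma pm_push_single [simp]: "pm_push h (Poly_Mapping.single k c) = Poly_Mapping.single (h k) c"
  by (simp add: pm_push_lin)

lemma keys_pm_lin: "Poly_Mapping.keys (pm_lin h x) \<subseteq> (\<Union>k\<in>Poly_Mapping.keys x. Poly_Mapping.keys (h k))"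
  unfolding pm_lin_def
  by (rule order_trans[OF keys_sum]) (intro UN_mono subset_refl keys_pm_scale)

lemma keys_pm_push: "Poly_Mapping.keys (pm_push h x) \<subseteq> h ` Poly_Mapping.keys x"
  unfolding pm_push_lin by (rule order_trans[OF keys_pm_lin]) auto

lemma pm_bilin_lin: "pm_bilin h x y = pm_lin (\<lambda>k. pm_lin (\<lambda>l. Poly_Mapping.single (h k l) 1) y) x"
  by (simp add: pm_bilin_def pm_lin_def pm.scale_sum_right)

lemma pm_linear_lin_left: "(\<And>k. pm_linear (f k)) \<Longrightarrow> pm_linear (\<lambda>y. pm_lin (\<lambda>k. f k y) x)"
  unfolding pm_lin_def by (rule pm_linear_setsum, rule pm_linear_scaled)

lemma pm_linear_bilin1: "pm_linear (\<lambda>x. pm_bilin h x y)"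
  by (simp add: pm_bilin_lin pm_linear_lin)

lemma pm_linear_bilin2: "pm_linear (\<lambda>y. pm_bilin h x y)"
  unfolding pm_bilin_lin by (rule pm_linear_lin_left) (rule pm_linear_lin)

lemma pm_bilin_single [simp]:
  "pm_bilin h (Poly_Mapping.single k c) (Poly_Mapping.single l d) = Poly_Mapping.single (h k l) (c * d)"
  by (simp add: pm_bilin_lin)

section \<open>The free associative algebra as a monoid ring\<close>

text \<open>With concatenation as the addition of words,
  \<open>'v list \<Rightarrow>\<^sub>0 'f\<close> is the monoid ring of the free monoid, that is the
  free associative algebra, with the ring operations of the type classes. Families of words
  \<open>nat \<Rightarrow> 'v list\<close> then form a monoid pointwise, and its monoid ring houses
  the tensor powers of the free algebra.\<close>

instantiation list :: (type) monoid_add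
begin

definition zero_list :: "'a list" where "zero_list = []"

definition plus_list :: "'a list \<Rightarrow> 'a list \<Rightarrow> 'a list" where "plus_list = (@)"

instance
  by standard (simp_all add: zero_list_def plus_list_def)

end

lemma pm_scale_eq_mult: "pm_scale c (x :: 'a::monoid_add \<Rightarrow>\<^sub>0 'f::field) = Poly_Mapping.single 0 c * x"
  by (simp add: pm_scale_def mult_map_scale_conv_mult)

lemma pm_scale_mult_left: "pm_scale c (x :: 'a::monoid_add \<Rightarrow>\<^sub>0 'f::field) * y = pm_scale c (x * y)"
  by (simp add: pm_scale_eq_mult mult.assoc)

lemma pm_linear_mult_right: "pm_linear (\<lambda>x :: 'a::monoid_add \<Rightarrow>\<^sub>0 'f::field. x * y)"
  by (rule pm_linearI) (simp_all add: distrib_right pm_scale_mult_left)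

lemma single_mult_scale:
  "x * Poly_Mapping.single 0 c = Poly_Mapping.single 0 c * (x :: 'a::monoid_add \<Rightarrow>\<^sub>0 'f::field)"
proof -
  have "pm_linear (\<lambda>x :: 'a \<Rightarrow>\<^sub>0 'f. Poly_Mapping.single 0 c * x)"
    unfolding pm_scale_eq_mult[symmetric] by (rule pm_linear_scaled[OF pm_linear_id])
  then show ?thesis
    by (rule pm_linear_eqI[of "\<lambda>x. x * Poly_Mapping.single 0 c" "\<lambda>x. Poly_Mapping.single 0 c * x",
          OF pm_linear_mult_right]) (simp add: mult_single)
qed

lemma pm_scale_mult_right: "x * pm_scale c (y :: 'a::monoid_add \<Rightarrow>\<^sub>0 'f::field) = pm_scale c (x * y)"
  unfolding pm_scale_eq_mult by (metis mult.assoc single_mult_scale)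

lemma pm_linear_mult_left: "pm_linear (\<lambda>x :: 'a::monoid_add \<Rightarrow>\<^sub>0 'f::field. y * x)"
  by (rule pm_linearI) (simp_all add: distrib_left pm_scale_mult_right)

lemma pm_bilin_append: "pm_bilin (@) x y = x * (y :: 'v list \<Rightarrow>\<^sub>0 'f::field)"
proof (rule pm_linear_eqI[of "\<lambda>x. pm_bilin (@) x y"])
  fix k
  show "pm_bilin (@) (Poly_Mapping.single k 1) y = Poly_Mapping.single k 1 * y"
    by (rule pm_linear_eqI[of "pm_bilin (@) (Poly_Mapping.single k 1)"])
       (simp_all add: pm_linear_bilin2 pm_linear_mult_left mult_single plus_list_def)
qed (simp_all add: pm_linear_bilin1 pm_linear_mult_right)

lemma pm_linear_mult_eqI:
  fixes f :: "('a::monoid_add \<Rightarrow>\<^sub>0 'f::field) \<Rightarrow> ('b::monoid_add \<Rightarrow>\<^sub>0 'f)"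
  assumes f: "pm_linear f"
    and single: "\<And>k l. f (Poly_Mapping.single (k + l) 1) =
      f (Poly_Mapping.single k 1) * f (Poly_Mapping.single l 1)"
  shows "f (x * y) = f x * f y"
proof (rule pm_linear_eqI[of "\<lambda>x. f (x * y)" "\<lambda>x. f x * f y"])
  show "pm_linear (\<lambda>x. f (x * y))" "pm_linear (\<lambda>x. f x * f y)"
    by (rule pm_linear_compose[OF f pm_linear_mult_right]
        pm_linear_compose[OF pm_linear_mult_right f])+
next
  fix k
  show "f (Poly_Mapping.single k 1 * y) = f (Poly_Mapping.single k 1) * f y"
  proof (rule pm_linear_eqI[of "\<lambda>y. f (Poly_Mapping.single k 1 * y)"
        "\<lambda>y. f (Poly_Mapping.single k 1) * f y"])
    show "pm_linear (\<lambda>y. f (Poly_Mapping.single k 1 * y))"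
      "pm_linear (\<lambda>y. f (Poly_Mapping.single k 1) * f y)"
      by (rule pm_linear_compose[OF f pm_linear_mult_left]
          pm_linear_compose[OF pm_linear_mult_left f])+
  qed (simp add: mult_single single)
qed

section \<open>Modules presented by generators and relations\<close>

text \<open>
  \<^term>\<open>presents G M q C K t\<close> says that \<^term>\<open>q\<close> induces an isomorphism from \<^term>\<open>C / K\<close>, with
  \<^term>\<open>G\<close> acting by \<^term>\<open>t\<close>, onto \<^term>\<open>M\<close>.
\<close>

definition presents ::
    "('g, 'b) monoid_scheme \<Rightarrow> ('f::field, 'g, 'm::comm_monoid_add) fgmod \<Rightarrow> (('k \<Rightarrow>\<^sub>0 'f) \<Rightarrow> 'm) \<Rightarrow>
     ('k \<Rightarrow>\<^sub>0 'f) set \<Rightarrow> ('k \<Rightarrow>\<^sub>0 'f) set \<Rightarrow> (('k \<Rightarrow>\<^sub>0 'f) \<Rightarrow> 'g \<Rightarrow> ('k \<Rightarrow>\<^sub>0 'f)) \<Rightarrow> bool" where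
  "presents G M q C K t \<longleftrightarrow>
     pm.subspace C \<and> pm.subspace K \<and> K \<subseteq> C \<and> carrier M = q ` C \<and>
     (\<forall>g\<in>carrier G. pm_linear (\<lambda>x. t x g)) \<and>
     (\<forall>g\<in>carrier G. \<forall>x\<in>C. t x g \<in> C) \<and> (\<forall>g\<in>carrier G. \<forall>x\<in>K. t x g \<in> K) \<and>
     (\<forall>x\<in>C. \<forall>y\<in>C. q (x + y) = q x + q y) \<and>
     (\<forall>c. \<forall>x\<in>C. scl M c (q x) = q (pm_scale c x)) \<and>
     (\<forall>g\<in>carrier G. \<forall>x\<in>C. act M (q x) g = q (t x g)) \<and>
     (\<forall>x\<in>C. \<forall>y\<in>C. q x = q y \<longleftrightarrow> x - y \<in> K)"

lemma presentsI:
  assumes "pm.subspace C" "pm.subspace K" "K \<subseteq> C" "carrier M = q ` C"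
    "\<And>g. g \<in> carrier G \<Longrightarrow> pm_linear (\<lambda>x. t x g)"
    "\<And>g x. g \<in> carrier G \<Longrightarrow> x \<in> C \<Longrightarrow> t x g \<in> C"
    "\<And>g x. g \<in> carrier G \<Longrightarrow> x \<in> K \<Longrightarrow> t x g \<in> K"
    "\<And>x y. x \<in> C \<Longrightarrow> y \<in> C \<Longrightarrow> q (x + y) = q x + q y"
    "\<And>c x. x \<in> C \<Longrightarrow> scl M c (q x) = q (pm_scale c x)"
    "\<And>g x. g \<in> carrier G \<Longrightarrow> x \<in> C \<Longrightarrow> act M (q x) g = q (t x g)"
    "\<And>x y. x \<in> C \<Longrightarrow> y \<in> C \<Longrightarrow> q x = q y \<longleftrightarrow> x - y \<in> K"
  shows "presents G M q C K t"
  using assms unfolding presents_def by simp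

lemma presentsD:
  assumes "presents G M q C K t"
  shows "pm.subspace C" "pm.subspace K" "K \<subseteq> C" "carrier M = q ` C"
    "g \<in> carrier G \<Longrightarrow> pm_linear (\<lambda>x. t x g)"
    "g \<in> carrier G \<Longrightarrow> x \<in> C \<Longrightarrow> t x g \<in> C"
    "g \<in> carrier G \<Longrightarrow> x \<in> K \<Longrightarrow> t x g \<in> K"
    "x \<in> C \<Longrightarrow> y \<in> C \<Longrightarrow> q (x + y) = q x + q y"
    "x \<in> C \<Longrightarrow> scl M c (q x) = q (pm_scale c x)"
    "g \<in> carrier G \<Longrightarrow> x \<in> C \<Longrightarrow> act M (q x) g = q (t x g)"
    "x \<in> C \<Longrightarrow> y \<in> C \<Longrightarrow> q x = q y \<longleftrightarrow> x - y \<in> K"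
  using assms unfolding presents_def by blast+

text \<open>The coset of \<open>q x\<close> modulo the image of \<open>D\<close> is the image of
  \<open>x + D\<close> under \<open>q\<close>, so the quotient is again presented on
  \<open>C\<close>, now with kernel \<open>D\<close>. This is what unwinds the iterated quotients in
  the definitions of the modules.\<close>

lemma presents_quot:
  assumes M: "presents G M q C K t" and D: "pm.subspace D" "K \<subseteq> D" "D \<subseteq> C"
    and tD: "\<And>g x. g \<in> carrier G \<Longrightarrow> x \<in> D \<Longrightarrow> t x g \<in> D"
  shows "presents G (quot_mod M (q ` D)) (\<lambda>x. q x +o q ` D) C D t"
proof -
  note P = M[unfolded presents_def]
  have C: "pm.subspace C" and add: "\<And>x y. x \<in> C \<Longrightarrow> y \<in> C \<Longrightarrow> q (x + y) = q x + q y" using P by auto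
  have eq: "q x +o q ` D = (\<lambda>d. q (x + d)) ` D" if "x \<in> C" for x
    using add[OF that] D(3) by (force simp: elt_set_plus_def)
  have d0: "0 \<in> D" using D(1) by (rule pm.subspace_0)
  have ker: "q x = q y \<longleftrightarrow> x - y \<in> K" if "x \<in> C" "y \<in> C" for x y using P that by blast
  have inC: "x + d \<in> C" if "x \<in> C" "d \<in> D" for x d
    using that D(3) pm.subspace_add[OF C] by blast
  have q3: "q (x + d) + q d' = q (x + (d + d'))" if "x \<in> C" "d \<in> D" "d' \<in> D" for x d d'
    using that D(3) inC add[of "x + d" d'] by (auto simp: add.assoc)
  have 1: "q (x + y) +o q ` D = (q x +o q ` D) + (q y +o q ` D)" if "x \<in> C" "y \<in> C" for x y
  proof -
    have xy: "x + y \<in> C" using that C by (rule pm.subspace_add[rotated])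
    have *: "q (x + d1) + q (y + d2) = q (x + y + (d1 + d2))" if "d1 \<in> D" "d2 \<in> D" for d1 d2
      using add[OF inC[OF \<open>x \<in> C\<close> that(1)] inC[OF \<open>y \<in> C\<close> that(2)]] by (simp add: add_ac)
    show ?thesis unfolding eq[OF that(1)] eq[OF that(2)] eq[OF xy]
    proof (intro equalityI subsetI)
      fix u assume "u \<in> (\<lambda>d. q (x + y + d)) ` D"
      then obtain d where "d \<in> D" "u = q (x + y + d)" by auto
      then have "u = q (x + d) + q (y + 0)" using *[of d 0] d0 by simp
      then show "u \<in> (\<lambda>d. q (x + d)) ` D + (\<lambda>d. q (y + d)) ` D"
        using \<open>d \<in> D\<close> d0 by (blast intro: set_plus_intro)
    next
      fix u assume "u \<in> (\<lambda>d. q (x + d)) ` D + (\<lambda>d. q (y + d)) ` D"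
      then obtain d1 d2 where "d1 \<in> D" "d2 \<in> D" "u = q (x + d1) + q (y + d2)"
        by (auto elim!: set_plus_elim)
      then show "u \<in> (\<lambda>d. q (x + y + d)) ` D"
        using * pm.subspace_add[OF D(1)] by auto
    qed
  qed
  \<comment> \<open>Scalar multiplication and group action are handled together: \<open>f\<close> is
    the operation on representatives and \<open>\<phi>\<close> the one on the module. The added
    summand restores the full coset, since \<open>f\<close> may map \<open>D\<close> onto a proper
    part of \<open>D\<close>, as for the scalar 0.\<close>
  have 23: "\<phi> ` (\<lambda>d. q (x + d)) ` D + q ` D = (\<lambda>d. q (f x + d)) ` D"
    if x: "x \<in> C" and fC: "f x \<in> C" and f: "pm_linear f" and fD: "\<And>d. d \<in> D \<Longrightarrow> f d \<in> D"
      and \<phi>: "\<And>x. x \<in> C \<Longrightarrow> \<phi> (q x) = q (f x)" for \<phi> f x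
  proof (intro equalityI subsetI)
    fix u assume "u \<in> \<phi> ` (\<lambda>d. q (x + d)) ` D + q ` D"
    then obtain d1 d2 where d: "d1 \<in> D" "d2 \<in> D" "u = \<phi> (q (x + d1)) + q d2"
      by (auto elim!: set_plus_elim)
    then have "u = q (f x + (f d1 + d2))"
      using q3[OF fC fD, of d1 d2] \<phi> inC[OF x] by (simp add: pm_linear_add[OF f])
    then show "u \<in> (\<lambda>d. q (f x + d)) ` D"
      using d fD pm.subspace_add[OF D(1)] by auto
  next
    fix u assume "u \<in> (\<lambda>d. q (f x + d)) ` D"
    then obtain d where d: "d \<in> D" "u = q (f x + d)" by auto
    then have "u = \<phi> (q (x + 0)) + q d"
      using q3[OF fC d0 d(1)] \<phi>[OF x] by simp
    then show "u \<in> \<phi> ` (\<lambda>d. q (x + d)) ` D + q ` D"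
      using d d0 by (blast intro: set_plus_intro)
  qed
  have 2: "scl (quot_mod M (q ` D)) c (q x +o q ` D) = q (pm_scale c x) +o q ` D" if "x \<in> C" for x c
  proof -
    have "pm_scale c x \<in> C" using that C by (simp add: pm.subspace_scale)
    with 23[of x "pm_scale c" "scl M c"] show ?thesis
      using that P pm.subspace_scale[OF D(1)] pm_linear_scaled[OF pm_linear_id, of c]
      by (simp add: eq quot_mod_def)
  qed
  have 3: "act (quot_mod M (q ` D)) (q x +o q ` D) g = q (t x g) +o q ` D"
    if "x \<in> C" and g: "g \<in> carrier G" for x g
  proof -
    have "t x g \<in> C" using that P by blast
    with 23[of x "\<lambda>x. t x g" "\<lambda>x. act M x g"] show ?thesis
      using that P tD[OF g] by (simp add: eq quot_mod_def)
  qed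
  have 4: "q x +o q ` D = q y +o q ` D \<longleftrightarrow> x - y \<in> D" if "x \<in> C" "y \<in> C" for x y
  proof
    assume "q x +o q ` D = q y +o q ` D"
    then have "q (x + 0) \<in> (\<lambda>d. q (y + d)) ` D"
      unfolding eq[OF that(1)] eq[OF that(2)] using d0 by blast
    then obtain d where d: "d \<in> D" "q x = q (y + d)" by auto
    then have "x - (y + d) \<in> K" using ker that inC by blast
    then have "x - (y + d) + d \<in> D" using d D by (intro pm.subspace_add) auto
    then show "x - y \<in> D" by simp
  next
    assume xy: "x - y \<in> D"
    have sub: "(\<lambda>d. q (x + d)) ` D \<subseteq> (\<lambda>d. q (y + d)) ` D" if "x - y \<in> D" for x y
    proof (rule image_subsetI)
      fix d assume "d \<in> D"
      then have "q (x + d) = q (y + (x - y + d))" "x - y + d \<in> D"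
        using that pm.subspace_add[OF D(1)] by simp_all
      then show "q (x + d) \<in> (\<lambda>d. q (y + d)) ` D" by (rule image_eqI)
    qed
    have "y - x \<in> D" using pm.subspace_neg[OF D(1) xy] by simp
    then show "q x +o q ` D = q y +o q ` D"
      unfolding eq[OF that(1)] eq[OF that(2)] using sub xy by (intro equalityI)
  qed
  have 0: "carrier (quot_mod M (q ` D)) = (\<lambda>x. q x +o q ` D) ` C"
    using P by (simp add: quot_mod_def image_image)
  show ?thesis
    by (rule presentsI[OF presentsD(1)[OF M] D(1) D(3) 0 presentsD(5)[OF M] presentsD(6)[OF M] tD 1 2 3 4])
qed

text \<open>The relations in \<open>K\<close> need not lie in the smaller space \<open>D\<close>,
  whence the kernel \<open>K \<inter> D\<close>.\<close>

lemma presents_carrier: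
  assumes M: "presents G M q C K t" and D: "pm.subspace D" "D \<subseteq> C"
    and tD: "\<And>g x. g \<in> carrier G \<Longrightarrow> x \<in> D \<Longrightarrow> t x g \<in> D"
  shows "presents G (M\<lparr>carrier := q ` D\<rparr>) q D (K \<inter> D) t"
proof (rule presentsI)
  fix x y assume "x \<in> D" "y \<in> D"
  then show "(q x = q y) = (x - y \<in> K \<inter> D)"
    using presentsD(11)[OF M, of x y] D by (auto simp: pm.subspace_diff)
qed (use presentsD[OF M] D tD in \<open>auto simp: pm.subspace_inter subset_iff\<close>)

lemma presents_free:
  fixes X :: "'k set"
  assumes "\<And>g x. g \<in> carrier G \<Longrightarrow> x \<in> X \<Longrightarrow> a x g \<in> X"
  shows "presents G (free_mod X a) (\<lambda>x. x) {x. Poly_Mapping.keys x \<subseteq> X} {0} (\<lambda>x g. pm_push (\<lambda>k. a k g) x)"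
proof -
  have "Poly_Mapping.keys (pm_push (\<lambda>k. a k g) x) \<subseteq> X"
    if "g \<in> carrier G" "Poly_Mapping.keys x \<subseteq> X" for g and x :: "'k \<Rightarrow>\<^sub>0 'f::field"
    using that assms by (intro order_trans[OF keys_pm_push]) auto
  then show ?thesis
    unfolding presents_def by (auto simp: subspace_keys pm_linear_push free_mod_def pm_linear_0)
qed

lemma presents_submodule:
  assumes M: "presents G M q C K t" and D: "pm.subspace D" "D \<subseteq> C"
    and tD: "\<And>g x. g \<in> carrier G \<Longrightarrow> x \<in> D \<Longrightarrow> t x g \<in> D"
  shows "fg_submodule G (q ` D) M"
  unfolding fg_submodule_def
proof (intro conjI ballI allI)
  show "q ` D \<subseteq> carrier M" using presentsD(4)[OF M] D by auto
  show "q ` D \<noteq> {}" using pm.subspace_0[OF D(1)] by auto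
  fix u v assume "u \<in> q ` D" "v \<in> q ` D"
  then obtain x y where xy: "u = q x" "v = q y" "x \<in> D" "y \<in> D" by auto
  then have "u + v = q (x + y)" using presentsD(8)[OF M subsetD[OF D(2)] subsetD[OF D(2)]] by simp
  then show "u + v \<in> q ` D" using pm.subspace_add[OF D(1)] xy by auto
next
  fix c u assume "u \<in> q ` D"
  then obtain x where x: "u = q x" "x \<in> D" by auto
  then have "scl M c u = q (pm_scale c x)" using presentsD(9)[OF M subsetD[OF D(2)]] by simp
  then show "scl M c u \<in> q ` D" using pm.subspace_scale[OF D(1)] x by auto
next
  fix g u assume g: "g \<in> carrier G" and "u \<in> q ` D"
  then obtain x where x: "u = q x" "x \<in> D" by auto
  then have "act M u g = q (t x g)" using presentsD(10)[OF M g subsetD[OF D(2)]] by simp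
  then show "act M u g \<in> q ` D" using tD[OF g] x by auto
qed

text \<open>\<open>P\<close> and \<open>P'\<close> induce injections of the two modules into one
  space, with the same image there, so matching elements of equal image is an isomorphism. The map
  \<open>\<gamma>\<close> has to describe the action of the group only on this common image.\<close>

lemma presents_iso:
  assumes M: "presents G M q C K t" and M': "presents G M' q' C' K' t'"
    and P: "pm_linear P" "\<And>x. x \<in> C \<Longrightarrow> P x = 0 \<longleftrightarrow> x \<in> K"
    and P': "pm_linear P'" "\<And>x. x \<in> C' \<Longrightarrow> P' x = 0 \<longleftrightarrow> x \<in> K'"
    and img: "P ` C = P' ` C'"
    and act: "\<And>g x. g \<in> carrier G \<Longrightarrow> x \<in> C \<Longrightarrow> P (t x g) = \<gamma> g (P x)"
      "\<And>g x. g \<in> carrier G \<Longrightarrow> x \<in> C' \<Longrightarrow> P' (t' x g) = \<gamma> g (P' x)"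
  shows "fg_iso G M M'"
proof -
  have qeq: "q x = q y \<longleftrightarrow> P x = P y" if "x \<in> C" "y \<in> C" for x y
    using presentsD(11)[OF M that] P(2)[OF pm.subspace_diff[OF presentsD(1)[OF M] that]]
    by (simp add: pm_linear_diff[OF P(1)])
  have qeq': "q' x = q' y \<longleftrightarrow> P' x = P' y" if "x \<in> C'" "y \<in> C'" for x y
    using presentsD(11)[OF M' that] P'(2)[OF pm.subspace_diff[OF presentsD(1)[OF M'] that]]
    by (simp add: pm_linear_diff[OF P'(1)])
  \<comment> \<open>The definition refers to the element \<open>m\<close> and not to a
    representative; the next fact shows that every representative, and every point with the same
    image, gives this value.\<close>
  define f where "f m = q' (SOME y. y \<in> C' \<and> (\<exists>x\<in>C. m = q x \<and> P' y = P x))" for m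
  have f: "f (q x) = q' y" if "x \<in> C" "y \<in> C'" "P' y = P x" for x y
  proof -
    let ?y = "SOME y. y \<in> C' \<and> (\<exists>x'\<in>C. q x = q x' \<and> P' y = P x')"
    have "?y \<in> C' \<and> (\<exists>x'\<in>C. q x = q x' \<and> P' ?y = P x')"
      by (rule someI[of _ y]) (use that in blast)
    then obtain x' where y: "?y \<in> C'" "x' \<in> C" "q x = q x'" "P' ?y = P x'" by blast
    then have "P' ?y = P' y" using qeq[of x x'] that by simp
    then show ?thesis unfolding f_def using qeq'[OF y(1) that(2)] by simp
  qed
  have ex: "\<exists>y\<in>C'. P' y = P x" if "x \<in> C" for x using img that by (metis imageE imageI)
  have ex': "\<exists>x\<in>C. P x = P' y" if "y \<in> C'" for y using img that by (metis imageE imageI)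
  note D = presentsD[OF M] and D' = presentsD[OF M']
  show ?thesis unfolding fg_iso_def
  proof (intro exI[of _ f] conjI ballI allI)
    show "bij_betw f (carrier M) (carrier M')"
    proof (rule bij_betwI')
      fix u v assume "u \<in> carrier M" "v \<in> carrier M"
      then obtain x y where xy: "u = q x" "v = q y" "x \<in> C" "y \<in> C" using D(4) by auto
      obtain x' y' where x'y': "x' \<in> C'" "P' x' = P x" "y' \<in> C'" "P' y' = P y" using ex xy by metis
      have "f u = q' x'" "f v = q' y'" using xy x'y' f by auto
      then show "(f u = f v) = (u = v)" using qeq[OF xy(3,4)] qeq'[OF x'y'(1,3)] xy x'y' by simp
    next
      fix u assume "u \<in> carrier M"
      then obtain x where x: "u = q x" "x \<in> C" using D(4) by auto
      obtain x' where "x' \<in> C'" "P' x' = P x" using ex x by metis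
      then show "f u \<in> carrier M'" using x D'(4) f by auto
    next
      fix v assume "v \<in> carrier M'"
      then obtain y where y: "v = q' y" "y \<in> C'" using D'(4) by auto
      obtain x where "x \<in> C" "P x = P' y" using ex' y by metis
      then show "\<exists>u\<in>carrier M. v = f u" using y D(4) f by (intro bexI[of _ "q x"]) auto
    qed
  next
    fix u v assume "u \<in> carrier M" "v \<in> carrier M"
    then obtain x y where xy: "u = q x" "v = q y" "x \<in> C" "y \<in> C" using D(4) by auto
    obtain x' y' where x'y': "x' \<in> C'" "P' x' = P x" "y' \<in> C'" "P' y' = P y" using ex xy by metis
    have "f (q (x + y)) = q' (x' + y')"
      using pm.subspace_add[OF D(1) xy(3,4)] pm.subspace_add[OF D'(1) x'y'(1,3)] x'y'
      by (intro f) (simp_all add: pm_linear_add[OF P(1)] pm_linear_add[OF P'(1)])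
    then show "f (u + v) = f u + f v"
      using D(8)[OF xy(3,4)] D'(8)[OF x'y'(1,3)] f[OF xy(3) x'y'(1,2)] f[OF xy(4) x'y'(3,4)] xy by simp
  next
    fix c u assume "u \<in> carrier M"
    then obtain x where x: "u = q x" "x \<in> C" using D(4) by auto
    obtain x' where x': "x' \<in> C'" "P' x' = P x" using ex x by metis
    have "f (q (pm_scale c x)) = q' (pm_scale c x')"
      using pm.subspace_scale[OF D(1) x(2)] pm.subspace_scale[OF D'(1) x'(1)] x'
      by (intro f) (simp_all add: pm_linear_scale[OF P(1)] pm_linear_scale[OF P'(1)])
    then show "f (scl M c u) = scl M' c (f u)"
      using D(9)[OF x(2)] D'(9)[OF x'(1)] f[OF x(2) x'] x by simp
  next
    fix g u assume g: "g \<in> carrier G" and "u \<in> carrier M"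
    then obtain x where x: "u = q x" "x \<in> C" using D(4) by auto
    obtain x' where x': "x' \<in> C'" "P' x' = P x" using ex x by metis
    have "f (q (t x g)) = q' (t' x' g)"
      using D(6)[OF g x(2)] D'(6)[OF g x'(1)] x' act(1)[OF g x(2)] act(2)[OF g x'(1)]
      by (intro f) simp_all
    then show "f (fgmod.act M u g) = fgmod.act M' (f u) g"
      using D(10)[OF g x(2)] D'(10)[OF g x'(1)] f[OF x(2) x'] x by simp
  qed
qed

section \<open>The Poincare--Birkhoff--Witt representation\<close>

lemma pm_lin_0 [simp]: "pm_lin h 0 = 0"
  by (rule pm_linear_0[OF pm_linear_lin])

lemma pm_lin_in_keys:
  assumes "\<And>k. k \<in> Poly_Mapping.keys x \<Longrightarrow> Poly_Mapping.keys (h k) \<subseteq> X"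
  shows "Poly_Mapping.keys (pm_lin h x) \<subseteq> X"
  using keys_pm_lin[of h x] assms by blast

lemma keys_diff_subset: "Poly_Mapping.keys x \<subseteq> X \<Longrightarrow> Poly_Mapping.keys y \<subseteq> X \<Longrightarrow> Poly_Mapping.keys (x - y) \<subseteq> X"
  for x y :: "'k \<Rightarrow>\<^sub>0 'f::ab_group_add"
  using keys_diff[of x y] by blast

lemma keys_add_subset: "Poly_Mapping.keys x \<subseteq> X \<Longrightarrow> Poly_Mapping.keys y \<subseteq> X \<Longrightarrow> Poly_Mapping.keys (x + y) \<subseteq> X"
  using keys_add[of x y] by blast

text \<open>A graded Lie algebra given by structure constants: \<open>br a b\<close> is the
  expansion of [a,b] in the basis \<open>B\<close>. The Jacobi identity is stated in the form that
  ad [a,b] is the commutator of ad a and ad b, in which it enters the commutation of operators. In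
  characteristic 2 the vanishing of [k,k] does not follow from antisymmetry, so it is assumed
  separately.\<close>

locale pbw = linorder le lt
  for le :: "'k \<Rightarrow> 'k \<Rightarrow> bool" (infix \<open>\<sqsubseteq>\<close> 50) and lt (infix \<open>\<sqsubset>\<close> 50) +
  fixes br :: "'k \<Rightarrow> 'k \<Rightarrow> ('k \<Rightarrow>\<^sub>0 'f::field)" and B :: "'k set" and dg :: "'k \<Rightarrow> nat"
  assumes br_self: "br k k = 0"
    and br_anti: "br k l = - br l k"
    and jacobi: "pm_lin (br a) (br b c) - pm_lin (br b) (br a c) = pm_lin (\<lambda>x. br x c) (br a b)"
    and br_B: "a \<in> B \<Longrightarrow> b \<in> B \<Longrightarrow> Poly_Mapping.keys (br a b) \<subseteq> B"
    and br_dg: "c \<in> Poly_Mapping.keys (br a b) \<Longrightarrow> dg c = dg a + dg b"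
    and dg_pos: "dg a > 0"
begin

abbreviation z :: "'k multiset \<Rightarrow> ('k multiset \<Rightarrow>\<^sub>0 'f)" where
  "z M \<equiv> Poly_Mapping.single M 1"

definition bel :: "'k \<Rightarrow> 'k multiset \<Rightarrow> bool" where
  "bel b M \<longleftrightarrow> (\<forall>m\<in>#M. b \<sqsubseteq> m)"

definition mn :: "'k multiset \<Rightarrow> 'k" where
  "mn M = (SOME b. b \<in># M \<and> bel b M)"

lemma ex_mn: "M \<noteq> {#} \<Longrightarrow> \<exists>b. b \<in># M \<and> bel b M"
proof (induction M)
  case (add x M)
  show ?case
  proof (cases "M = {#}")
    case False
    then obtain b where b: "b \<in># M" "bel b M" using add by auto
    show ?thesis
    proof (cases "x \<sqsubseteq> b")
      case True
      then show ?thesis using b by (intro exI[of _ x]) (auto simp: bel_def intro: order_trans)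
    next
      case False
      then show ?thesis using b by (intro exI[of _ b]) (auto simp: bel_def)
    qed
  qed (auto simp: bel_def)
qed simp

lemma mn: "M \<noteq> {#} \<Longrightarrow> mn M \<in># M \<and> bel (mn M) M"
  unfolding mn_def by (rule someI_ex) (rule ex_mn)

lemma mn_eq: "b \<in># M \<Longrightarrow> bel b M \<Longrightarrow> mn M = b"
proof -
  assume b: "b \<in># M" "bel b M"
  then have "M \<noteq> {#}" by auto
  then have "mn M \<sqsubseteq> b" "b \<sqsubseteq> mn M" using mn[of M] b unfolding bel_def by blast+
  then show "mn M = b" by (rule order.antisym)
qed

lemma mn_add: "bel b M \<Longrightarrow> mn (add_mset b M) = b"
  by (rule mn_eq) (auto simp: bel_def)

definition ty :: "'k multiset \<Rightarrow> nat multiset" where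
  "ty M = image_mset dg M"

text \<open>Fixing the sum keeps all comparisons among the partitions of one number. Types give the
  layers that are wanted in the end; the bound on the number of factors in \<open>sz\<close> is a
  second filtration, which drives the inductions.\<close>

definition gt :: "nat multiset \<Rightarrow> 'k multiset set" where
  "gt \<tau> = {M. set_mset M \<subseteq> B \<and> \<tau> < ty M \<and> sum_mset (ty M) = sum_mset \<tau>}"

definition ge :: "nat multiset \<Rightarrow> 'k multiset set" where
  "ge \<tau> = {M. set_mset M \<subseteq> B \<and> \<tau> \<le> ty M \<and> sum_mset (ty M) = sum_mset \<tau>}"

definition sz :: "nat \<Rightarrow> 'k multiset set" where
  "sz n = {M. set_mset M \<subseteq> B \<and> size M \<le> n}"

lemma ty_add [simp]: "ty (add_mset b M) = add_mset (dg b) (ty M)"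
  by (simp add: ty_def)

lemma ty_plus [simp]: "ty (M + N) = ty M + ty N"
  by (simp add: ty_def)

lemma gt_sz_subset:
  "\<tau> < \<tau>' \<Longrightarrow> sum_mset \<tau> = sum_mset \<tau>' \<Longrightarrow> k \<le> l \<Longrightarrow>
     {N. set_mset N \<subseteq> B \<and> \<tau>' \<le> ty N \<and> sum_mset (ty N) = sum_mset \<tau>' \<and> size N \<le> k} \<subseteq> gt \<tau> \<inter> sz l"
  by (auto simp: gt_def sz_def intro: order_less_le_trans)

text \<open>
  The recursion is what \<open>b m T = m b T + [b,m] T\<close> forces when \<open>m\<close> is the least factor of
  \<open>M = m T\<close>; the first argument of \<open>R\<close> is fuel, sufficient once it is at least \<^term>\<open>size M\<close>.
\<close>

primrec R :: "nat \<Rightarrow> 'k \<Rightarrow> 'k multiset \<Rightarrow> ('k multiset \<Rightarrow>\<^sub>0 'f)" where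
  "R 0 b M = z (add_mset b M)"
| "R (Suc m) b M = (if bel b M then z (add_mset b M) else
     z (add_mset b M) +
     pm_lin (R m (mn M)) (R m b (M - {#mn M#}) - z (add_mset b (M - {#mn M#}))) +
     pm_lin (\<lambda>c. R m c (M - {#mn M#})) (br b (mn M)))"

text \<open>In the multiset order one part outweighs any number of smaller ones, and positivity of
  degrees makes the merged part larger than both parts that it replaces.\<close>

lemma merge_less: "add_mset (dg a) (add_mset (dg b) M) < add_mset (dg a + dg b) M"
proof -
  have "{#dg a, dg b#} < {#dg a + dg b#}"
    using dg_pos[of a] dg_pos[of b] by simp
  then have "M + {#dg a, dg b#} < M + {#dg a + dg b#}" by (rule add_strict_left_mono)
  then show ?thesis by (simp add: add_mset_commute)
qed

text \<open>The estimate and the independence of the fuel are proved in one induction: the recursion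
  applies \<open>R m\<close> to the monomials of a correction term, and fuel \<open>m\<close>
  suffices for these only because the estimate bounds their size by that of the tail
  \<open>T\<close>.\<close>

lemma R_main:
  "b \<in> B \<Longrightarrow> set_mset M \<subseteq> B \<Longrightarrow> size M \<le> m \<Longrightarrow>
     Poly_Mapping.keys (R m b M - z (add_mset b M)) \<subseteq> gt (ty (add_mset b M)) \<inter> sz (size M) \<and>
     R (Suc m) b M = R m b M"
proof (induction m arbitrary: b M)
  case 0
  then show ?case by (auto simp: bel_def)
next
  case (Suc m)
  show ?case
  proof (cases "bel b M")
    case True
    then show ?thesis by simp
  next
    case False
    then have "M \<noteq> {#}" by (auto simp: bel_def)
    define \<mu> where "\<mu> = mn M"
    define T where "T = M - {#\<mu>#}"
    have \<mu>: "\<mu> \<in># M" "\<mu> \<in> B" using mn[OF \<open>M \<noteq> {#}\<close>] Suc.prems by (auto simp: \<mu>_def)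
    then have M: "M = add_mset \<mu> T" by (simp add: T_def)
    have T: "set_mset T \<subseteq> B" "size T \<le> m" using Suc.prems by (auto simp: M)
    note IH = Suc.IH
    let ?w = "R m b T - z (add_mset b T)"
    have w: "Poly_Mapping.keys ?w \<subseteq> gt (ty (add_mset b T)) \<inter> sz (size T)" "R (Suc m) b T = R m b T"
      using IH[OF Suc.prems(1) T] by auto
    have R1: "R (Suc m) b M = z (add_mset b M) + pm_lin (R m \<mu>) ?w + pm_lin (\<lambda>c. R m c T) (br b \<mu>)"
      using False by (simp add: \<mu>_def T_def)
    have R2: "R (Suc (Suc m)) b M = z (add_mset b M) + pm_lin (R (Suc m) \<mu>) (R (Suc m) b T - z (add_mset b T)) +
        pm_lin (\<lambda>c. R (Suc m) c T) (br b \<mu>)"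
      using False unfolding \<mu>_def T_def by (subst R.simps(2)) (simp del: R.simps)
    have wk: "set_mset M' \<subseteq> B" "size M' \<le> m" "size M' \<le> size T" "ty (add_mset b T) < ty M'"
      "sum_mset (ty M') = sum_mset (ty (add_mset b T))" if "M' \<in> Poly_Mapping.keys ?w" for M'
      using subsetD[OF w(1) that] T by (simp_all add: gt_def sz_def)
    have 1: "pm_lin (R (Suc m) \<mu>) ?w = pm_lin (R m \<mu>) ?w"
      by (rule pm_lin_cong) (use IH \<mu> wk in blast)
    have brk: "c \<in> B" "dg c = dg b + dg \<mu>" if "c \<in> Poly_Mapping.keys (br b \<mu>)" for c
      using br_B[OF Suc.prems(1) \<mu>(2)] br_dg[OF that] that by auto
    have 2: "pm_lin (\<lambda>c. R (Suc m) c T) (br b \<mu>) = pm_lin (\<lambda>c. R m c T) (br b \<mu>)"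
      by (rule pm_lin_cong) (use IH T brk in blast)
    have eq: "R (Suc (Suc m)) b M = R (Suc m) b M"
      unfolding R2 w(2) 1 2 R1 ..
    have keysR: "Poly_Mapping.keys (R m c N) \<subseteq> {N'. set_mset N' \<subseteq> B \<and> ty (add_mset c N) \<le> ty N' \<and>
        sum_mset (ty N') = sum_mset (ty (add_mset c N)) \<and> size N' \<le> Suc (size N)}"
      if c: "c \<in> B" "set_mset N \<subseteq> B" "size N \<le> m" for c N
    proof -
      have "R m c N = (R m c N - z (add_mset c N)) + z (add_mset c N)" by simp
      then have "Poly_Mapping.keys (R m c N) \<subseteq>
          Poly_Mapping.keys (R m c N - z (add_mset c N)) \<union> {add_mset c N}"
        using keys_add[of "R m c N - z (add_mset c N)" "z (add_mset c N)"] by auto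
      then show ?thesis using IH[OF c] c by (fastforce simp: gt_def sz_def)
    qed
    have 3: "Poly_Mapping.keys (pm_lin (R m \<mu>) ?w) \<subseteq> gt (ty (add_mset b M)) \<inter> sz (size M)"
    proof (rule pm_lin_in_keys)
      fix M' assume M': "M' \<in> Poly_Mapping.keys ?w"
      note k = wk[OF M']
      have "ty (add_mset b M) < ty (add_mset \<mu> M')"
        using k(4) by (simp add: M add_mset_commute)
      moreover have "sum_mset (ty (add_mset b M)) = sum_mset (ty (add_mset \<mu> M'))"
        using k(5) by (simp add: M)
      ultimately show "Poly_Mapping.keys (R m \<mu> M') \<subseteq> gt (ty (add_mset b M)) \<inter> sz (size M)"
        using k(3) by (intro subset_trans[OF keysR[OF \<mu>(2) k(1,2)] gt_sz_subset]) (simp_all add: M)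
    qed
    have 4: "Poly_Mapping.keys (pm_lin (\<lambda>c. R m c T) (br b \<mu>)) \<subseteq> gt (ty (add_mset b M)) \<inter> sz (size M)"
    proof (rule pm_lin_in_keys)
      fix c assume "c \<in> Poly_Mapping.keys (br b \<mu>)"
      note c = brk[OF this]
      have "ty (add_mset b M) < ty (add_mset c T)"
        using merge_less[of b \<mu> "ty T"] by (simp add: M c)
      moreover have "sum_mset (ty (add_mset b M)) = sum_mset (ty (add_mset c T))"
        using c by (simp add: M)
      ultimately show "Poly_Mapping.keys (R m c T) \<subseteq> gt (ty (add_mset b M)) \<inter> sz (size M)"
        by (intro subset_trans[OF keysR[OF c(1) T] gt_sz_subset]) (simp_all add: M)
    qed
    have "Poly_Mapping.keys (R (Suc m) b M - z (add_mset b M)) \<subseteq> gt (ty (add_mset b M)) \<inter> sz (size M)"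
      unfolding R1 using keys_add_subset[OF 3 4] by (simp add: add.assoc)
    then show ?thesis using eq by blast
  qed
qed

definition rho :: "'k \<Rightarrow> 'k multiset \<Rightarrow> ('k multiset \<Rightarrow>\<^sub>0 'f)" where
  "rho b M = R (size M) b M"

lemma R_eq_rho: "b \<in> B \<Longrightarrow> set_mset M \<subseteq> B \<Longrightarrow> size M \<le> m \<Longrightarrow> R m b M = rho b M"
proof (induction m)
  case (Suc m)
  show ?case
  proof (cases "size M = Suc m")
    case False
    then show ?thesis using Suc R_main[of b M m] by simp
  qed (simp add: rho_def)
qed (simp add: rho_def)

lemma rho_keys:
  "b \<in> B \<Longrightarrow> set_mset M \<subseteq> B \<Longrightarrow>
     Poly_Mapping.keys (rho b M - z (add_mset b M)) \<subseteq> gt (ty (add_mset b M)) \<inter> sz (size M)"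
  using R_main[of b M "size M"] by (simp add: rho_def)

lemma rho_bel: "bel b M \<Longrightarrow> rho b M = z (add_mset b M)"
  by (cases "size M") (auto simp: rho_def)

lemma rho_rec:
  assumes b: "b \<in> B" "set_mset T \<subseteq> B" "\<mu> \<in> B" "bel \<mu> T" "\<mu> \<sqsubset> b"
  shows "rho b (add_mset \<mu> T) = z (add_mset b (add_mset \<mu> T)) +
     pm_lin (rho \<mu>) (rho b T - z (add_mset b T)) + pm_lin (\<lambda>c. rho c T) (br b \<mu>)"
proof -
  have mn: "mn (add_mset \<mu> T) = \<mu>" using b(4) by (rule mn_add)
  have nb: "\<not> bel b (add_mset \<mu> T)" using b(5) by (auto simp: bel_def)
  have "rho b (add_mset \<mu> T) = z (add_mset b (add_mset \<mu> T)) +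
     pm_lin (R (size T) \<mu>) (R (size T) b T - z (add_mset b T)) + pm_lin (\<lambda>c. R (size T) c T) (br b \<mu>)"
    using nb by (simp add: rho_def mn)
  also have "R (size T) b T = rho b T" by (simp add: rho_def)
  also have "pm_lin (\<lambda>c. R (size T) c T) (br b \<mu>) = pm_lin (\<lambda>c. rho c T) (br b \<mu>)"
    by (simp add: rho_def)
  also have "pm_lin (R (size T) \<mu>) (rho b T - z (add_mset b T)) = pm_lin (rho \<mu>) (rho b T - z (add_mset b T))"
    by (rule pm_lin_cong) (use rho_keys[OF b(1,2)] b(3) in \<open>auto simp: sz_def intro!: R_eq_rho\<close>)
  finally show ?thesis .
qed

definition op :: "'k \<Rightarrow> ('k multiset \<Rightarrow>\<^sub>0 'f) \<Rightarrow> ('k multiset \<Rightarrow>\<^sub>0 'f)" where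
  "op b = pm_lin (rho b)"

definition act :: "('k \<Rightarrow>\<^sub>0 'f) \<Rightarrow> ('k multiset \<Rightarrow>\<^sub>0 'f) \<Rightarrow> ('k multiset \<Rightarrow>\<^sub>0 'f)" where
  "act x s = pm_lin (\<lambda>b. op b s) x"

abbreviation over :: "'k multiset set" where "over \<equiv> {M. set_mset M \<subseteq> B}"

lemma pm_linear_op: "pm_linear (op b)"
  by (simp add: op_def pm_linear_lin)

lemma op_z [simp]: "op b (z M) = rho b M"
  by (simp add: op_def)

lemma pm_linear_act1: "pm_linear (\<lambda>x. act x s)"
  unfolding act_def by (rule pm_linear_lin)

lemma pm_linear_act2: "pm_linear (act x)"
  unfolding act_def by (rule pm_linear_lin_left) (rule pm_linear_op)

lemma act_single [simp]: "act (Poly_Mapping.single b 1) s = op b s"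
  by (simp add: act_def)

lemma rho_over: "b \<in> B \<Longrightarrow> set_mset M \<subseteq> B \<Longrightarrow> Poly_Mapping.keys (rho b M) \<subseteq> over"
proof -
  assume b: "b \<in> B" "set_mset M \<subseteq> B"
  have "Poly_Mapping.keys (rho b M - z (add_mset b M)) \<subseteq> over"
    using rho_keys[OF b] by (auto simp: sz_def)
  moreover have "Poly_Mapping.keys (z (add_mset b M)) \<subseteq> over" using b by simp
  ultimately have "Poly_Mapping.keys (rho b M - z (add_mset b M) + z (add_mset b M)) \<subseteq> over"
    by (rule keys_add_subset)
  then show ?thesis by simp
qed

lemma op_over: "b \<in> B \<Longrightarrow> Poly_Mapping.keys s \<subseteq> over \<Longrightarrow> Poly_Mapping.keys (op b s) \<subseteq> over"
  unfolding op_def by (rule pm_lin_in_keys) (use rho_over in blast)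

lemma act_over: "Poly_Mapping.keys x \<subseteq> B \<Longrightarrow> Poly_Mapping.keys s \<subseteq> over \<Longrightarrow> Poly_Mapping.keys (act x s) \<subseteq> over"
  unfolding act_def by (rule pm_lin_in_keys) (use op_over in blast)

definition comm_at :: "'k \<Rightarrow> 'k \<Rightarrow> ('k multiset \<Rightarrow>\<^sub>0 'f) \<Rightarrow> bool" where
  "comm_at a b s \<longleftrightarrow> op a (op b s) - op b (op a s) = act (br a b) s"

lemma comm_at_sym: assumes "comm_at a b s" shows "comm_at b a s"
proof -
  have "op b (op a s) - op a (op b s) = - (op a (op b s) - op b (op a s))" by simp
  also have "\<dots> = - act (br a b) s" using assms by (simp only: comm_at_def)
  also have "\<dots> = act (br b a) s"
    unfolding br_anti[of b a] by (rule pm_linear_uminus[OF pm_linear_act1, symmetric])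
  finally show ?thesis by (simp only: comm_at_def)
qed

lemma comm_at_lin:
  assumes "\<And>M. M \<in> Poly_Mapping.keys s \<Longrightarrow> comm_at a b (z M)"
  shows "comm_at a b s"
  unfolding comm_at_def
proof (rule pm_linear_eqI[of "\<lambda>s. op a (op b s) - op b (op a s)" "act (br a b)"])
  show "pm_linear (\<lambda>s. op a (op b s) - op b (op a s))"
    by (rule pm_linear_minus[OF pm_linear_compose[OF pm_linear_op pm_linear_op]
          pm_linear_compose[OF pm_linear_op pm_linear_op]])
qed (use assms in \<open>auto simp: comm_at_def pm_linear_act2\<close>)

lemma comm_at_add: "comm_at a b s \<Longrightarrow> comm_at a b s' \<Longrightarrow> comm_at a b (s + s')"
  by (simp add: comm_at_def pm_linear_add[OF pm_linear_op] pm_linear_add[OF pm_linear_act2] algebra_simps)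

text \<open>With \<open>b\<close> below \<open>a\<close> and below every factor of \<open>T\<close>,
  the operator \<open>op b\<close> merely inserts \<open>b\<close>, and the recursion
  \<open>rho_rec\<close> for \<open>a\<close> acting on the monomial \<open>b T\<close> is the
  required identity.\<close>

lemma comm_at_direct:
  assumes "a \<in> B" "b \<in> B" "set_mset T \<subseteq> B" "b \<sqsubseteq> a" "bel b T"
  shows "comm_at a b (z T)"
proof (cases "a = b")
  case True
  then show ?thesis by (simp add: comm_at_def br_self pm_linear_0[OF pm_linear_act1])
next
  case False
  then have lt: "b \<sqsubset> a" using assms(4) by simp
  have 1: "op b (z T) = z (add_mset b T)" using rho_bel[OF assms(5)] by simp
  have 2: "op b (z (add_mset a T)) = z (add_mset b (add_mset a T))"
    using rho_bel[of b "add_mset a T"] assms by (simp add: bel_def)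
  have "op a (z (add_mset b T)) = z (add_mset a (add_mset b T)) +
      op b (op a (z T) - z (add_mset a T)) + act (br a b) (z T)"
    using rho_rec[OF assms(1,3,2,5) lt] by (simp add: op_def act_def)
  then show ?thesis
    unfolding comm_at_def 1 by (simp add: pm_linear_diff[OF pm_linear_op] 2 add_mset_commute del: op_z)
qed

text \<open>Serre's induction on the length of the monomial. If \<open>a\<close> or \<open>b\<close>
  is below every factor of \<open>T\<close>, the recursion decides. Otherwise the least factor
  \<open>n\<close> of \<open>T = n P\<close> is smaller than both, and moving \<open>a\<close> and
  \<open>b\<close> past \<open>n\<close> leaves terms in brackets with \<open>n\<close>, which the
  Jacobi identity combines.\<close>

lemma act_comm_basis:
  assumes "a \<in> B" "b \<in> B" "set_mset T \<subseteq> B"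
  shows "comm_at a b (z T)"
  using assms
proof (induction "size T" arbitrary: a b T rule: less_induct)
  case less
  note ab = less.prems
  show ?case
  proof (cases "bel a T \<or> bel b T")
    case True
    show ?thesis
    proof (cases "a \<sqsubseteq> b")
      case True
      then have "bel a T" using \<open>bel a T \<or> bel b T\<close> by (auto simp: bel_def intro: order_trans)
      then show ?thesis using comm_at_direct[of b a T] ab True by (auto intro: comm_at_sym)
    next
      case False
      then have "b \<sqsubseteq> a" by simp
      moreover have "bel b T" using \<open>bel a T \<or> bel b T\<close> \<open>b \<sqsubseteq> a\<close> by (auto simp: bel_def intro: order_trans)
      ultimately show ?thesis using comm_at_direct[of a b T] ab by auto
    qed
  next
    case False
    then have "T \<noteq> {#}" by (auto simp: bel_def)
    define n where "n = mn T"
    define P where "P = T - {#n#}"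
    have n: "n \<in># T" "bel n T" using mn[OF \<open>T \<noteq> {#}\<close>] by (auto simp: n_def)
    then have T: "T = add_mset n P" by (simp add: P_def)
    have nB: "n \<in> B" and PB: "set_mset P \<subseteq> B" and nP: "bel n P"
      using ab n by (auto simp: T bel_def)
    have below: "n \<sqsubset> c" if "\<not> bel c T" for c
      using that n(2) by (auto simp: bel_def not_le intro: le_less_trans)
    have na: "n \<sqsubset> a" and nb: "n \<sqsubset> b" using False below by auto
    have zT: "z T = op n (z P)" using rho_bel[OF nP] by (simp add: T)
    have IH: "comm_at c d s" if "c \<in> B" "d \<in> B" "Poly_Mapping.keys s \<subseteq> sz (size P)" for c d s
    proof (rule comm_at_lin)
      fix M assume "M \<in> Poly_Mapping.keys s"
      then have "size M < size T" "set_mset M \<subseteq> B" using that by (auto simp: sz_def T)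
      then show "comm_at c d (z M)" using less.hyps that by blast
    qed
    have IHP: "comm_at c d (z P)" if "c \<in> B" "d \<in> B" for c d
      using that PB by (intro IH) (auto simp: sz_def)
    \<comment> \<open>\<open>op d\<close> applied to \<open>P\<close> is the monomial
      \<open>d P\<close>, to which \<open>comm_at_direct\<close> applies because \<open>n\<close> is
      below \<open>d\<close> and \<open>P\<close>, plus terms with no more factors than
      \<open>P\<close>, which are covered by \<open>IH\<close>.\<close>
    have E2: "comm_at c n (op d (z P))" if cd: "c \<in> B" "d \<in> B" "n \<sqsubset> c" "n \<sqsubset> d" for c d
    proof -
      have "comm_at c n (z (add_mset d P))"
        using cd nB PB nP by (intro comm_at_direct) (auto simp: bel_def)
      moreover have "comm_at c n (rho d P - z (add_mset d P))"
        using rho_keys[OF cd(2) PB] cd nB by (intro IH) auto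
      ultimately have "comm_at c n (z (add_mset d P) + (rho d P - z (add_mset d P)))"
        by (rule comm_at_add)
      then show ?thesis by simp
    qed
    have E1: "op d (z T) = op n (op d (z P)) + act (br d n) (z P)" if "d \<in> B" for d
      using IHP[OF that nB] unfolding zT comm_at_def diff_eq_eq by (simp only: add.commute)
    have E3: "op c (act x (z P)) = act x (op c (z P)) + act (pm_lin (br c) x) (z P)"
      if c: "c \<in> B" and x: "Poly_Mapping.keys x \<subseteq> B" for c x
    proof (rule pm_linear_eqI[of "\<lambda>x. op c (act x (z P))"
          "\<lambda>x. act x (op c (z P)) + act (pm_lin (br c) x) (z P)"])
      show "pm_linear (\<lambda>x. op c (act x (z P)))"
        by (rule pm_linear_compose[OF pm_linear_op pm_linear_act1])
      show "pm_linear (\<lambda>x. act x (op c (z P)) + act (pm_lin (br c) x) (z P))"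
        by (rule pm_linear_plus[OF pm_linear_act1 pm_linear_compose[OF pm_linear_act1 pm_linear_lin]])
    next
      fix d assume "d \<in> Poly_Mapping.keys x"
      then have "comm_at c d (z P)" using IHP c x by auto
      then show "op c (act (Poly_Mapping.single d 1) (z P)) =
          act (Poly_Mapping.single d 1) (op c (z P)) + act (pm_lin (br c) (Poly_Mapping.single d 1)) (z P)"
        unfolding comm_at_def diff_eq_eq act_single pm_lin_single pm.scale_one by (simp only: add.commute)
    qed
    have E4: "act x (op n (z P)) = op n (act x (z P)) + act (pm_lin (\<lambda>c. br c n) x) (z P)"
      if x: "Poly_Mapping.keys x \<subseteq> B" for x
    proof -
      have "pm_lin (\<lambda>c. br c n) x = pm_lin (\<lambda>c. - br n c) x"
        using br_anti by metis
      also have "\<dots> = - pm_lin (br n) x"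
        by (simp add: pm_lin_def sum_negf)
      finally show ?thesis
        using E3[OF nB x] by (simp add: pm_linear_uminus[OF pm_linear_act1])
    qed
    have main: "op c (op d (z T)) = op n (op c (op d (z P))) + act (br c n) (op d (z P)) +
        act (br d n) (op c (z P)) + act (pm_lin (br c) (br d n)) (z P)"
      if cd: "c \<in> B" "d \<in> B" "n \<sqsubset> c" "n \<sqsubset> d" for c d
    proof -
      have "op c (op d (z T)) = op c (op n (op d (z P))) + op c (act (br d n) (z P))"
        by (simp only: E1[OF cd(2)] pm_linear_add[OF pm_linear_op])
      also have "op c (op n (op d (z P))) = op n (op c (op d (z P))) + act (br c n) (op d (z P))"
        using E2[OF cd] unfolding comm_at_def diff_eq_eq by (simp only: add.commute)
      also have "op c (act (br d n) (z P)) = act (br d n) (op c (z P)) + act (pm_lin (br c) (br d n)) (z P)"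
        by (rule E3[OF cd(1) br_B[OF cd(2) nB]])
      finally show ?thesis by (simp only: add.assoc)
    qed
    \<comment> \<open>The two middle terms of \<open>main\<close> together are symmetric in
      \<open>c\<close> and \<open>d\<close> and cancel in the commutator. Besides the commutator on
      \<open>P\<close> only the double brackets with \<open>n\<close> remain.\<close>
    have "op a (op b (z T)) - op b (op a (z T)) =
        op n (op a (op b (z P)) - op b (op a (z P))) +
        act (pm_lin (br a) (br b n) - pm_lin (br b) (br a n)) (z P)"
      unfolding main[OF ab(1,2) na nb] main[OF ab(2,1) nb na]
      by (simp only: pm_linear_diff[OF pm_linear_op] pm_linear_diff[OF pm_linear_act1]) (simp only: algebra_simps)
    also have "op a (op b (z P)) - op b (op a (z P)) = act (br a b) (z P)"
      using IHP[OF ab(1,2)] by (simp only: comm_at_def)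
    also have "pm_lin (br a) (br b n) - pm_lin (br b) (br a n) = pm_lin (\<lambda>c. br c n) (br a b)"
      by (rule jacobi)
    also have "op n (act (br a b) (z P)) + act (pm_lin (\<lambda>c. br c n) (br a b)) (z P) = act (br a b) (z T)"
      unfolding zT by (rule E4[OF br_B[OF ab(1,2)], symmetric])
    finally show ?thesis unfolding comm_at_def .
  qed
qed

theorem act_bracket:
  assumes x: "Poly_Mapping.keys x \<subseteq> B" and y: "Poly_Mapping.keys y \<subseteq> B" and s: "Poly_Mapping.keys s \<subseteq> over"
  shows "act (pm_lin (\<lambda>k. pm_lin (br k) y) x) s = act x (act y s) - act y (act x s)"
proof (rule pm_linear_eqI[of "\<lambda>x. act (pm_lin (\<lambda>k. pm_lin (br k) y) x) s" "\<lambda>x. act x (act y s) - act y (act x s)"])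
  show "pm_linear (\<lambda>x. act (pm_lin (\<lambda>k. pm_lin (br k) y) x) s)"
    by (rule pm_linear_compose[OF pm_linear_act1 pm_linear_lin])
  show "pm_linear (\<lambda>x. act x (act y s) - act y (act x s))"
    by (rule pm_linear_minus[OF pm_linear_act1 pm_linear_compose[OF pm_linear_act2 pm_linear_act1]])
next
  fix a assume "a \<in> Poly_Mapping.keys x"
  then have a: "a \<in> B" using x by auto
  have "act (pm_lin (br a) y) s = op a (act y s) - act y (op a s)"
  proof (rule pm_linear_eqI[of "\<lambda>y. act (pm_lin (br a) y) s" "\<lambda>y. op a (act y s) - act y (op a s)"])
    show "pm_linear (\<lambda>y. act (pm_lin (br a) y) s)"
      by (rule pm_linear_compose[OF pm_linear_act1 pm_linear_lin])
    show "pm_linear (\<lambda>y. op a (act y s) - act y (op a s))"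
      by (rule pm_linear_minus[OF pm_linear_compose[OF pm_linear_op pm_linear_act1] pm_linear_act1])
  next
    fix b assume "b \<in> Poly_Mapping.keys y"
    then have b: "b \<in> B" using y by auto
    have "comm_at a b s" by (rule comm_at_lin) (use act_comm_basis[OF a b] s in blast)
    then show "act (pm_lin (br a) (Poly_Mapping.single b 1)) s =
        op a (act (Poly_Mapping.single b 1) s) - act (Poly_Mapping.single b 1) (op a s)"
      by (simp add: comm_at_def)
  qed
  then show "act (pm_lin (\<lambda>k. pm_lin (br k) y) (Poly_Mapping.single a 1)) s =
      act (Poly_Mapping.single a 1) (act y s) - act y (act (Poly_Mapping.single a 1) s)"
    by simp
qed

end

section \<open>The tensor ideal and free Lie elements\<close>

lemma pm_linear_mult2: "pm_linear (\<lambda>x :: 'a::monoid_add \<Rightarrow>\<^sub>0 'f::field. a * x * b)"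
  by (rule pm_linear_compose[OF pm_linear_mult_right pm_linear_mult_left])

lemma pm_linear_sandwich_subset:
  assumes "pm.subspace S" "\<And>k l. Poly_Mapping.single k 1 * x * Poly_Mapping.single l 1 \<in> S"
  shows "a * (x :: 'a::monoid_add \<Rightarrow>\<^sub>0 'f::field) * b \<in> S"
proof (rule pm_linear_in_subspace[of "\<lambda>a. a * x * b", OF _ assms(1)])
  show "pm_linear (\<lambda>a. a * x * b)"
    by (rule pm_linear_compose[OF pm_linear_mult_right pm_linear_mult_right])
  fix k
  show "Poly_Mapping.single k 1 * x * b \<in> S"
    by (rule pm_linear_in_subspace[of "\<lambda>b. Poly_Mapping.single k 1 * x * b", OF pm_linear_mult_left assms(1)])
       (rule assms(2))
qed

abbreviation word :: "'v list \<Rightarrow> ('v list \<Rightarrow>\<^sub>0 'f::field)" where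
  "word w \<equiv> Poly_Mapping.single w 1"

lemma word_append: "word (xs @ ys) = word xs * word ys"
  by (simp add: mult_single plus_list_def)

lemma word_Nil: "word [] = 1"
  by (simp add: zero_list_def[symmetric])

lemma word_Cons: "word (x # xs) = word [x] * word xs"
  using word_append[of "[x]" xs] by simp

lemma homogeneous_keys: "homogeneous n x \<longleftrightarrow> Poly_Mapping.keys x \<subseteq> {w. length w = n}"
  by (auto simp: homogeneous_def)

lemma subspace_homogeneous: "pm.subspace {x. homogeneous n x}"
  unfolding homogeneous_keys by (rule subspace_keys)

lemma homogeneous_single [simp]: "homogeneous n (Poly_Mapping.single w c) \<longleftrightarrow> c = 0 \<or> length w = n"
  by (auto simp: homogeneous_def)

lemma homogeneous_diff: "homogeneous n x \<Longrightarrow> homogeneous n y \<Longrightarrow> homogeneous n (x - y)"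
  using pm.subspace_diff[OF subspace_homogeneous] by blast

lemma homogeneous_mult: "homogeneous m x \<Longrightarrow> homogeneous n y \<Longrightarrow> homogeneous (m + n) (x * y)"
  using keys_mult[of x y] by (fastforce simp: homogeneous_def plus_list_def)

lemma homogeneous_one: "homogeneous 0 1"
  using homogeneous_single[of 0 "[]" 1] by (simp add: word_Nil)

lemma homogeneous_prod_list:
  "list_all2 (\<lambda>x n. homogeneous n x) xs ns \<Longrightarrow> homogeneous (sum_list ns) (prod_list xs)"
  by (induction rule: list_all2_induct) (simp_all add: homogeneous_one homogeneous_mult)

definition hproj :: "nat \<Rightarrow> ('v list \<Rightarrow>\<^sub>0 'f::field) \<Rightarrow> ('v list \<Rightarrow>\<^sub>0 'f)" where
  "hproj n = pm_lin (\<lambda>w. if length w = n then word w else 0)"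

lemma pm_linear_hproj: "pm_linear (hproj n)"
  by (simp add: hproj_def pm_linear_lin)

lemma hproj_homogeneous: "homogeneous m x \<Longrightarrow> hproj n x = (if m = n then x else 0)"
proof -
  assume "homogeneous m x"
  then have "hproj n x = pm_lin (\<lambda>w. if m = n then word w else 0) x"
    unfolding hproj_def by (intro pm_lin_cong) (auto simp: homogeneous_def)
  also have "\<dots> = (if m = n then x else 0)"
    by (simp add: pm_lin_id) (simp add: pm_lin_def)
  finally show ?thesis .
qed

text \<open>The Lie algebra generated by the letters inside the free associative algebra on the set
  V. Inductions over brackets are made here, before passing to the quotient; the image in T(V) is
  L(V).\<close>

inductive_set lie_elems :: "('v list \<Rightarrow>\<^sub>0 'f::field) set" where
  gen: "word [v] \<in> lie_elems"
| add: "x \<in> lie_elems \<Longrightarrow> y \<in> lie_elems \<Longrightarrow> x + y \<in> lie_elems"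
| scale: "x \<in> lie_elems \<Longrightarrow> pm_scale c x \<in> lie_elems"
| bracket: "x \<in> lie_elems \<Longrightarrow> y \<in> lie_elems \<Longrightarrow> x * y - y * x \<in> lie_elems"

lemma subspace_lie_elems: "pm.subspace lie_elems"
proof -
  have "0 \<in> (lie_elems :: ('v list \<Rightarrow>\<^sub>0 'f::field) set)"
    using lie_elems.scale[OF lie_elems.gen, of 0] by simp
  then show ?thesis by (auto simp: pm.subspace_def intro: lie_elems.add lie_elems.scale)
qed

definition homog_lie :: "('v list \<Rightarrow>\<^sub>0 'f::field) set" where
  "homog_lie = {x \<in> lie_elems. \<exists>n>0. homogeneous n x}"

text \<open>Brackets of homogeneous Lie elements are again homogeneous Lie elements, so by
  bilinearity their span is closed under brackets. This is why a basis of L(V) can be chosen among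
  homogeneous elements.\<close>

lemma lie_elems_span: "x \<in> lie_elems \<Longrightarrow> x \<in> pm.span homog_lie"
proof (induction rule: lie_elems.induct)
  case (gen v)
  then show ?case
    by (intro pm.span_base) (auto simp: homog_lie_def intro!: lie_elems.gen exI[of _ 1])
next
  case (bracket x y)
  have *: "a * b - b * a \<in> homog_lie" if "a \<in> homog_lie" "b \<in> homog_lie" for a b :: "'a list \<Rightarrow>\<^sub>0 'b"
  proof -
    obtain m n where mn: "m > 0" "n > 0" "homogeneous m a" "homogeneous n b"
      using \<open>a \<in> homog_lie\<close> \<open>b \<in> homog_lie\<close> unfolding homog_lie_def by blast
    have "homogeneous (m + n) (a * b - b * a)"
      using pm.subspace_diff[OF subspace_homogeneous, of "a * b" "m + n" "b * a"]
        homogeneous_mult[OF mn(3,4)] homogeneous_mult[OF mn(4,3)] by (simp add: add.commute)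
    moreover have "m + n > 0" using mn by simp
    ultimately show ?thesis using that by (auto simp: homog_lie_def intro: lie_elems.bracket)
  qed
  have 1: "a * y - y * a \<in> pm.span homog_lie" if "a \<in> homog_lie" for a
    by (rule pm_linear_span_subset[OF _ pm.subspace_span _ bracket.IH(2)])
       (use *[OF that] pm.span_base in \<open>auto intro!: pm_linear_minus pm_linear_mult_left pm_linear_mult_right\<close>)
  show ?case
    by (rule pm_linear_span_subset[OF _ pm.subspace_span _ bracket.IH(1)])
       (use 1 in \<open>auto intro!: pm_linear_minus pm_linear_mult_left pm_linear_mult_right\<close>)
qed (auto intro: pm.span_add pm.span_scale)

lemma linear_rels_cases:
  assumes "\<rho> \<in> linear_rels M h"
  obtains (add) u v where "u \<in> carrier M" "v \<in> carrier M"
      "\<rho> = Poly_Mapping.single (h (u + v)) 1 - Poly_Mapping.single (h u) 1 - Poly_Mapping.single (h v) 1"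
    | (scl) c u where "u \<in> carrier M"
      "\<rho> = Poly_Mapping.single (h (scl M c u)) 1 - Poly_Mapping.single (h u) c"
  using assms unfolding linear_rels_def by blast

lemma linear_rels_add:
  "u \<in> carrier M \<Longrightarrow> v \<in> carrier M \<Longrightarrow>
     Poly_Mapping.single (h (u + v)) 1 - Poly_Mapping.single (h u) 1 - Poly_Mapping.single (h v) 1
       \<in> linear_rels M h"
  unfolding linear_rels_def by blast

lemma linear_rels_scl:
  "u \<in> carrier M \<Longrightarrow>
     Poly_Mapping.single (h (scl M c u)) 1 - Poly_Mapping.single (h u) c \<in> linear_rels M h"
  unfolding linear_rels_def by blast

lemma linear_rels_map:
  assumes "pm_linear f" "\<And>k. f (Poly_Mapping.single (h k) 1) = Poly_Mapping.single (h' k) 1"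
  shows "f ` linear_rels M h = linear_rels M h'"
proof -
  have "f (Poly_Mapping.single (h k) c) = Poly_Mapping.single (h' k) c" for k c
    using pm_linear_scale[OF assms(1), of c "Poly_Mapping.single (h k) 1"] assms(2)[of k] by simp
  then have f: "f (Poly_Mapping.single (h (u + v)) 1 - Poly_Mapping.single (h u) 1 - Poly_Mapping.single (h v) 1) =
      Poly_Mapping.single (h' (u + v)) 1 - Poly_Mapping.single (h' u) 1 - Poly_Mapping.single (h' v) 1"
    "f (Poly_Mapping.single (h (scl M c u)) 1 - Poly_Mapping.single (h u) c) =
      Poly_Mapping.single (h' (scl M c u)) 1 - Poly_Mapping.single (h' u) c" for u v c
    by (simp_all add: pm_linear_diff[OF assms(1)])
  show ?thesis
  proof (intro equalityI subsetI)
    fix \<rho> assume "\<rho> \<in> f ` linear_rels M h"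
    then obtain \<sigma> where "\<sigma> \<in> linear_rels M h" "\<rho> = f \<sigma>" by blast
    then show "\<rho> \<in> linear_rels M h'"
      by (cases rule: linear_rels_cases) (simp_all only: f linear_rels_add linear_rels_scl)
  next
    fix \<rho> assume "\<rho> \<in> linear_rels M h'"
    then show "\<rho> \<in> f ` linear_rels M h"
      by (cases rule: linear_rels_cases)
         (simp_all only: f[symmetric] imageI linear_rels_add linear_rels_scl)
  qed
qed

text \<open>Putting a letter into a context is multiplication by words from both sides, so
  \<open>tensor_ideal\<close> is the two-sided ideal generated by the linearity relations in degree
  1.\<close>

lemma linear_rels_context:
  "linear_rels V (\<lambda>v. xs @ v # ys) = (\<lambda>x. word xs * x * word ys) ` linear_rels V (\<lambda>v. [v])"
  by (rule linear_rels_map[symmetric])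
     (simp_all add: mult_single plus_list_def pm_linear_compose[OF pm_linear_mult_right pm_linear_mult_left])

context fg_module
begin

abbreviation I :: "('v list \<Rightarrow>\<^sub>0 'f) set" where "I \<equiv> tensor_ideal V"

lemma I_def: "I = pm.span (\<Union>xs ys. (\<lambda>x. word xs * x * word ys) ` linear_rels V (\<lambda>v. [v]))"
  by (simp add: tensor_ideal_def linear_rels_context)

lemma subspace_I: "pm.subspace I"
  by (simp add: tensor_ideal_def pm.subspace_span)

lemma I_cases:
  assumes "pm_linear f" "pm.subspace S" "x \<in> I"
    "\<And>xs ys \<rho>. \<rho> \<in> linear_rels V (\<lambda>v. [v]) \<Longrightarrow> f (word xs * \<rho> * word ys) \<in> S"
  shows "f x \<in> S"
  by (rule pm_linear_span_subset[OF assms(1,2) _ assms(3)[unfolded I_def]]) (use assms(4) in blast)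

lemma rel_in_I: "\<rho> \<in> linear_rels V (\<lambda>v. [v]) \<Longrightarrow> word xs * \<rho> * word ys \<in> I"
  unfolding I_def by (rule pm.span_base) blast

lemma I_mult: assumes "x \<in> I" shows "a * x * b \<in> I"
proof (rule I_cases[of "\<lambda>x. a * x * b", OF pm_linear_mult2 subspace_I assms])
  fix xs ys \<rho> assume \<rho>: "\<rho> \<in> linear_rels V (\<lambda>v. [v])"
  show "a * (word xs * \<rho> * word ys) * b \<in> I"
  proof (rule pm_linear_sandwich_subset[OF subspace_I])
    fix k l
    have "word k * (word xs * \<rho> * word ys) * word l = word (k @ xs) * \<rho> * word (ys @ l)"
      by (simp add: word_append mult.assoc)
    then show "word k * (word xs * \<rho> * word ys) * word l \<in> I"
      using rel_in_I[OF \<rho>] by simp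
  qed
qed

lemma I_mult_left: "x \<in> I \<Longrightarrow> a * x \<in> I"
  using I_mult[of x a 1] by simp

lemma I_mult_right: "x \<in> I \<Longrightarrow> x * a \<in> I"
  using I_mult[of x 1 a] by simp

lemma rel_homogeneous: "\<rho> \<in> linear_rels V (\<lambda>v. [v]) \<Longrightarrow> homogeneous 1 \<rho>"
  by (erule linear_rels_cases)
     (auto intro!: homogeneous_diff)

text \<open>The generators \<open>word xs * \<rho> * word ys\<close> are homogeneous, so the ideal
  is graded.\<close>

lemma I_hproj: "x \<in> I \<Longrightarrow> hproj n x \<in> I"
proof (erule I_cases[OF pm_linear_hproj subspace_I])
  fix xs ys \<rho> assume \<rho>: "\<rho> \<in> linear_rels V (\<lambda>v. [v])"
  have "homogeneous (length xs + 1 + length ys) (word xs * \<rho> * word ys)"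
    by (intro homogeneous_mult rel_homogeneous \<rho>) simp_all
  then show "hproj n (word xs * \<rho> * word ys) \<in> I"
    using rel_in_I[OF \<rho>] pm.subspace_0[OF subspace_I] by (simp add: hproj_homogeneous)
qed

definition tw :: "'g \<Rightarrow> ('v list \<Rightarrow>\<^sub>0 'f) \<Rightarrow> ('v list \<Rightarrow>\<^sub>0 'f)" where
  "tw g = pm_push (\<lambda>w. map (\<lambda>v. act V v g) w)"

lemma pm_linear_tw: "pm_linear (tw g)"
  by (simp add: tw_def pm_linear_push)

lemma tw_single [simp]: "tw g (Poly_Mapping.single w c) = Poly_Mapping.single (map (\<lambda>v. act V v g) w) c"
  by (simp add: tw_def)

lemma tw_mult: "tw g (x * y) = tw g x * tw g y"
  by (rule pm_linear_mult_eqI[OF pm_linear_tw]) (simp add: mult_single plus_list_def)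

lemma tw_one: "tw g 1 = 1"
  using tw_single[of g "[]" 1] by (simp add: word_Nil)

lemma tw_I: "g \<in> carrier G \<Longrightarrow> x \<in> I \<Longrightarrow> tw g x \<in> I"
proof (erule I_cases[OF pm_linear_tw subspace_I])
  fix xs ys \<rho> assume g: "g \<in> carrier G" and \<rho>: "\<rho> \<in> linear_rels V (\<lambda>v. [v])"
  have "tw g \<rho> \<in> linear_rels V (\<lambda>v. [v])"
    using linear_rels_add[of _ V _ "\<lambda>v. [v]"] linear_rels_scl[of _ V "\<lambda>v. [v]"]
    by (cases rule: linear_rels_cases[OF \<rho>])
       (simp_all add: pm_linear_diff[OF pm_linear_tw] act_add[OF g] act_scl[OF g] carrier_UNIV)
  then show "tw g (word xs * \<rho> * word ys) \<in> I"
    by (simp add: tw_mult rel_in_I)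
qed

lemma tw_homogeneous: "homogeneous n x \<Longrightarrow> homogeneous n (tw g x)"
  using keys_pm_push[of "map (\<lambda>v. act V v g)" x] unfolding tw_def homogeneous_def by fastforce

lemma tw_lie: "x \<in> lie_elems \<Longrightarrow> tw g x \<in> lie_elems"
  by (induction rule: lie_elems.induct)
     (auto simp: pm_linear_add[OF pm_linear_tw] pm_linear_diff[OF pm_linear_tw]
       pm_linear_scale[OF pm_linear_tw] tw_mult intro: lie_elems.intros)

abbreviation \<pi> :: "('v list \<Rightarrow>\<^sub>0 'f) \<Rightarrow> ('v list \<Rightarrow>\<^sub>0 'f) set" where
  "\<pi> x \<equiv> x +o I"

lemma presents_tensor: "presents G (tensor_algebra V) \<pi> UNIV I (\<lambda>x g. tw g x)"
proof -
  have "presents G (free_mod UNIV (\<lambda>w g. map (\<lambda>v. act V v g) w)) (\<lambda>x. x) {x. Poly_Mapping.keys x \<subseteq> UNIV}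
      {0} (\<lambda>x g. pm_push (\<lambda>k. map (\<lambda>v. act V v g) k) x)"
    by (rule presents_free) simp
  then have "presents G (free_mod UNIV (\<lambda>w g. map (\<lambda>v. act V v g) w)) (\<lambda>x. x) UNIV {0} (\<lambda>x g. tw g x)"
    by (simp add: tw_def)
  from presents_quot[OF this subspace_I] show ?thesis
    using tw_I pm.subspace_0[OF subspace_I] by (simp add: tensor_algebra_def)
qed

lemma pi_eq: "\<pi> x = \<pi> y \<longleftrightarrow> x - y \<in> I"
  using presentsD(11)[OF presents_tensor] by simp

lemma pi_add: "\<pi> (x + y) = \<pi> x + \<pi> y"
  using presentsD(8)[OF presents_tensor] by simp

lemma pi_scale: "scl (tensor_algebra V) c (\<pi> x) = \<pi> (pm_scale c x)"
  using presentsD(9)[OF presents_tensor] by simp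

lemma in_pi: "y \<in> \<pi> x \<longleftrightarrow> y - x \<in> I"
  by (force simp: elt_set_plus_def intro: bexI[of _ "y - x"])

lemma pi_mult: "tensor_mult V (\<pi> x) (\<pi> y) = \<pi> (x * y)"
proof (intro equalityI subsetI)
  fix u assume "u \<in> tensor_mult V (\<pi> x) (\<pi> y)"
  then obtain a b i where abi: "a \<in> \<pi> x" "b \<in> \<pi> y" "i \<in> I" "u = a * b + i"
    by (auto simp: tensor_mult_def set_plus_def pm_bilin_append)
  have "u - x * y = (a - x) * b + x * (b - y) + i" using abi by (simp add: algebra_simps)
  also have "\<dots> \<in> I"
    using abi by (intro pm.subspace_add[OF subspace_I] I_mult_left I_mult_right) (simp_all add: in_pi)
  finally show "u \<in> \<pi> (x * y)" by (simp add: in_pi)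
next
  fix u assume "u \<in> \<pi> (x * y)"
  then have "u = pm_bilin (@) x y + (u - x * y)" "u - x * y \<in> I" "x \<in> \<pi> x" "y \<in> \<pi> y"
    using pm.subspace_0[OF subspace_I] by (simp_all add: in_pi pm_bilin_append)
  then show "u \<in> tensor_mult V (\<pi> x) (\<pi> y)" unfolding tensor_mult_def
    by (metis (mono_tags, lifting) mem_Collect_eq set_plus_intro)
qed

lemma free_lie_algebra_eq: "free_lie_algebra V = \<pi> ` lie_elems"
proof (intro equalityI subsetI)
  fix a assume "a \<in> free_lie_algebra V"
  then show "a \<in> \<pi> ` lie_elems"
  proof (induction rule: free_lie_algebra.induct)
    case (add a b)
    then obtain x y where "x \<in> lie_elems" "y \<in> lie_elems" "a = \<pi> x" "b = \<pi> y" by blast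
    then show ?case by (intro image_eqI[where x="x + y"]) (simp_all add: pi_add lie_elems.add)
  next
    case (scale a c)
    then obtain x where "x \<in> lie_elems" "a = \<pi> x" by blast
    then show ?case by (intro image_eqI[where x="pm_scale c x"]) (simp_all add: pi_scale lie_elems.scale)
  next
    case (bracket a b)
    then obtain x y where xy: "x \<in> lie_elems" "y \<in> lie_elems" "a = \<pi> x" "b = \<pi> y" by blast
    have "tensor_mult V a b + scl (tensor_algebra V) (- 1) (tensor_mult V b a) = \<pi> (x * y - y * x)"
      using pi_add[of "x * y" "- (y * x)"] pi_scale[of "- 1" "y * x"] by (simp add: xy pi_mult)
    then show ?case using lie_elems.bracket[OF xy(1,2)] by (rule image_eqI)
  qed (auto intro: lie_elems.gen)
next
  fix a assume "a \<in> \<pi> ` lie_elems"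
  then obtain x where x: "x \<in> lie_elems" "a = \<pi> x" by blast
  from x(1) have "\<pi> x \<in> free_lie_algebra V"
  proof (induction rule: lie_elems.induct)
    case (gen v)
    show ?case by (rule free_lie_algebra.gen) (simp add: carrier_UNIV)
  next
    case (add x y)
    then show ?case by (simp add: pi_add free_lie_algebra.add)
  next
    case (scale x c)
    then show ?case using free_lie_algebra.scale[of "\<pi> x" V c] by (simp add: pi_scale)
  next
    case (bracket x y)
    have "tensor_mult V (\<pi> x) (\<pi> y) + scl (tensor_algebra V) (- 1) (tensor_mult V (\<pi> y) (\<pi> x)) = \<pi> (x * y - y * x)"
      using pi_add[of "x * y" "- (y * x)"] pi_scale[of "- 1" "y * x"] by (simp add: pi_mult)
    then show ?case using free_lie_algebra.bracket[OF bracket.IH] by simp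
  qed
  then show "a \<in> free_lie_algebra V" by (simp add: x)
qed

definition LL :: "('v list \<Rightarrow>\<^sub>0 'f) set" where
  "LL = {x. \<exists>y\<in>lie_elems. x - y \<in> I}"

lemma LL_iff: "x \<in> LL \<longleftrightarrow> \<pi> x \<in> free_lie_algebra V"
  by (auto simp: LL_def free_lie_algebra_eq image_iff pi_eq)

lemma lie_LL: "x \<in> lie_elems \<Longrightarrow> x \<in> LL"
  unfolding LL_def using pm.subspace_0[OF subspace_I] by (auto intro!: bexI[of _ x])

lemma LL_I: "y \<in> lie_elems \<Longrightarrow> x - y \<in> I \<Longrightarrow> x \<in> LL"
  by (auto simp: LL_def)

lemma LL_E: assumes "x \<in> LL" obtains y where "y \<in> lie_elems" "x - y \<in> I"
  using assms by (auto simp: LL_def)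

lemma subspace_LL: "pm.subspace LL"
  unfolding pm.subspace_def
proof (intro conjI ballI allI)
  show "0 \<in> LL" by (rule lie_LL[OF pm.subspace_0[OF subspace_lie_elems]])
next
  fix x y assume "x \<in> LL" "y \<in> LL"
  then obtain x' y' where xy: "x' \<in> lie_elems" "y' \<in> lie_elems" "x - x' \<in> I" "y - y' \<in> I"
    by (elim LL_E)
  have "x + y - (x' + y') = (x - x') + (y - y')" by simp
  also have "\<dots> \<in> I" using xy by (intro pm.subspace_add[OF subspace_I])
  finally show "x + y \<in> LL" using lie_elems.add[OF xy(1,2)] by (intro LL_I)
next
  fix c x assume "x \<in> LL"
  then obtain x' where x': "x' \<in> lie_elems" "x - x' \<in> I" by (elim LL_E)
  have "pm_scale c x - pm_scale c x' = pm_scale c (x - x')"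
    by (simp add: pm.scale_right_diff_distrib)
  also have "\<dots> \<in> I" using x' by (intro pm.subspace_scale[OF subspace_I])
  finally show "pm_scale c x \<in> LL" using lie_elems.scale[OF x'(1)] by (intro LL_I)
qed

lemma bracket_diff_I:
  assumes "x - x' \<in> I" "y - y' \<in> I"
  shows "(x * y - y * x) - (x' * y' - y' * x') \<in> I"
proof -
  have "(x * y - y * x) - (x' * y' - y' * x') =
      (x - x') * y + x' * (y - y') - ((y - y') * x + y' * (x - x'))"
    by (simp add: algebra_simps)
  also have "\<dots> \<in> I"
    by (intro pm.subspace_add[OF subspace_I] pm.subspace_diff[OF subspace_I] I_mult_left I_mult_right assms)
  finally show ?thesis .
qed

lemma LL_bracket:
  assumes "x \<in> LL" "y \<in> LL" shows "x * y - y * x \<in> LL"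
proof -
  obtain x' y' where xy: "x' \<in> lie_elems" "y' \<in> lie_elems" "x - x' \<in> I" "y - y' \<in> I"
    using assms by (elim LL_E)
  show ?thesis by (rule LL_I[OF lie_elems.bracket[OF xy(1,2)] bracket_diff_I[OF xy(3,4)]])
qed

lemma LL_tw:
  assumes g: "g \<in> carrier G" and "x \<in> LL" shows "tw g x \<in> LL"
proof -
  obtain y where y: "y \<in> lie_elems" "x - y \<in> I" using assms(2) by (elim LL_E)
  have "tw g x - tw g y \<in> I"
    using tw_I[OF g y(2)] by (simp add: pm_linear_diff[OF pm_linear_tw])
  then show ?thesis by (rule LL_I[OF tw_lie[OF y(1)]])
qed

end

section \<open>Normal forms in the tensor algebra\<close>

text \<open>Elements of the free algebra that form a basis of L(V) serve as keys themselves; a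
  formal combination of such keys is evaluated to the element that it denotes.\<close>

definition pm_val :: "(('k \<Rightarrow>\<^sub>0 'f) \<Rightarrow>\<^sub>0 'f::field) \<Rightarrow> ('k \<Rightarrow>\<^sub>0 'f)" where
  "pm_val = pm_lin (\<lambda>b. b)"

lemma pm_linear_val: "pm_linear pm_val"
  by (simp add: pm_val_def pm_linear_lin)

lemma pm_val_single [simp]: "pm_val (Poly_Mapping.single b c) = pm_scale c b"
  by (simp add: pm_val_def)

lemma lookup_pm_lin_filter:
  "Poly_Mapping.lookup (pm_lin (\<lambda>k. if Q k then Poly_Mapping.single k 1 else 0) x) k =
     (if Q k then Poly_Mapping.lookup x k else 0)"
proof -
  have "Poly_Mapping.lookup (pm_lin (\<lambda>k. if Q k then Poly_Mapping.single k 1 else 0) x) k =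
      (\<Sum>k'\<in>Poly_Mapping.keys x. if k' = k then (if Q k then Poly_Mapping.lookup x k else 0) else 0)"
    unfolding pm_lin_def lookup_sum by (rule sum.cong) (auto simp: lookup_single when_def)
  also have "\<dots> = (if Q k then Poly_Mapping.lookup x k else 0)"
    by (simp add: in_keys_iff)
  finally show ?thesis .
qed

text \<open>\<open>B\<close> represents a basis of L(V) by homogeneous elements, and
  \<open>crd\<close> gives coordinates modulo the ideal. The map \<open>crd\<close> is linear on the
  whole free algebra, but its values are meaningful as coordinates on \<open>LL\<close> only. The
  linear order fixes the order of factors in products.\<close>

locale lie_basis = fg_module G V + ord: linorder le lt
  for G :: "('g, 'b) monoid_scheme" (structure)
  and V :: "('f::field, 'g, 'v::ab_group_add) fgmod"
  and le :: "('v list \<Rightarrow>\<^sub>0 'f) \<Rightarrow> ('v list \<Rightarrow>\<^sub>0 'f) \<Rightarrow> bool"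
  and lt :: "('v list \<Rightarrow>\<^sub>0 'f) \<Rightarrow> ('v list \<Rightarrow>\<^sub>0 'f) \<Rightarrow> bool" +
  fixes B :: "('v list \<Rightarrow>\<^sub>0 'f) set" and crd :: "('v list \<Rightarrow>\<^sub>0 'f) \<Rightarrow> (('v list \<Rightarrow>\<^sub>0 'f) \<Rightarrow>\<^sub>0 'f)"
  assumes B_homog: "b \<in> B \<Longrightarrow> b \<in> homog_lie"
    and pm_linear_crd: "pm_linear crd"
    and crd_B: "b \<in> B \<Longrightarrow> crd b = Poly_Mapping.single b 1"
    and crd_I: "x \<in> I \<Longrightarrow> crd x = 0"
    and crd_keys: "x \<in> LL \<Longrightarrow> Poly_Mapping.keys (crd x) \<subseteq> B"
    and crd_val: "x \<in> LL \<Longrightarrow> x - pm_val (crd x) \<in> I"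
begin

text \<open>The locale \<open>pbw\<close> speaks of all keys, so values outside \<open>B\<close> are
  needed: the degree 1 keeps degrees positive there, and \<open>br\<close> vanishes as soon as one
  argument is not in \<open>B\<close>.\<close>

definition dg :: "('v list \<Rightarrow>\<^sub>0 'f) \<Rightarrow> nat" where
  "dg b = (if b \<in> B then SOME n. n > 0 \<and> homogeneous n b else 1)"

definition br :: "('v list \<Rightarrow>\<^sub>0 'f) \<Rightarrow> ('v list \<Rightarrow>\<^sub>0 'f) \<Rightarrow> (('v list \<Rightarrow>\<^sub>0 'f) \<Rightarrow>\<^sub>0 'f)" where
  "br a b = (if a \<in> B \<and> b \<in> B then crd (a * b - b * a) else 0)"

lemma B_LL: "b \<in> B \<Longrightarrow> b \<in> LL"
  using B_homog lie_LL by (auto simp: homog_lie_def)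

lemma dg: "b \<in> B \<Longrightarrow> dg b > 0 \<and> homogeneous (dg b) b"
proof -
  assume b: "b \<in> B"
  then have "\<exists>n>0. homogeneous n b" using B_homog by (auto simp: homog_lie_def)
  then have "(SOME n. n > 0 \<and> homogeneous n b) > 0 \<and> homogeneous (SOME n. n > 0 \<and> homogeneous n b) b"
    by (rule someI_ex[of "\<lambda>n. n > 0 \<and> homogeneous n b"])
  then show ?thesis using b by (simp add: dg_def)
qed

lemma crd_eq: "x - y \<in> I \<Longrightarrow> crd x = crd y"
  using crd_I[of "x - y"] pm_linear_diff[OF pm_linear_crd, of x y] by simp

lemma crd_pm_val: "Poly_Mapping.keys x \<subseteq> B \<Longrightarrow> crd (pm_val x) = x"
  by (rule pm_linear_eqI[of "\<lambda>x. crd (pm_val x)" "\<lambda>x. x"])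
     (auto simp: pm_linear_compose[OF pm_linear_crd pm_linear_val] pm_linear_id crd_B)

lemma br_linear:
  assumes x: "Poly_Mapping.keys x \<subseteq> B" and y: "Poly_Mapping.keys y \<subseteq> B"
  shows "pm_lin (\<lambda>k. pm_lin (br k) y) x = crd (pm_val x * pm_val y - pm_val y * pm_val x)"
proof (rule pm_linear_eqI[of "pm_lin (\<lambda>k. pm_lin (br k) y)" "\<lambda>x. crd (pm_val x * pm_val y - pm_val y * pm_val x)"])
  show "pm_linear (\<lambda>x. crd (pm_val x * pm_val y - pm_val y * pm_val x))"
    by (rule pm_linear_compose[OF pm_linear_crd pm_linear_minus[OF
          pm_linear_compose[OF pm_linear_mult_right pm_linear_val]
          pm_linear_compose[OF pm_linear_mult_left pm_linear_val]]])
next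
  fix a assume "a \<in> Poly_Mapping.keys x"
  then have a: "a \<in> B" using x by auto
  have "pm_lin (br a) y = crd (a * pm_val y - pm_val y * a)"
  proof (rule pm_linear_eqI[of "pm_lin (br a)" "\<lambda>y. crd (a * pm_val y - pm_val y * a)"])
    show "pm_linear (\<lambda>y. crd (a * pm_val y - pm_val y * a))"
      by (rule pm_linear_compose[OF pm_linear_crd pm_linear_minus[OF
            pm_linear_compose[OF pm_linear_mult_left pm_linear_val]
            pm_linear_compose[OF pm_linear_mult_right pm_linear_val]]])
  next
    fix b assume "b \<in> Poly_Mapping.keys y"
    then have b: "b \<in> B" using y by auto
    then show "pm_lin (br a) (Poly_Mapping.single b 1) =
        crd (a * pm_val (Poly_Mapping.single b 1) - pm_val (Poly_Mapping.single b 1) * a)"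
      using a by (simp add: br_def)
  qed (rule pm_linear_lin)
  then show "pm_lin (\<lambda>k. pm_lin (br k) y) (Poly_Mapping.single a 1) =
      crd (pm_val (Poly_Mapping.single a 1) * pm_val y - pm_val y * pm_val (Poly_Mapping.single a 1))"
    by simp
qed (rule pm_linear_lin)

lemma br_crd:
  assumes "x \<in> LL" "y \<in> LL"
  shows "pm_lin (\<lambda>k. pm_lin (br k) (crd y)) (crd x) = crd (x * y - y * x)"
proof -
  have "pm_lin (\<lambda>k. pm_lin (br k) (crd y)) (crd x) =
      crd (pm_val (crd x) * pm_val (crd y) - pm_val (crd y) * pm_val (crd x))"
    by (rule br_linear) (rule crd_keys assms)+
  also have "\<dots> = crd (x * y - y * x)"
    by (rule crd_eq[symmetric]) (rule bracket_diff_I[OF crd_val[OF assms(1)] crd_val[OF assms(2)]])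
  finally show ?thesis .
qed

text \<open>Modulo the graded ideal, \<open>x\<close> is the combination of basis elements given by
  its coordinates. Its projection to a degree other than \<open>n\<close> is a combination of basis
  elements lying in the ideal, and these are independent modulo the ideal.\<close>

lemma crd_homogeneous:
  assumes x: "x \<in> LL" "homogeneous n x" and b: "b \<in> Poly_Mapping.keys (crd x)"
  shows "dg b = n"
proof (rule ccontr)
  assume ne: "dg b \<noteq> n"
  let ?res = "pm_lin (\<lambda>b'. if dg b' = dg b then Poly_Mapping.single b' 1 else 0)"
  have "hproj (dg b) (x - pm_val (crd x)) \<in> I" by (rule I_hproj[OF crd_val[OF x(1)]])
  moreover have "hproj (dg b) x = 0" using hproj_homogeneous[OF x(2), of "dg b"] ne by simp
  moreover have "hproj (dg b) (pm_val (crd x)) = pm_val (?res (crd x))"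
  proof (rule pm_linear_eqI[of "\<lambda>y. hproj (dg b) (pm_val y)" "\<lambda>y. pm_val (?res y)"])
    fix b' assume "b' \<in> Poly_Mapping.keys (crd x)"
    then have "homogeneous (dg b') b'" using crd_keys[OF x(1)] dg by blast
    then show "hproj (dg b) (pm_val (Poly_Mapping.single b' 1)) = pm_val (?res (Poly_Mapping.single b' 1))"
      using hproj_homogeneous[of "dg b'" b' "dg b"] by (simp add: pm_linear_0[OF pm_linear_val])
  qed (rule pm_linear_compose[OF pm_linear_hproj pm_linear_val]
      pm_linear_compose[OF pm_linear_val pm_linear_lin])+
  ultimately have "pm_val (?res (crd x)) \<in> I"
    using pm.subspace_neg[OF subspace_I, of "- pm_val (?res (crd x))"]
    by (simp add: pm_linear_diff[OF pm_linear_hproj])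
  then have f1: "crd (pm_val (?res (crd x))) = 0" by (rule crd_I)
  have f2: "Poly_Mapping.keys (?res (crd x)) \<subseteq> B"
    by (rule pm_lin_in_keys) (use crd_keys[OF x(1)] in auto)
  have "?res (crd x) = 0" using crd_pm_val[OF f2] f1 by (rule trans[OF sym])
  moreover have "Poly_Mapping.lookup (?res (crd x)) b = Poly_Mapping.lookup (crd x) b"
    by (simp add: lookup_pm_lin_filter)
  ultimately show False using b by (simp add: in_keys_iff)
qed

lemma lin_br_0: "(\<And>k. f k = 0) \<Longrightarrow> pm_lin f x = 0"
  by (simp add: pm_lin_def)

sublocale P: pbw le lt br B dg
proof
  fix a b c
  show "br a a = 0" by (simp add: br_def pm_linear_0[OF pm_linear_crd])
  show "br a b = - br b a"
    using pm_linear_uminus[OF pm_linear_crd, of "b * a - a * b"] by (simp add: br_def)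
  show "dg a > 0" using dg by (cases "a \<in> B") (auto simp: dg_def)
  show "pm_lin (br a) (br b c) - pm_lin (br b) (br a c) = pm_lin (\<lambda>x. br x c) (br a b)"
  proof (cases "a \<in> B \<and> b \<in> B \<and> c \<in> B")
    case True
    have *: "pm_lin (br u) (br v w) = crd (u * (v * w - w * v) - (v * w - w * v) * u)"
      if "u \<in> B" "v \<in> B" "w \<in> B" for u v w
      using br_crd[OF B_LL[OF that(1)] LL_bracket[OF B_LL[OF that(2)] B_LL[OF that(3)]]] that
      by (simp add: crd_B br_def)
    have **: "pm_lin (\<lambda>x. br x w) (br u v) = crd ((u * v - v * u) * w - w * (u * v - v * u))"
      if "u \<in> B" "v \<in> B" "w \<in> B" for u v w
      using br_crd[OF LL_bracket[OF B_LL[OF that(1)] B_LL[OF that(2)]] B_LL[OF that(3)]] that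
      by (simp add: crd_B br_def)
    show ?thesis
      using True by (simp only: * ** pm_linear_diff[OF pm_linear_crd, symmetric]) (simp add: algebra_simps)
  next
    case False
    then consider "a \<notin> B" | "b \<notin> B" | "c \<notin> B" by blast
    then show ?thesis
    proof cases
      case 1
      then have "\<And>k. br a k = 0" by (simp add: br_def)
      then show ?thesis by (simp add: lin_br_0)
    next
      case 2
      then have "\<And>k. br b k = 0" "br a b = 0" by (simp_all add: br_def)
      then show ?thesis by (simp add: lin_br_0)
    next
      case 3
      then have "\<And>k. br k c = 0" by (simp add: br_def)
      then show ?thesis by (simp add: lin_br_0)
    qed
  qed
  show "a \<in> B \<Longrightarrow> b \<in> B \<Longrightarrow> Poly_Mapping.keys (br a b) \<subseteq> B"
    using crd_keys[OF LL_bracket[OF B_LL B_LL]] by (simp add: br_def)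
  show "dg c = dg a + dg b" if c: "c \<in> Poly_Mapping.keys (br a b)"
  proof -
    have ab: "a \<in> B" "b \<in> B" using c by (auto simp: br_def split: if_splits)
    have "homogeneous (dg a + dg b) (a * b - b * a)"
      using homogeneous_mult[of "dg a" a "dg b" b] homogeneous_mult[of "dg b" b "dg a" a] dg ab
      by (intro homogeneous_diff) (simp_all add: add.commute)
    moreover have "c \<in> Poly_Mapping.keys (crd (a * b - b * a))" using c ab by (simp add: br_def)
    ultimately show ?thesis using crd_homogeneous[OF LL_bracket[OF B_LL B_LL]] ab by blast
  qed
qed

section \<open>The normal form of a tensor\<close>

primrec Nw :: "'v list \<Rightarrow> (('v list \<Rightarrow>\<^sub>0 'f) multiset \<Rightarrow>\<^sub>0 'f)" where
  "Nw [] = P.z {#}"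
| "Nw (v # w) = P.act (crd (word [v])) (Nw w)"

definition N :: "('v list \<Rightarrow>\<^sub>0 'f) \<Rightarrow> (('v list \<Rightarrow>\<^sub>0 'f) multiset \<Rightarrow>\<^sub>0 'f)" where
  "N = pm_lin Nw"

lemma pm_linear_N: "pm_linear N"
  by (simp add: N_def pm_linear_lin)

lemma letter_LL: "word [v] \<in> LL"
  by (intro lie_LL lie_elems.gen)

lemma Nw_over: "Poly_Mapping.keys (Nw w) \<subseteq> P.over"
proof (induction w)
  case (Cons v w)
  then show ?case
    unfolding Nw.simps by (rule P.act_over[OF crd_keys[OF letter_LL]])
qed simp

lemma N_over: "Poly_Mapping.keys (N x) \<subseteq> P.over"
  unfolding N_def by (rule pm_lin_in_keys[OF Nw_over])

lemma N_letter: "N (word [v] * x) = P.act (crd (word [v])) (N x)"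
proof (rule pm_linear_eqI[of "\<lambda>x. N (word [v] * x)" "\<lambda>x. P.act (crd (word [v])) (N x)"])
  show "pm_linear (\<lambda>x. N (word [v] * x))"
    by (rule pm_linear_compose[OF pm_linear_N pm_linear_mult_left])
  show "pm_linear (\<lambda>x. P.act (crd (word [v])) (N x))"
    by (rule pm_linear_compose[OF P.pm_linear_act2 pm_linear_N])
qed (simp add: N_def word_Cons[symmetric])

lemma N_one: "N 1 = P.z {#}"
  by (simp add: N_def word_Nil[symmetric])

text \<open>Letters act through their coordinates by definition. By \<open>act_bracket\<close> the
  polynomials are a module over the Lie algebra with basis \<open>B\<close>, so a bracket, which
  multiplies as a commutator, acts through its coordinates as well.\<close>

lemma N_lie: "x \<in> lie_elems \<Longrightarrow> N (x * y) = P.act (crd x) (N y)"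
proof (induction arbitrary: y rule: lie_elems.induct)
  case (gen v)
  show ?case by (rule N_letter)
next
  case (add x x')
  then show ?case
    by (simp add: distrib_right pm_linear_add[OF pm_linear_N] pm_linear_add[OF pm_linear_crd]
        pm_linear_add[OF P.pm_linear_act1])
next
  case (scale x c)
  then show ?case
    by (simp add: pm_scale_mult_left pm_linear_scale[OF pm_linear_N] pm_linear_scale[OF pm_linear_crd]
        pm_linear_scale[OF P.pm_linear_act1])
next
  case (bracket x x')
  have "N ((x * x' - x' * x) * y) = N (x * (x' * y)) - N (x' * (x * y))"
    by (simp add: left_diff_distrib pm_linear_diff[OF pm_linear_N] mult.assoc)
  also have "\<dots> = P.act (crd x) (P.act (crd x') (N y)) - P.act (crd x') (P.act (crd x) (N y))"
    by (simp add: bracket.IH)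
  also have "\<dots> = P.act (pm_lin (\<lambda>k. pm_lin (br k) (crd x')) (crd x)) (N y)"
    using bracket.hyps by (intro P.act_bracket[symmetric] crd_keys lie_LL N_over)
  also have "\<dots> = P.act (crd (x * x' - x' * x)) (N y)"
    using bracket.hyps by (simp add: br_crd lie_LL)
  finally show ?case .
qed

lemma N_word_mult: "N x = N y \<Longrightarrow> N (word w * x) = N (word w * y)"
proof (induction w)
  case (Cons v w)
  then show ?case by (simp add: word_Cons[of v w] mult.assoc N_letter)
qed (simp add: word_Nil)

lemma N_rel: "\<rho> \<in> linear_rels V (\<lambda>v. [v]) \<Longrightarrow> N (\<rho> * y) = P.act (crd \<rho>) (N y)"
proof (erule linear_rels_cases)
  have s: "Poly_Mapping.single [u] c \<in> lie_elems" for u c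
    using lie_elems.scale[OF lie_elems.gen, of c u] by simp
  show "N (\<rho> * y) = P.act (crd \<rho>) (N y)" if "\<rho> = word [u + v] - word [u] - word [v]" for u v
    unfolding that by (intro N_lie pm.subspace_diff[OF subspace_lie_elems] s)
  show "N (\<rho> * y) = P.act (crd \<rho>) (N y)" if "\<rho> = word [scl V c u] - Poly_Mapping.single [u] c" for c u
    unfolding that by (intro N_lie pm.subspace_diff[OF subspace_lie_elems] s)
qed

text \<open>A linearity relation is a combination of letters and hence a Lie element; as it lies in
  the ideal, its coordinates vanish and it acts as zero. Multiplying by words on either side
  preserves this, so \<open>N\<close> is well defined on T(V).\<close>

lemma N_I: "x \<in> I \<Longrightarrow> N x = 0"
proof -
  assume x: "x \<in> I"
  have "N x \<in> {0}"
  proof (rule I_cases[OF pm_linear_N _ x])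
    fix xs ys \<rho> assume \<rho>: "\<rho> \<in> linear_rels V (\<lambda>v. [v])"
    have "\<rho> \<in> I" using rel_in_I[OF \<rho>, of "[]" "[]"] by (simp add: word_Nil)
    then have "N (\<rho> * word ys) = 0"
      using N_rel[OF \<rho>, of "word ys"] crd_I by (simp add: pm_linear_0[OF P.pm_linear_act1])
    then have "N (word xs * (\<rho> * word ys)) = N (word xs * 0)"
      by (intro N_word_mult) (simp add: pm_linear_0[OF pm_linear_N])
    then show "N (word xs * \<rho> * word ys) \<in> {0}"
      by (simp add: mult.assoc pm_linear_0[OF pm_linear_N])
  qed (simp add: pm.subspace_0)
  then show ?thesis by simp
qed

lemma N_cong: "x - y \<in> I \<Longrightarrow> N x = N y"
  using N_I[of "x - y"] pm_linear_diff[OF pm_linear_N, of x y] by simp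

lemma N_LL: "x \<in> LL \<Longrightarrow> N (x * y) = P.act (crd x) (N y)"
proof (erule LL_E)
  fix x' assume x': "x' \<in> lie_elems" "x - x' \<in> I"
  have "x * y - x' * y \<in> I" using I_mult_right[OF x'(2), of y] by (simp add: algebra_simps)
  then have "N (x * y) = N (x' * y)" by (rule N_cong)
  also have "\<dots> = P.act (crd x') (N y)" by (rule N_lie[OF x'(1)])
  also have "crd x' = crd x" using crd_eq[OF x'(2)] by simp
  finally show ?thesis .
qed

section \<open>Ordered products of basis elements\<close>

primrec prn :: "nat \<Rightarrow> ('v list \<Rightarrow>\<^sub>0 'f) multiset \<Rightarrow> ('v list \<Rightarrow>\<^sub>0 'f)" where
  "prn 0 M = 1"
| "prn (Suc n) M = P.mn M * prn n (M - {#P.mn M#})"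

definition pr :: "('v list \<Rightarrow>\<^sub>0 'f) multiset \<Rightarrow> ('v list \<Rightarrow>\<^sub>0 'f)" where
  "pr M = prn (size M) M"

lemma pr_empty [simp]: "pr {#} = 1"
  by (simp add: pr_def)

lemma pr_add: "P.bel b M \<Longrightarrow> pr (add_mset b M) = b * pr M"
  by (simp add: pr_def P.mn_add)

lemma mset_mn_induct [case_names empty add]:
  assumes "Q {#}" "\<And>b M. P.bel b M \<Longrightarrow> Q M \<Longrightarrow> Q (add_mset b M)"
  shows "Q M"
proof (induction "size M" arbitrary: M)
  case (Suc n)
  then have "M \<noteq> {#}" by auto
  then have mn: "P.mn M \<in># M" "P.bel (P.mn M) M" using P.mn by auto
  then have M: "M = add_mset (P.mn M) (M - {#P.mn M#})" by simp
  have "P.bel (P.mn M) (M - {#P.mn M#})" using mn(2) by (auto simp: P.bel_def dest: in_diffD)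
  moreover have "Q (M - {#P.mn M#})" using Suc mn(1) by (intro Suc.hyps(1)) (simp add: size_Diff_singleton)
  ultimately show ?case using assms(2) M by metis
qed (use assms(1) in simp)

definition sig :: "(('v list \<Rightarrow>\<^sub>0 'f) multiset \<Rightarrow>\<^sub>0 'f) \<Rightarrow> ('v list \<Rightarrow>\<^sub>0 'f)" where
  "sig = pm_lin pr"

lemma pm_linear_sig: "pm_linear sig"
  by (simp add: sig_def pm_linear_lin)

lemma sig_z [simp]: "sig (P.z M) = pr M"
  by (simp add: sig_def)

text \<open>The recursion for \<open>rho\<close> is modelled on
  \<open>b \<mu> T = \<mu> b T + [b,\<mu>] T\<close>, and \<open>sig\<close> turns it back into this
  identity of tensors.\<close>

lemma sig_rho: "b \<in> B \<Longrightarrow> set_mset M \<subseteq> B \<Longrightarrow> sig (P.rho b M) - b * pr M \<in> I"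
proof (induction "size M" arbitrary: b M rule: less_induct)
  case less
  show ?case
  proof (cases "P.bel b M")
    case True
    then show ?thesis using pm.subspace_0[OF subspace_I] by (simp add: P.rho_bel pr_add)
  next
    case False
    then have "M \<noteq> {#}" by (auto simp: P.bel_def)
    define \<mu> where "\<mu> = P.mn M"
    define T where "T = M - {#\<mu>#}"
    have mn: "\<mu> \<in># M" "P.bel \<mu> M" using P.mn[OF \<open>M \<noteq> {#}\<close>] by (auto simp: \<mu>_def)
    then have M: "M = add_mset \<mu> T" by (simp add: T_def)
    have \<mu>: "\<mu> \<in> B" and T: "set_mset T \<subseteq> B" and \<mu>T: "P.bel \<mu> T"
      using less.prems mn(2) by (auto simp: M P.bel_def)
    have lt: "\<not> le b \<mu>" using False mn(2) by (auto simp: P.bel_def intro: ord.order_trans)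
    then have le: "le \<mu> b" using ord.linear by blast
    have IH: "sig (P.op c s) - c * sig s \<in> I" if "c \<in> B" "Poly_Mapping.keys s \<subseteq> P.sz (size T)" for c s
    proof (rule pm_linear_in_subspace[of "\<lambda>s. sig (P.op c s) - c * sig s", OF _ subspace_I])
      show "pm_linear (\<lambda>s. sig (P.op c s) - c * sig s)"
        by (rule pm_linear_minus[OF pm_linear_compose[OF pm_linear_sig P.pm_linear_op]
              pm_linear_compose[OF pm_linear_mult_left pm_linear_sig]])
      fix M' assume "M' \<in> Poly_Mapping.keys s"
      then have "size M' < size M" "set_mset M' \<subseteq> B" using that by (auto simp: P.sz_def M)
      then show "sig (P.op c (P.z M')) - c * sig (P.z M') \<in> I"
        using less.hyps that(1) by simp
    qed
    have zT: "Poly_Mapping.keys (P.z T) \<subseteq> P.sz (size T)" using T by (simp add: P.sz_def)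
    have 1: "sig (P.op b (P.z T)) - b * pr T \<in> I" using IH[OF less.prems(1) zT] by simp
    \<comment> \<open>\<open>\<mu>\<close> is below \<open>add_mset b T\<close>, so on the leading
      monomial of \<open>rho b T\<close> the product is ordered already; the other monomials have at
      most \<open>size T\<close> factors and fall under \<open>IH\<close>.\<close>
    have 2: "sig (P.op \<mu> (P.op b (P.z T))) - \<mu> * sig (P.op b (P.z T)) \<in> I"
    proof -
      have "P.bel \<mu> (add_mset b T)" using \<mu>T le by (simp add: P.bel_def)
      then have "sig (P.op \<mu> (P.z (add_mset b T))) = \<mu> * sig (P.z (add_mset b T))"
        by (simp add: P.rho_bel pr_add)
      moreover have "sig (P.op \<mu> (P.rho b T - P.z (add_mset b T))) - \<mu> * sig (P.rho b T - P.z (add_mset b T)) \<in> I"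
        using P.rho_keys[OF less.prems(1) T] by (intro IH[OF \<mu>]) simp
      moreover have "sig (P.op \<mu> (P.rho b T - P.z (add_mset b T))) - \<mu> * sig (P.rho b T - P.z (add_mset b T)) =
          (sig (P.op \<mu> (P.rho b T)) - \<mu> * sig (P.rho b T)) -
          (sig (P.op \<mu> (P.z (add_mset b T))) - \<mu> * sig (P.z (add_mset b T)))"
        by (simp only: pm_linear_diff[OF P.pm_linear_op] pm_linear_diff[OF pm_linear_sig] right_diff_distrib)
          (simp only: algebra_simps)
      ultimately show ?thesis by simp
    qed
    have 3: "sig (P.act x (P.z T)) - pm_val x * pr T \<in> I" if "Poly_Mapping.keys x \<subseteq> B" for x
    proof (rule pm_linear_in_subspace[of "\<lambda>x. sig (P.act x (P.z T)) - pm_val x * pr T", OF _ subspace_I])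
      show "pm_linear (\<lambda>x. sig (P.act x (P.z T)) - pm_val x * pr T)"
        by (rule pm_linear_minus[OF pm_linear_compose[OF pm_linear_sig P.pm_linear_act1]
              pm_linear_compose[OF pm_linear_mult_right pm_linear_val]])
      fix c assume "c \<in> Poly_Mapping.keys x"
      then show "sig (P.act (Poly_Mapping.single c 1) (P.z T)) - pm_val (Poly_Mapping.single c 1) * pr T \<in> I"
        using IH[OF _ zT, of c] that by auto
    qed
    \<comment> \<open>The commutation of \<open>b\<close> with \<open>\<mu>\<close> on
      \<open>T\<close>, where \<open>\<mu>\<close> acts by insertion, expresses
      \<open>rho b M\<close> by operators applied to the shorter monomial \<open>T\<close>.\<close>
    have "P.comm_at b \<mu> (P.z T)" by (rule P.act_comm_basis[OF less.prems(1) \<mu> T])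
    then have "P.rho b M = P.op \<mu> (P.op b (P.z T)) + P.act (br b \<mu>) (P.z T)"
      using P.rho_bel[OF \<mu>T] by (simp add: P.comm_at_def M diff_eq_eq add.commute)
    then have "sig (P.rho b M) - b * pr M =
        (sig (P.op \<mu> (P.op b (P.z T))) - \<mu> * sig (P.op b (P.z T))) +
        \<mu> * (sig (P.op b (P.z T)) - b * pr T) +
        (sig (P.act (br b \<mu>) (P.z T)) - pm_val (br b \<mu>) * pr T) -
        ((b * \<mu> - \<mu> * b) - pm_val (br b \<mu>)) * pr T"
      by (simp add: pm_linear_add[OF pm_linear_sig] M pr_add[OF \<mu>T] algebra_simps del: P.op_z)
    also have "\<dots> \<in> I"
    proof -
      have br: "Poly_Mapping.keys (br b \<mu>) \<subseteq> B" by (rule P.br_B[OF less.prems(1) \<mu>])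
      have d: "b * \<mu> - \<mu> * b - pm_val (br b \<mu>) \<in> I"
        using crd_val[OF LL_bracket[OF B_LL B_LL]] less.prems(1) \<mu> by (simp add: br_def)
      show ?thesis
        by (rule pm.subspace_diff[OF subspace_I pm.subspace_add[OF subspace_I
              pm.subspace_add[OF subspace_I 2 I_mult_left[OF 1]] 3[OF br]] I_mult_right[OF d]])
    qed
    finally show ?thesis .
  qed
qed

lemma sig_act:
  assumes x: "Poly_Mapping.keys x \<subseteq> B" and s: "Poly_Mapping.keys s \<subseteq> P.over"
  shows "sig (P.act x s) - pm_val x * sig s \<in> I"
proof (rule pm_linear_in_subspace[of "\<lambda>x. sig (P.act x s) - pm_val x * sig s", OF _ subspace_I])
  show "pm_linear (\<lambda>x. sig (P.act x s) - pm_val x * sig s)"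
    by (rule pm_linear_minus[OF pm_linear_compose[OF pm_linear_sig P.pm_linear_act1]
          pm_linear_compose[OF pm_linear_mult_right pm_linear_val]])
  fix b assume "b \<in> Poly_Mapping.keys x"
  then have b: "b \<in> B" using x by auto
  have "sig (P.op b s) - b * sig s \<in> I"
  proof (rule pm_linear_in_subspace[of "\<lambda>s. sig (P.op b s) - b * sig s", OF _ subspace_I])
    show "pm_linear (\<lambda>s. sig (P.op b s) - b * sig s)"
      by (rule pm_linear_minus[OF pm_linear_compose[OF pm_linear_sig P.pm_linear_op]
            pm_linear_compose[OF pm_linear_mult_left pm_linear_sig]])
    fix M assume "M \<in> Poly_Mapping.keys s"
    then show "sig (P.op b (P.z M)) - b * sig (P.z M) \<in> I" using sig_rho[OF b, of M] s by auto
  qed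
  then show "sig (P.act (Poly_Mapping.single b 1) s) - pm_val (Poly_Mapping.single b 1) * sig s \<in> I" by simp
qed

lemma sig_N: "x - sig (N x) \<in> I"
proof (rule pm_linear_in_subspace[of "\<lambda>x. x - sig (N x)", OF _ subspace_I])
  show "pm_linear (\<lambda>x. x - sig (N x))"
    by (rule pm_linear_minus[OF pm_linear_id pm_linear_compose[OF pm_linear_sig pm_linear_N]])
  fix w
  show "word w - sig (N (word w)) \<in> I"
  proof (induction w)
    case Nil
    have "sig (N (word [])) = 1" unfolding word_Nil N_one sig_z by simp
    then show ?case using pm.subspace_0[OF subspace_I] by (simp add: word_Nil)
  next
    case (Cons v w)
    let ?c = "crd (word [v])" and ?s = "N (word w)"
    have "word (v # w) - sig (N (word (v # w))) =
        word [v] * (word w - sig ?s) + (word [v] - pm_val ?c) * sig ?s - (sig (P.act ?c ?s) - pm_val ?c * sig ?s)"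
      by (simp add: word_Cons[of v w] N_letter algebra_simps)
    also have "\<dots> \<in> I"
      by (intro pm.subspace_diff[OF subspace_I] pm.subspace_add[OF subspace_I] I_mult_left I_mult_right
          Cons.IH crd_val[OF letter_LL] sig_act crd_keys[OF letter_LL] N_over)
    finally show ?case .
  qed
qed

text \<open>By \<open>sig_N\<close> a tensor is recovered from its normal form, so \<open>N\<close>
  embeds T(V) into the polynomials. The types in \<open>N x\<close> are thus attached to the element
  of T(V), and at least one occurs unless this element is zero.\<close>

lemma N_eq_0_iff: "N x = 0 \<longleftrightarrow> x \<in> I"
  using sig_N[of x] N_I by (auto simp: pm_linear_0[OF pm_linear_sig])

end

section \<open>Existence of a homogeneous basis of L(V)\<close>

lemma ex_linorder: "\<exists>(le :: 'a \<Rightarrow> 'a \<Rightarrow> bool) lt. class.linorder le lt"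
proof -
  from well_ordering obtain r :: "'a rel" where r: "Well_order r \<and> Field r = UNIV" ..
  have lin: "refl_on UNIV r" "trans r" "antisym r" "total r"
    using conjunct1[OF r] unfolding conjunct2[OF r] order_on_defs by simp_all
  have refl: "(x, x) \<in> r" for x using refl_onD[OF lin(1)] by simp
  have "class.linorder (\<lambda>a b. (a, b) \<in> r) (\<lambda>a b. (a, b) \<in> r \<and> a \<noteq> b)"
  proof (unfold_locales, goal_cases)
    case (1 x y)
    then show ?case using antisymD[OF lin(3), of x y] refl[of x] by blast
  next
    case (2 x)
    then show ?case by (rule refl)
  next
    case (3 x y z)
    then show ?case by (rule transD[OF lin(2)])
  next
    case (4 x y)
    then show ?case using antisymD[OF lin(3)] by blast
  next
    case (5 x y)
    show ?case
    proof (cases "x = y")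
      case True
      then show ?thesis using refl[of x] by simp
    next
      case False
      then show ?thesis using lin(4) by (simp add: total_on_def)
    qed
  qed
  then show ?thesis by (intro exI)
qed

lemma pm_linear_extend:
  fixes f :: "('k \<Rightarrow>\<^sub>0 'f::field) \<Rightarrow> ('l \<Rightarrow>\<^sub>0 'f)"
  assumes "pm.independent S"
  shows "\<exists>g. pm_linear g \<and> (\<forall>x\<in>S. g x = f x)"
proof -
  interpret vp: vector_space_pair "pm_scale :: 'f \<Rightarrow> ('k \<Rightarrow>\<^sub>0 'f) \<Rightarrow> _" "pm_scale :: 'f \<Rightarrow> ('l \<Rightarrow>\<^sub>0 'f) \<Rightarrow> _"
    by unfold_locales
  obtain g where g: "Vector_Spaces.linear pm_scale pm_scale g" "\<forall>x\<in>S. g x = f x"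
    using vp.linear_independent_extend[OF assms, of f] by blast
  have "pm_linear g"
    by (rule pm_linearI) (simp_all add: vp.linear_add[OF g(1)] vp.linear_scale[OF g(1)])
  then show ?thesis using g(2) by (intro exI[of _ g] conjI)
qed

text \<open>A basis \<open>BI\<close> of the ideal is extended by homogeneous Lie elements to a
  basis \<open>B'\<close> of the span of both. The added vectors \<open>B\<close> form a basis of
  L(V) modulo the ideal; \<open>crd\<close> sends each of them to itself as a key, and
  \<open>BI\<close> to 0.\<close>

lemma (in fg_module) ex_lie_basis: "\<exists>le lt B crd. lie_basis G V le lt B crd"
proof -
  obtain le lt :: "('v list \<Rightarrow>\<^sub>0 'f) \<Rightarrow> ('v list \<Rightarrow>\<^sub>0 'f) \<Rightarrow> bool" where ord: "class.linorder le lt"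
    using ex_linorder by (elim exE)
  obtain BI where BI: "BI \<subseteq> I" "pm.independent BI" "I \<subseteq> pm.span BI"
    using pm.maximal_independent_subset[of I] by blast
  obtain B' where B': "BI \<subseteq> B'" "B' \<subseteq> I \<union> homog_lie" "pm.independent B'" "I \<union> homog_lie \<subseteq> pm.span B'"
    using pm.maximal_independent_subset_extend[of BI "I \<union> homog_lie"] BI by blast
  define B where "B = B' - BI"
  have BnI: "b \<notin> I" if "b \<in> B" for b
  proof
    assume "b \<in> I"
    then have "b \<in> pm.span BI" using BI(3) by blast
    moreover have "BI \<subseteq> B' - {b}" using B'(1) that by (auto simp: B_def)
    ultimately have "b \<in> pm.span (B' - {b})" using pm.span_mono by blast
    then show False using B'(3) that by (auto simp: B_def pm.dependent_def)
  qed
  obtain crd :: "('v list \<Rightarrow>\<^sub>0 'f) \<Rightarrow> (('v list \<Rightarrow>\<^sub>0 'f) \<Rightarrow>\<^sub>0 'f)" where crd: "pm_linear crd"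
    "\<And>x. x \<in> B' \<Longrightarrow> crd x = (if x \<in> B then Poly_Mapping.single x 1 else 0)"
    using pm_linear_extend[OF B'(3), of "\<lambda>x. if x \<in> B then Poly_Mapping.single x 1 else 0"] by blast
  have crdI: "crd x = 0" if "x \<in> I" for x
    by (rule pm_linear_kernel_span[OF crd(1), of BI])
       (use that BI(3) B'(1) crd(2) in \<open>auto simp: B_def\<close>)
  have LLspan: "x \<in> pm.span B'" if "x \<in> LL" for x
  proof -
    obtain y where y: "y \<in> lie_elems" "x - y \<in> I" using \<open>x \<in> LL\<close> by (elim LL_E)
    have "homog_lie \<subseteq> pm.span B'" using B'(4) by blast
    then have "pm.span homog_lie \<subseteq> pm.span B'" using pm.span_minimal pm.subspace_span by blast
    then have "y \<in> pm.span B'" using lie_elems_span[OF y(1)] by blast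
    moreover have "x - y \<in> pm.span B'" using y(2) B'(4) by blast
    ultimately have "y + (x - y) \<in> pm.span B'" by (rule pm.span_add)
    then show ?thesis by simp
  qed
  have "lie_basis G V le lt B crd"
  proof (intro lie_basis.intro lie_basis_axioms.intro ord fg_module_axioms crd(1) crdI)
    fix b assume b: "b \<in> B"
    then show "b \<in> homog_lie" using B'(2) BnI[OF b] by (auto simp: B_def)
    show "crd b = Poly_Mapping.single b 1" using b crd(2) by (auto simp: B_def)
  next
    fix x assume x: "x \<in> LL"
    have "crd x \<in> {y. Poly_Mapping.keys y \<subseteq> B}"
      by (rule pm_linear_span_subset[OF crd(1) subspace_keys _ LLspan[OF x]]) (simp add: crd(2))
    then show "Poly_Mapping.keys (crd x) \<subseteq> B" by simp
    show "x - pm_val (crd x) \<in> I"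
    proof (rule pm_linear_span_subset[of "\<lambda>x. x - pm_val (crd x)", OF _ subspace_I _ LLspan[OF x]])
      show "pm_linear (\<lambda>x. x - pm_val (crd x))"
        by (rule pm_linear_minus[OF pm_linear_id pm_linear_compose[OF pm_linear_val crd(1)]])
      fix b assume b: "b \<in> B'"
      show "b - pm_val (crd b) \<in> I"
      proof (cases "b \<in> B")
        case False
        then have "b \<in> I" using b BI(1) by (auto simp: B_def)
        then show ?thesis using False b by (simp add: crd(2) pm_linear_0[OF pm_linear_val])
      qed (use b in \<open>simp add: crd(2) pm.subspace_0[OF subspace_I]\<close>)
    qed
  qed
  then show ?thesis by (intro exI)
qed

lemma z_mult: "Poly_Mapping.single M 1 * Poly_Mapping.single N 1 = (Poly_Mapping.single (M + N) 1 :: 'k multiset \<Rightarrow>\<^sub>0 'f::field)"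
  by (simp add: mult_single)

section \<open>Leading terms of products of Lie elements\<close>

context lie_basis
begin

text \<open>The linear polynomial belonging to a Lie element, that is its image in the degree one
  part of the symmetric algebra of L(V).\<close>

definition ell :: "('v list \<Rightarrow>\<^sub>0 'f) \<Rightarrow> (('v list \<Rightarrow>\<^sub>0 'f) multiset \<Rightarrow>\<^sub>0 'f)" where
  "ell x = pm_lin (\<lambda>b. P.z {#b#}) (crd x)"

lemma pm_linear_ell: "pm_linear ell"
  unfolding ell_def by (rule pm_linear_compose[OF pm_linear_lin pm_linear_crd])

lemma ell_B: "b \<in> B \<Longrightarrow> ell b = P.z {#b#}"
  by (simp add: ell_def crd_B)

lemma ell_cong: "x - y \<in> I \<Longrightarrow> ell x = ell y"
  by (simp add: ell_def crd_eq)

lemma ell_I: "x \<in> I \<Longrightarrow> ell x = 0"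
  by (simp add: ell_def crd_I)

lemma ell_keys: "x \<in> LL \<Longrightarrow> homogeneous n x \<Longrightarrow> Poly_Mapping.keys (ell x) \<subseteq> {{#b#} | b. b \<in> B \<and> dg b = n}"
  unfolding ell_def
  by (rule pm_lin_in_keys) (use crd_keys crd_homogeneous in auto)

lemma gt_add_mono: "M \<in> P.ge \<tau> \<Longrightarrow> P.gt (add_mset n (P.ty M)) \<subseteq> P.gt (add_mset n \<tau>)"
  by (auto simp: P.gt_def P.ge_def intro: order_le_less_trans[OF add_mset_le_right_le])

lemma ty_empty [simp]: "P.ty {#} = {#}"
  by (simp add: P.ty_def)

text \<open>By \<open>rho_keys\<close> a basis element acts as multiplication by its variable up to
  monomials of larger type, and adding the same part \<open>n\<close> to two types preserves their
  order.\<close>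

lemma act_ell:
  assumes x: "x \<in> LL" "homogeneous n x" and s: "Poly_Mapping.keys s \<subseteq> P.ge \<tau>"
  shows "Poly_Mapping.keys (P.act (crd x) s - ell x * s) \<subseteq> P.gt (add_mset n \<tau>)"
proof -
  let ?S = "{y. Poly_Mapping.keys y \<subseteq> P.gt (add_mset n \<tau>)}"
  have "P.act (crd x) s - pm_lin (\<lambda>b. P.z {#b#}) (crd x) * s \<in> ?S"
  proof (rule pm_linear_in_subspace[of "\<lambda>c. P.act c s - pm_lin (\<lambda>b. P.z {#b#}) c * s", OF _ subspace_keys])
    show "pm_linear (\<lambda>c. P.act c s - pm_lin (\<lambda>b. P.z {#b#}) c * s)"
      by (rule pm_linear_minus[OF P.pm_linear_act1 pm_linear_compose[OF pm_linear_mult_right pm_linear_lin]])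
    fix b assume b': "b \<in> Poly_Mapping.keys (crd x)"
    then have b: "b \<in> B" "dg b = n" using crd_keys crd_homogeneous x by auto
    have "P.op b s - P.z {#b#} * s \<in> ?S"
    proof (rule pm_linear_in_subspace[of "\<lambda>s. P.op b s - P.z {#b#} * s", OF _ subspace_keys])
      show "pm_linear (\<lambda>s. P.op b s - P.z {#b#} * s)"
        by (rule pm_linear_minus[OF P.pm_linear_op pm_linear_mult_left])
      fix M assume "M \<in> Poly_Mapping.keys s"
      then have M: "M \<in> P.ge \<tau>" using s by auto
      then have MB: "set_mset M \<subseteq> B" by (simp add: P.ge_def)
      have "Poly_Mapping.keys (P.rho b M - P.z (add_mset b M)) \<subseteq> P.gt (add_mset n (P.ty M))"
        using P.rho_keys[OF b(1) MB] b(2) by simp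
      then have "Poly_Mapping.keys (P.rho b M - P.z (add_mset b M)) \<subseteq> P.gt (add_mset n \<tau>)"
        using gt_add_mono[OF M] by (rule subset_trans)
      then show "P.op b (P.z M) - P.z {#b#} * P.z M \<in> ?S" by (simp add: z_mult)
    qed
    then show "P.act (Poly_Mapping.single b 1) s - pm_lin (\<lambda>b. P.z {#b#}) (Poly_Mapping.single b 1) * s \<in> ?S"
      by simp
  qed
  then show ?thesis by (simp add: ell_def)
qed

lemma keys_mult_subset:
  fixes f g :: "'k::monoid_add \<Rightarrow>\<^sub>0 'f"
  assumes "Poly_Mapping.keys f \<subseteq> X" "Poly_Mapping.keys g \<subseteq> Y" "\<And>a b. a \<in> X \<Longrightarrow> b \<in> Y \<Longrightarrow> a + b \<in> Z"
  shows "Poly_Mapping.keys (f * g) \<subseteq> Z"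
  using keys_mult[of f g] assms by blast

lemma ell_mult_gt:
  assumes x: "x \<in> LL" "homogeneous n x" and s: "Poly_Mapping.keys s \<subseteq> P.gt \<tau>"
  shows "Poly_Mapping.keys (ell x * s) \<subseteq> P.gt (add_mset n \<tau>)"
  by (rule keys_mult_subset[OF ell_keys[OF x] s]) (auto simp: P.gt_def)

definition types :: "nat multiset \<Rightarrow> ('v list \<Rightarrow>\<^sub>0 'f) multiset set" where
  "types \<tau> = {M. set_mset M \<subseteq> B \<and> P.ty M = \<tau>}"

lemma types_ge: "types \<tau> \<subseteq> P.ge \<tau>"
  by (auto simp: types_def P.ge_def)

lemma gt_ge: "P.gt \<tau> \<subseteq> P.ge \<tau>"
  by (auto simp: P.gt_def P.ge_def)

text \<open>The leading term of a product of Lie elements is the product of their linear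
  polynomials. The latter is commutative, so rearranging the factors affects the normal form only in
  types above \<open>mset ns\<close>.\<close>

lemma N_prod_list:
  assumes "list_all2 (\<lambda>x n. x \<in> LL \<and> homogeneous n x) xs ns"
  shows "Poly_Mapping.keys (N (prod_list xs) - prod_list (map ell xs)) \<subseteq> P.gt (mset ns) \<and>
         Poly_Mapping.keys (prod_list (map ell xs)) \<subseteq> types (mset ns)"
  using assms
proof (induction rule: list_all2_induct)
  case Nil
  show ?case by (simp add: N_one types_def P.ty_def)
next
  case (Cons x xs n ns)
  then have x: "x \<in> LL" "homogeneous n x" by auto
  let ?p = "prod_list (map ell xs)" and ?s = "N (prod_list xs)"
  have "Poly_Mapping.keys ((?s - ?p) + ?p) \<subseteq> P.ge (mset ns)"
    using Cons.IH gt_ge types_ge by (intro keys_add_subset) blast+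
  then have s: "Poly_Mapping.keys ?s \<subseteq> P.ge (mset ns)" by simp
  have "Poly_Mapping.keys ((P.act (crd x) ?s - ell x * ?s) + ell x * (?s - ?p)) \<subseteq> P.gt (add_mset n (mset ns))"
    using Cons.IH by (intro keys_add_subset act_ell[OF x s] ell_mult_gt[OF x]) blast
  then have 1: "Poly_Mapping.keys (N (x * prod_list xs) - ell x * ?p) \<subseteq> P.gt (add_mset n (mset ns))"
    by (simp add: N_LL[OF x(1)] right_diff_distrib)
  have 2: "Poly_Mapping.keys (ell x * ?p) \<subseteq> types (add_mset n (mset ns))"
    by (rule keys_mult_subset[OF ell_keys[OF x] conjunct2[OF Cons.IH]]) (auto simp: types_def)
  show ?case using 1 2 by simp
qed

text \<open>A word is a product of letters, whose leading type is (1,...,1); the larger types that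
  may occur have the same sum.\<close>

lemma N_homogeneous:
  assumes "homogeneous r x"
  shows "Poly_Mapping.keys (N x) \<subseteq> {M. set_mset M \<subseteq> B \<and> sum_mset (P.ty M) = r}"
proof -
  have "N x \<in> {y. Poly_Mapping.keys y \<subseteq> {M. set_mset M \<subseteq> B \<and> sum_mset (P.ty M) = r}}"
  proof (rule pm_linear_in_subspace[OF pm_linear_N subspace_keys])
    fix w assume "w \<in> Poly_Mapping.keys x"
    then have len: "length w = r" using assms by (auto simp: homogeneous_def)
    have w: "word w = (prod_list (map (\<lambda>v. word [v]) w) :: 'v list \<Rightarrow>\<^sub>0 'f)"
    proof (induction w)
      case (Cons v w)
      then show ?case by (subst word_Cons) simp
    qed (simp add: word_Nil)
    have "list_all2 (\<lambda>x n. x \<in> LL \<and> homogeneous n x) (map (\<lambda>v. word [v]) w) (replicate r 1)"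
      using len letter_LL by (auto simp: list_all2_conv_all_nth)
    note * = N_prod_list[OF this, folded w]
    define \<tau> where "\<tau> = mset (replicate r (1::nat))"
    have sm: "sum_mset \<tau> = r" by (simp add: \<tau>_def)
    have "P.gt \<tau> \<subseteq> {M. set_mset M \<subseteq> B \<and> sum_mset (P.ty M) = r}"
      "types \<tau> \<subseteq> {M. set_mset M \<subseteq> B \<and> sum_mset (P.ty M) = r}"
      using sm by (auto simp: P.gt_def types_def)
    with * have "Poly_Mapping.keys (N (word w) - prod_list (map ell (map (\<lambda>v. word [v]) w)) +
        prod_list (map ell (map (\<lambda>v. word [v]) w))) \<subseteq> {M. set_mset M \<subseteq> B \<and> sum_mset (P.ty M) = r}"
      unfolding \<tau>_def by (intro keys_add_subset) (auto dest: subsetD)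
    then show "N (word w) \<in> {y. Poly_Mapping.keys y \<subseteq> {M. set_mset M \<subseteq> B \<and> sum_mset (P.ty M) = r}}"
      by simp
  qed
  then show ?thesis by simp
qed

lemma pr_list: "\<exists>bs. mset bs = M \<and> pr M = prod_list bs"
proof (induction M rule: mset_mn_induct)
  case (add b M)
  then obtain bs where "mset bs = M" "pr M = prod_list bs" by blast
  then show ?case using add.hyps by (intro exI[of _ "b # bs"]) (simp add: pr_add)
qed simp

lemma list_all2_B: "set bs \<subseteq> B \<Longrightarrow> list_all2 (\<lambda>x n. x \<in> LL \<and> homogeneous n x) bs (map dg bs)"
  using B_LL dg by (auto simp: list_all2_conv_all_nth subset_iff)

lemma pr_homogeneous: "set_mset M \<subseteq> B \<Longrightarrow> homogeneous (sum_mset (P.ty M)) (pr M)"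
proof -
  assume M: "set_mset M \<subseteq> B"
  obtain bs where bs: "mset bs = M" "pr M = prod_list bs" using pr_list by blast
  then have "set bs \<subseteq> B" using M by auto
  then have "list_all2 (\<lambda>x n. homogeneous n x) bs (map dg bs)"
    by (rule list_all2_mono[OF list_all2_B]) simp
  from homogeneous_prod_list[OF this] show ?thesis
    by (metis P.ty_def bs mset_map sum_mset_sum_list)
qed

lemma prod_list_ell_B: "set bs \<subseteq> B \<Longrightarrow> prod_list (map ell bs) = P.z (mset bs)"
  by (induction bs) (simp_all add: ell_B z_mult)

lemma N_prod_list_B:
  assumes "set bs \<subseteq> B"
  shows "Poly_Mapping.keys (N (prod_list bs) - P.z (mset bs)) \<subseteq> P.gt (image_mset dg (mset bs))"
  using N_prod_list[OF list_all2_B[OF assms]] by (simp add: prod_list_ell_B[OF assms])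

definition cmp :: "nat multiset \<Rightarrow> (('v list \<Rightarrow>\<^sub>0 'f) multiset \<Rightarrow>\<^sub>0 'f) \<Rightarrow> (('v list \<Rightarrow>\<^sub>0 'f) multiset \<Rightarrow>\<^sub>0 'f)" where
  "cmp \<tau> = pm_lin (\<lambda>M. if P.ty M = \<tau> then P.z M else 0)"

lemma pm_linear_cmp: "pm_linear (cmp \<tau>)"
  by (simp add: cmp_def pm_linear_lin)

lemma lookup_cmp: "Poly_Mapping.lookup (cmp \<tau> s) M = (if P.ty M = \<tau> then Poly_Mapping.lookup s M else 0)"
  unfolding cmp_def by (rule lookup_pm_lin_filter)

lemma keys_cmp: "Poly_Mapping.keys (cmp \<tau> s) = {M \<in> Poly_Mapping.keys s. P.ty M = \<tau>}"
  by (auto simp: in_keys_iff lookup_cmp split: if_splits)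

lemma cmp_zero: "(\<And>M. M \<in> Poly_Mapping.keys s \<Longrightarrow> P.ty M \<noteq> \<tau>) \<Longrightarrow> cmp \<tau> s = 0"
  by (rule poly_mapping_eqI) (auto simp: lookup_cmp in_keys_iff)

lemma cmp_types: "Poly_Mapping.keys s \<subseteq> types \<tau> \<Longrightarrow> cmp \<tau> s = s"
  by (rule poly_mapping_eqI) (auto simp: lookup_cmp types_def in_keys_iff subset_iff)

lemma cmp_gt: "Poly_Mapping.keys s \<subseteq> P.gt \<tau> \<Longrightarrow> cmp \<tau> s = 0"
  by (rule poly_mapping_eqI) (auto simp: lookup_cmp P.gt_def in_keys_iff subset_iff)

section \<open>The group action on leading terms\<close>

definition gam :: "'g \<Rightarrow> (('v list \<Rightarrow>\<^sub>0 'f) multiset \<Rightarrow>\<^sub>0 'f) \<Rightarrow> (('v list \<Rightarrow>\<^sub>0 'f) multiset \<Rightarrow>\<^sub>0 'f)" where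
  "gam g = pm_lin (\<lambda>M. \<Prod>b\<in>#M. ell (tw g b))"

lemma pm_linear_gam: "pm_linear (gam g)"
  by (simp add: gam_def pm_linear_lin)

lemma gam_z: "gam g (P.z M) = (\<Prod>b\<in>#M. ell (tw g b))"
  by (simp add: gam_def)

lemma gam_mult: "gam g (x * y) = gam g x * gam g y"
  by (rule pm_linear_mult_eqI[OF pm_linear_gam]) (simp add: gam_def)

lemma gam_one: "gam g 1 = 1"
  by (simp add: gam_def flip: single_one)

text \<open>\<open>gam g\<close> is the algebra endomorphism prescribed on the variables; that it
  follows the action of \<open>g\<close> on all of L(V) holds because \<open>ell\<close> is linear
  and vanishes on the ideal. The map \<open>N\<close> itself need not be equivariant, since
  \<open>g\<close> need not preserve \<open>B\<close>.\<close>

lemma gam_ell: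
  assumes "x \<in> LL" "g \<in> carrier G" shows "gam g (ell x) = ell (tw g x)"
proof -
  have "tw g x - tw g (pm_val (crd x)) \<in> I"
    using tw_I[OF assms(2) crd_val[OF assms(1)]] by (simp add: pm_linear_diff[OF pm_linear_tw])
  then have "ell (tw g x) = ell (tw g (pm_val (crd x)))" by (rule ell_cong)
  also have "\<dots> = gam g (pm_lin (\<lambda>b. P.z {#b#}) (crd x))"
    by (rule pm_linear_eqI[of "\<lambda>c. ell (tw g (pm_val c))" "\<lambda>c. gam g (pm_lin (\<lambda>b. P.z {#b#}) c)"])
       (simp_all add: pm_linear_compose[OF pm_linear_ell pm_linear_compose[OF pm_linear_tw pm_linear_val]]
          pm_linear_compose[OF pm_linear_gam pm_linear_lin] gam_z)
  finally show ?thesis by (simp add: ell_def)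
qed

lemma N_tw_pr:
  assumes M: "set_mset M \<subseteq> B" and g: "g \<in> carrier G"
  shows "Poly_Mapping.keys (N (tw g (pr M)) - gam g (P.z M)) \<subseteq> P.gt (P.ty M)"
    "Poly_Mapping.keys (gam g (P.z M)) \<subseteq> types (P.ty M)"
proof -
  obtain bs where bs: "mset bs = M" "pr M = prod_list bs" using pr_list by blast
  have tw: "tw g (prod_list bs) = prod_list (map (tw g) bs)" for bs
    by (induction bs) (simp_all add: tw_one tw_mult)
  have "list_all2 (\<lambda>x n. x \<in> LL \<and> homogeneous n x) (map (tw g) bs) (map dg bs)"
    using list_all2_B[of bs] M bs(1) LL_tw[OF g] tw_homogeneous
    by (auto simp: list_all2_conv_all_nth)
  note * = N_prod_list[OF this]
  have "prod_list (map ell (map (tw g) bs)) = gam g (P.z M)"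
    by (simp add: gam_def comp_def flip: bs(1) prod_mset_prod_list mset_map)
  moreover have "mset (map dg bs) = P.ty M" by (simp add: P.ty_def bs(1))
  ultimately show "Poly_Mapping.keys (N (tw g (pr M)) - gam g (P.z M)) \<subseteq> P.gt (P.ty M)"
    "Poly_Mapping.keys (gam g (P.z M)) \<subseteq> types (P.ty M)"
    using * by (simp_all add: bs(2) tw)
qed

text \<open>\<open>sig (N x)\<close> represents the same tensor as \<open>x\<close> by ordered
  products, on which the effect of \<open>g\<close> is computed factor by factor.\<close>

lemma N_tw: "g \<in> carrier G \<Longrightarrow> N (tw g x) = N (tw g (sig (N x)))"
  using tw_I[OF _ sig_N[of x]] by (intro N_cong) (simp add: pm_linear_diff[OF pm_linear_tw])

lemma pm_linear_N_tw_sig: "pm_linear (\<lambda>s. N (tw g (sig s)))"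
  by (rule pm_linear_compose[OF pm_linear_N pm_linear_compose[OF pm_linear_tw pm_linear_sig]])

lemma N_tw_keys:
  assumes g: "g \<in> carrier G"
  shows "Poly_Mapping.keys (N (tw g x)) \<subseteq> {M. \<exists>M'\<in>Poly_Mapping.keys (N x). P.ty M' \<le> P.ty M}"
proof -
  let ?S = "{y. Poly_Mapping.keys y \<subseteq> {M. \<exists>M'\<in>Poly_Mapping.keys (N x). P.ty M' \<le> P.ty M}}"
  have "N (tw g (sig (N x))) \<in> ?S"
  proof (rule pm_linear_in_subspace[OF pm_linear_N_tw_sig subspace_keys])
    fix M assume M: "M \<in> Poly_Mapping.keys (N x)"
    then have MB: "set_mset M \<subseteq> B" using N_over by auto
    have "Poly_Mapping.keys ((N (tw g (pr M)) - gam g (P.z M)) + gam g (P.z M)) \<subseteq> P.ge (P.ty M)"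
      by (rule keys_add_subset[OF subset_trans[OF N_tw_pr(1)[OF MB g] gt_ge]
            subset_trans[OF N_tw_pr(2)[OF MB g] types_ge]])
    then show "N (tw g (sig (P.z M))) \<in> ?S" using M by (auto simp: P.ge_def)
  qed
  then show ?thesis using N_tw[OF g] by simp
qed

text \<open>Acting with \<open>g\<close> on the ordered product of a monomial gives
  \<open>gam g\<close> of the monomial plus larger types. When all types in \<open>N x\<close> are
  at least \<open>\<tau>\<close>, only the monomials of type \<open>\<tau>\<close> contribute to the
  component of type \<open>\<tau>\<close> of the result.\<close>

lemma cmp_N_tw:
  assumes g: "g \<in> carrier G" and x: "\<And>M. M \<in> Poly_Mapping.keys (N x) \<Longrightarrow> \<tau> \<le> P.ty M"
  shows "cmp \<tau> (N (tw g x)) = gam g (cmp \<tau> (N x))"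
  unfolding N_tw[OF g, of x]
proof (rule pm_linear_eqI[of "\<lambda>s. cmp \<tau> (N (tw g (sig s)))" "\<lambda>s. gam g (cmp \<tau> s)"])
  show "pm_linear (\<lambda>s. cmp \<tau> (N (tw g (sig s))))"
    by (rule pm_linear_compose[OF pm_linear_cmp pm_linear_N_tw_sig])
  show "pm_linear (\<lambda>s. gam g (cmp \<tau> s))"
    by (rule pm_linear_compose[OF pm_linear_gam pm_linear_cmp])
next
  fix M assume M: "M \<in> Poly_Mapping.keys (N x)"
  then have MB: "set_mset M \<subseteq> B" using N_over by auto
  let ?d = "N (tw g (pr M)) - gam g (P.z M)"
  show "cmp \<tau> (N (tw g (sig (P.z M)))) = gam g (cmp \<tau> (P.z M))"
  proof (cases "P.ty M = \<tau>")
    case True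
    have "cmp \<tau> (?d + gam g (P.z M)) = cmp \<tau> ?d + cmp \<tau> (gam g (P.z M))"
      by (rule pm_linear_add[OF pm_linear_cmp])
    also have "\<dots> = gam g (P.z M)"
      using N_tw_pr[OF MB g] by (simp add: True cmp_gt cmp_types)
    finally show ?thesis using True by (simp add: cmp_def)
  next
    case False
    have "\<tau> < P.ty M" using x[OF M] False by simp
    then have "Poly_Mapping.keys (?d + gam g (P.z M)) \<subseteq> {M'. \<tau> < P.ty M'}"
      using N_tw_pr[OF MB g]
      by (intro keys_add_subset) (auto simp: P.gt_def types_def intro: order_less_trans)
    then have "cmp \<tau> (?d + gam g (P.z M)) = 0" by (intro cmp_zero) auto
    then show ?thesis using False by (simp add: cmp_def pm_linear_0[OF pm_linear_gam])
  qed
qed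

end

section \<open>The action of the descent algebra on products of Lie elements\<close>

text \<open>A list \<open>c\<close> colours the places of \<open>w\<close>. The subword of colour
  \<open>j\<close> keeps the order of its letters, and \<open>out\<close> below writes the subwords
  one after the other, which unshuffles \<open>w\<close> according to \<open>c\<close>.\<close>

definition sub :: "nat \<Rightarrow> nat list \<Rightarrow> 'a list \<Rightarrow> 'a list" where
  "sub j c w = map snd (filter (\<lambda>p. fst p = j) (zip c w))"

definition out :: "nat \<Rightarrow> nat list \<Rightarrow> 'a list \<Rightarrow> 'a list" where
  "out k c w = concat (map (\<lambda>j. sub j c w) [0..<k])"

definition colourings :: "nat \<Rightarrow> nat \<Rightarrow> nat list set" where
  "colourings k m = {c. length c = m \<and> set c \<subseteq> {..<k}}"

lemma sub_Nil [simp]: "sub j [] w = []" "sub j c [] = []"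
  by (simp_all add: sub_def)

lemma sub_Cons [simp]: "sub j (a # c) (v # w) = (if a = j then v # sub j c w else sub j c w)"
  by (simp add: sub_def)

lemma sub_map: "sub j c (map f w) = map f (sub j c w)"
  by (simp add: sub_def zip_map2 filter_map comp_def split_def)

lemma out_map: "out k c (map f w) = map f (out k c w)"
  by (simp add: out_def sub_map map_concat comp_def)

lemma length_sub: "length c = length w \<Longrightarrow> length (sub j c w) = count_list c j"
  by (induction c w rule: list_induct2) auto

lemma mset_concat_upt: "mset (concat (map f [0..<k])) = (\<Sum>j<k. mset (f j))"
  by (induction k) auto

lemma mset_out: "length c = length w \<Longrightarrow> set c \<subseteq> {..<k} \<Longrightarrow> mset (out k c w) = mset w"
proof (induction c w rule: list_induct2)
  case Nil
  then show ?case by (simp add: out_def mset_concat_upt)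
next
  case (Cons a c v w)
  have "mset (out k (a # c) (v # w)) = (\<Sum>j<k. (if a = j then {#v#} else {#}) + mset (sub j c w))"
    unfolding out_def mset_concat_upt by (rule sum.cong) auto
  also have "\<dots> = (\<Sum>j<k. if a = j then {#v#} else {#}) + mset (out k c w)"
    by (simp add: sum.distrib out_def mset_concat_upt)
  also have "(\<Sum>j<k. if a = j then {#v#} else {#}) = {#v#}" using Cons.prems by simp
  finally show ?case using Cons by simp
qed

lemma colourings_0: "colourings k 0 = {[]}"
  by (auto simp: colourings_def)

lemma colourings_Suc: "colourings k (Suc m) = (\<lambda>(a, c). a # c) ` ({..<k} \<times> colourings k m)"
  by (auto simp: colourings_def length_Suc_conv image_iff)

lemma finite_colourings: "finite (colourings k m)"
  by (induction m) (simp_all add: colourings_0 colourings_Suc)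

lemma prod_list_sum:
  fixes F :: "nat \<Rightarrow> 'a \<Rightarrow> 'r::ring_1"
  shows "prod_list (map (\<lambda>x. \<Sum>j<k. F j x) xs) = (\<Sum>c\<in>colourings k (length xs). prod_list (map2 F c xs))"
proof (induction xs)
  case (Cons x xs)
  have "(\<Sum>c\<in>colourings k (length (x # xs)). prod_list (map2 F c (x # xs))) =
      (\<Sum>(a, c)\<in>{..<k} \<times> colourings k (length xs). F a x * prod_list (map2 F c xs))"
    unfolding length_Cons colourings_Suc
    by (subst sum.reindex) (auto simp: inj_on_def comp_def split_def)
  also have "\<dots> = (\<Sum>a<k. \<Sum>c\<in>colourings k (length xs). F a x * prod_list (map2 F c xs))"
    by (simp add: sum.cartesian_product)
  also have "\<dots> = (\<Sum>j<k. F j x) * (\<Sum>c\<in>colourings k (length xs). prod_list (map2 F c xs))"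
    by (simp add: sum_product)
  finally show ?case using Cons.IH by simp
qed (simp add: colourings_0)

section \<open>Primitivity of Lie elements\<close>

definition slot :: "nat \<Rightarrow> ('v list \<Rightarrow>\<^sub>0 'f::field) \<Rightarrow> ((nat \<Rightarrow> 'v list) \<Rightarrow>\<^sub>0 'f)" where
  "slot j = pm_push (\<lambda>w i. if i = j then w else [])"

lemma pm_linear_slot: "pm_linear (slot j)"
  by (simp add: slot_def pm_linear_push)

lemma slot_single [simp]:
  "slot j (Poly_Mapping.single w c) = Poly_Mapping.single (\<lambda>i. if i = j then w else []) c"
  by (simp add: slot_def)

lemma slot_mult: "slot j (x * y) = slot j x * slot j y"
proof (rule pm_linear_mult_eqI[OF pm_linear_slot])
  fix k l :: "'a list"
  have "(\<lambda>i. if i = j then k + l else []) = (\<lambda>i. if i = j then k else []) + (\<lambda>i. if i = j then l else [])"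
    by (auto simp: plus_list_def)
  then show "slot j (word (k + l)) = slot j (word k) * slot j (word l :: 'a list \<Rightarrow>\<^sub>0 'b)"
    by (simp add: mult_single)
qed

lemma slot_commute:
  assumes "i \<noteq> j" shows "slot i x * slot j y = slot j y * slot i x"
proof (rule pm_linear_eqI[of "\<lambda>x. slot i x * slot j y" "\<lambda>x. slot j y * slot i x"])
  show "pm_linear (\<lambda>x. slot i x * slot j y)" "pm_linear (\<lambda>x. slot j y * slot i x)"
    by (rule pm_linear_compose[OF pm_linear_mult_right pm_linear_slot]
        pm_linear_compose[OF pm_linear_mult_left pm_linear_slot])+
  fix k
  show "slot i (word k) * slot j y = slot j y * slot i (word k)"
  proof (rule pm_linear_eqI[of "\<lambda>y. slot i (word k) * slot j y" "\<lambda>y. slot j y * slot i (word k)"])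
    show "pm_linear (\<lambda>y. slot i (word k) * slot j y)" "pm_linear (\<lambda>y. slot j y * slot i (word k))"
      by (rule pm_linear_compose[OF pm_linear_mult_right pm_linear_slot]
          pm_linear_compose[OF pm_linear_mult_left pm_linear_slot])+
    fix l
    have "(\<lambda>i'. if i' = i then k else []) + (\<lambda>i'. if i' = j then l else []) =
        (\<lambda>i'. if i' = j then l else []) + (\<lambda>i'. if i' = i then k else [])"
      using assms by (auto simp: plus_list_def)
    then show "slot i (word k) * slot j (word l) = slot j (word l) * slot i (word k)"
      by (simp add: mult_single)
  qed
qed

text \<open>The unshuffle coproduct into the \<^term>\<open>k\<close>-fold tensor power.\<close>

definition coprod :: "nat \<Rightarrow> ('v list \<Rightarrow>\<^sub>0 'f::field) \<Rightarrow> ((nat \<Rightarrow> 'v list) \<Rightarrow>\<^sub>0 'f)" where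
  "coprod k = pm_lin (\<lambda>w. prod_list (map (\<lambda>v. \<Sum>j<k. slot j (word [v])) w))"

lemma pm_linear_coprod: "pm_linear (coprod k)"
  by (simp add: coprod_def pm_linear_lin)

lemma coprod_word: "coprod k (word w) = prod_list (map (\<lambda>v. \<Sum>j<k. slot j (word [v])) w)"
  by (simp add: coprod_def)

lemma coprod_mult: "coprod k (x * y) = coprod k x * coprod k y"
  by (rule pm_linear_mult_eqI[OF pm_linear_coprod]) (simp add: coprod_word plus_list_def)

lemma coprod_one: "coprod k 1 = 1"
  using coprod_word[of k "[]"] by (simp add: word_Nil)

text \<open>In the commutator of two sums over the slots the mixed terms cancel, because elements in
  different slots commute; the remaining terms give the bracket in each slot.\<close>

lemma coprod_lie: "x \<in> lie_elems \<Longrightarrow> coprod k x = (\<Sum>j<k. slot j x)"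
proof (induction rule: lie_elems.induct)
  case (gen v)
  then show ?case by (simp add: coprod_word)
next
  case (add x y)
  then show ?case
    by (simp add: pm_linear_add[OF pm_linear_coprod] pm_linear_add[OF pm_linear_slot] sum.distrib)
next
  case (scale x c)
  then show ?case
    by (simp add: pm_linear_scale[OF pm_linear_coprod] pm_linear_scale[OF pm_linear_slot] pm.scale_sum_right)
next
  case (bracket x y)
  have inner: "(\<Sum>j<k. slot i x * slot j y - slot j y * slot i x) = slot i (x * y - y * x)" if "i < k" for i
  proof -
    have "(\<Sum>j<k. slot i x * slot j y - slot j y * slot i x) =
        (\<Sum>j<k. if i = j then slot i (x * y - y * x) else 0)"
    proof (rule sum.cong[OF refl])
      fix j
      show "slot i x * slot j y - slot j y * slot i x = (if i = j then slot i (x * y - y * x) else 0)"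
        using slot_commute[of i j x y] by (auto simp: slot_mult pm_linear_diff[OF pm_linear_slot])
    qed
    then show ?thesis using that by simp
  qed
  have "coprod k (x * y - y * x) = (\<Sum>i<k. slot i x) * (\<Sum>j<k. slot j y) - (\<Sum>j<k. slot j y) * (\<Sum>i<k. slot i x)"
    by (simp add: pm_linear_diff[OF pm_linear_coprod] coprod_mult bracket.IH)
  also have "(\<Sum>j<k. slot j y) * (\<Sum>i<k. slot i x) = (\<Sum>i<k. \<Sum>j<k. slot j y * slot i x)"
    by (simp add: sum_product) (rule sum.swap)
  also have "(\<Sum>i<k. slot i x) * (\<Sum>j<k. slot j y) = (\<Sum>i<k. \<Sum>j<k. slot i x * slot j y)"
    by (simp add: sum_product)
  also have "(\<Sum>i<k. \<Sum>j<k. slot i x * slot j y) - (\<Sum>i<k. \<Sum>j<k. slot j y * slot i x) =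
      (\<Sum>i<k. \<Sum>j<k. slot i x * slot j y - slot j y * slot i x)"
    by (simp add: sum_subtractf)
  also have "\<dots> = (\<Sum>i<k. slot i (x * y - y * x))"
    by (rule sum.cong[OF refl]) (simp add: inner)
  finally show ?case .
qed

definition tens :: "nat \<Rightarrow> (nat \<Rightarrow> ('v list \<Rightarrow>\<^sub>0 'f::field)) \<Rightarrow> ((nat \<Rightarrow> 'v list) \<Rightarrow>\<^sub>0 'f)" where
  "tens k y = prod_list (map (\<lambda>j. slot j (y j)) [0..<k])"

lemma tens_Suc: "tens (Suc k) y = tens k y * slot k (y k)"
  by (simp add: tens_def)

lemma tens_cong: "(\<And>j. j < k \<Longrightarrow> y j = y' j) \<Longrightarrow> tens k y = tens k y'"
  unfolding tens_def by (intro arg_cong[where f=prod_list] map_cong) auto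

lemma slot_tens_commute: "k \<le> a \<Longrightarrow> slot a x * tens k y = tens k y * slot a x"
proof (induction k)
  case (Suc k)
  have "slot a x * tens (Suc k) y = (slot a x * tens k y) * slot k (y k)"
    by (simp only: tens_Suc mult.assoc)
  also have "slot a x * tens k y = tens k y * slot a x" using Suc by simp
  also have "\<dots> * slot k (y k) = tens k y * (slot a x * slot k (y k))" by (rule mult.assoc)
  also have "slot a x * slot k (y k) = slot k (y k) * slot a x" using Suc.prems by (intro slot_commute) simp
  finally show ?case by (simp add: tens_Suc mult.assoc)
qed (simp add: tens_def)

lemma slot_tens: "a < k \<Longrightarrow> slot a x * tens k y = tens k (y(a := x * y a))"
proof (induction k)
  case (Suc k)
  show ?case
  proof (cases "a = k")
    case True
    have "slot a x * tens (Suc k) y = (slot a x * tens k y) * slot k (y k)"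
      by (simp add: tens_Suc mult.assoc)
    also have "slot a x * tens k y = tens k y * slot a x" using True by (intro slot_tens_commute) simp
    also have "tens k y = tens k (y(a := x * y a))" using True by (intro tens_cong) auto
    also have "\<dots> * slot a x * slot k (y k) = \<dots> * slot k ((y(a := x * y a)) k)"
      using True by (simp only: mult.assoc slot_mult fun_upd_same)
    finally show ?thesis by (simp only: tens_Suc)
  next
    case False
    then have "a < k" using Suc.prems by simp
    then have "slot a x * tens k y = tens k (y(a := x * y a))" by (rule Suc.IH)
    moreover have "(y(a := x * y a)) k = y k" using False by simp
    ultimately show ?thesis by (simp only: tens_Suc mult.assoc[symmetric])
  qed
qed simp

lemma slot_one: "slot j 1 = 1"
proof -
  have "(\<lambda>i. if i = j then [] else []) = (0 :: nat \<Rightarrow> 'a list)"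
    by (auto simp: zero_list_def)
  then have "slot j (word []) = (1 :: (nat \<Rightarrow> 'a list) \<Rightarrow>\<^sub>0 'b)"
    unfolding slot_single by (simp only: if_cancel single_one)
  then show ?thesis by (simp only: word_Nil)
qed

lemma prod_list_slot:
  "length c = length xs \<Longrightarrow> set c \<subseteq> {..<k} \<Longrightarrow>
     prod_list (map2 slot c xs) = tens k (\<lambda>j. prod_list (sub j c xs))"
proof (induction c xs rule: list_induct2)
  case Nil
  have "tens k (\<lambda>j. 1) = 1" by (induction k) (simp_all add: tens_def slot_one)
  then show ?case by simp
next
  case (Cons a c x xs)
  then have "prod_list (map2 slot (a # c) (x # xs)) = slot a x * tens k (\<lambda>j. prod_list (sub j c xs))"
    by simp
  also have "\<dots> = tens k ((\<lambda>j. prod_list (sub j c xs))(a := x * prod_list (sub a c xs)))"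
    using Cons.prems by (intro slot_tens) simp
  also have "\<dots> = tens k (\<lambda>j. prod_list (sub j (a # c) (x # xs)))"
    by (rule tens_cong) auto
  finally show ?case .
qed

text \<open>Takes the component of multidegree \<open>nu\<close> and multiplies the tensor factors
  in their order. Applied after the coproduct it is the convolution product of the projections of
  the free algebra to the degrees in \<open>nu\<close>, which \<open>descent_elem_coprod\<close>
  identifies with the action of \<open>descent_elem nu\<close>.\<close>

definition join_blocks :: "nat list \<Rightarrow> ((nat \<Rightarrow> 'v list) \<Rightarrow>\<^sub>0 'f::field) \<Rightarrow> ('v list \<Rightarrow>\<^sub>0 'f)" where
  "join_blocks nu = pm_lin (\<lambda>t. if \<forall>j<length nu. length (t j) = nu ! j
     then word (concat (map t [0..<length nu])) else 0)"

lemma pm_linear_join: "pm_linear (join_blocks nu)"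
  by (simp add: join_blocks_def pm_linear_lin)

lemma tens_words: "tens k (\<lambda>j. word (u j)) = Poly_Mapping.single (\<lambda>i. if i < k then u i else []) 1"
proof (induction k)
  case 0
  have "(\<lambda>i. []) = (0 :: nat \<Rightarrow> 'a list)" by (auto simp: zero_list_def)
  then show ?case by (simp add: tens_def)
next
  case (Suc k)
  have "(\<lambda>i. if i < k then u i else []) + (\<lambda>i. if i = k then u k else []) =
      (\<lambda>i. if i < Suc k then u i else [])"
    by (auto simp: plus_list_def less_Suc_eq)
  then show ?case by (simp add: tens_Suc Suc.IH mult_single)
qed

lemma hproj_word: "hproj n (word w) = (if length w = n then word w else 0)"
  by (simp add: hproj_def)

lemma prod_list_hproj_words:
  "prod_list (map (\<lambda>j. hproj (f j) (word (u j))) [0..<k]) =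
     (if \<forall>j<k. length (u j) = f j then word (concat (map u [0..<k])) else 0)"
proof (induction k)
  case (Suc k)
  then show ?case
    by (auto simp: hproj_word word_append less_Suc_eq)
qed (simp add: word_Nil)

lemma upt_split3: "n < k \<Longrightarrow> [0..<k] = [0..<n] @ n # [Suc n..<k]"
  using upt_add_eq_append[of 0 n "k - n"] upt_conv_Cons[of n k] by simp

text \<open>Both sides are linear in each \<open>y j\<close>, and on words both test lengths and
  concatenate. The induction reduces the slots to words one by one; \<open>n\<close> is the number
  of initial slots in which \<open>y\<close> is still arbitrary.\<close>

lemma join_tens: "join_blocks nu (tens (length nu) y) = prod_list (map (\<lambda>j. hproj (nu ! j) (y j)) [0..<length nu])"
proof -
  let ?k = "length nu"
  let ?L = "\<lambda>y. join_blocks nu (tens ?k y)" and ?R = "\<lambda>y. prod_list (map (\<lambda>j. hproj (nu ! j) (y j)) [0..<?k])"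
  have "(\<forall>j<?k. n \<le> j \<longrightarrow> (\<exists>u. y j = word u)) \<longrightarrow> ?L y = ?R y" if "n \<le> ?k" for n and y :: "nat \<Rightarrow> ('a list \<Rightarrow>\<^sub>0 'b)"
    using that
  proof (induction n arbitrary: y)
    case 0
    show ?case
    proof
      assume "\<forall>j<?k. 0 \<le> j \<longrightarrow> (\<exists>u. y j = word u)"
      then have "\<forall>j. \<exists>u. j < ?k \<longrightarrow> y j = word u" by auto
      then obtain u where u: "\<And>j. j < ?k \<Longrightarrow> y j = word (u j)" by metis
      have "tens ?k y = tens ?k (\<lambda>j. word (u j))" by (rule tens_cong) (rule u)
      moreover have "?R y = prod_list (map (\<lambda>j. hproj (nu ! j) (word (u j))) [0..<?k])"
        by (intro arg_cong[where f=prod_list] map_cong) (auto simp: u)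
      ultimately show "?L y = ?R y"
        by (auto simp: tens_words prod_list_hproj_words join_blocks_def intro!: arg_cong[where f=word] arg_cong[where f=concat])
    qed
  next
    case (Suc n)
    show ?case
    proof
      assume y: "\<forall>j<?k. Suc n \<le> j \<longrightarrow> (\<exists>u. y j = word u)"
      have n: "n < ?k" using Suc.prems by simp
      have updS1: "map (\<lambda>j. slot j ((y(n := x)) j)) [0..<n] = map (\<lambda>j. slot j (y j)) [0..<n]" for x
        by (rule map_cong) auto
      have updS2: "map (\<lambda>j. slot j ((y(n := x)) j)) [Suc n..<?k] = map (\<lambda>j. slot j (y j)) [Suc n..<?k]" for x
        by (rule map_cong) auto
      have updH1: "map (\<lambda>j. hproj (nu ! j) ((y(n := x)) j)) [0..<n] = map (\<lambda>j. hproj (nu ! j) (y j)) [0..<n]" for x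
        by (rule map_cong) auto
      have updH2: "map (\<lambda>j. hproj (nu ! j) ((y(n := x)) j)) [Suc n..<?k] = map (\<lambda>j. hproj (nu ! j) (y j)) [Suc n..<?k]" for x
        by (rule map_cong) auto
      have L: "tens ?k (y(n := x)) = prod_list (map (\<lambda>j. slot j (y j)) [0..<n]) * slot n x *
          prod_list (map (\<lambda>j. slot j (y j)) [Suc n..<?k])" for x
        unfolding tens_def upt_split3[OF n] map_append list.map prod_list.append prod_list.Cons
          updS1 updS2 fun_upd_same
        by (simp add: mult.assoc)
      have R: "?R (y(n := x)) = prod_list (map (\<lambda>j. hproj (nu ! j) (y j)) [0..<n]) * hproj (nu ! n) x *
          prod_list (map (\<lambda>j. hproj (nu ! j) (y j)) [Suc n..<?k])" for x
        unfolding upt_split3[OF n] map_append list.map prod_list.append prod_list.Cons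
          updH1 updH2 fun_upd_same
        by (simp add: mult.assoc)
      have "?L (y(n := y n)) = ?R (y(n := y n))"
      proof (rule pm_linear_eqI[of "\<lambda>x. ?L (y(n := x))" "\<lambda>x. ?R (y(n := x))"])
        show "pm_linear (\<lambda>x. ?L (y(n := x)))"
          unfolding L by (rule pm_linear_compose[OF pm_linear_join
            pm_linear_compose[OF pm_linear_mult2 pm_linear_slot]])
        show "pm_linear (\<lambda>x. ?R (y(n := x)))"
          unfolding R by (rule pm_linear_compose[OF pm_linear_mult2 pm_linear_hproj])
        fix w
        have "\<forall>j<?k. n \<le> j \<longrightarrow> (\<exists>u. (y(n := word w)) j = word u)" using y by auto
        then show "?L (y(n := word w)) = ?R (y(n := word w))"
          by (rule mp[OF Suc.IH[OF less_imp_le[OF n]]])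
      qed
      then show "?L y = ?R y" by simp
    qed
  qed
  from this[of ?k y] show ?thesis by simp
qed

text \<open>The distributions of the parts \<open>ns\<close> over blocks such that block
  \<open>j\<close> receives total size \<open>nu ! j\<close>. If all parts are 1, they are the
  colourings with a prescribed number of places of each colour.\<close>

definition weighted :: "nat list \<Rightarrow> nat list \<Rightarrow> nat list set" where
  "weighted nu ns = {c \<in> colourings (length nu) (length ns). \<forall>j<length nu. sum_list (sub j c ns) = nu ! j}"

lemma finite_weighted: "finite (weighted nu ns)"
  by (simp add: weighted_def finite_colourings)

lemma list_all2_sub:
  "length c = length xs \<Longrightarrow> list_all2 Q xs ns \<Longrightarrow> list_all2 Q (sub j c xs) (sub j c ns)"
proof (induction c xs arbitrary: ns rule: list_induct2)
  case (Cons a c x xs)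
  then show ?case by (cases ns) auto
qed simp

text \<open>Primitivity turns the coproduct of the product into a product of sums, whose expansion
  runs over all colourings of the factors. By homogeneity \<open>join_blocks\<close> keeps the
  summands whose degrees in the slots are \<open>nu\<close>. The lemma serves twice, for letters and
  for Lie elements.\<close>

lemma join_coprod_prod_list:
  assumes "list_all2 (\<lambda>x n. coprod (length nu) x = (\<Sum>j<length nu. slot j x) \<and> homogeneous n x) xs ns"
  shows "join_blocks nu (coprod (length nu) (prod_list xs)) = (\<Sum>c\<in>weighted nu ns. prod_list (out (length nu) c xs))"
proof -
  let ?k = "length nu"
  have len: "length xs = length ns" using assms by (rule list_all2_lengthD)
  have "coprod ?k (prod_list xs) = prod_list (map (coprod ?k) xs)"
    by (induction xs) (simp_all add: coprod_one coprod_mult)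
  also have "map (coprod ?k) xs = map (\<lambda>x. \<Sum>j<?k. slot j x) xs"
    using assms by (auto simp: list_all2_conv_all_nth in_set_conv_nth)
  also have "prod_list (map (\<lambda>x. \<Sum>j<?k. slot j x) xs) =
      (\<Sum>c\<in>colourings ?k (length xs). prod_list (map2 slot c xs))"
    by (rule prod_list_sum)
  also have "\<dots> = (\<Sum>c\<in>colourings ?k (length xs). tens ?k (\<lambda>j. prod_list (sub j c xs)))"
    by (rule sum.cong) (auto simp: colourings_def prod_list_slot)
  finally have "join_blocks nu (coprod ?k (prod_list xs)) =
      (\<Sum>c\<in>colourings ?k (length xs). prod_list (map (\<lambda>j. hproj (nu ! j) (prod_list (sub j c xs))) [0..<?k]))"
    by (simp add: pm_linear_sum[OF pm_linear_join] join_tens)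
  also have "\<dots> = (\<Sum>c\<in>colourings ?k (length xs). if \<forall>j<?k. sum_list (sub j c ns) = nu ! j
      then prod_list (out ?k c xs) else 0)"
  proof (rule sum.cong[OF refl])
    fix c assume "c \<in> colourings ?k (length xs)"
    then have c: "length c = length xs" by (simp add: colourings_def)
    have hom: "homogeneous (sum_list (sub j c ns)) (prod_list (sub j c xs))" for j
      by (rule homogeneous_prod_list, rule list_all2_sub[OF c])
         (use assms in \<open>auto intro: list_all2_mono\<close>)
    have *: "prod_list (map (\<lambda>j. hproj (nu ! j) (prod_list (sub j c xs))) [0..<k]) =
        (if \<forall>j<k. sum_list (sub j c ns) = nu ! j
         then prod_list (concat (map (\<lambda>j. sub j c xs) [0..<k])) else 0)" for k
    proof (induction k)
      case (Suc k)
      then show ?case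
        using hproj_homogeneous[OF hom[of k], of "nu ! k"] by (auto simp: less_Suc_eq)
    qed simp
    show "prod_list (map (\<lambda>j. hproj (nu ! j) (prod_list (sub j c xs))) [0..<?k]) =
        (if \<forall>j<?k. sum_list (sub j c ns) = nu ! j then prod_list (out ?k c xs) else 0)"
      unfolding out_def by (rule *)
  qed
  also have "\<dots> = (\<Sum>c\<in>weighted nu ns. prod_list (out ?k c xs))"
    unfolding weighted_def len by (rule sum.inter_filter[OF finite_colourings, symmetric])
  finally show ?thesis .
qed

lemma sorted_wrt_sub: "sorted_wrt R w \<Longrightarrow> sorted_wrt R (sub j c w)"
proof (induction w arbitrary: c)
  case (Cons v w)
  have "set (sub j c w) \<subseteq> set w" for c
    by (auto simp: sub_def dest: set_zip_rightD)
  with Cons show ?case by (cases c) auto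
qed (simp add: sub_def)

lemma set_sub: "set (sub j c w) = {w ! i | i. i < length c \<and> i < length w \<and> c ! i = j}"
  by (auto simp: sub_def set_zip image_iff)

lemma sub_map_self: "sub j (map f w) w = filter (\<lambda>x. f x = j) w"
  by (induction w) auto

section \<open>Permutations increasing on blocks, and colourings\<close>

fun incr_blocks :: "nat list \<Rightarrow> nat list \<Rightarrow> bool" where
  "incr_blocks [] L = True"
| "incr_blocks (n # nu) L = (sorted_wrt (<) (take n L) \<and> incr_blocks nu (drop n L))"

definition bounds :: "nat list \<Rightarrow> nat set" where
  "bounds nu = {sum_list (take j nu) | j. 0 < j \<and> j < length nu}"

lemma bounds_Cons: "i > n \<Longrightarrow> i \<in> bounds (n # nu) \<longleftrightarrow> i - n \<in> bounds nu"
proof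
  assume i: "i > n" "i \<in> bounds (n # nu)"
  then obtain j where j: "0 < j" "j < Suc (length nu)" "i = sum_list (take j (n # nu))"
    by (auto simp: bounds_def)
  then obtain j' where j': "j = Suc j'" by (cases j) auto
  then have "i = n + sum_list (take j' nu)" "j' < length nu" using j by auto
  moreover have "0 < j'" using calculation i by (cases j') auto
  ultimately show "i - n \<in> bounds nu" by (auto simp: bounds_def)
next
  assume i: "i > n" "i - n \<in> bounds nu"
  then obtain j where "0 < j" "j < length nu" "i - n = sum_list (take j nu)"
    by (auto simp: bounds_def)
  then have "0 < Suc j" "Suc j < length (n # nu)" "i = sum_list (take (Suc j) (n # nu))" using i by auto
  then show "i \<in> bounds (n # nu)" unfolding bounds_def by blast
qed

lemma bounds_Cons_first: "nu \<noteq> [] \<Longrightarrow> n \<in> bounds (n # nu)"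
  unfolding bounds_def by (auto intro!: exI[of _ 1])

lemma bounds_Cons_less: "i < n \<Longrightarrow> i \<notin> bounds (n # nu)"
  by (auto simp: bounds_def take_Cons split: nat.splits)

lemma incr_blocks_iff:
  "length L = sum_list nu \<Longrightarrow>
     incr_blocks nu L \<longleftrightarrow> (\<forall>i. Suc i < length L \<longrightarrow> Suc i \<notin> bounds nu \<longrightarrow> L ! i < L ! Suc i)"
proof (induction nu arbitrary: L)
  case (Cons n nu)
  have IH: "incr_blocks nu (drop n L) \<longleftrightarrow> (\<forall>i. Suc i < length (drop n L) \<longrightarrow> Suc i \<notin> bounds nu \<longrightarrow>
      drop n L ! i < drop n L ! Suc i)"
    using Cons.prems by (intro Cons.IH) simp
  have S: "sorted_wrt (<) (take n L) \<longleftrightarrow> (\<forall>i. Suc i < n \<longrightarrow> L ! i < L ! Suc i)"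
    using Cons.prems by (auto simp: sorted_wrt_iff_nth_Suc_transp)
  have len: "n \<le> length L" using Cons.prems by simp
  show ?case
  proof
    assume inc: "incr_blocks (n # nu) L"
    show "\<forall>i. Suc i < length L \<longrightarrow> Suc i \<notin> bounds (n # nu) \<longrightarrow> L ! i < L ! Suc i"
    proof (intro allI impI)
      fix i assume i: "Suc i < length L" "Suc i \<notin> bounds (n # nu)"
      consider "Suc i < n" | "Suc i = n" | "Suc i > n" by linarith
      then show "L ! i < L ! Suc i"
      proof cases
        case 1
        then show ?thesis using inc S by simp
      next
        case 2
        then have "nu \<noteq> []" using i Cons.prems by auto
        then show ?thesis using bounds_Cons_first i 2 by auto
      next
        case 3
        then have "Suc (i - n) \<notin> bounds nu" using bounds_Cons[of n "Suc i" nu] i by (simp add: Suc_diff_le)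
        moreover have "Suc (i - n) < length (drop n L)" using 3 i by simp
        ultimately have "drop n L ! (i - n) < drop n L ! Suc (i - n)" using inc IH by simp
        then show ?thesis using 3 len by simp
      qed
    qed
  next
    assume R: "\<forall>i. Suc i < length L \<longrightarrow> Suc i \<notin> bounds (n # nu) \<longrightarrow> L ! i < L ! Suc i"
    have "\<forall>i. Suc i < n \<longrightarrow> L ! i < L ! Suc i" using R bounds_Cons_less[of _ n nu] len by simp
    moreover have "\<forall>i. Suc i < length (drop n L) \<longrightarrow> Suc i \<notin> bounds nu \<longrightarrow> drop n L ! i < drop n L ! Suc i"
    proof (intro allI impI)
      fix i assume i: "Suc i < length (drop n L)" "Suc i \<notin> bounds nu"
      then have "Suc (n + i) \<notin> bounds (n # nu)" using bounds_Cons[of n "Suc (n + i)" nu] by simp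
      then show "drop n L ! i < drop n L ! Suc i" using R i len by simp
    qed
    ultimately show "incr_blocks (n # nu) L" using S IH by simp
  qed
qed simp

lemma incr_blocks_concat:
  "incr_blocks (map length Ls) (concat Ls) \<longleftrightarrow> (\<forall>l\<in>set Ls. sorted_wrt (<) l)"
  by (induction Ls) auto

lemma ex_concat: "length L = sum_list nu \<Longrightarrow> \<exists>Ls. concat Ls = L \<and> map length Ls = nu"
proof (induction nu arbitrary: L)
  case (Cons n nu)
  then have "length (drop n L) = sum_list nu" by simp
  from Cons.IH[OF this] obtain Ls where "concat Ls = drop n L" "map length Ls = nu" by blast
  then have "concat (take n L # Ls) = L" "map length (take n L # Ls) = n # nu" using Cons.prems by auto
  then show ?case by (intro exI[of _ "take n L # Ls"] conjI)
qed simp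

lemma distinct_concat_index:
  "distinct (concat Ls) \<Longrightarrow> j < length Ls \<Longrightarrow> j' < length Ls \<Longrightarrow> x \<in> set (Ls ! j) \<Longrightarrow> x \<in> set (Ls ! j') \<Longrightarrow> j = j'"
proof (induction Ls arbitrary: j j')
  case (Cons l Ls)
  have *: "x \<in> set (concat Ls)" if "i < length Ls" "x \<in> set (Ls ! i)" for i using that by auto
  show ?case
  proof (cases j)
    case 0
    show ?thesis
    proof (cases j')
      case (Suc i')
      then have "x \<in> set (concat Ls)" using Cons.prems by (intro *[of i']) auto
      then show ?thesis using Cons.prems 0 by auto
    qed (use 0 in simp)
  next
    case (Suc i)
    show ?thesis
    proof (cases j')
      case 0
      have "x \<in> set (concat Ls)" using Cons.prems Suc by (intro *[of i]) auto
      then show ?thesis using Cons.prems 0 by auto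
    next
      case (Suc i')
      then show ?thesis using Cons.IH[of i i'] Cons.prems \<open>j = Suc i\<close> by auto
    qed
  qed
qed simp

definition descents :: "nat list \<Rightarrow> (nat \<Rightarrow> nat) set" where
  "descents nu = {\<sigma> \<in> perms (sum_list nu). \<forall>i\<in>{1..<sum_list nu} - bounds nu. \<sigma> i < \<sigma> (Suc i)}"

lemma descents_iff:
  assumes "\<sigma> \<in> perms (sum_list nu)"
  shows "\<sigma> \<in> descents nu \<longleftrightarrow> incr_blocks nu (map \<sigma> [1..<Suc (sum_list nu)])"
proof -
  let ?r = "sum_list nu"
  have "incr_blocks nu (map \<sigma> [1..<Suc ?r]) \<longleftrightarrow>
      (\<forall>i. Suc i < ?r \<longrightarrow> Suc i \<notin> bounds nu \<longrightarrow> \<sigma> (Suc i) < \<sigma> (Suc (Suc i)))"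
    by (subst incr_blocks_iff) (auto simp del: upt_Suc)
  also have "\<dots> \<longleftrightarrow> (\<forall>i\<in>{1..<?r} - bounds nu. \<sigma> i < \<sigma> (Suc i))"
  proof
    assume R: "\<forall>i. Suc i < ?r \<longrightarrow> Suc i \<notin> bounds nu \<longrightarrow> \<sigma> (Suc i) < \<sigma> (Suc (Suc i))"
    show "\<forall>i\<in>{1..<?r} - bounds nu. \<sigma> i < \<sigma> (Suc i)"
    proof
      fix i assume "i \<in> {1..<?r} - bounds nu"
      then show "\<sigma> i < \<sigma> (Suc i)" using R[rule_format, of "i - 1"] by auto
    qed
  qed auto
  finally show ?thesis using assms by (simp add: descents_def)
qed

lemma perms_list:
  assumes "\<sigma> \<in> perms r"
  shows "distinct (map \<sigma> [1..<Suc r])" "set (map \<sigma> [1..<Suc r]) = {1..r}"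
proof -
  have s: "\<sigma> permutes {1..r}" using assms by (simp add: perms_def)
  have i: "set [1..<Suc r] = {1..r}" by auto
  show "distinct (map \<sigma> [1..<Suc r])"
    unfolding distinct_map i using permutes_inj[OF s] by (simp add: inj_on_def inj_def)
  show "set (map \<sigma> [1..<Suc r]) = {1..r}"
    unfolding set_map i by (rule permutes_image[OF s])
qed

text \<open>The permutation with one-line notation \<open>L\<close>; the shift by 1 accounts for
  places being counted from 1.\<close>

definition list_perm :: "nat list \<Rightarrow> nat \<Rightarrow> nat" where
  "list_perm L i = (if i \<in> {1..length L} then L ! (i - 1) else i)"

lemma map_list_perm: "map (list_perm L) [1..<Suc (length L)] = L"
  by (rule nth_equalityI) (auto simp: list_perm_def simp del: upt_Suc One_nat_def)

lemma list_perm_perms: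
  assumes "distinct L" "set L = {1..length L}"
  shows "list_perm L \<in> perms (length L)"
proof -
  let ?r = "length L"
  have i: "set [1..<Suc ?r] = {1..?r}" by auto
  have "inj_on (list_perm L) {1..?r}"
    using assms(1) unfolding i[symmetric] by (metis distinct_map map_list_perm)
  moreover have "list_perm L ` {1..?r} = {1..?r}"
    unfolding i[symmetric] by (subst set_map[symmetric], subst map_list_perm) (simp add: assms(2) i atLeastLessThanSuc_atLeastAtMost del: upt_Suc One_nat_def)
  ultimately have "list_perm L permutes {1..?r}"
    by (intro bij_imp_permutes bij_betw_imageI) (auto simp: list_perm_def)
  then show ?thesis by (simp add: perms_def)
qed

lemma list_perm_inverse:
  assumes "\<sigma> \<in> perms r" shows "list_perm (map \<sigma> [1..<Suc r]) = \<sigma>"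
proof
  fix i
  have s: "\<sigma> permutes {1..r}" using assms by (simp add: perms_def)
  show "list_perm (map \<sigma> [1..<Suc r]) i = \<sigma> i"
  proof (cases "i \<in> {1..r}")
    case True
    then show ?thesis by (auto simp: list_perm_def simp del: upt_Suc One_nat_def)
  next
    case False
    then show ?thesis using permutes_not_in[OF s False] by (auto simp: list_perm_def simp del: upt_Suc One_nat_def)
  qed
qed

abbreviation unit_weighted :: "nat list \<Rightarrow> nat list set" where
  "unit_weighted nu \<equiv> weighted nu (replicate (sum_list nu) 1)"

lemma unit_weighted_iff:
  "c \<in> unit_weighted nu \<longleftrightarrow> c \<in> colourings (length nu) (sum_list nu) \<and> (\<forall>j<length nu. count_list c j = nu ! j)"
proof -
  have "sum_list (sub j c (replicate (length c) 1)) = count_list c j" for j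
    by (induction c) auto
  then show ?thesis by (auto simp: weighted_def colourings_def)
qed

text \<open>A permutation that increases on every block is determined by the sets of its values on
  the blocks, hence by colouring each value with its block. Conversely, listing the values colour by
  colour, increasing within each colour, gives its one-line notation.\<close>

lemma out_bij:
  "bij_betw (\<lambda>c. list_perm (out (length nu) c [1..<Suc (sum_list nu)])) (unit_weighted nu) (descents nu)"
proof -
  let ?r = "sum_list nu" and ?k = "length nu"
  let ?L1 = "[1..<Suc ?r]"
  let ?o = "\<lambda>c. out ?k c ?L1"
  have c: "length c = ?r" "length c = length ?L1" "set c \<subseteq> {..<?k}" "\<And>j. j < ?k \<Longrightarrow> length (sub j c ?L1) = nu ! j"
    if "c \<in> unit_weighted nu" for c
    using that unfolding unit_weighted_iff by (auto simp: colourings_def length_sub simp del: upt_Suc One_nat_def)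
  have o: "mset (?o c) = mset ?L1" if "c \<in> unit_weighted nu" for c
    by (rule mset_out[OF c(2,3)[OF that]])
  have o1: "distinct (?o c)" if "c \<in> unit_weighted nu" for c
    using mset_eq_imp_distinct_iff[OF o[OF that]] distinct_upt by blast
  have o2: "set (?o c) = {1..?r}" if "c \<in> unit_weighted nu" for c
    using mset_eq_setD[OF o[OF that]] by (simp only: set_upt atLeastLessThanSuc_atLeastAtMost)
  have o3: "length (?o c) = ?r" if "c \<in> unit_weighted nu" for c
    using mset_eq_length[OF o[OF that]] by (simp only: length_upt diff_Suc_1)
  have mp: "map (list_perm (?o c)) ?L1 = ?o c" if "c \<in> unit_weighted nu" for c
    using map_list_perm[of "?o c"] unfolding o3[OF that] .
  have lens: "map length (map (\<lambda>j. sub j c ?L1) [0..<?k]) = nu" if "c \<in> unit_weighted nu" for c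
    by (rule nth_equalityI) (auto simp: c(4)[OF that] simp del: upt_Suc One_nat_def)
  show ?thesis
  proof (rule bij_betwI')
    fix c c' assume cc: "c \<in> unit_weighted nu" "c' \<in> unit_weighted nu"
    show "(list_perm (?o c) = list_perm (?o c')) = (c = c')"
    proof
      assume eq: "list_perm (?o c) = list_perm (?o c')"
      have "?o c = map (list_perm (?o c)) ?L1" by (rule mp[OF cc(1), symmetric])
      also have "\<dots> = ?o c'" unfolding eq by (rule mp[OF cc(2)])
      finally have "map (\<lambda>j. sub j c ?L1) [0..<?k] = map (\<lambda>j. sub j c' ?L1) [0..<?k]"
        unfolding out_def
        by (rule concat_injective) (auto simp: set_zip c(4)[OF cc(1)] c(4)[OF cc(2)] simp del: upt_Suc One_nat_def)
      then have "\<forall>j\<in>set [0..<?k]. sub j c ?L1 = sub j c' ?L1" by (simp only: map_eq_conv)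
      then have sub: "sub j c ?L1 = sub j c' ?L1" if "j < ?k" for j using that by simp
      show "c = c'"
      proof (rule nth_equalityI)
        show "length c = length c'" using c(1) cc by simp
        fix i assume i: "i < length c"
        then have "c ! i < ?k" using c(3)[OF cc(1)] nth_mem by blast
        then have "set (sub (c ! i) c ?L1) = set (sub (c ! i) c' ?L1)" using sub by simp
        moreover have "?L1 ! i \<in> set (sub (c ! i) c ?L1)"
          unfolding set_sub using i c(2)[OF cc(1)]
          by (intro CollectI exI[of _ i]) (simp del: upt_Suc One_nat_def)
        ultimately have "?L1 ! i \<in> set (sub (c ! i) c' ?L1)" by simp
        then obtain i' where "i' < length c'" "?L1 ! i = ?L1 ! i'" "c' ! i' = c ! i"
          unfolding set_sub by (auto simp del: upt_Suc One_nat_def)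
        then show "c ! i = c' ! i" using i c(1)[OF cc(1)] c(1)[OF cc(2)] by (auto simp del: upt_Suc One_nat_def)
      qed
    qed simp
  next
    fix c assume cc: "c \<in> unit_weighted nu"
    have p: "list_perm (?o c) \<in> perms ?r"
      using list_perm_perms[of "?o c"] unfolding o3[OF cc] by (simp only: o1[OF cc] o2[OF cc])
    have "map (list_perm (?o c)) ?L1 = ?o c" by (rule mp[OF cc])
    moreover have "incr_blocks nu (?o c)"
    proof -
      have "sorted_wrt (<) (sub j c ?L1)" for j by (rule sorted_wrt_sub) (rule sorted_wrt_upt)
      then have "incr_blocks (map length (map (\<lambda>j. sub j c ?L1) [0..<?k])) (concat (map (\<lambda>j. sub j c ?L1) [0..<?k]))"
        unfolding incr_blocks_concat by auto
      then show ?thesis unfolding lens[OF cc] out_def .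
    qed
    ultimately show "list_perm (?o c) \<in> descents nu"
      unfolding descents_iff[OF p] by (simp only:)
  next
    fix \<sigma> assume \<sigma>: "\<sigma> \<in> descents nu"
    then have p: "\<sigma> \<in> perms ?r" by (simp add: descents_def)
    let ?S = "map \<sigma> ?L1"
    have "length ?S = ?r" by (simp only: length_map length_upt diff_Suc_1)
    from ex_concat[OF this] obtain Ls where Ls: "concat Ls = ?S" "map length Ls = nu" by (elim exE conjE)
    have k: "length Ls = ?k" using arg_cong[OF Ls(2), of length] by simp
    have "incr_blocks nu ?S" using \<sigma> unfolding descents_iff[OF p] .
    then have "incr_blocks (map length Ls) (concat Ls)" unfolding Ls .
    then have inc: "\<forall>l\<in>set Ls. sorted_wrt (<) l" by (simp only: incr_blocks_concat)
    have dist: "distinct (concat Ls)" unfolding Ls(1) by (rule perms_list(1)[OF p])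
    have setLs: "set (concat Ls) = {1..?r}" unfolding Ls(1) by (rule perms_list(2)[OF p])
    have "\<forall>i\<in>{1..?r}. \<exists>j. j < ?k \<and> i \<in> set (Ls ! j)"
    proof
      fix i assume "i \<in> {1..?r}"
      then have "i \<in> set (concat Ls)" unfolding setLs .
      then obtain l where "l \<in> set Ls" "i \<in> set l" by auto
      moreover from this(1) obtain j where "j < length Ls" "Ls ! j = l" by (auto simp: in_set_conv_nth)
      ultimately show "\<exists>j. j < ?k \<and> i \<in> set (Ls ! j)" using k by auto
    qed
    \<comment> \<open>The colour of a value is the index of the block of the one-line notation in
      which it stands.\<close>
    from bchoice[OF this] obtain col where col: "\<forall>i\<in>{1..?r}. col i < ?k \<and> i \<in> set (Ls ! col i)" ..
    have col_iff: "col i = j \<longleftrightarrow> i \<in> set (Ls ! j)" if "i \<in> {1..?r}" "j < ?k" for i j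
    proof
      assume "col i = j"
      then show "i \<in> set (Ls ! j)" using col that(1) by blast
    next
      assume "i \<in> set (Ls ! j)"
      moreover have "col i < length Ls" "i \<in> set (Ls ! col i)" using bspec[OF col that(1)] k by simp_all
      ultimately show "col i = j"
        using distinct_concat_index[OF dist] that(2) k by simp
    qed
    let ?c = "map col ?L1"
    \<comment> \<open>Both lists are strictly increasing, so it is enough that they have the same
      elements.\<close>
    have sub: "sub j ?c ?L1 = Ls ! j" if j: "j < ?k" for j
      unfolding sub_map_self
    proof (rule strict_sorted_equal)
      show "sorted_wrt (<) (Ls ! j)" using inc j k by simp
      show "sorted_wrt (<) (filter (\<lambda>x. col x = j) ?L1)"
        by (intro sorted_wrt_filter sorted_wrt_upt)
      have "Ls ! j \<in> set Ls" using j k by simp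
      then have "set (Ls ! j) \<subseteq> {1..?r}" unfolding setLs[symmetric] by auto
      moreover have "x \<in> set (filter (\<lambda>x. col x = j) ?L1) \<longleftrightarrow> x \<in> set (Ls ! j)" if "x \<in> {1..?r}" for x
        using col_iff[OF that j] that by (simp del: upt_Suc One_nat_def)
      moreover have "set (filter (\<lambda>x. col x = j) ?L1) \<subseteq> {1..?r}" by auto
      ultimately show "set (filter (\<lambda>x. col x = j) ?L1) = set (Ls ! j)" by blast
    qed
    have c: "?c \<in> unit_weighted nu"
      unfolding unit_weighted_iff
    proof (intro conjI allI impI)
      show "?c \<in> colourings ?k ?r" using col by (auto simp: colourings_def simp del: upt_Suc One_nat_def)
      fix j assume j: "j < ?k"
      have "count_list ?c j = length (sub j ?c ?L1)" by (rule length_sub[symmetric]) (rule length_map)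
      also have "\<dots> = nu ! j" unfolding sub[OF j] using arg_cong[OF Ls(2), of "\<lambda>l. l ! j"] j k by simp
      finally show "count_list ?c j = nu ! j" .
    qed
    have m: "map (\<lambda>j. sub j ?c ?L1) [0..<?k] = Ls"
    proof (rule nth_equalityI)
      fix i assume "i < length (map (\<lambda>j. sub j ?c ?L1) [0..<?k])"
      then have "i < ?k" by (simp only: length_map length_upt diff_zero)
      then show "map (\<lambda>j. sub j ?c ?L1) [0..<?k] ! i = Ls ! i" by (simp add: sub del: upt_Suc One_nat_def)
    qed (simp only: length_map length_upt diff_zero k)
    have "?o ?c = ?S" unfolding out_def m by (rule Ls(1))
    then have "\<sigma> = list_perm (?o ?c)" by (simp only: list_perm_inverse[OF p])
    then show "\<exists>c\<in>unit_weighted nu. \<sigma> = list_perm (?o c)" using c by (rule bexI)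
  qed
qed

text \<open>A place permutation \<sigma> puts the letter from place \<sigma>(i) into place i, so it
  performs on \<open>w\<close> the rearrangement that produces the one-line notation of \<sigma>
  from 1, 2, ..., r.\<close>

lemma place_perm_list_perm:
  assumes c: "length c = length w" "set c \<subseteq> {..<k}"
  shows "place_perm (list_perm (out k c [1..<Suc (length w)])) w = out k c w"
proof -
  let ?L1 = "[1..<Suc (length w)]"
  let ?o = "out k c ?L1"
  have len: "length ?o = length w"
    using mset_eq_length[OF mset_out[of c ?L1 k]] c by (simp del: upt_Suc One_nat_def)
  have w: "map (\<lambda>p. w ! (p - 1)) ?L1 = w" by (rule nth_equalityI) (auto simp del: upt_Suc One_nat_def)
  have "place_perm (list_perm ?o) w = map (\<lambda>p. w ! (p - 1)) (map (list_perm ?o) ?L1)"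
    by (simp add: place_perm_def comp_def del: upt_Suc One_nat_def)
  also have "map (list_perm ?o) ?L1 = ?o" using map_list_perm[of ?o] by (simp only: len)
  also have "map (\<lambda>p. w ! (p - 1)) ?o = out k c (map (\<lambda>p. w ! (p - 1)) ?L1)" by (rule out_map[symmetric])
  finally show ?thesis unfolding w .
qed

lemma descent_elem_eq: "descent_elem nu = (\<Sum>\<sigma>\<in>descents nu. Poly_Mapping.single \<sigma> 1)"
  by (simp add: descent_elem_def descents_def bounds_def)

lemma descent_elem_word:
  fixes w :: "'v list"
  assumes "length w = sum_list nu"
  shows "pm_bilin place_perm (descent_elem nu) (word w :: 'v list \<Rightarrow>\<^sub>0 'f::field) = (\<Sum>c\<in>unit_weighted nu. word (out (length nu) c w))"
proof -
  have "pm_bilin place_perm (descent_elem nu) (word w :: 'v list \<Rightarrow>\<^sub>0 'f) = (\<Sum>\<sigma>\<in>descents nu. word (place_perm \<sigma> w))"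
    unfolding descent_elem_eq by (subst pm_linear_sum[OF pm_linear_bilin1]) simp
  also have "\<dots> = (\<Sum>c\<in>unit_weighted nu.
      word (place_perm (list_perm (out (length nu) c [1..<Suc (sum_list nu)])) w))"
    by (rule sum.reindex_bij_betw[OF out_bij, symmetric])
  also have "\<dots> = (\<Sum>c\<in>unit_weighted nu. word (out (length nu) c w))"
  proof (rule sum.cong[OF refl])
    fix c assume "c \<in> unit_weighted nu"
    then have "length c = length w" "set c \<subseteq> {..<length nu}"
      unfolding unit_weighted_iff by (simp_all only: colourings_def mem_Collect_eq assms)
    from place_perm_list_perm[OF this]
    show "(word (place_perm (list_perm (out (length nu) c [1..<Suc (sum_list nu)])) w) :: 'v list \<Rightarrow>\<^sub>0 'f) =
        word (out (length nu) c w)"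
      by (simp only: assms)
  qed
  finally show ?thesis .
qed

text \<open>On a word both sides are the sum over the colourings with \<open>nu ! j\<close> places
  of colour \<open>j\<close>: the left side by the bijection \<open>out_bij\<close>, the right side
  because letters are primitive of degree 1.\<close>

lemma descent_elem_coprod:
  assumes "homogeneous (sum_list nu) x"
  shows "pm_bilin place_perm (descent_elem nu) x = join_blocks nu (coprod (length nu) x)"
proof (rule pm_linear_eqI[OF pm_linear_bilin2 pm_linear_compose[OF pm_linear_join pm_linear_coprod]])
  fix w assume "w \<in> Poly_Mapping.keys x"
  then have len: "length w = sum_list nu" using assms by (simp add: homogeneous_def)
  have letters: "prod_list (map (\<lambda>v. word [v]) w) = word w" for w :: "'a list"
  proof (induction w)
    case (Cons v w)
    then show ?case by (subst word_Cons) simp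
  qed (simp add: word_Nil)
  have "join_blocks nu (coprod (length nu) (prod_list (map (\<lambda>v. word [v]) w))) =
      (\<Sum>c\<in>unit_weighted nu. prod_list (out (length nu) c (map (\<lambda>v. word [v]) w)))"
    by (rule join_coprod_prod_list) (auto simp: list_all2_conv_all_nth len coprod_lie lie_elems.gen)
  then have "join_blocks nu (coprod (length nu) (word w)) = (\<Sum>c\<in>unit_weighted nu. word (out (length nu) c w))"
    by (simp only: out_map letters)
  then show "pm_bilin place_perm (descent_elem nu) (word w) = join_blocks nu (coprod (length nu) (word w))"
    unfolding descent_elem_word[OF len] by (rule sym)
qed

theorem descent_elem_prod_list:
  assumes "list_all2 (\<lambda>x n. x \<in> lie_elems \<and> homogeneous n x) xs ns" "sum_list ns = sum_list nu"
  shows "pm_bilin place_perm (descent_elem nu) (prod_list xs) =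
     (\<Sum>c\<in>weighted nu ns. prod_list (out (length nu) c xs))"
proof -
  have "homogeneous (sum_list nu) (prod_list xs)"
    unfolding assms(2)[symmetric] by (rule homogeneous_prod_list) (use assms(1) in \<open>auto intro: list_all2_mono\<close>)
  then have "pm_bilin place_perm (descent_elem nu) (prod_list xs) = join_blocks nu (coprod (length nu) (prod_list xs))"
    by (rule descent_elem_coprod)
  also have "\<dots> = (\<Sum>c\<in>weighted nu ns. prod_list (out (length nu) c xs))"
    by (rule join_coprod_prod_list) (use assms(1) in \<open>auto intro: list_all2_mono simp: coprod_lie\<close>)
  finally show ?thesis .
qed

section \<open>Young characters\<close>

text \<open>Each fibre of \<open>\<beta>\<close> in \<open>S\<close> is numbered from 0 and rotated
  by one step.\<close>

lemma ex_cyclic_perm: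
  fixes S :: "'a set" and \<beta> :: "'a \<Rightarrow> 'b"
  assumes "finite S"
  shows "\<exists>\<sigma>. \<sigma> permutes S \<and> (\<forall>p\<in>S. orbit \<sigma> p = {q \<in> S. \<beta> q = \<beta> p})"
proof -
  define C where "C p = {q \<in> S. \<beta> q = \<beta> p}" for p
  have fin: "finite (C p)" for p using assms by (simp add: C_def)
  have CS: "C p \<subseteq> S" for p by (auto simp: C_def)
  have Ceq: "C q = C p" if "q \<in> C p" for p q using that by (auto simp: C_def)
  have self: "p \<in> C p" if "p \<in> S" for p using that by (simp add: C_def)
  have "\<forall>X. \<exists>f :: nat \<Rightarrow> 'a. finite X \<longrightarrow> bij_betw f {0..<card X} X"
    using ex_bij_betw_nat_finite by blast
  then obtain f :: "'a set \<Rightarrow> nat \<Rightarrow> 'a" where f: "\<And>X. finite X \<Longrightarrow> bij_betw (f X) {0..<card X} X"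
    by metis
  define m where "m p = card (C p)" for p
  define ix where "ix p = inv_into {0..<m p} (f (C p)) p" for p
  have mpos: "m p > 0" if "p \<in> S" for p using self[OF that] fin by (auto simp: m_def card_gt_0_iff)
  have fC: "bij_betw (f (C p)) {0..<m p} (C p)" for p unfolding m_def by (rule f[OF fin])
  have fx: "f (C p) (ix p) = p" "ix p < m p" if "p \<in> S" for p
  proof -
    have "p \<in> f (C p) ` {0..<m p}" using fC[of p] self[OF that] by (simp add: bij_betw_def)
    then show "f (C p) (ix p) = p" "ix p < m p"
      unfolding ix_def using f_inv_into_f[of p "f (C p)" "{0..<m p}"] inv_into_into[of p "f (C p)" "{0..<m p}"]
      by simp_all
  qed
  have fin_C: "f (C p) i \<in> C p" if "i < m p" for p i
    using bij_betwE[OF fC[of p]] that by auto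
  define \<sigma> where "\<sigma> p = (if p \<in> S then f (C p) ((ix p + 1) mod m p) else p)" for p
  have ix_f: "ix (f (C p) i) = i" if "p \<in> S" "i < m p" for p i
  proof -
    have e: "C (f (C p) i) = C p" by (rule Ceq[OF fin_C[OF that(2)]])
    then have "m (f (C p) i) = m p" by (simp add: m_def)
    then show ?thesis unfolding ix_def e
      using inv_into_f_f[OF bij_betw_imp_inj_on[OF fC[of p]], of i] that by simp
  qed
  have pow: "(\<sigma> ^^ t) p = f (C p) ((ix p + t) mod m p)" if p: "p \<in> S" for p t
  proof (induction t)
    case 0
    then show ?case using fx[OF p] by simp
  next
    case (Suc t)
    let ?q = "f (C p) ((ix p + t) mod m p)"
    have lt: "(ix p + t) mod m p < m p" using mpos[OF p] by simp
    have q: "?q \<in> C p" by (rule fin_C[OF lt])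
    then have "?q \<in> S" "C ?q = C p" "m ?q = m p" using CS Ceq by (auto simp: m_def)
    then have "\<sigma> ?q = f (C p) ((ix ?q + 1) mod m p)" by (simp add: \<sigma>_def)
    also have "ix ?q = (ix p + t) mod m p" by (rule ix_f[OF p lt])
    also have "((ix p + t) mod m p + 1) mod m p = (ix p + Suc t) mod m p"
      by (simp add: mod_Suc_eq)
    finally show ?case using Suc.IH by simp
  qed
  have orb: "orbit \<sigma> p = C p" if p: "p \<in> S" for p
  proof (intro equalityI subsetI)
    fix q assume "q \<in> orbit \<sigma> p"
    then obtain t where "q = (\<sigma> ^^ t) p" unfolding orbit_altdef by auto
    then show "q \<in> C p" using pow[OF p] fin_C mpos[OF p] by simp
  next
    fix q assume q: "q \<in> C p"
    have qS: "q \<in> S" using q CS by blast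
    have e: "C q = C p" "m q = m p" using Ceq[OF q] by (simp_all add: m_def)
    \<comment> \<open>The number of steps from \<open>p\<close> to \<open>q\<close> along the cycle,
      increased by a full turn to be positive, since \<open>orbit\<close> collects positive powers
      only.\<close>
    let ?t = "m p + ix q - ix p"
    have lt: "ix p < m p" "ix q < m p" using fx(2)[OF p] fx(2)[OF qS] e by simp_all
    then have "ix p + ?t = ix q + m p" by simp
    then have "(\<sigma> ^^ ?t) p = f (C p) (ix q)" using pow[OF p, of ?t] lt by simp
    also have "\<dots> = q" using fx(1)[OF qS] e by simp
    finally show "q \<in> orbit \<sigma> p" unfolding orbit_altdef using lt by (intro CollectI exI[of _ ?t]) simp
  qed
  have "\<sigma> permutes S"
  proof (rule bij_imp_permutes)
    have "\<sigma> ` S \<subseteq> S"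
    proof
      fix q assume "q \<in> \<sigma> ` S"
      then obtain p where "p \<in> S" "q = \<sigma> p" by blast
      then have "q \<in> orbit \<sigma> p" by (simp add: orbit.base)
      then show "q \<in> S" using orb[OF \<open>p \<in> S\<close>] CS by blast
    qed
    moreover have "S \<subseteq> \<sigma> ` S"
    proof
      fix p assume p: "p \<in> S"
      then have "p \<in> orbit \<sigma> p" using orb self by simp
      then show "p \<in> \<sigma> ` S"
      proof (cases rule: orbit.cases)
        case base
        then show ?thesis using p by blast
      next
        case (step y)
        then have "y \<in> S" using orb[OF p] CS by blast
        then show ?thesis using step by blast
      qed
    qed
    ultimately have im: "\<sigma> ` S = S" by (rule equalityI)
    then have "inj_on \<sigma> S" using assms by (simp add: eq_card_imp_inj_on)
    then show "bij_betw \<sigma> S S" using im by (simp add: bij_betw_def)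
  qed (simp add: \<sigma>_def)
  moreover have "\<forall>p\<in>S. orbit \<sigma> p = {q \<in> S. \<beta> q = \<beta> p}" using orb by (simp add: C_def)
  ultimately show ?thesis by (intro exI[of _ \<sigma>] conjI)
qed

section \<open>Blocks of a composition and Young subgroups\<close>

fun spread :: "nat list \<Rightarrow> 'a list \<Rightarrow> 'a list" where
  "spread (n # ns) (a # as) = replicate n a @ spread ns as"
| "spread _ _ = []"

definition labels :: "nat list \<Rightarrow> nat list" where
  "labels ns = spread ns [0..<length ns]"

lemma length_spread: "length ns = length as \<Longrightarrow> length (spread ns as) = sum_list ns"
  by (induction ns as rule: list_induct2) simp_all

lemma spread_map: "length ns = length as \<Longrightarrow> spread ns (map f as) = map f (spread ns as)"
  by (induction ns as rule: list_induct2) simp_all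

lemma length_labels [simp]: "length (labels ns) = sum_list ns"
  by (simp add: labels_def length_spread)

lemma map_labels: "length d = length ns \<Longrightarrow> map ((!) d) (labels ns) = spread ns d"
proof -
  assume len: "length d = length ns"
  have "spread ns (map ((!) d) [0..<length ns]) = map ((!) d) (labels ns)"
    unfolding labels_def by (rule spread_map) simp
  then show ?thesis by (simp add: map_nth flip: len)
qed

lemma count_list_spread: "length ns = length d \<Longrightarrow> count_list (spread ns d) j = sum_list (sub j d ns)"
proof (induction ns d rule: list_induct2)
  case (Cons n ns a d)
  have "count_list (replicate n a) j = (if a = j then n else 0)" by (induction n) auto
  then show ?case using Cons by simp
qed simp

lemma set_spread_subset: "length ns = length as \<Longrightarrow> set (spread ns as) \<subseteq> set as"
  by (induction ns as rule: list_induct2) auto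

lemma labels_less: "q < sum_list ns \<Longrightarrow> labels ns ! q < length ns"
proof -
  assume "q < sum_list ns"
  then have "labels ns ! q \<in> set (labels ns)" by simp
  then show ?thesis using set_spread_subset[of ns "[0..<length ns]"] by (auto simp: labels_def)
qed

lemma labels_Cons: "labels (n # ns) = replicate n 0 @ map Suc (labels ns)"
  by (simp add: labels_def upt_conv_Cons map_Suc_upt[symmetric] spread_map del: upt_Suc)

lemma count_list_labels: "i < length ns \<Longrightarrow> count_list (labels ns) i = ns ! i"
proof (induction ns arbitrary: i)
  case (Cons n ns)
  have r: "count_list (replicate n 0) i = (if i = 0 then n else 0)" by (induction n) auto
  have m0: "count_list (map Suc xs) 0 = 0" for xs by (induction xs) auto
  have mS: "count_list (map Suc xs) (Suc k) = count_list xs k" for xs k by (induction xs) auto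
  show ?case using Cons r by (cases i) (simp_all add: labels_Cons m0 mS)
qed simp

lemma nth_labels_iff:
  "q < sum_list ns \<Longrightarrow> j < length ns \<Longrightarrow>
     labels ns ! q = j \<longleftrightarrow> sum_list (take j ns) \<le> q \<and> q < sum_list (take (Suc j) ns)"
proof (induction ns arbitrary: q j)
  case (Cons n ns)
  show ?case
  proof (cases "q < n")
    case True
    then show ?thesis by (cases j) (auto simp: labels_Cons nth_append)
  next
    case False
    then have q: "labels (n # ns) ! q = Suc (labels ns ! (q - n))" "q - n < sum_list ns"
      using Cons.prems by (auto simp: labels_Cons nth_append)
    show ?thesis
    proof (cases j)
      case 0
      then show ?thesis using False q by simp
    next
      case (Suc j')
      then show ?thesis using Cons.IH[OF q(2), of j'] Cons.prems False q(1) by auto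
    qed
  qed
qed simp

definition block :: "nat list \<Rightarrow> nat \<Rightarrow> nat" where
  "block ns p = labels ns ! (p - 1)"

lemma block_less: "p \<in> {1..sum_list ns} \<Longrightarrow> block ns p < length ns"
  unfolding block_def by (rule labels_less) auto

lemma block_iff:
  "p \<in> {1..sum_list ns} \<Longrightarrow> j < length ns \<Longrightarrow>
     block ns p = j \<longleftrightarrow> p \<in> {sum_list (take j ns)<..sum_list (take (Suc j) ns)}"
proof -
  assume p: "p \<in> {1..sum_list ns}" and j: "j < length ns"
  then have q: "p - 1 < sum_list ns" by auto
  show ?thesis unfolding block_def nth_labels_iff[OF q j] using p by auto
qed

lemma card_count_list: "card {q \<in> {1..length xs}. xs ! (q - 1) = a} = count_list xs a"
proof -
  have "{q \<in> {1..length xs}. xs ! (q - 1) = a} = Suc ` {i. i < length xs \<and> xs ! i = a}"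
  proof (intro equalityI subsetI)
    fix q assume "q \<in> {q \<in> {1..length xs}. xs ! (q - 1) = a}"
    then show "q \<in> Suc ` {i. i < length xs \<and> xs ! i = a}" by (intro image_eqI[of _ _ "q - 1"]) auto
  qed auto
  then have "card {q \<in> {1..length xs}. xs ! (q - 1) = a} = card {i. i < length xs \<and> xs ! i = a}"
    by (simp add: card_image)
  also have "\<dots> = count_list xs a"
    by (simp add: count_list_eq_length_filter length_filter_conv_card eq_commute[of a])
  finally show ?thesis .
qed

lemma take_sum_le: "sum_list (take j (ns::nat list)) \<le> sum_list ns"
  by (metis append_take_drop_id le_add1 sum_list_append)

text \<open>It is enough that every block is mapped into itself: blocks are finite and permutations
  injective, so the images are the whole blocks.\<close>

lemma young_subgroup_iff:
  "\<sigma> \<in> young_subgroup nu \<longleftrightarrow> \<sigma> \<in> perms (sum_list nu) \<and> (\<forall>p\<in>{1..sum_list nu}. block nu (\<sigma> p) = block nu p)"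
proof (cases "\<sigma> \<in> perms (sum_list nu)")
  case True
  let ?r = "sum_list nu"
  let ?B = "\<lambda>j. {sum_list (take j nu)<..sum_list (take (Suc j) nu)}"
  have s: "\<sigma> permutes {1..?r}" using True by (simp add: perms_def)
  have sp: "\<sigma> p \<in> {1..?r}" if "p \<in> {1..?r}" for p using permutes_in_image[OF s] that by blast
  have B: "?B j \<subseteq> {1..?r}" for j using take_sum_le[of "Suc j" nu] by auto
  have inB: "p \<in> ?B j \<longleftrightarrow> block nu p = j" if "p \<in> {1..?r}" "j < length nu" for p j
    using block_iff[OF that] by blast
  have "(\<forall>j<length nu. \<sigma> ` ?B j = ?B j) \<longleftrightarrow> (\<forall>p\<in>{1..?r}. block nu (\<sigma> p) = block nu p)"
  proof
    assume L: "\<forall>j<length nu. \<sigma> ` ?B j = ?B j"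
    show "\<forall>p\<in>{1..?r}. block nu (\<sigma> p) = block nu p"
    proof
      fix p assume p: "p \<in> {1..?r}"
      have j: "block nu p < length nu" by (rule block_less[OF p])
      have "p \<in> ?B (block nu p)" using inB[OF p j] by simp
      then have "\<sigma> p \<in> ?B (block nu p)" using L j by blast
      then show "block nu (\<sigma> p) = block nu p" using inB[OF sp[OF p] j] by simp
    qed
  next
    assume R: "\<forall>p\<in>{1..?r}. block nu (\<sigma> p) = block nu p"
    show "\<forall>j<length nu. \<sigma> ` ?B j = ?B j"
    proof (intro allI impI)
      fix j assume j: "j < length nu"
      have "\<sigma> ` ?B j \<subseteq> ?B j"
      proof
        fix q assume "q \<in> \<sigma> ` ?B j"
        then obtain p where p: "p \<in> ?B j" "q = \<sigma> p" by blast
        then have pr: "p \<in> {1..?r}" using B by blast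
        then have "block nu (\<sigma> p) = j" using R p(1) inB[OF pr j] by simp
        then show "q \<in> ?B j" using inB[OF sp[OF pr] j] p(2) by simp
      qed
      moreover have "card (\<sigma> ` ?B j) = card (?B j)"
        by (rule card_image) (rule inj_on_subset[OF permutes_inj[OF s] subset_UNIV])
      ultimately show "\<sigma> ` ?B j = ?B j" by (intro card_subset_eq) simp_all
    qed
  qed
  then show ?thesis using True unfolding young_subgroup_def by blast
qed (simp add: young_subgroup_def)

lemma finite_perms: "finite (perms r)"
  by (simp add: perms_def finite_permutations)

lemma id_perms: "id \<in> perms r"
  by (simp add: perms_def permutes_id)

lemma card_young_subgroup: "card (young_subgroup nu) > 0"
proof -
  have "id \<in> young_subgroup nu" by (simp add: young_subgroup_iff id_perms)
  moreover have "finite (young_subgroup nu)"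
    by (rule finite_subset[OF _ finite_perms[of "sum_list nu"]]) (auto simp: young_subgroup_iff)
  ultimately show ?thesis by (auto simp: card_gt_0_iff)
qed

lemma perms_comp: "\<sigma> \<in> perms r \<Longrightarrow> \<tau> \<in> perms r \<Longrightarrow> \<tau> \<circ> \<sigma> \<in> perms r"
  by (simp add: perms_def permutes_compose)

lemma perms_inv: "\<sigma> \<in> perms r \<Longrightarrow> inv_into UNIV \<sigma> \<in> perms r"
  by (simp add: perms_def permutes_inv)

text \<open>Each \<open>q\<close> is coloured by the block that contains \<open>\<tau> q\<close>.
  Two permutations have the same colouring iff one is the other followed by an element of the Young
  subgroup, so colourings stand for the cosets of this subgroup.\<close>

definition colouring_of :: "nat list \<Rightarrow> (nat \<Rightarrow> nat) \<Rightarrow> nat list" where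
  "colouring_of nu \<tau> = map (\<lambda>q. block nu (\<tau> q)) [1..<Suc (sum_list nu)]"

lemma nth_colouring_of: "q \<in> {1..sum_list nu} \<Longrightarrow> colouring_of nu \<tau> ! (q - 1) = block nu (\<tau> q)"
  by (auto simp: colouring_of_def simp del: upt_Suc)

lemma length_colouring_of: "length (colouring_of nu \<tau>) = sum_list nu"
  by (simp add: colouring_of_def del: upt_Suc)

lemma colouring_of_eq_iff:
  "colouring_of nu \<tau> = colouring_of nu \<tau>' \<longleftrightarrow> (\<forall>q\<in>{1..sum_list nu}. block nu (\<tau> q) = block nu (\<tau>' q))"
  unfolding colouring_of_def map_eq_conv by (auto simp del: upt_Suc)

lemma unit_weighted_mset: "c \<in> unit_weighted nu \<longleftrightarrow> mset c = mset (labels nu)"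
proof
  assume c: "c \<in> unit_weighted nu"
  show "mset c = mset (labels nu)"
  proof (rule multiset_eqI)
    fix j
    show "count (mset c) j = count (mset (labels nu)) j"
    proof (cases "j < length nu")
      case True
      then show ?thesis using c count_list_labels unfolding unit_weighted_iff count_mset by simp
    next
      case False
      then have "j \<notin> set c" "j \<notin> set (labels nu)"
        using c set_spread_subset[of nu "[0..<length nu]"] unfolding unit_weighted_iff
        by (auto simp: colourings_def labels_def)
      then show ?thesis by (simp add: count_mset)
    qed
  qed
next
  assume c: "mset c = mset (labels nu)"
  have "set (labels nu) \<subseteq> {..<length nu}"
    using set_spread_subset[of nu "[0..<length nu]"] by (auto simp: labels_def)
  then show "c \<in> unit_weighted nu"
    unfolding unit_weighted_iff colourings_def
    using mset_eq_length[OF c] mset_eq_setD[OF c] count_list_labels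
    by (auto simp: count_mset[symmetric] c)
qed

text \<open>A fibre is the set of products of one of its members \<open>\<tau>0\<close> with the
  elements of the Young subgroup. Such a member exists because \<open>c\<close> is a rearrangement
  of \<open>labels nu\<close>.\<close>

lemma colouring_of_fibre:
  assumes c: "c \<in> unit_weighted nu"
  shows "card {\<tau> \<in> perms (sum_list nu). colouring_of nu \<tau> = c} = card (young_subgroup nu)"
proof -
  let ?r = "sum_list nu"
  obtain p where p: "p permutes {..<length (labels nu)}" "permute_list p (labels nu) = c"
    using mset_eq_permutation[of c "labels nu"] c unfolding unit_weighted_mset by blast
  have pr: "p permutes {..<?r}" using p(1) by simp
  define L where "L = map (\<lambda>i. Suc (p i)) [0..<?r]"
  have lenL: "length L = ?r" by (simp add: L_def)
  have "inj_on (\<lambda>i. Suc (p i)) {0..<?r}"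
    using permutes_inj[OF pr] by (auto simp: inj_on_def inj_def)
  then have "distinct L" unfolding L_def distinct_map by simp
  moreover have "set L = {1..?r}"
  proof -
    have "set L = Suc ` (p ` {..<?r})" unfolding L_def by (auto simp: atLeast0LessThan)
    also have "p ` {..<?r} = {..<?r}" by (rule permutes_image[OF pr])
    also have "Suc ` {..<?r} = {1..?r}" using image_Suc_lessThan by simp
    finally show ?thesis .
  qed
  ultimately have \<tau>0: "list_perm L \<in> perms ?r" using list_perm_perms[of L] unfolding lenL by blast
  define \<tau>0 where "\<tau>0 = list_perm L"
  have t0: "\<tau>0 \<in> perms ?r" using \<tau>0 by (simp add: \<tau>0_def)
  then have t0p: "\<tau>0 permutes {1..?r}" by (simp add: perms_def)
  have "colouring_of nu \<tau>0 = c"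
  proof (rule nth_equalityI)
    have "length c = ?r" using p(2) by (auto simp: permute_list_def)
    then show "length (colouring_of nu \<tau>0) = length c" by (simp add: length_colouring_of)
    fix i assume "i < length (colouring_of nu \<tau>0)"
    then have i: "i < ?r" by (simp add: length_colouring_of)
    have "colouring_of nu \<tau>0 ! i = block nu (\<tau>0 (Suc i))"
      using nth_colouring_of[of "Suc i" nu \<tau>0] i by simp
    also have "\<tau>0 (Suc i) = Suc (p i)" using i by (simp add: \<tau>0_def list_perm_def lenL) (simp add: L_def)
    also have "block nu (Suc (p i)) = c ! i"
      using i p(2) by (auto simp: block_def permute_list_def)
    finally show "colouring_of nu \<tau>0 ! i = c ! i" .
  qed
  then have "{\<tau> \<in> perms ?r. colouring_of nu \<tau> = c} = {\<tau> \<in> perms ?r. colouring_of nu \<tau> = colouring_of nu \<tau>0}"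
    by simp
  also have "\<dots> = (\<lambda>\<upsilon>. \<upsilon> \<circ> \<tau>0) ` young_subgroup nu"
  proof (intro equalityI subsetI)
    fix \<tau> assume "\<tau> \<in> {\<tau> \<in> perms ?r. colouring_of nu \<tau> = colouring_of nu \<tau>0}"
    then have t: "\<tau> \<in> perms ?r" "\<forall>q\<in>{1..?r}. block nu (\<tau> q) = block nu (\<tau>0 q)"
      by (simp_all add: colouring_of_eq_iff)
    let ?\<upsilon> = "\<tau> \<circ> inv_into UNIV \<tau>0"
    have "?\<upsilon> \<in> young_subgroup nu"
      unfolding young_subgroup_iff
    proof (intro conjI ballI)
      show "?\<upsilon> \<in> perms ?r" by (rule perms_comp[OF perms_inv[OF t0] t(1)])
      fix q assume q: "q \<in> {1..?r}"
      have "inv_into UNIV \<tau>0 q \<in> {1..?r}" using permutes_in_image[OF permutes_inv[OF t0p]] q by blast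
      then show "block nu (?\<upsilon> q) = block nu q" using t(2) permutes_inverses(1)[OF t0p] by simp
    qed
    moreover have "\<tau> = ?\<upsilon> \<circ> \<tau>0" using permutes_inverses(2)[OF t0p] by (auto simp: fun_eq_iff)
    ultimately show "\<tau> \<in> (\<lambda>\<upsilon>. \<upsilon> \<circ> \<tau>0) ` young_subgroup nu" by blast
  next
    fix \<tau> assume "\<tau> \<in> (\<lambda>\<upsilon>. \<upsilon> \<circ> \<tau>0) ` young_subgroup nu"
    then obtain \<upsilon> where u: "\<upsilon> \<in> perms ?r" "\<forall>p\<in>{1..?r}. block nu (\<upsilon> p) = block nu p" "\<tau> = \<upsilon> \<circ> \<tau>0"
      by (auto simp: young_subgroup_iff)
    have "\<tau>0 q \<in> {1..?r}" if "q \<in> {1..?r}" for q using permutes_in_image[OF t0p] that by blast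
    then show "\<tau> \<in> {\<tau> \<in> perms ?r. colouring_of nu \<tau> = colouring_of nu \<tau>0}"
      using u perms_comp[OF t0 u(1)] by (simp add: colouring_of_eq_iff)
  qed
  also have "card \<dots> = card (young_subgroup nu)"
  proof (rule card_image, rule inj_onI)
    fix u v assume "u \<circ> \<tau>0 = v \<circ> \<tau>0"
    then have "u (\<tau>0 x) = v (\<tau>0 x)" for x by (simp add: fun_eq_iff)
    then have "u (\<tau>0 (inv_into UNIV \<tau>0 x)) = v (\<tau>0 (inv_into UNIV \<tau>0 x))" for x by blast
    then show "u = v" using permutes_inverses(1)[OF t0p] by (simp add: fun_eq_iff)
  qed
  finally show ?thesis .
qed

lemma colouring_of_unit_weighted: "\<tau> \<in> perms (sum_list nu) \<Longrightarrow> colouring_of nu \<tau> \<in> unit_weighted nu"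
proof -
  let ?r = "sum_list nu"
  assume "\<tau> \<in> perms ?r"
  note L = perms_list[OF this]
  have "mset (map \<tau> [1..<Suc ?r]) = mset_set {1..?r}"
    using mset_set_set[OF L(1)] unfolding L(2) by simp
  also have "\<dots> = mset [1..<Suc ?r]"
    using mset_set_set[of "[1..<Suc ?r]"] by (simp only: distinct_upt set_upt atLeastLessThanSuc_atLeastAtMost)
  finally have "mset (map (block nu) (map \<tau> [1..<Suc ?r])) = mset (map (block nu) [1..<Suc ?r])"
    unfolding mset_map by simp
  moreover have "map (block nu) [1..<Suc ?r] = labels nu"
    by (rule nth_equalityI) (auto simp: block_def simp del: upt_Suc)
  moreover have "colouring_of nu \<tau> = map (block nu) (map \<tau> [1..<Suc ?r])"
    by (simp only: colouring_of_def map_map comp_def)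
  ultimately show ?thesis unfolding unit_weighted_mset by (simp only:)
qed

text \<open>The conjugate of \<open>\<sigma>\<close> by \<open>\<tau>\<close> lies in the Young
  subgroup iff the colouring of \<open>\<tau>\<close> is invariant under \<open>\<sigma>\<close>.
  Each colouring arises from as many \<open>\<tau>\<close> as the Young subgroup has elements, which
  cancels the denominator of the induced character.\<close>

lemma young_character_count:
  assumes \<sigma>: "\<sigma> \<in> perms (sum_list nu)"
  shows "young_character nu \<sigma> =
    of_nat (card {c \<in> unit_weighted nu. \<forall>q\<in>{1..sum_list nu}. c ! (\<sigma> q - 1) = c ! (q - 1)})"
proof -
  let ?r = "sum_list nu"
  let ?K = "{c \<in> unit_weighted nu. \<forall>q\<in>{1..?r}. c ! (\<sigma> q - 1) = c ! (q - 1)}"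
  let ?T = "{\<tau> \<in> perms ?r. \<tau> \<circ> \<sigma> \<circ> inv_into UNIV \<tau> \<in> young_subgroup nu}"
  have s: "\<sigma> permutes {1..?r}" using \<sigma> by (simp add: perms_def)
  have T: "\<tau> \<circ> \<sigma> \<circ> inv_into UNIV \<tau> \<in> young_subgroup nu \<longleftrightarrow> colouring_of nu \<tau> \<in> ?K" if \<tau>: "\<tau> \<in> perms ?r" for \<tau>
  proof -
    have t: "\<tau> permutes {1..?r}" using \<tau> by (simp add: perms_def)
    have "\<tau> \<circ> \<sigma> \<circ> inv_into UNIV \<tau> \<in> young_subgroup nu \<longleftrightarrow>
        (\<forall>p\<in>{1..?r}. block nu (\<tau> (\<sigma> (inv_into UNIV \<tau> p))) = block nu p)"
      using perms_comp[OF perms_inv[OF \<tau>] perms_comp[OF \<sigma> \<tau>]] by (simp add: young_subgroup_iff)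
    also have "\<dots> \<longleftrightarrow> (\<forall>q\<in>{1..?r}. block nu (\<tau> (\<sigma> q)) = block nu (\<tau> q))"
    proof (intro iffI ballI)
      fix q assume *: "\<forall>p\<in>{1..?r}. block nu (\<tau> (\<sigma> (inv_into UNIV \<tau> p))) = block nu p" "q \<in> {1..?r}"
      then have "\<tau> q \<in> {1..?r}" using permutes_in_image[OF t] by blast
      then show "block nu (\<tau> (\<sigma> q)) = block nu (\<tau> q)" using *(1) permutes_inverses(2)[OF t, of q] by metis
    next
      fix p assume *: "\<forall>q\<in>{1..?r}. block nu (\<tau> (\<sigma> q)) = block nu (\<tau> q)" "p \<in> {1..?r}"
      then have "inv_into UNIV \<tau> p \<in> {1..?r}" using permutes_in_image[OF permutes_inv[OF t]] by blast
      then show "block nu (\<tau> (\<sigma> (inv_into UNIV \<tau> p))) = block nu p"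
        using *(1) permutes_inverses(1)[OF t, of p] by metis
    qed
    also have "\<dots> \<longleftrightarrow> (\<forall>q\<in>{1..?r}. colouring_of nu \<tau> ! (\<sigma> q - 1) = colouring_of nu \<tau> ! (q - 1))"
    proof (rule ball_cong[OF refl])
      fix q assume q: "q \<in> {1..?r}"
      then have "\<sigma> q \<in> {1..?r}" using permutes_in_image[OF s] by blast
      then show "(block nu (\<tau> (\<sigma> q)) = block nu (\<tau> q)) =
          (colouring_of nu \<tau> ! (\<sigma> q - 1) = colouring_of nu \<tau> ! (q - 1))"
        using q by (simp only: nth_colouring_of)
    qed
    finally show ?thesis using colouring_of_unit_weighted[OF \<tau>] by blast
  qed
  have finT: "finite ?T" using finite_perms[of ?r] by simp
  have finK: "finite ?K" using finite_weighted[of nu "replicate ?r 1"] by simp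
  have "card ?T = (\<Sum>\<tau>\<in>?T. 1)" by simp
  also have "\<dots> = (\<Sum>c\<in>?K. \<Sum>\<tau>\<in>{\<tau> \<in> ?T. colouring_of nu \<tau> = c}. 1)"
    by (rule sum.group[symmetric, OF finT finK]) (use T in blast)
  also have "\<dots> = (\<Sum>c\<in>?K. card (young_subgroup nu))"
  proof (rule sum.cong[OF refl])
    fix c assume c: "c \<in> ?K"
    then have "{\<tau> \<in> ?T. colouring_of nu \<tau> = c} = {\<tau> \<in> perms ?r. colouring_of nu \<tau> = c}" using T by blast
    then show "(\<Sum>\<tau>\<in>{\<tau> \<in> ?T. colouring_of nu \<tau> = c}. 1) = card (young_subgroup nu)"
      using colouring_of_fibre[of c nu] c by simp
  qed
  finally have "card ?T = card ?K * card (young_subgroup nu)" by simp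
  then show ?thesis
    using card_young_subgroup[of nu] by (simp add: young_character_def induced_character_def)
qed

text \<open>The blocks of \<open>ns\<close> are made the cycles of \<sigma>. A colouring fixed by
  \<sigma> is constant on these cycles, so it is a colouring of the parts of \<open>ns\<close>, and
  the numbers of places of each colour become sums of parts. One \<sigma> serves all
  \<open>nu\<close> at once, as is needed for linear combinations of Young characters.\<close>

theorem ex_perm_young_character:
  assumes n: "0 \<notin> set ns"
  shows "\<exists>\<sigma>\<in>perms (sum_list ns). cycle_type (sum_list ns) \<sigma> = rev (sorted_list_of_multiset (mset ns)) \<and>
    (\<forall>nu. sum_list nu = sum_list ns \<longrightarrow> young_character nu \<sigma> = of_nat (card (weighted nu ns)))"
proof -
  let ?r = "sum_list ns"
  obtain \<sigma> where \<sigma>: "\<sigma> permutes {1..?r}" "\<forall>p\<in>{1..?r}. orbit \<sigma> p = {q \<in> {1..?r}. block ns q = block ns p}"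
    using ex_cyclic_perm[of "{1..?r}" "block ns"] by auto
  have \<sigma>r: "\<sigma> \<in> perms ?r" using \<sigma>(1) by (simp add: perms_def)
  define C where "C i = {q \<in> {1..?r}. block ns q = i}" for i
  have cardC: "card (C i) = ns ! i" if "i < length ns" for i
    using card_count_list[of "labels ns" i] count_list_labels[OF that] by (simp add: C_def block_def)
  have nz: "ns ! i > 0" if "i < length ns" for i using n nth_mem[OF that] by (metis gr0I)
  have Cne: "C i \<noteq> {}" if "i < length ns" for i
    using cardC[OF that] nz[OF that] by (metis card.empty less_irrefl)
  have orbits: "orbit \<sigma> ` {1..?r} = C ` {..<length ns}"
  proof (intro equalityI subsetI)
    fix X assume "X \<in> orbit \<sigma> ` {1..?r}"
    then obtain p where "p \<in> {1..?r}" "X = orbit \<sigma> p" by blast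
    then show "X \<in> C ` {..<length ns}"
      using \<sigma>(2) block_less[of p ns] by (intro image_eqI[of _ _ "block ns p"]) (auto simp: C_def)
  next
    fix X assume "X \<in> C ` {..<length ns}"
    then obtain i where i: "i < length ns" "X = C i" by blast
    then obtain p where p: "p \<in> C i" using Cne by blast
    then have "p \<in> {1..?r}" "block ns p = i" by (simp_all add: C_def)
    then have "orbit \<sigma> p = C i" using \<sigma>(2) by (simp add: C_def)
    then show "X \<in> orbit \<sigma> ` {1..?r}" using i \<open>p \<in> {1..?r}\<close> by blast
  qed
  have injC: "inj_on C {..<length ns}"
  proof (rule inj_onI)
    fix i j assume ij: "i \<in> {..<length ns}" "j \<in> {..<length ns}" "C i = C j"
    from ij(1) obtain p where p: "p \<in> C i" using Cne by blast
    then have "p \<in> C j" using ij(3) by blast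
    then show "i = j" using p by (simp only: C_def mem_Collect_eq)
  qed
  have "image_mset card (mset_set (orbit \<sigma> ` {1..?r})) = image_mset card (image_mset C (mset_set {..<length ns}))"
    unfolding orbits by (simp only: image_mset_mset_set[OF injC])
  also have "\<dots> = image_mset (\<lambda>i. ns ! i) (mset_set {..<length ns})"
    unfolding image_mset.compositionality comp_def by (rule image_mset_cong) (simp add: cardC)
  also have "\<dots> = mset (map (\<lambda>i. ns ! i) [0..<length ns])"
    by (simp only: mset_set_upto_eq_mset_upto mset_map)
  finally have "image_mset card (mset_set (orbit \<sigma> ` {1..?r})) = mset ns" by (simp only: map_nth)
  then have ct: "cycle_type ?r \<sigma> = rev (sorted_list_of_multiset (mset ns))"
    by (simp only: cycle_type_def)
  have yc: "young_character nu \<sigma> = of_nat (card (weighted nu ns))" if nu: "sum_list nu = ?r" for nu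
  proof -
    let ?K = "{c \<in> unit_weighted nu. \<forall>q\<in>{1..sum_list nu}. c ! (\<sigma> q - 1) = c ! (q - 1)}"
    have "bij_betw (\<lambda>d. spread ns d) (weighted nu ns) ?K"
    proof (rule bij_betwI')
      fix d d' assume "d \<in> weighted nu ns" "d' \<in> weighted nu ns"
      then have len: "length ns = length d" "length d = length d'" by (simp_all add: weighted_def colourings_def)
      show "(spread ns d = spread ns d') = (d = d')"
      proof
        show "spread ns d = spread ns d' \<Longrightarrow> d = d'"
          using len n
        proof (induction ns d arbitrary: d' rule: list_induct2)
          case (Cons n ns a d)
          then obtain b e where "d' = b # e" "length e = length d" by (cases d') auto
          then show ?case using Cons by (cases n) auto
        qed simp
      qed simp
    next
      fix d assume d: "d \<in> weighted nu ns"
      then have len: "length ns = length d" and dk: "set d \<subseteq> {..<length nu}"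
        and ct: "\<forall>j<length nu. sum_list (sub j d ns) = nu ! j" by (simp_all add: weighted_def colourings_def)
      have "spread ns d \<in> unit_weighted nu"
        unfolding unit_weighted_iff colourings_def
        using set_spread_subset[OF len] dk ct nu by (auto simp: count_list_spread[OF len] length_spread[OF len])
      moreover have "spread ns d ! (\<sigma> q - 1) = spread ns d ! (q - 1)" if q: "q \<in> {1..?r}" for q
      proof -
        have sq: "\<sigma> q \<in> {1..?r}" using permutes_in_image[OF \<sigma>(1)] q by blast
        have "\<sigma> q \<in> orbit \<sigma> q" by (rule orbit.base)
        then have b: "block ns (\<sigma> q) = block ns q" using \<sigma>(2) q by auto
        have "spread ns d ! (p - 1) = d ! block ns p" if "p \<in> {1..?r}" for p
          unfolding map_labels[OF len[symmetric], symmetric] block_def using that by (subst nth_map) auto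
        then show ?thesis using b q sq by simp
      qed
      ultimately show "spread ns d \<in> ?K" using nu by simp
    next
      fix c assume c: "c \<in> ?K"
      then have inv: "c ! (\<sigma> q - 1) = c ! (q - 1)" if "q \<in> {1..?r}" for q using that nu by simp
      have "c \<in> unit_weighted nu" using c by blast
      then have cu: "c \<in> colourings (length nu) ?r" "\<forall>j<length nu. count_list c j = nu ! j"
        unfolding unit_weighted_iff unfolding nu by blast+
      have lenc: "length c = ?r" using cu by (simp add: colourings_def)
      have orb: "c ! (p - 1) = c ! (q - 1)" if "p \<in> orbit \<sigma> q" "q \<in> {1..?r}" for p q
        using that(1)
      proof (induction rule: orbit.induct)
        case base
        then show ?case using inv that(2) by simp
      next
        case (step y)
        have "y \<in> {1..?r}" using step.hyps \<sigma>(2) that(2) by auto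
        then show ?case using inv step.IH by simp
      qed
      have "\<forall>i. \<exists>p. i < length ns \<longrightarrow> p \<in> C i" using Cne by blast
      \<comment> \<open>\<open>pos i\<close> is a point of the \<open>i\<close>-th cycle, at which
        the colour of the corresponding part is read off.\<close>
      then obtain pos where pos: "\<And>i. i < length ns \<Longrightarrow> pos i \<in> C i" by metis
      define d where "d = map (\<lambda>i. c ! (pos i - 1)) [0..<length ns]"
      have len: "length d = length ns" by (simp add: d_def)
      have "spread ns d = c"
      proof (rule nth_equalityI)
        show "length (spread ns d) = length c" using len lenc by (simp add: length_spread)
        fix q assume "q < length (spread ns d)"
        then have q: "q < ?r" using len by (simp add: length_spread)
        let ?i = "labels ns ! q"
        have i: "?i < length ns" by (rule labels_less[OF q])
        have pi: "pos ?i \<in> {1..?r}" "block ns (pos ?i) = ?i" using pos[OF i] by (simp_all add: C_def)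
        have "spread ns d ! q = d ! ?i"
          unfolding map_labels[OF len, symmetric] using q by simp
        also have "\<dots> = c ! (pos ?i - 1)" using i by (simp add: d_def)
        also have "\<dots> = c ! (Suc q - 1)"
          by (rule orb) (use \<sigma>(2) q pi in \<open>auto simp: block_def\<close>)
        finally show "spread ns d ! q = c ! q" by simp
      qed
      moreover have "d \<in> weighted nu ns"
      proof -
        have "set d \<subseteq> set c"
        proof
          fix x assume "x \<in> set d"
          then obtain i where i: "i < length ns" "x = c ! (pos i - 1)" by (auto simp: d_def)
          have "pos i - 1 < length c" using pos[OF i(1)] lenc by (auto simp: C_def)
          then show "x \<in> set c" using i by simp
        qed
        then have "d \<in> colourings (length nu) (length ns)"
          using cu(1) len by (auto simp: colourings_def)
        moreover have "sum_list (sub j d ns) = nu ! j" if "j < length nu" for j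
          using count_list_spread[OF len[symmetric], of j] cu(2) that \<open>spread ns d = c\<close> by simp
        ultimately show ?thesis by (simp add: weighted_def)
      qed
      ultimately show "\<exists>d\<in>weighted nu ns. c = spread ns d" by (intro bexI[of _ d]) simp_all
    qed
    then have "card (weighted nu ns) = card ?K" by (rule bij_betw_same_card)
    then show ?thesis using young_character_count[of \<sigma> nu] \<sigma>r nu by simp
  qed
  show ?thesis using \<sigma>r ct yc by (intro bexI[of _ \<sigma>] conjI allI impI)
qed

section \<open>The descent algebra acting on tensors\<close>

lemma compositions_finite: "finite (compositions r)"
proof (rule finite_subset)
  show "compositions r \<subseteq> {xs. set xs \<subseteq> {..r} \<and> length xs \<le> r}"
  proof
    fix nu assume "nu \<in> compositions r"
    then have nu: "0 \<notin> set nu" "sum_list nu = r" by (simp_all add: compositions_def)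
    have "set nu \<subseteq> {..r}" using member_le_sum_list nu(2) by fastforce
    moreover have "length nu \<le> sum_list nu" using nu(1) by (induction nu) auto
    ultimately show "nu \<in> {xs. set xs \<subseteq> {..r} \<and> length xs \<le> r}" using nu(2) by simp
  qed
  show "finite {xs. set xs \<subseteq> {..r} \<and> length xs \<le> r}" by (rule finite_lists_length_le) simp
qed

lemma descents_finite: "finite (descents nu)"
  by (rule finite_subset[OF _ finite_perms[of "sum_list nu"]]) (auto simp: descents_def)

lemma lookup_descent_elem:
  "Poly_Mapping.lookup (descent_elem nu) \<sigma> = (if \<sigma> \<in> descents nu then 1 else 0)"
  using descents_finite[of nu]
  by (simp add: descent_elem_eq lookup_sum lookup_single when_def)

lemma bounds_less:
  assumes "0 \<notin> set nu" "i \<in> bounds nu" shows "0 < i \<and> i < sum_list nu"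
proof -
  obtain j where j: "0 < j" "j < length nu" "i = sum_list (take j nu)"
    using assms(2) by (auto simp: bounds_def)
  have pos: "0 < sum_list xs" if "xs \<noteq> []" "0 \<notin> set xs" for xs :: "nat list"
    using that by (cases xs) auto
  have "sum_list nu = sum_list (take j nu) + sum_list (drop j nu)"
    by (metis append_take_drop_id sum_list_append)
  moreover have "0 < sum_list (drop j nu)"
    using j assms(1) by (intro pos) (auto dest: in_set_dropD)
  moreover have "0 < sum_list (take j nu)"
    using j assms(1) by (intro pos) (auto dest: in_set_takeD)
  ultimately show ?thesis using j(3) by simp
qed

lemma bounds_inj:
  "0 \<notin> set nu \<Longrightarrow> 0 \<notin> set nu' \<Longrightarrow> sum_list nu = sum_list nu' \<Longrightarrow> bounds nu = bounds nu' \<Longrightarrow> nu = nu'"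
proof (induction nu arbitrary: nu')
  case Nil
  then show ?case by (cases nu') auto
next
  case (Cons n mu)
  then obtain n' mu' where nu': "nu' = n' # mu'" by (cases nu') auto
  have less: False
    if "n < n'" "0 \<notin> set (n' # mu')" "sum_list (n # mu) = sum_list (n' # mu')"
      "bounds (n # mu) = bounds (n' # mu')" for n n' mu mu'
  proof -
    have "mu \<noteq> []" using that by auto
    then have "n \<in> bounds (n' # mu')" using bounds_Cons_first that(4) by blast
    then show False using bounds_Cons_less[OF that(1)] by blast
  qed
  have "n = n'"
    using less[of n n' mu' mu] less[of n' n mu mu'] Cons.prems unfolding nu' by (metis linorder_neqE_nat)
  moreover have "bounds mu = bounds mu'"
  proof -
    have "i \<in> bounds mu \<longleftrightarrow> i \<in> bounds mu'" for i
    proof (cases "i = 0")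
      case True
      then show ?thesis using bounds_less[of mu i] bounds_less[of mu' i] Cons.prems nu' by auto
    next
      case False
      then show ?thesis
        using bounds_Cons[of n "n + i" mu] bounds_Cons[of n "n + i" mu'] Cons.prems(4) \<open>n = n'\<close> nu' by simp
    qed
    then show ?thesis by blast
  qed
  ultimately show ?case using Cons.IH[of mu'] Cons.prems nu' by simp
qed

text \<open>This allows sums over the set of basis elements to be written as sums over compositions,
  as in \<open>descent_hom\<close>. The boundaries of a composition, and with them the composition,
  can be recovered from the set of permutations that it allows.\<close>

lemma inj_on_descent_elem:
  "inj_on (descent_elem :: nat list \<Rightarrow> ((nat \<Rightarrow> nat) \<Rightarrow>\<^sub>0 'f::field)) (compositions r)"
proof (rule inj_onI)
  fix nu nu' assume c: "nu \<in> compositions r" "nu' \<in> compositions r"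
    and eq: "descent_elem nu = (descent_elem nu' :: (nat \<Rightarrow> nat) \<Rightarrow>\<^sub>0 'f)"
  have desc: "descents nu = descents nu'"
  proof (rule Set.set_eqI)
    fix \<sigma>
    have "(if \<sigma> \<in> descents nu then 1 else 0) = (if \<sigma> \<in> descents nu' then 1 else (0::'f))"
      using lookup_descent_elem[of nu \<sigma>] lookup_descent_elem[of nu' \<sigma>] eq by metis
    then show "\<sigma> \<in> descents nu \<longleftrightarrow> \<sigma> \<in> descents nu'" by (simp split: if_splits)
  qed
  have sub: "bounds nu \<subseteq> bounds nu'"
    if c: "nu \<in> compositions r" "nu' \<in> compositions r" and desc: "descents nu = descents nu'" for nu nu'
  proof
    fix i assume i: "i \<in> bounds nu"
    have r: "sum_list nu = r" "sum_list nu' = r" "0 \<notin> set nu" using c by (simp_all add: compositions_def)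
    have ir: "0 < i" "i < r" using bounds_less[OF r(3) i] r by simp_all
    \<comment> \<open>The transposition of \<open>i\<close> and \<open>i + 1\<close> has its only
      descent at \<open>i\<close>, so it is in \<open>descents nu'\<close> only if \<open>i\<close>
      is a boundary of \<open>nu'\<close>.\<close>
    let ?t = "transpose i (Suc i)"
    have "?t \<in> perms r" using ir by (simp add: perms_def permutes_swap_id)
    moreover have "\<forall>q\<in>{1..<sum_list nu} - bounds nu. ?t q < ?t (Suc q)"
    proof
      fix q assume "q \<in> {1..<sum_list nu} - bounds nu"
      then have "q \<noteq> i" using i by blast
      then show "?t q < ?t (Suc q)" by (auto simp: transpose_def)
    qed
    ultimately have "?t \<in> descents nu" by (simp only: descents_def mem_Collect_eq r(1))
    then have "?t \<in> descents nu'" using desc by simp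
    then have "\<forall>q\<in>{1..<r} - bounds nu'. ?t q < ?t (Suc q)" using r by (simp add: descents_def)
    moreover have "\<not> ?t i < ?t (Suc i)" by simp
    moreover have "i \<in> {1..<r}" using ir by simp
    ultimately show "i \<in> bounds nu'" by blast
  qed
  have "bounds nu = bounds nu'" using sub[OF c desc] sub[OF c(2,1) desc[symmetric]] by (rule equalityI)
  then show "nu = nu'" using bounds_inj[of nu nu'] c by (simp add: compositions_def)
qed

lemma descent_elem_perms: "nu \<in> compositions r \<Longrightarrow> Poly_Mapping.keys (descent_elem nu) \<subseteq> perms r"
  by (auto simp: in_keys_iff lookup_descent_elem descents_def compositions_def split: if_splits)

lemma descent_algebra_perms: "a \<in> descent_algebra r \<Longrightarrow> Poly_Mapping.keys a \<subseteq> perms r"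
  using pm_linear_span_subset[OF pm_linear_id subspace_keys[of "perms r"], of "descent_elem ` compositions r" a]
    descent_elem_perms by (auto simp: descent_algebra_def)

lemma descent_algebra_expand:
  assumes ind: "pm.independent (descent_elem ` compositions r :: ((nat \<Rightarrow> nat) \<Rightarrow>\<^sub>0 'f::field) set)"
    and a: "a \<in> (descent_algebra r :: ((nat \<Rightarrow> nat) \<Rightarrow>\<^sub>0 'f::field) set)"
  shows "a = (\<Sum>nu\<in>compositions r. pm_scale
    (pm.representation (descent_elem ` compositions r) a (descent_elem nu)) (descent_elem nu))"
proof -
  let ?X = "descent_elem ` compositions r :: ((nat \<Rightarrow> nat) \<Rightarrow>\<^sub>0 'f) set"
  have "(\<Sum>b\<in>?X. pm_scale (pm.representation ?X a b) b) = a"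
    by (rule pm.sum_representation_eq[OF ind])
       (use a compositions_finite in \<open>auto simp: descent_algebra_def\<close>)
  then show ?thesis by (subst (asm) sum.reindex[OF inj_on_descent_elem]) (simp add: comp_def)
qed

section \<open>Place permutations of tensors\<close>

abbreviation place :: "((nat \<Rightarrow> nat) \<Rightarrow>\<^sub>0 'f::field) \<Rightarrow> ('v list \<Rightarrow>\<^sub>0 'f) \<Rightarrow> ('v list \<Rightarrow>\<^sub>0 'f)" where
  "place \<equiv> pm_bilin place_perm"

lemma length_place_perm [simp]: "length (place_perm \<sigma> w) = length w"
  by (simp add: place_perm_def del: upt_Suc)

lemma nth_place_perm: "i < length w \<Longrightarrow> place_perm \<sigma> w ! i = w ! (\<sigma> (Suc i) - 1)"
  by (simp add: place_perm_def del: upt_Suc)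

lemma perms_range: "\<sigma> \<in> perms r \<Longrightarrow> i < r \<Longrightarrow> \<sigma> (Suc i) - 1 < r \<and> \<sigma> (Suc i) > 0"
  using permutes_in_image[of \<sigma> "{1..r}" "Suc i"] by (auto simp: perms_def)

lemma place_perm_comp:
  assumes "\<sigma> \<in> perms (length w)"
  shows "place_perm \<sigma> (place_perm \<tau> w) = place_perm (\<tau> \<circ> \<sigma>) w"
proof (rule nth_equalityI)
  fix i assume "i < length (place_perm \<sigma> (place_perm \<tau> w))"
  then have i: "i < length w" by simp
  note s = perms_range[OF assms i]
  then have "place_perm \<tau> w ! (\<sigma> (Suc i) - 1) = w ! (\<tau> (Suc (\<sigma> (Suc i) - 1)) - 1)"
    by (intro nth_place_perm) simp
  then show "place_perm \<sigma> (place_perm \<tau> w) ! i = place_perm (\<tau> \<circ> \<sigma>) w ! i"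
    using i s by (simp add: nth_place_perm)
qed simp

lemma place_perm_map:
  assumes "\<sigma> \<in> perms (length w)" shows "place_perm \<sigma> (map f w) = map f (place_perm \<sigma> w)"
  using perms_range[OF assms] by (intro nth_equalityI) (simp_all add: nth_place_perm)

lemma place_perm_id [simp]: "place_perm id w = w"
  by (rule nth_equalityI) (simp_all add: nth_place_perm)

text \<open>The letter \<open>v\<close> is moved to a place determined by \<open>\<sigma>\<close>
  and the length of \<open>xs\<close>, and what surrounds it there does not depend on
  \<open>v\<close>. Hence linearity relations in one context go to linearity relations in
  another.\<close>

lemma place_perm_context:
  assumes "\<sigma> \<in> perms (length xs + 1 + length ys)"
  shows "\<exists>xs' ys'. \<forall>v. place_perm \<sigma> (xs @ v # ys) = xs' @ v # ys'"
proof -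
  let ?r = "length xs + 1 + length ys"
  have s: "\<sigma> permutes {1..?r}" using assms by (simp add: perms_def)
  have "Suc (length xs) \<in> {1..?r}" by simp
  then have "Suc (length xs) \<in> \<sigma> ` {1..?r}" using permutes_image[OF s] by simp
  then obtain q where q: "q \<in> {1..?r}" "\<sigma> q = Suc (length xs)" by force
  define p where "p = q - 1"
  have p: "p < ?r" "\<sigma> (Suc p) = Suc (length xs)" using q by (auto simp: p_def)
  define L where "L v = place_perm \<sigma> (xs @ v # ys)" for v
  have len: "length (L v) = ?r" for v by (simp add: L_def)
  have Lp: "L v ! p = v" for v using p by (simp add: L_def nth_place_perm)
  have other: "L v ! i = L u ! i" if i: "i < ?r" "i \<noteq> p" for v u i
  proof -
    have "\<sigma> (Suc i) \<noteq> Suc (length xs)" using permutes_inj[OF s] p(2) i(2) by (metis injD nat.inject)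
    then have "\<sigma> (Suc i) - 1 \<noteq> length xs" using perms_range[OF assms i(1)] by arith
    moreover have "(xs @ v # ys) ! n = (xs @ u # ys) ! n" if "n \<noteq> length xs" for n
      using that by (auto simp: nth_append nth_Cons')
    ultimately show ?thesis using i(1) by (simp only: L_def nth_place_perm length_append length_Cons)
  qed
  have "L v = take p (L undefined) @ v # drop (Suc p) (L undefined)" for v
  proof -
    have "L v = take p (L v) @ L v ! p # drop (Suc p) (L v)" using p(1) len by (simp add: id_take_nth_drop)
    moreover have "take p (L v) = take p (L undefined)"
      by (rule nth_equalityI) (use p(1) len other[of _ v undefined] in simp_all)
    moreover have "drop (Suc p) (L v) = drop (Suc p) (L undefined)"
      by (rule nth_equalityI) (use p(1) len other[of _ v undefined] in simp_all)
    ultimately show ?thesis using Lp by metis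
  qed
  then show ?thesis unfolding L_def by blast
qed

lemma place_homogeneous: "homogeneous r x \<Longrightarrow> homogeneous r (place a x)"
proof -
  assume x: "homogeneous r x"
  have "place a x \<in> {y. homogeneous r y}"
  proof (rule pm_linear_in_subspace[OF pm_linear_bilin1 subspace_homogeneous])
    fix k
    show "place (Poly_Mapping.single k 1) x \<in> {y. homogeneous r y}"
      by (rule pm_linear_in_subspace[OF pm_linear_bilin2 subspace_homogeneous])
         (use x in \<open>auto simp: homogeneous_def\<close>)
  qed
  then show ?thesis by simp
qed

text \<open>By \<open>place_perm_comp\<close> the convention for products in
  \<open>perm_mult\<close>, the left factor being applied to an index first, is the one that makes
  place permutations a left action.\<close>

lemma place_mult:
  fixes a b :: "(nat \<Rightarrow> nat) \<Rightarrow>\<^sub>0 'f::field" and x :: "'v list \<Rightarrow>\<^sub>0 'f"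
  assumes a: "Poly_Mapping.keys a \<subseteq> perms r" and x: "homogeneous r x"
  shows "place a (place b x) = place (perm_mult a b) x"
proof (rule pm_linear_eqI[of "\<lambda>a. place a (place b x)" "\<lambda>a. place (perm_mult a b) x"])
  show "pm_linear (\<lambda>a. place a (place b x))" by (rule pm_linear_bilin1)
  show "pm_linear (\<lambda>a. place (perm_mult a b) x)"
    unfolding perm_mult_def by (rule pm_linear_compose[OF pm_linear_bilin1 pm_linear_bilin1])
  fix \<sigma> assume "\<sigma> \<in> Poly_Mapping.keys a"
  then have s: "\<sigma> \<in> perms r" using a by blast
  let ?s = "Poly_Mapping.single \<sigma> (1::'f)"
  show "place ?s (place b x) = place (perm_mult ?s b) x"
  proof (rule pm_linear_eqI[of "\<lambda>b. place ?s (place b x)" "\<lambda>b. place (perm_mult ?s b) x"])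
    show "pm_linear (\<lambda>b. place ?s (place b x))" by (rule pm_linear_compose[OF pm_linear_bilin2 pm_linear_bilin1])
    show "pm_linear (\<lambda>b. place (perm_mult ?s b) x)"
      unfolding perm_mult_def by (rule pm_linear_compose[OF pm_linear_bilin1 pm_linear_bilin2])
    fix \<tau> :: "nat \<Rightarrow> nat"
    let ?t = "Poly_Mapping.single \<tau> (1::'f)"
    show "place ?s (place ?t x) = place (perm_mult ?s ?t) x"
    proof (rule pm_linear_eqI[of "\<lambda>x. place ?s (place ?t x)" "\<lambda>x. place (perm_mult ?s ?t) x"])
      show "pm_linear (\<lambda>x. place ?s (place ?t x))" by (rule pm_linear_compose[OF pm_linear_bilin2 pm_linear_bilin2])
      show "pm_linear (\<lambda>x. place (perm_mult ?s ?t) x)" by (rule pm_linear_bilin2)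
      fix w assume "w \<in> Poly_Mapping.keys x"
      then have "length w = r" using x by (simp add: homogeneous_def)
      then show "place ?s (place ?t (word w)) = place (perm_mult ?s ?t) (word w)"
        using s by (simp add: perm_mult_def place_perm_comp)
    qed
  qed
qed

lemma place_one: "place perm_one x = x"
  unfolding perm_one_def
  by (rule pm_linear_eqI[of "place (Poly_Mapping.single id 1)" "\<lambda>x. x", OF pm_linear_bilin2 pm_linear_id]) simp

context fg_module
begin

lemma place_I:
  assumes a: "Poly_Mapping.keys a \<subseteq> perms r" and x: "x \<in> I" "homogeneous r x"
  shows "place a x \<in> I"
proof (rule pm_linear_in_subspace[of "\<lambda>a. place a x", OF pm_linear_bilin1 subspace_I])
  fix \<sigma> assume "\<sigma> \<in> Poly_Mapping.keys a"
  then have s: "\<sigma> \<in> perms r" using a by blast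
  \<comment> \<open>An element of degree \<open>r\<close> in the ideal may have been written with
    generators of other degrees. Setting \<open>f\<close> to 0 on words of other lengths makes it a
    linear map that can be evaluated on every generator.\<close>
  define f where "f = pm_lin (\<lambda>w. if length w = r then word (place_perm \<sigma> w) else (0 :: 'v list \<Rightarrow>\<^sub>0 'f))"
  have linf: "pm_linear f" by (simp add: f_def pm_linear_lin)
  have "f x = place (Poly_Mapping.single \<sigma> 1) x"
    by (rule pm_linear_eqI[OF linf pm_linear_bilin2]) (use x(2) in \<open>auto simp: f_def homogeneous_def\<close>)
  moreover have "f x \<in> I"
  proof (rule I_cases[OF linf subspace_I x(1)])
    fix xs ys \<rho> assume \<rho>: "\<rho> \<in> linear_rels V (\<lambda>v. [v])"
    have h: "homogeneous 1 \<rho>" by (rule rel_homogeneous[OF \<rho>])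
    have lin: "pm_linear (\<lambda>\<rho>. f (word xs * \<rho> * word ys))"
      by (rule pm_linear_compose[OF linf pm_linear_mult2])
    show "f (word xs * \<rho> * word ys) \<in> I"
    proof (cases "length xs + 1 + length ys = r")
      case True
      then obtain xs' ys' where p: "\<And>v. place_perm \<sigma> (xs @ v # ys) = xs' @ v # ys'"
        using place_perm_context[of \<sigma> xs ys] s by blast
      have "f (word xs * \<rho> * word ys) = word xs' * \<rho> * word ys'"
      proof (rule pm_linear_eqI[OF lin pm_linear_mult2])
        fix k assume "k \<in> Poly_Mapping.keys \<rho>"
        then obtain v where k: "k = [v]" using h by (auto simp: homogeneous_def length_Suc_conv)
        show "f (word xs * word k * word ys) = word xs' * word k * word ys'"
          using True p by (simp add: k word_append[symmetric] f_def)
      qed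
      then show ?thesis using rel_in_I[OF \<rho>] by simp
    next
      case False
      have "f (word xs * \<rho> * word ys) = 0"
      proof (rule pm_linear_eqI[OF lin pm_linear_zero])
        fix k assume "k \<in> Poly_Mapping.keys \<rho>"
        then have "length k = 1" using h by (auto simp: homogeneous_def)
        then show "f (word xs * word k * word ys) = 0"
          using False by (simp add: word_append[symmetric] f_def)
      qed
      then show ?thesis using pm.subspace_0[OF subspace_I] by simp
    qed
  qed
  ultimately show "place (Poly_Mapping.single \<sigma> 1) x \<in> I" by simp
qed

lemma place_tw:
  assumes a: "Poly_Mapping.keys a \<subseteq> perms r" and x: "homogeneous r x"
  shows "tw g (place a x) = place a (tw g x)"
proof (rule pm_linear_eqI[of "\<lambda>a. tw g (place a x)" "\<lambda>a. place a (tw g x)"])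
  show "pm_linear (\<lambda>a. tw g (place a x))" by (rule pm_linear_compose[OF pm_linear_tw pm_linear_bilin1])
  show "pm_linear (\<lambda>a. place a (tw g x))" by (rule pm_linear_bilin1)
  fix \<sigma> assume "\<sigma> \<in> Poly_Mapping.keys a"
  then have s: "\<sigma> \<in> perms r" using a by blast
  show "tw g (place (Poly_Mapping.single \<sigma> 1) x) = place (Poly_Mapping.single \<sigma> 1) (tw g x)"
  proof (rule pm_linear_eqI[of "\<lambda>x. tw g (place (Poly_Mapping.single \<sigma> 1) x)"
        "\<lambda>x. place (Poly_Mapping.single \<sigma> 1) (tw g x)"])
    show "pm_linear (\<lambda>x. tw g (place (Poly_Mapping.single \<sigma> 1) x))"
      by (rule pm_linear_compose[OF pm_linear_tw pm_linear_bilin2])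
    show "pm_linear (\<lambda>x. place (Poly_Mapping.single \<sigma> 1) (tw g x))"
      by (rule pm_linear_compose[OF pm_linear_bilin2 pm_linear_tw])
    fix w assume "w \<in> Poly_Mapping.keys x"
    then have "length w = r" using x by (simp add: homogeneous_def)
    then show "tw g (place (Poly_Mapping.single \<sigma> 1) (word w)) = place (Poly_Mapping.single \<sigma> 1) (tw g (word w))"
      using s by (simp add: place_perm_map)
  qed
qed

lemma place_action_pi:
  assumes a: "Poly_Mapping.keys a \<subseteq> perms r" and x: "homogeneous r x"
  shows "place_action V r a (\<pi> x) = \<pi> (place a x)"
proof (intro equalityI subsetI)
  fix u assume "u \<in> place_action V r a (\<pi> x)"
  then obtain y i where yi: "y \<in> \<pi> x" "homogeneous r y" "i \<in> I" "u = place a y + i"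
    by (auto simp: place_action_def set_plus_def)
  have "place a (y - x) \<in> I"
    by (rule place_I[OF a]) (use yi x in \<open>auto simp: in_pi intro: homogeneous_diff\<close>)
  then have "place a (y - x) + i \<in> I" using yi(3) by (intro pm.subspace_add[OF subspace_I])
  moreover have "u - place a x = place a (y - x) + i"
    using yi(4) by (simp add: pm_linear_diff[OF pm_linear_bilin2])
  ultimately show "u \<in> \<pi> (place a x)" by (simp add: in_pi)
next
  fix u assume "u \<in> \<pi> (place a x)"
  then have "u - place a x \<in> I" by (simp add: in_pi)
  moreover have "x \<in> {y \<in> \<pi> x. homogeneous r y}"
    using x pm.subspace_0[OF subspace_I] by (simp add: in_pi)
  ultimately have "place a x + (u - place a x) \<in> place a ` {y \<in> \<pi> x. homogeneous r y} + I"
    by (intro set_plus_intro imageI)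
  then show "u \<in> place_action V r a (\<pi> x)" by (simp add: place_action_def)
qed

end

section \<open>The descent algebra on leading terms\<close>

context lie_basis
begin

text \<open>\<open>descent_elem nu\<close> produces one rearrangement of \<open>bs\<close> for every
  colouring in \<open>weighted nu (map dg bs)\<close>, and all rearrangements have the same leading
  term.\<close>

lemma N_descent_elem:
  assumes bs: "set bs \<subseteq> B" and nu: "sum_list nu = sum_list (map dg bs)"
  shows "Poly_Mapping.keys (N (place (descent_elem nu) (prod_list bs)) -
      pm_scale (of_nat (card (weighted nu (map dg bs)))) (P.z (mset bs)))
     \<subseteq> P.gt (image_mset dg (mset bs))"
proof -
  let ?W = "weighted nu (map dg bs)" and ?k = "length nu"
  have l: "list_all2 (\<lambda>x n. x \<in> lie_elems \<and> homogeneous n x) bs (map dg bs)"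
    using bs B_homog dg by (auto simp: list_all2_conv_all_nth homog_lie_def subset_iff)
  have "N (place (descent_elem nu) (prod_list bs)) = (\<Sum>c\<in>?W. N (prod_list (out ?k c bs)))"
    unfolding descent_elem_prod_list[OF l nu[symmetric]] by (rule pm_linear_sum[OF pm_linear_N])
  moreover have "pm_scale (of_nat (card ?W)) (P.z (mset bs)) = (\<Sum>c\<in>?W. P.z (mset bs))"
    by (rule poly_mapping_eqI, unfold lookup_sum lookup_pm_scale) simp
  ultimately have "N (place (descent_elem nu) (prod_list bs)) - pm_scale (of_nat (card ?W)) (P.z (mset bs)) =
      (\<Sum>c\<in>?W. N (prod_list (out ?k c bs)) - P.z (mset bs))"
    by (simp only: sum_subtractf)
  also have "\<dots> \<in> {s. Poly_Mapping.keys s \<subseteq> P.gt (image_mset dg (mset bs))}"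
  proof (rule pm.subspace_sum[OF subspace_keys])
    fix c assume "c \<in> ?W"
    then have m: "mset (out ?k c bs) = mset bs"
      by (intro mset_out) (simp_all add: weighted_def colourings_def)
    then have "set (out ?k c bs) \<subseteq> B" using mset_eq_setD bs by metis
    from N_prod_list_B[OF this]
    show "N (prod_list (out ?k c bs)) - P.z (mset bs) \<in> {s. Poly_Mapping.keys s \<subseteq> P.gt (image_mset dg (mset bs))}"
      by (simp add: m)
  qed
  finally show ?thesis by simp
qed

text \<open>One \<sigma> whose cycle type is the type of \<open>M\<close> gives the scalar for all
  \<open>a\<close>: for a basis element the scalar is a number of colourings, which is the Young
  character at \<sigma> read in the field, and both sides are linear in \<open>a\<close>.
  Independence is a premise because \<open>pm.representation\<close> yields coordinates only with
  respect to independent vectors.\<close>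

theorem N_descent_algebra:
  assumes M: "set_mset M \<subseteq> B" "sum_mset (P.ty M) = r"
  shows "\<exists>\<sigma>\<in>perms r. cycle_type r \<sigma> = rev (sorted_list_of_multiset (P.ty M)) \<and>
    (\<forall>a\<in>descent_algebra r. pm.independent (descent_elem ` compositions r :: ((nat \<Rightarrow> nat) \<Rightarrow>\<^sub>0 'f) set) \<longrightarrow>
       Poly_Mapping.keys (N (place a (pr M)) - pm_scale (descent_hom r a \<sigma>) (P.z M)) \<subseteq> P.gt (P.ty M))"
proof -
  obtain bs where bs: "mset bs = M" "pr M = prod_list bs" using pr_list by blast
  have bsB: "set bs \<subseteq> B" using M bs(1) by auto
  have ty: "P.ty M = mset (map dg bs)" by (simp add: P.ty_def flip: bs(1))
  have sumr: "sum_list (map dg bs) = r" using M(2) unfolding ty by (simp only: sum_mset_sum_list)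
  have "0 \<notin> set (map dg bs)" using dg bsB by force
  from ex_perm_young_character[OF this, unfolded sumr] obtain \<sigma> where \<sigma>: "\<sigma> \<in> perms r"
      "cycle_type r \<sigma> = rev (sorted_list_of_multiset (mset (map dg bs)))"
      "\<And>nu. sum_list nu = r \<Longrightarrow> young_character nu \<sigma> = of_nat (card (weighted nu (map dg bs)))"
    by blast
  have "Poly_Mapping.keys (N (place a (pr M)) - pm_scale (descent_hom r a \<sigma>) (P.z M)) \<subseteq> P.gt (P.ty M)"
    if a: "a \<in> descent_algebra r" and ind: "pm.independent (descent_elem ` compositions r :: ((nat \<Rightarrow> nat) \<Rightarrow>\<^sub>0 'f) set)"
    for a
  proof -
    define c where "c nu = pm.representation (descent_elem ` compositions r) a (descent_elem nu)" for nu
    have a_eq: "a = (\<Sum>nu\<in>compositions r. pm_scale (c nu) (descent_elem nu))"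
      unfolding c_def by (rule descent_algebra_expand[OF ind a])
    have y: "young_character_field nu \<sigma> = (of_nat (card (weighted nu (map dg bs))) :: 'f)"
      if "nu \<in> compositions r" for nu
      using \<sigma>(3)[of nu] that by (simp add: young_character_field_def compositions_def)
    have "N (place a (pr M)) = (\<Sum>nu\<in>compositions r. pm_scale (c nu) (N (place (descent_elem nu) (pr M))))"
      by (subst a_eq) (simp add: pm_linear_sum[OF pm_linear_bilin1] pm_linear_sum[OF pm_linear_N]
          pm_linear_scale[OF pm_linear_bilin1] pm_linear_scale[OF pm_linear_N])
    moreover have "pm_scale (descent_hom r a \<sigma>) (P.z M) =
        (\<Sum>nu\<in>compositions r. pm_scale (c nu) (pm_scale (of_nat (card (weighted nu (map dg bs)))) (P.z M)))"
    proof -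
      have "descent_hom r a \<sigma> = (\<Sum>nu\<in>compositions r. c nu * of_nat (card (weighted nu (map dg bs))))"
        unfolding descent_hom_def c_def[symmetric] by (rule sum.cong[OF refl]) (simp only: y)
      then show ?thesis by (simp only: pm.scale_sum_left pm.scale_scale)
    qed
    ultimately have "N (place a (pr M)) - pm_scale (descent_hom r a \<sigma>) (P.z M) =
        (\<Sum>nu\<in>compositions r. pm_scale (c nu) (N (place (descent_elem nu) (pr M)) -
           pm_scale (of_nat (card (weighted nu (map dg bs)))) (P.z M)))"
      by (simp only: sum_subtractf pm.scale_right_diff_distrib)
    also have "\<dots> \<in> {s. Poly_Mapping.keys s \<subseteq> P.gt (P.ty M)}"
    proof (intro pm.subspace_sum[OF subspace_keys] pm.subspace_scale[OF subspace_keys])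
      fix nu assume "nu \<in> compositions r"
      then have "sum_list nu = sum_list (map dg bs)" by (simp add: compositions_def sumr)
      from N_descent_elem[OF bsB this]
      show "N (place (descent_elem nu) (pr M)) - pm_scale (of_nat (card (weighted nu (map dg bs)))) (P.z M)
          \<in> {s. Poly_Mapping.keys s \<subseteq> P.gt (P.ty M)}"
        by (simp add: bs P.ty_def)
    qed
    finally show ?thesis by simp
  qed
  then show ?thesis using \<sigma>(1,2) unfolding ty[symmetric] by blast
qed

end

section \<open>Evaluating symmetric powers and tensor products\<close>

text \<open>\<open>\<phi>\<close> maps \<open>M\<close> linearly and equivariantly to polynomials,
  on which \<open>\<gamma>\<close> describes the action. As the elements of \<open>M\<close> may be
  cosets, linearity is expressed by sums and scalar multiples on the carrier and not through the
  type class zero or negatives.\<close>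

definition ev_module ::
    "('g, 'b) monoid_scheme \<Rightarrow> ('f::field, 'g, 'm::comm_monoid_add) fgmod \<Rightarrow>
     ('m \<Rightarrow> ('l::comm_monoid_add \<Rightarrow>\<^sub>0 'f)) \<Rightarrow> ('g \<Rightarrow> ('l \<Rightarrow>\<^sub>0 'f) \<Rightarrow> ('l \<Rightarrow>\<^sub>0 'f)) \<Rightarrow> bool" where
  "ev_module G M \<phi> \<gamma> \<longleftrightarrow>
     (\<forall>u\<in>carrier M. \<forall>v\<in>carrier M. u + v \<in> carrier M \<and> \<phi> (u + v) = \<phi> u + \<phi> v) \<and>
     (\<forall>c. \<forall>u\<in>carrier M. scl M c u \<in> carrier M \<and> \<phi> (scl M c u) = pm_scale c (\<phi> u)) \<and>
     (\<forall>g\<in>carrier G. \<forall>u\<in>carrier M. act M u g \<in> carrier M \<and> \<phi> (act M u g) = \<gamma> g (\<phi> u) \<and>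
        (\<forall>v\<in>carrier M. act M (u + v) g = act M u g + act M v g) \<and>
        (\<forall>c. act M (scl M c u) g = scl M c (act M u g)))"

text \<open>\<open>W\<close> spans \<open>M\<close>. In a module of cosets the neutral element need
  not be the constant 0, so it enters as \<open>scl M 0 u\<close>.\<close>

definition gen_by :: "('f::field, 'g, 'm::comm_monoid_add) fgmod \<Rightarrow> 'm set \<Rightarrow> bool" where
  "gen_by M W \<longleftrightarrow> W \<subseteq> carrier M \<and> (\<forall>Q. W \<subseteq> Q \<longrightarrow> (\<forall>u\<in>carrier M. scl M 0 u \<in> Q) \<longrightarrow>
     (\<forall>u\<in>Q \<inter> carrier M. \<forall>v\<in>Q \<inter> carrier M. u + v \<in> Q) \<longrightarrow>
     (\<forall>c. \<forall>u\<in>Q \<inter> carrier M. scl M c u \<in> Q) \<longrightarrow> carrier M \<subseteq> Q)"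

lemma ev_moduleD:
  assumes "ev_module G M \<phi> \<gamma>"
  shows "u \<in> carrier M \<Longrightarrow> v \<in> carrier M \<Longrightarrow> u + v \<in> carrier M"
    "u \<in> carrier M \<Longrightarrow> v \<in> carrier M \<Longrightarrow> \<phi> (u + v) = \<phi> u + \<phi> v"
    "u \<in> carrier M \<Longrightarrow> scl M c u \<in> carrier M"
    "u \<in> carrier M \<Longrightarrow> \<phi> (scl M c u) = pm_scale c (\<phi> u)"
    "g \<in> carrier G \<Longrightarrow> u \<in> carrier M \<Longrightarrow> act M u g \<in> carrier M"
    "g \<in> carrier G \<Longrightarrow> u \<in> carrier M \<Longrightarrow> \<phi> (act M u g) = \<gamma> g (\<phi> u)"
    "g \<in> carrier G \<Longrightarrow> u \<in> carrier M \<Longrightarrow> v \<in> carrier M \<Longrightarrow> act M (u + v) g = act M u g + act M v g"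
    "g \<in> carrier G \<Longrightarrow> u \<in> carrier M \<Longrightarrow> act M (scl M c u) g = scl M c (act M u g)"
  using assms unfolding ev_module_def by blast+

definition eval_coset :: "(('k \<Rightarrow>\<^sub>0 'f::field) \<Rightarrow> 'm) \<Rightarrow> ('k \<Rightarrow>\<^sub>0 'f) set \<Rightarrow> (('k \<Rightarrow>\<^sub>0 'f) \<Rightarrow> ('l \<Rightarrow>\<^sub>0 'f)) \<Rightarrow>
    'm \<Rightarrow> ('l \<Rightarrow>\<^sub>0 'f)" where
  "eval_coset q C P s = P (SOME x. x \<in> C \<and> q x = s)"

lemma eval_coset:
  assumes M: "presents G M q C K t" and P: "pm_linear P" "\<And>x. x \<in> K \<Longrightarrow> P x = 0" and x: "x \<in> C"
  shows "eval_coset q C P (q x) = P x"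
proof -
  let ?y = "SOME y. y \<in> C \<and> q y = q x"
  have y: "?y \<in> C \<and> q ?y = q x" by (rule someI[of _ x]) (use x in simp)
  then have "?y - x \<in> K" using presentsD(11)[OF M, of ?y x] x by blast
  then have "P (?y - x) = 0" by (rule P(2))
  then show ?thesis unfolding eval_coset_def by (simp add: pm_linear_diff[OF P(1)])
qed

lemma ev_module_presents:
  assumes M: "presents G M q C K t" and P: "pm_linear P" "\<And>x. x \<in> K \<Longrightarrow> P x = 0"
    and \<gamma>: "\<And>g x. g \<in> carrier G \<Longrightarrow> x \<in> C \<Longrightarrow> P (t x g) = \<gamma> g (P x)"
  shows "ev_module G M (eval_coset q C P) \<gamma>"
proof -
  note D = presentsD[OF M]
  have ev: "eval_coset q C P (q x) = P x" if "x \<in> C" for x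
    by (rule eval_coset[OF M P(1) _ that]) (rule P(2))
  show ?thesis
    unfolding ev_module_def
  proof (intro conjI ballI allI)
    fix u v assume "u \<in> carrier M" "v \<in> carrier M"
    then obtain x y where xy: "u = q x" "v = q y" "x \<in> C" "y \<in> C" using D(4) by auto
    have s: "x + y \<in> C" using D(1) xy by (intro pm.subspace_add)
    have e: "u + v = q (x + y)" using D(8)[OF xy(3,4)] xy by simp
    show "u + v \<in> carrier M" unfolding e D(4) using s by (rule imageI)
    show "eval_coset q C P (u + v) = eval_coset q C P u + eval_coset q C P v"
      unfolding e ev[OF s] by (simp only: xy(1,2) ev[OF xy(3)] ev[OF xy(4)] pm_linear_add[OF P(1)])
  next
    fix c u assume "u \<in> carrier M"
    then obtain x where x: "u = q x" "x \<in> C" using D(4) by auto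
    have s: "pm_scale c x \<in> C" using D(1) x by (intro pm.subspace_scale)
    have e: "scl M c u = q (pm_scale c x)" using D(9)[OF x(2)] x by simp
    show "scl M c u \<in> carrier M" unfolding e D(4) using s by (rule imageI)
    show "eval_coset q C P (scl M c u) = pm_scale c (eval_coset q C P u)"
      unfolding e ev[OF s] by (simp only: x(1) ev[OF x(2)] pm_linear_scale[OF P(1)])
  next
    fix g u assume g: "g \<in> carrier G" and "u \<in> carrier M"
    then obtain x where x: "u = q x" "x \<in> C" using D(4) by auto
    have s: "t x g \<in> C" by (rule D(6)[OF g x(2)])
    have e: "fgmod.act M u g = q (t x g)" using D(10)[OF g x(2)] x by simp
    show "fgmod.act M u g \<in> carrier M" unfolding e D(4) using s by (rule imageI)
    show "eval_coset q C P (fgmod.act M u g) = \<gamma> g (eval_coset q C P u)"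
      unfolding e ev[OF s] by (simp only: x(1) ev[OF x(2)] \<gamma>[OF g x(2)])
    {
      fix v assume "v \<in> carrier M"
      then obtain y where y: "v = q y" "y \<in> C" using D(4) by auto
      have "x + y \<in> C" using D(1) x y by (intro pm.subspace_add)
      then show "fgmod.act M (u + v) g = fgmod.act M u g + fgmod.act M v g"
        using D(8)[OF x(2) y(2)] D(10)[OF g, of "x + y"] D(10)[OF g x(2)] D(10)[OF g y(2)]
          D(8)[OF s D(6)[OF g y(2)]] x y by (simp add: pm_linear_add[OF D(5)[OF g]])
    }
    fix c
    have "pm_scale c x \<in> C" using D(1) x by (intro pm.subspace_scale)
    then show "fgmod.act M (scl M c u) g = scl M c (fgmod.act M u g)"
      using D(9)[OF x(2)] D(10)[OF g, of "pm_scale c x"] D(10)[OF g x(2)] D(9)[OF s] x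
      by (simp add: pm_linear_scale[OF D(5)[OF g]])
  qed
qed

lemma gen_by_presents:
  assumes M: "presents G M q C K t" and W: "W \<subseteq> C" "C \<subseteq> pm.span (W \<union> K)"
  shows "gen_by M (q ` W)"
  unfolding gen_by_def
proof (intro conjI allI impI)
  note D = presentsD[OF M]
  show "q ` W \<subseteq> carrier M" using W(1) D(4) by blast
  fix Q assume Q: "q ` W \<subseteq> Q" "\<forall>u\<in>carrier M. scl M 0 u \<in> Q"
    "\<forall>u\<in>Q \<inter> carrier M. \<forall>v\<in>Q \<inter> carrier M. u + v \<in> Q" "\<forall>c. \<forall>u\<in>Q \<inter> carrier M. scl M c u \<in> Q"
  have q0: "q 0 \<in> Q"
  proof -
    have 0: "0 \<in> C" by (rule pm.subspace_0[OF D(1)])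
    then have "scl M 0 (q 0) = q 0" using D(9)[OF 0, of 0] by simp
    moreover have "scl M 0 (q 0) \<in> Q" using Q(2) D(4) 0 by blast
    ultimately show ?thesis by simp
  qed
  have S: "pm.subspace {x \<in> C. q x \<in> Q}"
    unfolding pm.subspace_def
  proof (intro conjI ballI allI)
    show "0 \<in> {x \<in> C. q x \<in> Q}" using q0 pm.subspace_0[OF D(1)] by simp
    fix x y assume xy: "x \<in> {x \<in> C. q x \<in> Q}" "y \<in> {x \<in> C. q x \<in> Q}"
    then have "q (x + y) = q x + q y" "q x \<in> Q \<inter> carrier M" "q y \<in> Q \<inter> carrier M" "x + y \<in> C"
      using D(8)[of x y] D(4) pm.subspace_add[OF D(1)] by auto
    then show "x + y \<in> {x \<in> C. q x \<in> Q}" using Q(3) by auto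
  next
    fix c x assume x: "x \<in> {x \<in> C. q x \<in> Q}"
    then have "scl M c (q x) = q (pm_scale c x)" "q x \<in> Q \<inter> carrier M" "pm_scale c x \<in> C"
      using D(9)[of x c] D(4) pm.subspace_scale[OF D(1)] by auto
    then show "pm_scale c x \<in> {x \<in> C. q x \<in> Q}" using Q(4) by (metis (mono_tags) mem_Collect_eq)
  qed
  have "W \<union> K \<subseteq> {x \<in> C. q x \<in> Q}"
  proof (intro Un_least subsetI)
    fix x assume "x \<in> K"
    then have "x \<in> C" "q x = q 0" using D(3) D(11)[of x 0] pm.subspace_0[OF D(1)] by auto
    then show "x \<in> {x \<in> C. q x \<in> Q}" using q0 by simp
  qed (use W(1) Q(1) in auto)
  then have "pm.span (W \<union> K) \<subseteq> {x \<in> C. q x \<in> Q}" by (rule pm.span_minimal[OF _ S])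
  then show "carrier M \<subseteq> Q" using W(2) D(4) by auto
qed

lemma linear_rels_image_subset:
  assumes M: "ev_module G M \<phi> \<gamma>" and g: "g \<in> carrier G"
    and h: "\<And>u. u \<in> carrier M \<Longrightarrow> a (h u) = h' (act M u g)"
    and x: "x \<in> linear_rels M h"
  shows "pm_push a x \<in> linear_rels M h'"
  using x
proof (cases rule: linear_rels_cases)
  case (add u v)
  show ?thesis
    using linear_rels_add[OF ev_moduleD(5)[OF M g add(1)] ev_moduleD(5)[OF M g add(2)], of h']
      h[OF add(1)] h[OF add(2)] h[OF ev_moduleD(1)[OF M add(1,2)]] ev_moduleD(7)[OF M g add(1,2)]
    by (simp add: add(3) pm_linear_diff[OF pm_linear_push])
next
  case (scl c u)
  show ?thesis
    using linear_rels_scl[OF ev_moduleD(5)[OF M g scl(1)], of h' c]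
      h[OF scl(1)] h[OF ev_moduleD(3)[OF M scl(1)]] ev_moduleD(8)[OF M g scl(1)]
    by (simp add: scl(2) pm_linear_diff[OF pm_linear_push])
qed

lemma linear_rels_keys:
  fixes M :: "('f::field, 'g, 'm::comm_monoid_add) fgmod"
  assumes M: "ev_module G M \<phi> \<gamma>" and h: "\<And>u. u \<in> carrier M \<Longrightarrow> h u \<in> X" and x: "x \<in> linear_rels M h"
  shows "Poly_Mapping.keys x \<subseteq> X"
proof -
  have s: "Poly_Mapping.keys (Poly_Mapping.single (h u) c) \<subseteq> X" if "u \<in> carrier M" for u and c :: 'f
    using h[OF that] by simp
  show ?thesis
    using x
  proof (cases rule: linear_rels_cases)
    case (add u v)
    show ?thesis unfolding add(3) by (intro keys_diff_subset s add ev_moduleD(1)[OF M add(1,2)])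
  next
    case (scl c u)
    show ?thesis unfolding scl(2) by (intro keys_diff_subset s scl ev_moduleD(3)[OF M scl(1)])
  qed
qed

lemma gen_byD:
  assumes "gen_by M W" "W \<subseteq> Q" "\<And>u. u \<in> carrier M \<Longrightarrow> scl M 0 u \<in> Q"
    "\<And>u v. u \<in> Q \<Longrightarrow> u \<in> carrier M \<Longrightarrow> v \<in> Q \<Longrightarrow> v \<in> carrier M \<Longrightarrow> u + v \<in> Q"
    "\<And>c u. u \<in> Q \<Longrightarrow> u \<in> carrier M \<Longrightarrow> scl M c u \<in> Q"
  shows "carrier M \<subseteq> Q"
proof -
  have "\<forall>u\<in>carrier M. scl M 0 u \<in> Q" "\<forall>u\<in>Q \<inter> carrier M. \<forall>v\<in>Q \<inter> carrier M. u + v \<in> Q"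
    "\<forall>c. \<forall>u\<in>Q \<inter> carrier M. scl M c u \<in> Q"
    using assms(3-5) by simp_all
  then show ?thesis
    using conjunct2[OF assms(1)[unfolded gen_by_def], rule_format, of Q] assms(2) by simp
qed

text \<open>When \<open>T\<close> contains the linearity relations for \<open>h\<close>, the
  elements \<open>u\<close> whose basis vector \<open>h u\<close> lies in \<open>T\<close> are
  closed under the operations of \<open>M\<close>. So one argument of a multilinear expression may
  be restricted to generators.\<close>

lemma linear_rels_closed:
  assumes M: "gen_by M W" and T: "pm.subspace T" "linear_rels M h \<subseteq> T"
    and W: "\<And>u. u \<in> W \<Longrightarrow> Poly_Mapping.single (h u) 1 \<in> T" and u: "u \<in> carrier M"
  shows "Poly_Mapping.single (h u) 1 \<in> T"
proof -
  let ?Q = "{u. Poly_Mapping.single (h u) 1 \<in> T}"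
  have sc: "Poly_Mapping.single (h u) c \<in> T" if "u \<in> ?Q" for u c
    using pm.subspace_scale[OF T(1), of "Poly_Mapping.single (h u) 1" c] that by simp
  have "carrier M \<subseteq> ?Q"
  proof (rule gen_byD[OF M])
    show "W \<subseteq> ?Q" using W by blast
  next
    fix u assume "u \<in> carrier M"
    from linear_rels_scl[OF this, of h 0]
    have "Poly_Mapping.single (h (scl M 0 u)) 1 \<in> linear_rels M h" by simp
    then show "scl M 0 u \<in> ?Q" using T(2) by blast
  next
    fix u v assume u: "u \<in> ?Q" "u \<in> carrier M" and v: "v \<in> ?Q" "v \<in> carrier M"
    have 1: "Poly_Mapping.single (h (u + v)) 1 - Poly_Mapping.single (h u) 1 - Poly_Mapping.single (h v) 1 \<in> T"
      using T(2) linear_rels_add[OF u(2) v(2)] by blast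
    have 2: "Poly_Mapping.single (h u) 1 + Poly_Mapping.single (h v) 1 \<in> T"
      using pm.subspace_add[OF T(1)] u(1) v(1) by blast
    from pm.subspace_add[OF T(1) 1 2] show "u + v \<in> ?Q" by simp
  next
    fix c u assume u: "u \<in> ?Q" "u \<in> carrier M"
    have 1: "Poly_Mapping.single (h (scl M c u)) 1 - Poly_Mapping.single (h u) c \<in> T"
      using T(2) linear_rels_scl[OF u(2)] by blast
    from pm.subspace_add[OF T(1) 1 sc[OF u(1), of c]] show "scl M c u \<in> ?Q" by simp
  qed
  then show ?thesis using u by blast
qed

section \<open>Symmetric powers\<close>

definition sym_gens :: "('f::field, 'g, 'm::comm_monoid_add) fgmod \<Rightarrow> nat \<Rightarrow> 'm multiset set" where
  "sym_gens M m = {A. set_mset A \<subseteq> carrier M \<and> size A = m}"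

definition sym_rels :: "('f::field, 'g, 'm::comm_monoid_add) fgmod \<Rightarrow> nat \<Rightarrow> ('m multiset \<Rightarrow>\<^sub>0 'f) set" where
  "sym_rels M m = pm.span (\<Union>A\<in>{A. set_mset A \<subseteq> carrier M \<and> Suc (size A) = m}.
     linear_rels M (\<lambda>u. add_mset u A))"

lemma subspace_sym_rels: "pm.subspace (sym_rels M m)"
  by (simp add: sym_rels_def pm.subspace_span)

lemma presents_sym:
  assumes M: "ev_module G M \<phi> \<gamma>"
  shows "presents G (sym_power M m) (\<lambda>x. x +o sym_rels M m) {x. Poly_Mapping.keys x \<subseteq> sym_gens M m}
    (sym_rels M m) (\<lambda>x g. pm_push (\<lambda>A. image_mset (\<lambda>x. act M x g) A) x)"
proof -
  let ?a = "\<lambda>A g. image_mset (\<lambda>x. act M x g) A"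
  have cl: "image_mset (\<lambda>x. act M x g) A \<in> sym_gens M m" if "g \<in> carrier G" "A \<in> sym_gens M m" for g A
    using that ev_moduleD(5)[OF M] by (auto simp: sym_gens_def)
  have free: "presents G (free_mod (sym_gens M m) ?a) (\<lambda>x. x) {x. Poly_Mapping.keys x \<subseteq> sym_gens M m} {0}
      (\<lambda>x g. pm_push (\<lambda>A. ?a A g) x)"
    by (rule presents_free) (rule cl)
  have sub: "sym_rels M m \<subseteq> {x. Poly_Mapping.keys x \<subseteq> sym_gens M m}"
    unfolding sym_rels_def
  proof (rule pm.span_minimal[OF _ subspace_keys], rule subsetI)
    fix x assume "x \<in> (\<Union>A\<in>{A. set_mset A \<subseteq> carrier M \<and> Suc (size A) = m}. linear_rels M (\<lambda>u. add_mset u A))"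
    then obtain A where A: "set_mset A \<subseteq> carrier M" "Suc (size A) = m" "x \<in> linear_rels M (\<lambda>u. add_mset u A)"
      by blast
    have "Poly_Mapping.keys x \<subseteq> sym_gens M m"
      by (rule linear_rels_keys[OF M _ A(3)]) (use A in \<open>auto simp: sym_gens_def\<close>)
    then show "x \<in> {x. Poly_Mapping.keys x \<subseteq> sym_gens M m}" by simp
  qed
  have act: "pm_push (\<lambda>A. ?a A g) x \<in> sym_rels M m" if g: "g \<in> carrier G" and x: "x \<in> sym_rels M m" for g x
    using x unfolding sym_rels_def
  proof (rule pm_linear_span_subset[OF pm_linear_push pm.subspace_span, rotated])
    fix x assume "x \<in> (\<Union>A\<in>{A. set_mset A \<subseteq> carrier M \<and> Suc (size A) = m}. linear_rels M (\<lambda>u. add_mset u A))"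
    then obtain A where A: "set_mset A \<subseteq> carrier M" "Suc (size A) = m" "x \<in> linear_rels M (\<lambda>u. add_mset u A)"
      by blast
    have "pm_push (\<lambda>A. ?a A g) x \<in> linear_rels M (\<lambda>u. add_mset u (?a A g))"
      by (rule linear_rels_image_subset[OF M g _ A(3)]) simp
    moreover have "set_mset (?a A g) \<subseteq> carrier M" using A(1) ev_moduleD(5)[OF M g] by auto
    moreover have "Suc (size (?a A g)) = m" using A(2) by simp
    ultimately show "pm_push (\<lambda>A. ?a A g) x \<in> pm.span (\<Union>A\<in>{A. set_mset A \<subseteq> carrier M \<and> Suc (size A) = m}.
        linear_rels M (\<lambda>u. add_mset u A))"
      by (intro pm.span_base) blast
  qed
  have z: "{0} \<subseteq> sym_rels M m" using pm.subspace_0[OF subspace_sym_rels] by blast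
  from presents_quot[OF free subspace_sym_rels z sub act]
  show ?thesis by (simp add: sym_power_def sym_gens_def[symmetric] sym_rels_def[symmetric])
qed

definition sym_eval :: "('m \<Rightarrow> ('l::comm_monoid_add \<Rightarrow>\<^sub>0 'f::field)) \<Rightarrow> ('m multiset \<Rightarrow>\<^sub>0 'f) \<Rightarrow> ('l \<Rightarrow>\<^sub>0 'f)" where
  "sym_eval \<phi> = pm_lin (\<lambda>A. \<Prod>u\<in>#A. \<phi> u)"

lemma pm_linear_sym_eval: "pm_linear (sym_eval \<phi>)"
  by (simp add: sym_eval_def pm_linear_lin)

lemma sym_eval_rels:
  assumes M: "ev_module G M \<phi> \<gamma>" and x: "x \<in> sym_rels M m"
  shows "sym_eval \<phi> x = 0"
  using x unfolding sym_rels_def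
proof (rule pm_linear_kernel_span[OF pm_linear_sym_eval, rotated])
  fix x assume "x \<in> (\<Union>A\<in>{A. set_mset A \<subseteq> carrier M \<and> Suc (size A) = m}. linear_rels M (\<lambda>u. add_mset u A))"
  then obtain A where x: "x \<in> linear_rels M (\<lambda>u. add_mset u A)" by blast
  then show "sym_eval \<phi> x = 0"
  proof (cases rule: linear_rels_cases)
    case (add u v)
    then show ?thesis
      by (simp add: pm_linear_diff[OF pm_linear_sym_eval])
         (simp add: sym_eval_def ev_moduleD(2)[OF M add(1,2)] distrib_right)
  next
    case (scl c u)
    then show ?thesis
      by (simp add: pm_linear_diff[OF pm_linear_sym_eval])
         (simp add: sym_eval_def ev_moduleD(4)[OF M scl(1)] pm_scale_mult_left)
  qed
qed

lemma prod_mset_hom: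
  assumes "\<And>x y. \<gamma> (x * y) = \<gamma> x * \<gamma> y" "\<gamma> 1 = (1 :: 'r::comm_monoid_mult)"
  shows "\<gamma> (\<Prod>u\<in>#A. \<phi> u) = (\<Prod>u\<in>#A. \<gamma> (\<phi> u :: 'r))"
  by (induction A) (simp_all add: assms)

lemma ev_module_sym:
  fixes M :: "('f::field, 'g, 'm::comm_monoid_add) fgmod"
  assumes M: "ev_module G M \<phi> \<gamma>"
    and \<gamma>: "\<And>g. pm_linear (\<gamma> g)" "\<And>g x y. \<gamma> g (x * y) = \<gamma> g x * \<gamma> g y" "\<And>g. \<gamma> g 1 = 1"
  shows "ev_module G (sym_power M m)
    (eval_coset (\<lambda>x. x +o sym_rels M m) {x. Poly_Mapping.keys x \<subseteq> sym_gens M m} (sym_eval \<phi>)) \<gamma>"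
proof (rule ev_module_presents[OF presents_sym[OF M] pm_linear_sym_eval sym_eval_rels[OF M]])
  fix g and x :: "'m multiset \<Rightarrow>\<^sub>0 'f"
  assume g: "g \<in> carrier G" and x: "x \<in> {x. Poly_Mapping.keys x \<subseteq> sym_gens M m}"
  show "sym_eval \<phi> (pm_push (\<lambda>A. image_mset (\<lambda>x. act M x g) A) x) = \<gamma> g (sym_eval \<phi> x)"
  proof (rule pm_linear_eqI[of "\<lambda>x. sym_eval \<phi> (pm_push (\<lambda>A. image_mset (\<lambda>x. act M x g) A) x)" "\<lambda>x. \<gamma> g (sym_eval \<phi> x)"])
    show "pm_linear (\<lambda>x. sym_eval \<phi> (pm_push (\<lambda>A. image_mset (\<lambda>x. act M x g) A) x))"
      by (rule pm_linear_compose[OF pm_linear_sym_eval pm_linear_push])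
    show "pm_linear (\<lambda>x. \<gamma> g (sym_eval \<phi> x))" by (rule pm_linear_compose[OF \<gamma>(1) pm_linear_sym_eval])
    fix A assume "A \<in> Poly_Mapping.keys x"
    then have A: "set_mset A \<subseteq> carrier M" using x by (auto simp: sym_gens_def)
    have "(\<Prod>u\<in>#A. \<phi> (act M u g)) = (\<Prod>u\<in>#A. \<gamma> g (\<phi> u))"
      using A ev_moduleD(6)[OF M g] by (intro arg_cong[where f=prod_mset] image_mset_cong) auto
    then show "sym_eval \<phi> (pm_push (\<lambda>A. image_mset (\<lambda>x. act M x g) A) (Poly_Mapping.single A 1)) =
        \<gamma> g (sym_eval \<phi> (Poly_Mapping.single A 1))"
      by (simp add: sym_eval_def image_mset.compositionality comp_def prod_mset_hom[of "\<gamma> g", OF \<gamma>(2,3)])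
  qed
qed

text \<open>Entries are exchanged for generators one at a time: \<open>A\<close> holds those already
  in \<open>W\<close>, \<open>A'\<close> those still arbitrary, and
  \<open>linear_rels_closed\<close> justifies each exchange.\<close>

lemma sym_span:
  fixes M :: "('f::field, 'g, 'm::comm_monoid_add) fgmod"
  assumes M: "gen_by M W"
  shows "{x. Poly_Mapping.keys x \<subseteq> sym_gens M m} \<subseteq>
    pm.span ((\<lambda>A. Poly_Mapping.single A 1) ` {A. set_mset A \<subseteq> W \<and> size A = m} \<union> sym_rels M m)"
proof
  let ?W = "(\<lambda>A. Poly_Mapping.single A 1) ` {A. set_mset A \<subseteq> W \<and> size A = m} \<union> sym_rels M m"
  have WM: "W \<subseteq> carrier M" using M by (simp add: gen_by_def)
  have *: "Poly_Mapping.single (A + A') 1 \<in> pm.span ?W"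
    if "set_mset A \<subseteq> W" "set_mset A' \<subseteq> carrier M" "size A + size A' = m" for A A'
    using that
  proof (induction A' arbitrary: A)
    case empty
    then show ?case by (intro pm.span_base) auto
  next
    case (add u A')
    have rels: "linear_rels M (\<lambda>u. add_mset u (A + A')) \<subseteq> pm.span ?W"
    proof -
      have "linear_rels M (\<lambda>u. add_mset u (A + A')) \<subseteq> sym_rels M m"
        unfolding sym_rels_def using add.prems WM by (intro subset_trans[OF _ pm.span_superset] UN_upper) auto
      then show ?thesis using pm.span_superset[of ?W] by blast
    qed
    have "Poly_Mapping.single (add_mset u (A + A')) 1 \<in> pm.span ?W"
    proof (rule linear_rels_closed[OF M pm.subspace_span rels])
      fix w assume "w \<in> W"
      then have "Poly_Mapping.single (add_mset w A + A') 1 \<in> pm.span ?W"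
        using add.prems by (intro add.IH) auto
      then show "Poly_Mapping.single (add_mset w (A + A')) 1 \<in> pm.span ?W" by simp
    qed (use add.prems in simp)
    then show ?case by simp
  qed
  fix x :: "'m multiset \<Rightarrow>\<^sub>0 'f" assume x: "x \<in> {x. Poly_Mapping.keys x \<subseteq> sym_gens M m}"
  show "x \<in> pm.span ?W"
  proof (rule pm_linear_in_subspace[OF pm_linear_id pm.subspace_span])
    fix A assume "A \<in> Poly_Mapping.keys x"
    then show "Poly_Mapping.single A 1 \<in> pm.span ?W"
      using x *[of "{#}" A] by (auto simp: sym_gens_def)
  qed
qed

lemma gen_by_sym:
  assumes M: "ev_module G M \<phi> \<gamma>" and W: "gen_by M W"
  shows "gen_by (sym_power M m)
    ((\<lambda>x. x +o sym_rels M m) ` (\<lambda>A. Poly_Mapping.single A 1) ` {A. set_mset A \<subseteq> W \<and> size A = m})"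
proof (rule gen_by_presents[OF presents_sym[OF M] _ sym_span[OF W]])
  have "W \<subseteq> carrier M" using W by (simp add: gen_by_def)
  then show "(\<lambda>A. Poly_Mapping.single A 1) ` {A. set_mset A \<subseteq> W \<and> size A = m} \<subseteq>
      {x. Poly_Mapping.keys x \<subseteq> sym_gens M m}"
    by (intro image_subsetI) (auto simp: sym_gens_def)
qed

section \<open>Tensor products\<close>

definition tens_gens :: "('f::field, 'g, 'm::comm_monoid_add) fgmod list \<Rightarrow> 'm list set" where
  "tens_gens Ms = {xs. length xs = length Ms \<and> (\<forall>i<length Ms. xs ! i \<in> carrier (Ms ! i))}"

lemma listset_iff: "xs \<in> listset As \<longleftrightarrow> length xs = length As \<and> (\<forall>i<length As. xs ! i \<in> As ! i)"
proof (induction As arbitrary: xs)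
  case (Cons A As)
  show ?case by (cases xs) (auto simp: set_Cons_def Cons.IH less_Suc_eq_0_disj)
qed simp

lemma listset_carrier: "listset (map carrier Ms) = tens_gens Ms"
  by (auto simp: listset_iff tens_gens_def)

definition tens_rels :: "('f::field, 'g, 'm::comm_monoid_add) fgmod list \<Rightarrow> ('m list \<Rightarrow>\<^sub>0 'f) set" where
  "tens_rels Ms = pm.span (\<Union>xs\<in>tens_gens Ms. \<Union>i<length Ms. linear_rels (Ms ! i) (\<lambda>u. xs[i := u]))"

lemma subspace_tens_rels: "pm.subspace (tens_rels Ms)"
  by (simp add: tens_rels_def pm.subspace_span)

lemma tens_gens_update: "xs \<in> tens_gens Ms \<Longrightarrow> u \<in> carrier (Ms ! i) \<Longrightarrow> xs[i := u] \<in> tens_gens Ms"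
  by (cases "i < length Ms") (auto simp: tens_gens_def nth_list_update list_update_beyond)

lemma tens_rels_cases:
  assumes "pm_linear f" "pm.subspace S" "x \<in> tens_rels Ms"
    "\<And>xs i x. xs \<in> tens_gens Ms \<Longrightarrow> i < length Ms \<Longrightarrow> x \<in> linear_rels (Ms ! i) (\<lambda>u. xs[i := u]) \<Longrightarrow> f x \<in> S"
  shows "f x \<in> S"
  by (rule pm_linear_span_subset[OF assms(1,2) _ assms(3)[unfolded tens_rels_def]]) (use assms(4) in blast)

lemma presents_tensor_product:
  assumes M: "\<And>i. i < length Ms \<Longrightarrow> ev_module G (Ms ! i) (\<phi> i) \<gamma>"
  shows "presents G (tensor_product Ms) (\<lambda>x. x +o tens_rels Ms) {x. Poly_Mapping.keys x \<subseteq> tens_gens Ms}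
    (tens_rels Ms) (\<lambda>x g. pm_push (\<lambda>xs. map2 (\<lambda>M x. act M x g) Ms xs) x)"
proof -
  let ?a = "\<lambda>xs g. map2 (\<lambda>M x. act M x g) Ms xs"
  have cl: "?a xs g \<in> tens_gens Ms" if "g \<in> carrier G" "xs \<in> tens_gens Ms" for g xs
    using that ev_moduleD(5)[OF M] by (auto simp: tens_gens_def)
  have free: "presents G (free_mod (tens_gens Ms) ?a) (\<lambda>x. x) {x. Poly_Mapping.keys x \<subseteq> tens_gens Ms} {0}
      (\<lambda>x g. pm_push (\<lambda>A. ?a A g) x)"
    by (rule presents_free) (rule cl)
  have sub: "tens_rels Ms \<subseteq> {x. Poly_Mapping.keys x \<subseteq> tens_gens Ms}"
  proof
    fix x assume x: "x \<in> tens_rels Ms"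
    show "x \<in> {x. Poly_Mapping.keys x \<subseteq> tens_gens Ms}"
    proof (rule tens_rels_cases[OF pm_linear_id subspace_keys x])
      fix xs i x assume xs: "xs \<in> tens_gens Ms" "i < length Ms" "x \<in> linear_rels (Ms ! i) (\<lambda>u. xs[i := u])"
      have "Poly_Mapping.keys x \<subseteq> tens_gens Ms"
        by (rule linear_rels_keys[OF M[OF xs(2)] tens_gens_update[OF xs(1)] xs(3)])
      then show "x \<in> {x. Poly_Mapping.keys x \<subseteq> tens_gens Ms}" by simp
    qed
  qed
  have act: "pm_push (\<lambda>A. ?a A g) x \<in> tens_rels Ms" if g: "g \<in> carrier G" and x: "x \<in> tens_rels Ms" for g x
  proof (rule tens_rels_cases[OF pm_linear_push subspace_tens_rels x])
    fix xs i x assume xs: "xs \<in> tens_gens Ms" "i < length Ms" "x \<in> linear_rels (Ms ! i) (\<lambda>u. xs[i := u])"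
    have "pm_push (\<lambda>A. ?a A g) x \<in> linear_rels (Ms ! i) (\<lambda>u. (?a xs g)[i := u])"
    proof (rule linear_rels_image_subset[OF M[OF xs(2)] g _ xs(3)])
      fix u
      show "?a (xs[i := u]) g = (?a xs g)[i := fgmod.act (Ms ! i) u g]"
        using xs(1,2) by (intro nth_equalityI) (auto simp: tens_gens_def nth_list_update)
    qed
    then show "pm_push (\<lambda>A. ?a A g) x \<in> tens_rels Ms"
      unfolding tens_rels_def using xs(2) cl[OF g xs(1)] by (intro pm.span_base) blast
  qed
  have z: "{0} \<subseteq> tens_rels Ms" using pm.subspace_0[OF subspace_tens_rels] by blast
  from presents_quot[OF free subspace_tens_rels z sub act]
  show ?thesis by (simp add: tensor_product_def listset_carrier tens_rels_def[symmetric])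
qed

definition tens_eval :: "nat \<Rightarrow> (nat \<Rightarrow> 'm \<Rightarrow> ('l::comm_monoid_add \<Rightarrow>\<^sub>0 'f::field)) \<Rightarrow> ('m list \<Rightarrow>\<^sub>0 'f) \<Rightarrow> ('l \<Rightarrow>\<^sub>0 'f)" where
  "tens_eval n \<phi> = pm_lin (\<lambda>xs. \<Prod>i<n. \<phi> i (xs ! i))"

lemma pm_linear_tens_eval: "pm_linear (tens_eval n \<phi>)"
  by (simp add: tens_eval_def pm_linear_lin)

lemma tens_eval_single: "tens_eval n \<phi> (Poly_Mapping.single xs c) = pm_scale c (\<Prod>i<n. \<phi> i (xs ! i))"
  by (simp add: tens_eval_def)

lemma tens_eval_update:
  assumes "i < n" "length xs = n"
  shows "(\<Prod>j<n. \<phi> j (xs[i := u] ! j)) = \<phi> i u * (\<Prod>j\<in>{..<n} - {i}. \<phi> j (xs ! j))"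
proof -
  have "(\<Prod>j<n. \<phi> j (xs[i := u] ! j)) = \<phi> i (xs[i := u] ! i) * (\<Prod>j\<in>{..<n} - {i}. \<phi> j (xs[i := u] ! j))"
    by (rule prod.remove) (use assms in auto)
  also have "(\<Prod>j\<in>{..<n} - {i}. \<phi> j (xs[i := u] ! j)) = (\<Prod>j\<in>{..<n} - {i}. \<phi> j (xs ! j))"
    by (rule prod.cong) auto
  finally show ?thesis using assms by simp
qed

lemma tens_eval_rels:
  assumes M: "\<And>i. i < length Ms \<Longrightarrow> ev_module G (Ms ! i) (\<phi> i) \<gamma>" and x: "x \<in> tens_rels Ms"
  shows "tens_eval (length Ms) \<phi> x = 0"
proof -
  have "tens_eval (length Ms) \<phi> x \<in> {0}"
  proof (rule tens_rels_cases[OF pm_linear_tens_eval pm.subspace_single_0 x])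
    fix xs i x assume xs: "xs \<in> tens_gens Ms" "i < length Ms" "x \<in> linear_rels (Ms ! i) (\<lambda>u. xs[i := u])"
    have len: "length xs = length Ms" using xs(1) by (simp add: tens_gens_def)
    note Mi = M[OF xs(2)]
    from xs(3) show "tens_eval (length Ms) \<phi> x \<in> {0}"
    proof (cases rule: linear_rels_cases)
      case (add u v)
      then show ?thesis
        by (simp add: pm_linear_diff[OF pm_linear_tens_eval] tens_eval_single
            tens_eval_update[OF xs(2) len] ev_moduleD(2)[OF Mi add(1,2)] distrib_right)
    next
      case (scl c u)
      then show ?thesis
        by (simp add: pm_linear_diff[OF pm_linear_tens_eval] tens_eval_single
            tens_eval_update[OF xs(2) len] ev_moduleD(4)[OF Mi scl(1)] pm_scale_mult_left)
    qed
  qed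
  then show ?thesis by simp
qed

lemma tens_eval_act:
  assumes M: "\<And>i. i < length Ms \<Longrightarrow> ev_module G (Ms ! i) (\<phi> i) \<gamma>"
    and \<gamma>: "pm_linear (\<gamma> g)" "\<And>x y. \<gamma> g (x * y) = \<gamma> g x * \<gamma> g y" "\<gamma> g 1 = 1"
    and g: "g \<in> carrier G" and x: "Poly_Mapping.keys x \<subseteq> tens_gens Ms"
  shows "tens_eval (length Ms) \<phi> (pm_push (\<lambda>xs. map2 (\<lambda>M x. act M x g) Ms xs) x) = \<gamma> g (tens_eval (length Ms) \<phi> x)"
proof (rule pm_linear_eqI[of "\<lambda>x. tens_eval (length Ms) \<phi> (pm_push (\<lambda>xs. map2 (\<lambda>M x. act M x g) Ms xs) x)"
      "\<lambda>x. \<gamma> g (tens_eval (length Ms) \<phi> x)"])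
  show "pm_linear (\<lambda>x. tens_eval (length Ms) \<phi> (pm_push (\<lambda>xs. map2 (\<lambda>M x. act M x g) Ms xs) x))"
    by (rule pm_linear_compose[OF pm_linear_tens_eval pm_linear_push])
  show "pm_linear (\<lambda>x. \<gamma> g (tens_eval (length Ms) \<phi> x))" by (rule pm_linear_compose[OF \<gamma>(1) pm_linear_tens_eval])
  fix xs assume "xs \<in> Poly_Mapping.keys x"
  then have xs: "length xs = length Ms" "\<And>i. i < length Ms \<Longrightarrow> xs ! i \<in> carrier (Ms ! i)"
    using x by (auto simp: tens_gens_def)
  have hom: "\<gamma> g (\<Prod>i<n. f i) = (\<Prod>i<n. \<gamma> g (f i))" for n :: nat and f
    by (induction n) (simp_all add: \<gamma>)
  have "(\<Prod>i<length Ms. \<phi> i (map2 (\<lambda>M x. act M x g) Ms xs ! i)) = (\<Prod>i<length Ms. \<gamma> g (\<phi> i (xs ! i)))"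
    by (rule prod.cong) (use xs ev_moduleD(6)[OF M g] in auto)
  then show "tens_eval (length Ms) \<phi> (pm_push (\<lambda>xs. map2 (\<lambda>M x. act M x g) Ms xs) (Poly_Mapping.single xs 1)) =
      \<gamma> g (tens_eval (length Ms) \<phi> (Poly_Mapping.single xs 1))"
    by (simp add: tens_eval_single hom)
qed

text \<open>The same exchange of entries, place by place from the end: the entries from place
  \<open>n\<close> on are in \<open>W\<close> already, those before it are arbitrary.\<close>

lemma tens_span:
  fixes Ms :: "('f::field, 'g, 'm::comm_monoid_add) fgmod list"
  assumes W: "\<And>i. i < length Ms \<Longrightarrow> gen_by (Ms ! i) (W i)"
  shows "{x. Poly_Mapping.keys x \<subseteq> tens_gens Ms} \<subseteq>
    pm.span ((\<lambda>xs. Poly_Mapping.single xs 1) ` {xs. length xs = length Ms \<and> (\<forall>i<length Ms. xs ! i \<in> W i)} \<union>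
      tens_rels Ms)"
proof
  let ?W = "(\<lambda>xs. Poly_Mapping.single xs 1) ` {xs. length xs = length Ms \<and> (\<forall>i<length Ms. xs ! i \<in> W i)} \<union>
      tens_rels Ms"
  have *: "\<forall>xs\<in>tens_gens Ms. (\<forall>i<length Ms. n \<le> i \<longrightarrow> xs ! i \<in> W i) \<longrightarrow> Poly_Mapping.single xs 1 \<in> pm.span ?W"
    if "n \<le> length Ms" for n
    using that
  proof (induction n)
    case 0
    show ?case
    proof (intro ballI impI pm.span_base UnI1 imageI CollectI conjI)
      fix xs assume "xs \<in> tens_gens Ms" "\<forall>i<length Ms. 0 \<le> i \<longrightarrow> xs ! i \<in> W i"
      then show "length xs = length Ms" "\<forall>i<length Ms. xs ! i \<in> W i" by (simp_all add: tens_gens_def)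
    qed
  next
    case (Suc n)
    show ?case
    proof (intro ballI impI)
      fix xs assume xs: "xs \<in> tens_gens Ms" "\<forall>i<length Ms. Suc n \<le> i \<longrightarrow> xs ! i \<in> W i"
      have n: "n < length Ms" and len: "length xs = length Ms" using Suc.prems xs(1) by (simp_all add: tens_gens_def)
      have rels: "linear_rels (Ms ! n) (\<lambda>u. xs[n := u]) \<subseteq> pm.span ?W"
      proof -
        have "linear_rels (Ms ! n) (\<lambda>u. xs[n := u]) \<subseteq> tens_rels Ms"
          unfolding tens_rels_def using xs(1) n by (intro subset_trans[OF _ pm.span_superset]) blast
        then show ?thesis using pm.span_superset[of ?W] by blast
      qed
      have "Poly_Mapping.single (xs[n := xs ! n]) 1 \<in> pm.span ?W"
      proof (rule linear_rels_closed[OF W[OF n] pm.subspace_span rels])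
        fix w assume w: "w \<in> W n"
        then have "xs[n := w] \<in> tens_gens Ms"
          using W[OF n] by (intro tens_gens_update[OF xs(1)]) (auto simp: gen_by_def)
        moreover have "\<forall>i<length Ms. n \<le> i \<longrightarrow> xs[n := w] ! i \<in> W i"
          using xs(2) w len by (auto simp: nth_list_update)
        ultimately show "Poly_Mapping.single (xs[n := w]) 1 \<in> pm.span ?W"
          using Suc.IH n by simp
      qed (use xs(1) n in \<open>simp add: tens_gens_def\<close>)
      then show "Poly_Mapping.single xs 1 \<in> pm.span ?W" by simp
    qed
  qed
  fix x :: "'m list \<Rightarrow>\<^sub>0 'f" assume x: "x \<in> {x. Poly_Mapping.keys x \<subseteq> tens_gens Ms}"
  show "x \<in> pm.span ?W"
  proof (rule pm_linear_in_subspace[OF pm_linear_id pm.subspace_span])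
    fix xs assume "xs \<in> Poly_Mapping.keys x"
    then have "xs \<in> tens_gens Ms" using x by auto
    then show "Poly_Mapping.single xs 1 \<in> pm.span ?W" using *[of "length Ms"] by simp
  qed
qed

section \<open>Higher Lie modules\<close>

lemma count_image_mset_filter: "count (image_mset f M) i = size (filter_mset (\<lambda>b. f b = i) M)"
  by (induction M) auto

lemma filter_mset_sum: "filter_mset Q (\<Sum>j<n. M j) = (\<Sum>j<(n::nat). filter_mset Q (M j))"
  by (induction n) simp_all

lemma filter_mset_split_le:
  "filter_mset (\<lambda>b. 0 < f b \<and> f b \<le> Suc n) M =
     filter_mset (\<lambda>b. 0 < f b \<and> f b \<le> n) M + filter_mset (\<lambda>b. f b = Suc n) M"
  by (rule multiset_eqI) auto

context lie_basis
begin

definition lie_deg :: "nat \<Rightarrow> ('v list \<Rightarrow>\<^sub>0 'f) set" where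
  "lie_deg i = {x. homogeneous i x} \<inter> LL"

lemma subspace_lie_deg: "pm.subspace (lie_deg i)"
  unfolding lie_deg_def by (rule pm.subspace_inter[OF subspace_homogeneous subspace_LL])

lemma presents_lie: "presents G (lie_power V i) \<pi> (lie_deg i) (I \<inter> lie_deg i) (\<lambda>x g. tw g x)"
proof -
  have "presents G ((tensor_algebra V)\<lparr>carrier := \<pi> ` lie_deg i\<rparr>) \<pi> (lie_deg i) (I \<inter> lie_deg i) (\<lambda>x g. tw g x)"
    by (rule presents_carrier[OF presents_tensor subspace_lie_deg])
       (auto simp: lie_deg_def tw_homogeneous LL_tw)
  moreover have "carrier (tensor_power V i) \<inter> free_lie_algebra V = \<pi> ` lie_deg i"
    by (auto simp: tensor_power_def lie_deg_def LL_iff)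
  ultimately show ?thesis by (simp add: lie_power_def)
qed

definition ev_lie :: "nat \<Rightarrow> ('v list \<Rightarrow>\<^sub>0 'f) set \<Rightarrow> (('v list \<Rightarrow>\<^sub>0 'f) multiset \<Rightarrow>\<^sub>0 'f)" where
  "ev_lie i = eval_coset \<pi> (lie_deg i) ell"

lemma ev_lie_pi: "x \<in> lie_deg i \<Longrightarrow> ev_lie i (\<pi> x) = ell x"
  unfolding ev_lie_def by (rule eval_coset[OF presents_lie pm_linear_ell]) (auto intro: ell_I)

lemma ev_module_lie: "ev_module G (lie_power V i) (ev_lie i) gam"
  unfolding ev_lie_def
  by (rule ev_module_presents[OF presents_lie pm_linear_ell])
     (auto intro: ell_I simp: gam_ell lie_deg_def)

definition B_deg :: "nat \<Rightarrow> ('v list \<Rightarrow>\<^sub>0 'f) set" where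
  "B_deg i = {b \<in> B. dg b = i}"

lemma B_deg_lie_deg: "B_deg i \<subseteq> lie_deg i"
  using B_LL dg by (auto simp: B_deg_def lie_deg_def)

lemma gen_by_lie: "gen_by (lie_power V i) (\<pi> ` B_deg i)"
proof (rule gen_by_presents[OF presents_lie B_deg_lie_deg], rule subsetI)
  fix x assume x: "x \<in> lie_deg i"
  then have xL: "x \<in> LL" "homogeneous i x" by (simp_all add: lie_deg_def)
  have v: "pm_val (crd x) \<in> pm.span (B_deg i)"
  proof (rule pm_linear_in_subspace[OF pm_linear_val pm.subspace_span])
    fix b assume "b \<in> Poly_Mapping.keys (crd x)"
    then have "b \<in> B_deg i" using crd_keys[OF xL(1)] crd_homogeneous[OF xL] by (auto simp: B_deg_def)
    then show "pm_val (Poly_Mapping.single b 1) \<in> pm.span (B_deg i)" by (simp add: pm.span_base)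
  qed
  have "pm.span (B_deg i) \<subseteq> lie_deg i" by (rule pm.span_minimal[OF B_deg_lie_deg subspace_lie_deg])
  then have "x - pm_val (crd x) \<in> lie_deg i" using v x by (intro pm.subspace_diff[OF subspace_lie_deg]) auto
  then have "x - pm_val (crd x) \<in> pm.span (B_deg i \<union> I \<inter> lie_deg i)"
    using crd_val[OF xL(1)] by (intro pm.span_base) simp
  moreover have "pm_val (crd x) \<in> pm.span (B_deg i \<union> I \<inter> lie_deg i)"
    using v pm.span_mono[of "B_deg i" "B_deg i \<union> I \<inter> lie_deg i"] by blast
  ultimately have "(x - pm_val (crd x)) + pm_val (crd x) \<in> pm.span (B_deg i \<union> I \<inter> lie_deg i)"
    by (rule pm.span_add)
  then show "x \<in> pm.span (B_deg i \<union> I \<inter> lie_deg i)" by simp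
qed

abbreviation sym_coset :: "nat \<Rightarrow> nat \<Rightarrow> (('v list \<Rightarrow>\<^sub>0 'f) set multiset \<Rightarrow>\<^sub>0 'f) \<Rightarrow> _" where
  "sym_coset i m x \<equiv> x +o sym_rels (lie_power V i) m"

definition ev_sym :: "nat \<Rightarrow> nat \<Rightarrow> (('v list \<Rightarrow>\<^sub>0 'f) set multiset \<Rightarrow>\<^sub>0 'f) set \<Rightarrow> (('v list \<Rightarrow>\<^sub>0 'f) multiset \<Rightarrow>\<^sub>0 'f)" where
  "ev_sym i m = eval_coset (sym_coset i m) {x. Poly_Mapping.keys x \<subseteq> sym_gens (lie_power V i) m} (sym_eval (ev_lie i))"

lemma ev_module_sym_lie: "ev_module G (sym_power (lie_power V i) m) (ev_sym i m) gam"
  unfolding ev_sym_def by (rule ev_module_sym[OF ev_module_lie pm_linear_gam gam_mult gam_one])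

lemma prod_mset_z: "(\<Prod>b\<in>#M. P.z {#b#}) = P.z M"
  by (induction M) (simp_all add: z_mult)

definition sym_basis :: "nat \<Rightarrow> nat \<Rightarrow> ('v list \<Rightarrow>\<^sub>0 'f) multiset \<Rightarrow> (('v list \<Rightarrow>\<^sub>0 'f) set multiset \<Rightarrow>\<^sub>0 'f) set" where
  "sym_basis i m M = sym_coset i m (Poly_Mapping.single (image_mset \<pi> M) 1)"

lemma ev_sym_basis:
  assumes M: "set_mset M \<subseteq> B_deg i" "size M = m"
  shows "ev_sym i m (sym_basis i m M) = P.z M"
proof -
  have "\<pi> b \<in> carrier (lie_power V i)" if "b \<in> B_deg i" for b
    using presentsD(4)[OF presents_lie, of i] B_deg_lie_deg that by blast
  then have "image_mset \<pi> M \<in> sym_gens (lie_power V i) m"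
    using M by (auto simp: sym_gens_def)
  then have "ev_sym i m (sym_basis i m M) = sym_eval (ev_lie i) (Poly_Mapping.single (image_mset \<pi> M) 1)"
    unfolding ev_sym_def sym_basis_def
    by (intro eval_coset[OF presents_sym[OF ev_module_lie] pm_linear_sym_eval])
       (auto intro: sym_eval_rels[OF ev_module_lie])
  also have "\<dots> = (\<Prod>b\<in>#M. ev_lie i (\<pi> b))"
    by (simp add: sym_eval_def image_mset.compositionality comp_def)
  also have "\<dots> = (\<Prod>b\<in>#M. P.z {#b#})"
  proof (intro arg_cong[where f=prod_mset] image_mset_cong)
    fix b assume "b \<in># M"
    then have "b \<in> B_deg i" using M(1) by blast
    then show "ev_lie i (\<pi> b) = P.z {#b#}"
      using B_deg_lie_deg by (subst ev_lie_pi) (auto simp: B_deg_def ell_B)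
  qed
  finally show ?thesis by (simp only: prod_mset_z)
qed

lemma gen_by_sym_lie:
  "gen_by (sym_power (lie_power V i) m) (sym_basis i m ` {M. set_mset M \<subseteq> B_deg i \<and> size M = m})"
proof -
  have "(\<lambda>A. Poly_Mapping.single A (1::'f)) ` {A. set_mset A \<subseteq> \<pi> ` B_deg i \<and> size A = m} =
      (\<lambda>M. Poly_Mapping.single (image_mset \<pi> M) 1) ` {M. set_mset M \<subseteq> B_deg i \<and> size M = m}"
  proof (intro equalityI image_subsetI)
    fix A assume A: "A \<in> {A. set_mset A \<subseteq> \<pi> ` B_deg i \<and> size A = m}"
    define s where "s u = (SOME b. b \<in> B_deg i \<and> \<pi> b = u)" for u
    have s: "s u \<in> B_deg i \<and> \<pi> (s u) = u" if "u \<in># A" for u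
      unfolding s_def by (rule someI_ex) (use A that in blast)
    have "image_mset \<pi> (image_mset s A) = image_mset (\<lambda>u. u) A"
      unfolding image_mset.compositionality comp_def by (rule image_mset_cong) (use s in blast)
    then have e: "A = image_mset \<pi> (image_mset s A)" by simp
    have "image_mset s A \<in> {M. set_mset M \<subseteq> B_deg i \<and> size M = m}" using s A by auto
    then show "Poly_Mapping.single A (1::'f) \<in>
        (\<lambda>M. Poly_Mapping.single (image_mset \<pi> M) 1) ` {M. set_mset M \<subseteq> B_deg i \<and> size M = m}"
      by (rule image_eqI[rotated]) (simp only: e[symmetric])
  next
    fix M assume "M \<in> {M. set_mset M \<subseteq> B_deg i \<and> size M = m}"
    then have "image_mset \<pi> M \<in> {A. set_mset A \<subseteq> \<pi> ` B_deg i \<and> size A = m}" by auto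
    then show "Poly_Mapping.single (image_mset \<pi> M) (1::'f) \<in>
        (\<lambda>A. Poly_Mapping.single A 1) ` {A. set_mset A \<subseteq> \<pi> ` B_deg i \<and> size A = m}"
      by (rule imageI)
  qed
  then show ?thesis
    using gen_by_sym[OF ev_module_lie[of i] gen_by_lie[of i], of m]
    by (simp only: image_image sym_basis_def[abs_def])
qed

text \<open>The tensor obtained by sorting the factors of \<open>M\<close> by degree. The list
  begins with degree 1, so degree \<open>Suc j\<close> stands at index \<open>j\<close>.\<close>

definition hl_basis :: "nat list \<Rightarrow> ('v list \<Rightarrow>\<^sub>0 'f) multiset \<Rightarrow> (('v list \<Rightarrow>\<^sub>0 'f) set multiset \<Rightarrow>\<^sub>0 'f) set list" where
  "hl_basis lam M = map (\<lambda>i. sym_basis i (count_list lam i) (filter_mset (\<lambda>b. dg b = i) M)) [1..<Suc (sum_list lam)]"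

definition hl_mods :: "nat list \<Rightarrow> ('f, 'g, (('v list \<Rightarrow>\<^sub>0 'f) set multiset \<Rightarrow>\<^sub>0 'f) set) fgmod list" where
  "hl_mods lam = map (\<lambda>i. sym_power (lie_power V i) (count_list lam i)) [1..<Suc (sum_list lam)]"

definition hl_ev :: "nat list \<Rightarrow> ((('v list \<Rightarrow>\<^sub>0 'f) set multiset \<Rightarrow>\<^sub>0 'f) set list \<Rightarrow>\<^sub>0 'f) \<Rightarrow> (('v list \<Rightarrow>\<^sub>0 'f) multiset \<Rightarrow>\<^sub>0 'f)" where
  "hl_ev lam = tens_eval (length (hl_mods lam)) (\<lambda>j. ev_sym (Suc j) (count_list lam (Suc j)))"

lemma length_hl_mods: "length (hl_mods lam) = sum_list lam"
  by (simp add: hl_mods_def del: upt_Suc)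

lemma nth_hl_mods: "j < sum_list lam \<Longrightarrow> hl_mods lam ! j = sym_power (lie_power V (Suc j)) (count_list lam (Suc j))"
  by (simp add: hl_mods_def del: upt_Suc)

lemma nth_hl_basis:
  "j < sum_list lam \<Longrightarrow> hl_basis lam M ! j =
     sym_basis (Suc j) (count_list lam (Suc j)) (filter_mset (\<lambda>b. dg b = Suc j) M)"
  by (simp add: hl_basis_def del: upt_Suc)

lemma length_hl_basis: "length (hl_basis lam M) = sum_list lam"
  by (simp add: hl_basis_def del: upt_Suc)

lemma filter_deg:
  assumes "M \<in> types (mset lam)"
  shows "set_mset (filter_mset (\<lambda>b. dg b = i) M) \<subseteq> B_deg i"
    "size (filter_mset (\<lambda>b. dg b = i) M) = count_list lam i"
proof -
  show "set_mset (filter_mset (\<lambda>b. dg b = i) M) \<subseteq> B_deg i" using assms by (auto simp: types_def B_deg_def)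
  have "size (filter_mset (\<lambda>b. dg b = i) M) = count (P.ty M) i"
    unfolding P.ty_def by (rule count_image_mset_filter[symmetric])
  also have "\<dots> = count_list lam i" using assms by (simp add: types_def count_mset)
  finally show "size (filter_mset (\<lambda>b. dg b = i) M) = count_list lam i" .
qed

text \<open>Multiplying the monomials of the separate degrees restores \<open>M\<close>, since all
  its factors have degrees between 1 and \<open>sum_list lam\<close>.\<close>

lemma hl_ev_basis:
  assumes M: "M \<in> types (mset lam)"
  shows "hl_ev lam (Poly_Mapping.single (hl_basis lam M) 1) = P.z M"
proof -
  have z: "(\<Prod>j<n. P.z (filter_mset (\<lambda>b. dg b = Suc j) M)) = P.z (filter_mset (\<lambda>b. 0 < dg b \<and> dg b \<le> n) M)" for n
  proof (induction n)
    case 0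
    have "filter_mset (\<lambda>b. 0 < dg b \<and> dg b \<le> 0) M = filter_mset (\<lambda>b. False) M"
      by (rule filter_mset_cong) auto
    then have e: "filter_mset (\<lambda>b. 0 < dg b \<and> dg b \<le> 0) M = {#}" by simp
    show ?case unfolding e by simp
  next
    case (Suc n)
    then show ?case by (simp add: filter_mset_split_le z_mult)
  qed
  have "hl_ev lam (Poly_Mapping.single (hl_basis lam M) 1) =
      (\<Prod>j<sum_list lam. ev_sym (Suc j) (count_list lam (Suc j)) (hl_basis lam M ! j))"
    by (simp add: hl_ev_def tens_eval_single length_hl_mods)
  also have "\<dots> = (\<Prod>j<sum_list lam. P.z (filter_mset (\<lambda>b. dg b = Suc j) M))"
    by (rule prod.cong[OF refl]) (simp add: nth_hl_basis ev_sym_basis[OF filter_deg[OF M]])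
  also have "\<dots> = P.z (filter_mset (\<lambda>b. 0 < dg b \<and> dg b \<le> sum_list lam) M)" by (rule z)
  also have "filter_mset (\<lambda>b. 0 < dg b \<and> dg b \<le> sum_list lam) M = M"
  proof -
    have "0 < dg b \<and> dg b \<le> sum_list lam" if b: "b \<in># M" for b
    proof
      have bB: "b \<in> B" and ty: "P.ty M = mset lam" using M b by (auto simp: types_def)
      show "0 < dg b" using dg[OF bB] by simp
      have "dg b \<in># P.ty M" using b by (simp add: P.ty_def)
      then have "dg b \<in> set lam" unfolding ty by simp
      then show "dg b \<le> sum_list lam" by (rule member_le_sum_list) simp
    qed
    then show ?thesis by (simp add: filter_mset_eq_conv)
  qed
  finally show ?thesis .
qed

lemma hl_basis_exists:
  assumes lam: "0 \<notin> set lam" and xs: "length xs = sum_list lam"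
    "\<forall>j<sum_list lam. xs ! j \<in> sym_basis (Suc j) (count_list lam (Suc j)) `
       {M. set_mset M \<subseteq> B_deg (Suc j) \<and> size M = count_list lam (Suc j)}"
  shows "xs \<in> hl_basis lam ` types (mset lam)"
proof -
  let ?r = "sum_list lam"
  have "\<forall>j. \<exists>M. j < ?r \<longrightarrow> set_mset M \<subseteq> B_deg (Suc j) \<and> size M = count_list lam (Suc j) \<and>
      xs ! j = sym_basis (Suc j) (count_list lam (Suc j)) M"
    using xs(2) by blast
  from choice[OF this] obtain Mf where Mf: "\<And>j. j < ?r \<Longrightarrow> set_mset (Mf j) \<subseteq> B_deg (Suc j)"
      "\<And>j. j < ?r \<Longrightarrow> size (Mf j) = count_list lam (Suc j)"
      "\<And>j. j < ?r \<Longrightarrow> xs ! j = sym_basis (Suc j) (count_list lam (Suc j)) (Mf j)"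
    by blast
  define M where "M = (\<Sum>j<?r. Mf j)"
  have fj: "filter_mset (\<lambda>b. dg b = i) (Mf j) = (if i = Suc j then Mf j else {#})" if "j < ?r" for i j
  proof (cases "i = Suc j")
    case True
    then show ?thesis using Mf(1)[OF that] by (auto simp: filter_mset_eq_conv B_deg_def)
  next
    case False
    then have "filter_mset (\<lambda>b. dg b = i) (Mf j) = filter_mset (\<lambda>b. False) (Mf j)"
      using Mf(1)[OF that] by (intro filter_mset_cong) (auto simp: B_deg_def)
    then show ?thesis using False by simp
  qed
  have filt: "filter_mset (\<lambda>b. dg b = i) M = (\<Sum>j<?r. if i = Suc j then Mf j else {#})" for i
    unfolding M_def filter_mset_sum by (rule sum.cong[OF refl]) (simp add: fj)
  have filt_Suc: "filter_mset (\<lambda>b. dg b = Suc j) M = Mf j" if "j < ?r" for j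
    unfolding filt using that by simp
  have filt_other: "filter_mset (\<lambda>b. dg b = i) M = {#}" if "i = 0 \<or> i > ?r" for i
    unfolding filt by (rule sum.neutral) (use that in auto)
  have "P.ty M = mset lam"
  proof (rule multiset_eqI)
    fix i
    have "count (P.ty M) i = size (filter_mset (\<lambda>b. dg b = i) M)"
      unfolding P.ty_def by (rule count_image_mset_filter)
    also have "\<dots> = count_list lam i"
    proof (cases "i = 0 \<or> i > ?r")
      case True
      then have "i \<notin> set lam" using lam member_le_sum_list[of i lam] by auto
      then show ?thesis using filt_other[OF True] by simp
    next
      case False
      then obtain j where "i = Suc j" "j < ?r" by (cases i) auto
      then show ?thesis using filt_Suc Mf(2) by simp
    qed
    finally show "count (P.ty M) i = count (mset lam) i" by (simp only: count_mset)
  qed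
  moreover have "set_mset M \<subseteq> B"
    unfolding M_def using Mf(1) by (auto simp: set_mset_sum B_deg_def)
  ultimately have "M \<in> types (mset lam)" by (simp add: types_def)
  moreover have "xs = hl_basis lam M"
    by (rule nth_equalityI) (simp_all add: xs(1) length_hl_basis nth_hl_basis filt_Suc Mf(3))
  ultimately show ?thesis by blast
qed

definition hl_gens :: "nat list \<Rightarrow> ((('v list \<Rightarrow>\<^sub>0 'f) set multiset \<Rightarrow>\<^sub>0 'f) set list \<Rightarrow>\<^sub>0 'f) set" where
  "hl_gens lam = {x. Poly_Mapping.keys x \<subseteq> tens_gens (hl_mods lam)}"

lemma ev_module_hl_mods:
  "j < length (hl_mods lam) \<Longrightarrow> ev_module G (hl_mods lam ! j) (ev_sym (Suc j) (count_list lam (Suc j))) gam"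
  by (simp add: length_hl_mods nth_hl_mods ev_module_sym_lie)

lemma presents_higher_lie:
  "presents G (higher_lie V lam) (\<lambda>x. x +o tens_rels (hl_mods lam)) (hl_gens lam) (tens_rels (hl_mods lam))
    (\<lambda>x g. pm_push (\<lambda>xs. map2 (\<lambda>M x. act M x g) (hl_mods lam) xs) x)"
  using presents_tensor_product[of "hl_mods lam" G "\<lambda>j. ev_sym (Suc j) (count_list lam (Suc j))" gam,
      OF ev_module_hl_mods]
  by (simp only: higher_lie_def hl_mods_def[symmetric] hl_gens_def)

lemma pm_linear_hl_ev: "pm_linear (hl_ev lam)"
  by (simp add: hl_ev_def pm_linear_tens_eval)

lemma hl_ev_rels: "x \<in> tens_rels (hl_mods lam) \<Longrightarrow> hl_ev lam x = 0"
  unfolding hl_ev_def by (rule tens_eval_rels[OF ev_module_hl_mods])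

lemma hl_ev_act:
  "g \<in> carrier G \<Longrightarrow> x \<in> hl_gens lam \<Longrightarrow>
     hl_ev lam (pm_push (\<lambda>xs. map2 (\<lambda>M x. act M x g) (hl_mods lam) xs) x) = gam g (hl_ev lam x)"
  unfolding hl_ev_def hl_gens_def
  by (rule tens_eval_act[OF ev_module_hl_mods pm_linear_gam gam_mult gam_one]) simp_all

lemma hl_span:
  assumes lam: "0 \<notin> set lam"
  shows "hl_gens lam \<subseteq> pm.span ((\<lambda>M. Poly_Mapping.single (hl_basis lam M) 1) ` types (mset lam) \<union> tens_rels (hl_mods lam))"
proof -
  let ?W = "\<lambda>j. sym_basis (Suc j) (count_list lam (Suc j)) `
       {M. set_mset M \<subseteq> B_deg (Suc j) \<and> size M = count_list lam (Suc j)}"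
  have g: "gen_by (hl_mods lam ! j) (?W j)" if "j < length (hl_mods lam)" for j
    using that gen_by_sym_lie by (simp add: length_hl_mods nth_hl_mods)
  have "(\<lambda>xs. Poly_Mapping.single xs (1::'f)) `
      {xs. length xs = length (hl_mods lam) \<and> (\<forall>i<length (hl_mods lam). xs ! i \<in> ?W i)} \<subseteq>
      (\<lambda>M. Poly_Mapping.single (hl_basis lam M) 1) ` types (mset lam)"
    unfolding length_hl_mods using hl_basis_exists[OF lam] by blast
  then have "pm.span ((\<lambda>xs. Poly_Mapping.single xs (1::'f)) `
      {xs. length xs = length (hl_mods lam) \<and> (\<forall>i<length (hl_mods lam). xs ! i \<in> ?W i)} \<union> tens_rels (hl_mods lam)) \<subseteq>
      pm.span ((\<lambda>M. Poly_Mapping.single (hl_basis lam M) 1) ` types (mset lam) \<union> tens_rels (hl_mods lam))"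
    by (intro pm.span_mono Un_mono subset_refl)
  with tens_span[of "hl_mods lam" ?W, OF g] show ?thesis unfolding hl_gens_def by (rule subset_trans)
qed

text \<open>Modulo the relations, \<open>x\<close> is a combination \<open>a\<close> of the tensors
  \<open>hl_basis lam M\<close>. These are sent by \<open>hl_ev\<close> to the monomials
  \<open>M\<close>, so \<open>a\<close> is recovered from its value. Both the kernel and the image
  of \<open>hl_ev\<close> result from this.\<close>

lemma hl_ev_split:
  assumes lam: "0 \<notin> set lam" and x: "x \<in> hl_gens lam"
  obtains a where "x - a \<in> tens_rels (hl_mods lam)"
    "a = pm_lin (\<lambda>M. Poly_Mapping.single (hl_basis lam M) 1) (hl_ev lam a)"
    "Poly_Mapping.keys (hl_ev lam a) \<subseteq> types (mset lam)"
proof -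
  let ?W = "(\<lambda>M. Poly_Mapping.single (hl_basis lam M) (1::'f)) ` types (mset lam)"
  have "x \<in> pm.span (?W \<union> tens_rels (hl_mods lam))" using hl_span[OF lam] x by blast
  then obtain a b where ab: "a \<in> pm.span ?W" "b \<in> pm.span (tens_rels (hl_mods lam))" "x = a + b"
    unfolding pm.span_Un by blast
  have b: "b \<in> tens_rels (hl_mods lam)"
    using ab(2) pm.span_eq_iff[of "tens_rels (hl_mods lam)"] subspace_tens_rels by blast
  have "a - pm_lin (\<lambda>M. Poly_Mapping.single (hl_basis lam M) 1) (hl_ev lam a) = 0"
  proof (rule pm_linear_kernel_span[of "\<lambda>a. a - pm_lin (\<lambda>M. Poly_Mapping.single (hl_basis lam M) 1) (hl_ev lam a)" ?W, OF _ _ ab(1)])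
    show "pm_linear (\<lambda>a. a - pm_lin (\<lambda>M. Poly_Mapping.single (hl_basis lam M) 1) (hl_ev lam a))"
      by (rule pm_linear_minus[OF pm_linear_id pm_linear_compose[OF pm_linear_lin pm_linear_hl_ev]])
    fix y assume "y \<in> ?W"
    then obtain M where "M \<in> types (mset lam)" "y = Poly_Mapping.single (hl_basis lam M) 1" by blast
    then show "y - pm_lin (\<lambda>M. Poly_Mapping.single (hl_basis lam M) 1) (hl_ev lam y) = 0"
      by (simp add: hl_ev_basis)
  qed
  moreover have "hl_ev lam a \<in> {s. Poly_Mapping.keys s \<subseteq> types (mset lam)}"
  proof (rule pm_linear_span_subset[OF pm_linear_hl_ev subspace_keys _ ab(1)])
    fix y assume "y \<in> ?W"
    then obtain M where "M \<in> types (mset lam)" "y = Poly_Mapping.single (hl_basis lam M) 1" by blast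
    then show "hl_ev lam y \<in> {s. Poly_Mapping.keys s \<subseteq> types (mset lam)}" by (simp add: hl_ev_basis)
  qed
  moreover have "x - a \<in> tens_rels (hl_mods lam)" using ab(3) b by simp
  ultimately show thesis by (intro that[of a]) simp_all
qed

lemma hl_ev_kernel:
  assumes lam: "0 \<notin> set lam" and x: "x \<in> hl_gens lam"
  shows "hl_ev lam x = 0 \<longleftrightarrow> x \<in> tens_rels (hl_mods lam)"
proof
  assume 0: "hl_ev lam x = 0"
  obtain a where a: "x - a \<in> tens_rels (hl_mods lam)"
    "a = pm_lin (\<lambda>M. Poly_Mapping.single (hl_basis lam M) 1) (hl_ev lam a)"
    by (rule hl_ev_split[OF lam x])
  have "hl_ev lam a = 0" using hl_ev_rels[OF a(1)] 0 by (simp add: pm_linear_diff[OF pm_linear_hl_ev])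
  then have "a = 0" using a(2) by simp
  then show "x \<in> tens_rels (hl_mods lam)" using a(1) by simp
qed (rule hl_ev_rels)

lemma hl_ev_image:
  assumes lam: "0 \<notin> set lam"
  shows "hl_ev lam ` hl_gens lam = {s. Poly_Mapping.keys s \<subseteq> types (mset lam)}"
proof (intro equalityI subsetI)
  fix s assume "s \<in> hl_ev lam ` hl_gens lam"
  then obtain x where x: "x \<in> hl_gens lam" "s = hl_ev lam x" by blast
  obtain a where a: "x - a \<in> tens_rels (hl_mods lam)" "Poly_Mapping.keys (hl_ev lam a) \<subseteq> types (mset lam)"
    by (rule hl_ev_split[OF lam x(1)])
  have "hl_ev lam x = hl_ev lam a" using hl_ev_rels[OF a(1)] by (simp add: pm_linear_diff[OF pm_linear_hl_ev])
  then show "s \<in> {s. Poly_Mapping.keys s \<subseteq> types (mset lam)}" using a(2) x(2) by simp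
next
  fix s :: "('v list \<Rightarrow>\<^sub>0 'f) multiset \<Rightarrow>\<^sub>0 'f" assume s: "s \<in> {s. Poly_Mapping.keys s \<subseteq> types (mset lam)}"
  let ?x = "pm_lin (\<lambda>M. Poly_Mapping.single (hl_basis lam M) 1) s"
  have e: "hl_ev lam ?x = s"
    by (rule pm_linear_eqI[of "\<lambda>s. hl_ev lam (pm_lin (\<lambda>M. Poly_Mapping.single (hl_basis lam M) 1) s)" "\<lambda>s. s"])
       (use s in \<open>auto simp: pm_linear_compose[OF pm_linear_hl_ev pm_linear_lin] pm_linear_id hl_ev_basis\<close>)
  have m: "?x \<in> hl_gens lam"
    unfolding hl_gens_def mem_Collect_eq
  proof (rule pm_lin_in_keys)
    fix M assume "M \<in> Poly_Mapping.keys s"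
    then have M: "M \<in> types (mset lam)" using s by blast
    have "hl_basis lam M \<in> tens_gens (hl_mods lam)"
      unfolding tens_gens_def
    proof (intro CollectI conjI allI impI)
      show "length (hl_basis lam M) = length (hl_mods lam)" by (simp add: length_hl_basis length_hl_mods)
      fix j assume "j < length (hl_mods lam)"
      then have j: "j < sum_list lam" by (simp add: length_hl_mods)
      have "sym_basis (Suc j) (count_list lam (Suc j)) (filter_mset (\<lambda>b. dg b = Suc j) M) \<in>
          sym_basis (Suc j) (count_list lam (Suc j)) ` {M. set_mset M \<subseteq> B_deg (Suc j) \<and> size M = count_list lam (Suc j)}"
        by (rule imageI) (simp only: mem_Collect_eq filter_deg[OF M] simp_thms)
      then show "hl_basis lam M ! j \<in> carrier (hl_mods lam ! j)"
        using gen_by_sym_lie[of "Suc j" "count_list lam (Suc j)"] j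
        by (auto simp: gen_by_def nth_hl_basis nth_hl_mods simp del: mem_Collect_eq)
    qed
    then show "Poly_Mapping.keys (Poly_Mapping.single (hl_basis lam M) (1::'f)) \<subseteq> tens_gens (hl_mods lam)" by simp
  qed
  show "s \<in> hl_ev lam ` hl_gens lam" using imageI[OF m, of "hl_ev lam"] unfolding e .
qed

end

section \<open>The filtration\<close>

lemma sort_partition: "lam \<in> partitions r \<Longrightarrow> rev (sorted_list_of_multiset (mset lam)) = lam"
proof -
  assume "lam \<in> partitions r"
  then have "sorted (rev lam)" by (simp add: partitions_def sorted_wrt_rev)
  then have "sort (rev lam) = rev lam" by (rule sorted_sort_id)
  then show ?thesis using sorted_list_of_multiset_mset[of "rev lam"] by simp
qed

lemma partition_of_mset:
  assumes "0 \<notin># \<tau>" "sum_mset \<tau> = r"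
  shows "rev (sorted_list_of_multiset \<tau>) \<in> partitions r"
proof -
  have "sorted (sorted_list_of_multiset \<tau>)" by simp
  moreover have "sum_list (sorted_list_of_multiset \<tau>) = r"
    using assms(2) by (metis mset_sorted_list_of_multiset sum_mset_sum_list)
  moreover have "0 \<notin> set (sorted_list_of_multiset \<tau>)" using assms(1) by simp
  ultimately show ?thesis by (simp add: partitions_def sorted_wrt_rev)
qed

text \<open>At the first difference the part of \<open>theta\<close> exceeds that of
  \<open>lam\<close> and, parts being in decreasing order, all later parts of \<open>lam\<close>. In
  the multiset order this one part outweighs the rest, and the common beginning cancels.\<close>

lemma lex_less_mset:
  assumes "lam \<in> partitions r" "theta \<in> partitions r" "lex_less lam theta"
  shows "mset lam < mset theta"
proof -
  obtain i where i: "i < length lam" "i < length theta" "lam ! i < theta ! i" "\<forall>j<i. lam ! j = theta ! j"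
    using assms(3) by (auto simp: lex_less_def)
  have "take i lam = take i theta" using i by (intro nth_equalityI) auto
  then have e: "mset lam = mset (take i theta) + mset (drop i lam)"
    by (metis append_take_drop_id mset_append)
  have e': "mset theta = mset (take i theta) + mset (drop i theta)"
    by (metis append_take_drop_id mset_append)
  have "mset (drop i lam) < mset (drop i theta)"
  proof (rule ex_gt_imp_less_multiset)
    have "theta ! i \<in># mset (drop i theta)"
      using i(2) by (metis Cons_nth_drop_Suc list.set_intros(1) set_mset_mset)
    moreover have "x < theta ! i" if x: "x \<in># mset (drop i lam)" for x
    proof -
      obtain k where k: "k < length (drop i lam)" "x = drop i lam ! k"
        using x by (metis in_set_conv_nth set_mset_mset)
      have "lam ! (i + k) \<le> lam ! i"
      proof (cases k)
        case (Suc k')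
        then show ?thesis using assms(1) k(1) sorted_wrt_nth_less[of "(\<ge>)" lam i "i + k"]
          by (simp add: partitions_def)
      qed simp
      moreover have "x = lam ! (i + k)" using k i(1) by simp
      ultimately show ?thesis using i(3) by simp
    qed
    ultimately show "\<exists>y. y \<in># mset (drop i theta) \<and> (\<forall>x. x \<in># mset (drop i lam) \<longrightarrow> x < y)" by blast
  qed
  then show ?thesis unfolding e e' by (rule add_strict_left_mono)
qed

lemma partitions_finite: "finite (partitions r)"
  by (rule finite_subset[OF _ compositions_finite[of r]]) (auto simp: partitions_def compositions_def)

lemma ex_perm_cycle_type: "lam \<in> partitions r \<Longrightarrow> \<exists>\<sigma>\<in>perms r. cycle_type r \<sigma> = lam"
proof -
  assume lam: "lam \<in> partitions r"
  then have "0 \<notin> set lam" "sum_list lam = r" by (simp_all add: partitions_def)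
  then show ?thesis
    using ex_perm_young_character[of lam] unfolding sort_partition[OF lam] by blast
qed

lemma p_classes_finite: "finite (p_classes p r)"
  unfolding p_classes_def quotient_def using partitions_finite by simp

lemma p_classes_subset: "J \<in> p_classes p r \<Longrightarrow> J \<subseteq> partitions r"
  by (auto simp: p_classes_def quotient_def)

lemma p_classes_nonempty: "J \<in> p_classes p r \<Longrightarrow> J \<noteq> {}"
proof -
  assume "J \<in> p_classes p r"
  then obtain lam where lam: "lam \<in> partitions r"
    "J = {theta. theta \<in> partitions r \<and> p_equiv p r lam theta}"
    by (auto simp: p_classes_def quotient_def Image_def)
  obtain \<sigma> where \<sigma>: "\<sigma> \<in> perms r" "cycle_type r \<sigma> = lam" using ex_perm_cycle_type[OF lam(1)] by blast
  have "id \<circ> (\<sigma> ^^ (p ^ 1)) \<circ> inv_into UNIV id = \<sigma> ^^ (p ^ 1)" by simp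
  then have "p_equiv p r lam lam"
    unfolding p_equiv_def using \<sigma> id_perms zero_less_one by blast
  then show "J \<noteq> {}" using lam by blast
qed

context fg_module
begin

lemma presents_tensor_power:
  "presents G (tensor_power V r) \<pi> {x. homogeneous r x} (I \<inter> {x. homogeneous r x}) (\<lambda>x g. tw g x)"
  unfolding tensor_power_def
  by (rule presents_carrier[OF presents_tensor subspace_homogeneous]) (simp_all add: tw_homogeneous)

text \<open>The empty sum of sets is \<open>{0}\<close>, which is in general not the neutral element
  \<open>I\<close> of the module, so the index set has to be nonempty.\<close>

lemma pi_sum:
  assumes "finite S" "S \<noteq> {}" shows "(\<Sum>J\<in>S. \<pi> (f J)) = \<pi> (\<Sum>J\<in>S. f J)"
  using assms by (induction S rule: finite_ne_induct) (simp_all add: pi_add)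

lemma place_submodule:
  assumes a: "Poly_Mapping.keys a \<subseteq> perms r"
  shows "fg_submodule G (\<pi> ` place a ` {x. homogeneous r x}) (tensor_power V r)"
proof (rule presents_submodule[OF presents_tensor_power])
  show "pm.subspace (place a ` {x :: 'v list \<Rightarrow>\<^sub>0 'f. homogeneous r x})"
    by (rule pm_linear_subspace_image[OF pm_linear_bilin2 subspace_homogeneous])
  show "place a ` {x :: 'v list \<Rightarrow>\<^sub>0 'f. homogeneous r x} \<subseteq> {x. homogeneous r x}"
    by (auto intro: place_homogeneous)
  fix g and x :: "'v list \<Rightarrow>\<^sub>0 'f" assume "x \<in> place a ` {x. homogeneous r x}"
  then obtain y where "homogeneous r y" "x = place a y" by blast
  then show "tw g x \<in> place a ` {x. homogeneous r x}"
    using place_tw[OF a, of y g] tw_homogeneous[of r y g] by auto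
qed

lemma place_action_carrier:
  assumes a: "Poly_Mapping.keys a \<subseteq> perms r"
  shows "place_action V r a ` carrier (tensor_power V r) = \<pi> ` place a ` {x. homogeneous r x}"
  unfolding presentsD(4)[OF presents_tensor_power] image_image
  by (rule image_cong[OF refl]) (simp add: place_action_pi[OF a])

end

section \<open>The summands belonging to the idempotents\<close>

locale descent_idempotents = lie_basis G V le lt B crd
  for G :: "('g, 'b) monoid_scheme" (structure)
  and V :: "('f::field, 'g, 'v::ab_group_add) fgmod"
  and le lt B crd +
  fixes p r :: nat and e :: "nat list set \<Rightarrow> ((nat \<Rightarrow> nat) \<Rightarrow>\<^sub>0 'f)"
  assumes in_algebra: "J \<in> p_classes p r \<Longrightarrow> e J \<in> descent_algebra r"
    and idempotent: "J \<in> p_classes p r \<Longrightarrow> perm_mult (e J) (e J) = e J"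
    and orthogonal: "J \<in> p_classes p r \<Longrightarrow> K \<in> p_classes p r \<Longrightarrow> J \<noteq> K \<Longrightarrow> perm_mult (e J) (e K) = 0"
    and sum_one: "perm_one = (\<Sum>J\<in>p_classes p r. e J)"
    and vals: "J \<in> p_classes p r \<Longrightarrow> lam \<in> partitions r \<Longrightarrow> \<sigma> \<in> perms r \<Longrightarrow> cycle_type r \<sigma> = lam \<Longrightarrow>
      descent_hom r (e J) \<sigma> = (if lam \<in> J then 1 else 0)"
begin

lemma e_perms: "J \<in> p_classes p r \<Longrightarrow> Poly_Mapping.keys (e J) \<subseteq> perms r"
  by (rule descent_algebra_perms[OF in_algebra])

lemma classes_nonempty: "p_classes p r \<noteq> {}"
proof
  assume "p_classes p r = {}"
  then have "Poly_Mapping.single (id :: nat \<Rightarrow> nat) (1::'f) = 0" using sum_one by (simp add: perm_one_def)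
  then show False by (metis single_zero inj_single injD zero_neq_one)
qed

text \<open>
  Were the \<^term>\<open>descent_elem nu\<close> linearly dependent, \<^const>\<open>pm.representation\<close> and hence
  \<^const>\<open>descent_hom\<close> would be identically zero, against the values prescribed for the idempotents.
\<close>

lemma independent_descent_elem: "pm.independent (descent_elem ` compositions r :: ((nat \<Rightarrow> nat) \<Rightarrow>\<^sub>0 'f) set)"
proof (rule ccontr)
  assume dep: "\<not> pm.independent (descent_elem ` compositions r :: ((nat \<Rightarrow> nat) \<Rightarrow>\<^sub>0 'f) set)"
  obtain J where J: "J \<in> p_classes p r" using classes_nonempty by blast
  then obtain lam where lam: "lam \<in> J" "lam \<in> partitions r"
    using p_classes_nonempty p_classes_subset by blast
  obtain \<sigma> where "\<sigma> \<in> perms r" "cycle_type r \<sigma> = lam" using ex_perm_cycle_type[OF lam(2)] by blast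
  then have "descent_hom r (e J) \<sigma> = 1" using vals[OF J lam(2)] lam(1) by simp
  moreover have "descent_hom r (e J) \<sigma> = 0"
    using dep by (simp add: descent_hom_def pm.representation_def)
  ultimately show False by simp
qed

abbreviation E :: "nat list set \<Rightarrow> ('v list \<Rightarrow>\<^sub>0 'f) \<Rightarrow> ('v list \<Rightarrow>\<^sub>0 'f)" where
  "E J \<equiv> place (e J)"

lemma E_E:
  "J \<in> p_classes p r \<Longrightarrow> K \<in> p_classes p r \<Longrightarrow> homogeneous r x \<Longrightarrow> E J (E K x) = (if J = K then E K x else 0)"
  using place_mult[OF e_perms, of J x "e K"] idempotent[of K] orthogonal[of J K]
    pm_linear_0[OF pm_linear_bilin1] by auto

text \<open>The decomposition by orthogonal idempotents with sum 1, carried out on homogeneous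
  representatives. For uniqueness, \<open>E J\<close> is applied to a difference lying in the ideal;
  it preserves the ideal in degree \<open>r\<close> and isolates the component of
  \<open>J\<close>.\<close>

lemma direct_sum:
  "fg_direct_sum G (tensor_power V r) (p_classes p r)
     (\<lambda>J. place_action V r (e J) ` carrier (tensor_power V r))"
  unfolding fg_direct_sum_def
proof (intro conjI ballI)
  fix J assume "J \<in> p_classes p r"
  then show "fg_submodule G (place_action V r (e J) ` carrier (tensor_power V r)) (tensor_power V r)"
    by (simp only: place_action_carrier[OF e_perms] place_submodule[OF e_perms])
next
  let ?U = "\<lambda>J. place_action V r (e J) ` carrier (tensor_power V r)"
  fix m assume "m \<in> carrier (tensor_power V r)"
  then obtain z where z: "homogeneous r z" "m = \<pi> z"
    unfolding presentsD(4)[OF presents_tensor_power] by blast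
  have U: "?U J = \<pi> ` E J ` {x. homogeneous r x}" if "J \<in> p_classes p r" for J
    by (rule place_action_carrier[OF e_perms[OF that]])
  let ?x = "restrict (\<lambda>J. \<pi> (E J z)) (p_classes p r)"
  show "\<exists>!x. x \<in> (\<Pi>\<^sub>E J\<in>p_classes p r. ?U J) \<and> m = (\<Sum>J\<in>p_classes p r. x J)"
  proof (rule ex1I[of _ ?x], intro conjI)
    show "?x \<in> (\<Pi>\<^sub>E J\<in>p_classes p r. ?U J)"
      using z(1) by (auto simp: U intro!: imageI)
    have "(\<Sum>J\<in>p_classes p r. ?x J) = (\<Sum>J\<in>p_classes p r. \<pi> (E J z))" by simp
    also have "\<dots> = \<pi> (\<Sum>J\<in>p_classes p r. E J z)" by (rule pi_sum[OF p_classes_finite classes_nonempty])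
    also have "(\<Sum>J\<in>p_classes p r. E J z) = z"
    proof -
      have "(\<Sum>J\<in>p_classes p r. E J z) = place (\<Sum>J\<in>p_classes p r. e J) z"
        by (rule pm_linear_sum[OF pm_linear_bilin1, symmetric])
      then show ?thesis unfolding sum_one[symmetric] place_one .
    qed
    finally show "m = (\<Sum>J\<in>p_classes p r. ?x J)" by (simp add: z(2))
  next
    fix x assume x: "x \<in> (\<Pi>\<^sub>E J\<in>p_classes p r. ?U J) \<and> m = (\<Sum>J\<in>p_classes p r. x J)"
    have "\<forall>J\<in>p_classes p r. \<exists>y. homogeneous r y \<and> x J = \<pi> (E J y)"
    proof
      fix J assume J: "J \<in> p_classes p r"
      then have "x J \<in> ?U J" using x by blast
      then show "\<exists>y. homogeneous r y \<and> x J = \<pi> (E J y)" unfolding U[OF J] by blast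
    qed
    from bchoice[OF this] obtain y where y: "\<forall>J\<in>p_classes p r. homogeneous r (y J) \<and> x J = \<pi> (E J (y J))" by blast
    have "\<pi> z = (\<Sum>K\<in>p_classes p r. \<pi> (E K (y K)))" using x y z(2) by simp
    also have "\<dots> = \<pi> (\<Sum>K\<in>p_classes p r. E K (y K))" by (rule pi_sum[OF p_classes_finite classes_nonempty])
    finally have d: "z - (\<Sum>K\<in>p_classes p r. E K (y K)) \<in> I" by (simp add: pi_eq)
    have hom: "homogeneous r (\<Sum>K\<in>p_classes p r. E K (y K))"
      using pm.subspace_sum[OF subspace_homogeneous[of r], of "p_classes p r" "\<lambda>K. E K (y K)"] y
      by (simp add: place_homogeneous)
    show "x = ?x"
    proof
      fix J
      show "x J = ?x J"
      proof (cases "J \<in> p_classes p r")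
        case True
        have "E J (z - (\<Sum>K\<in>p_classes p r. E K (y K))) \<in> I"
          by (rule place_I[OF e_perms[OF True] d]) (rule homogeneous_diff[OF z(1) hom])
        moreover have "E J (\<Sum>K\<in>p_classes p r. E K (y K)) = (\<Sum>K\<in>p_classes p r. if J = K then E K (y K) else 0)"
          unfolding pm_linear_sum[OF pm_linear_bilin2] by (rule sum.cong) (use True y E_E in auto)
        moreover have "(\<Sum>K\<in>p_classes p r. if J = K then E K (y K) else 0) = E J (y J)"
          using True p_classes_finite by simp
        ultimately have "E J z - E J (y J) \<in> I" by (simp add: pm_linear_diff[OF pm_linear_bilin2])
        then have "\<pi> (E J z) = \<pi> (E J (y J))" by (simp only: pi_eq)
        then show ?thesis using True y by simp
      next
        case False
        then show ?thesis using x by (auto simp: PiE_def extensional_def)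
      qed
    qed
  qed
qed

lemma ty_partition:
  assumes "set_mset M \<subseteq> B" "sum_mset (P.ty M) = r"
  shows "rev (sorted_list_of_multiset (P.ty M)) \<in> partitions r"
  using assms dg by (intro partition_of_mset) (fastforce simp: P.ty_def)+

text \<open>The scalar provided by \<open>N_descent_algebra\<close> is here the prescribed value 1
  or 0 of the idempotent.\<close>

lemma N_E_pr:
  assumes J: "J \<in> p_classes p r" and M: "set_mset M \<subseteq> B" "sum_mset (P.ty M) = r"
  shows "Poly_Mapping.keys (N (E J (pr M)) -
      (if rev (sorted_list_of_multiset (P.ty M)) \<in> J then P.z M else 0)) \<subseteq> P.gt (P.ty M)"
proof -
  obtain \<sigma> where \<sigma>: "\<sigma> \<in> perms r" "cycle_type r \<sigma> = rev (sorted_list_of_multiset (P.ty M))"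
    "Poly_Mapping.keys (N (E J (pr M)) - pm_scale (descent_hom r (e J) \<sigma>) (P.z M)) \<subseteq> P.gt (P.ty M)"
    using N_descent_algebra[OF M] in_algebra[OF J] independent_descent_elem by blast
  have "descent_hom r (e J) \<sigma> = (if rev (sorted_list_of_multiset (P.ty M)) \<in> J then 1 else 0)"
    by (rule vals[OF J ty_partition[OF M] \<sigma>(1,2)])
  then have "pm_scale (descent_hom r (e J) \<sigma>) (P.z M) =
      (if rev (sorted_list_of_multiset (P.ty M)) \<in> J then P.z M else 0)" by simp
  with \<sigma>(3) show ?thesis by (simp only:)
qed

lemma sig_homogeneous:
  "Poly_Mapping.keys s \<subseteq> {M. set_mset M \<subseteq> B \<and> sum_mset (P.ty M) = r} \<Longrightarrow> homogeneous r (sig s)"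
proof -
  assume s: "Poly_Mapping.keys s \<subseteq> {M. set_mset M \<subseteq> B \<and> sum_mset (P.ty M) = r}"
  have "sig s \<in> {x. homogeneous r x}"
  proof (rule pm_linear_in_subspace[OF pm_linear_sig subspace_homogeneous])
    fix M assume "M \<in> Poly_Mapping.keys s"
    then have "set_mset M \<subseteq> B" "sum_mset (P.ty M) = r" using s by auto
    then show "sig (P.z M) \<in> {x. homogeneous r x}" using pr_homogeneous[of M] by simp
  qed
  then show ?thesis by simp
qed

lemma pm_linear_N_E_sig: "pm_linear (\<lambda>s. N (E J (sig s)))"
  by (rule pm_linear_compose[OF pm_linear_N pm_linear_compose[OF pm_linear_bilin2 pm_linear_sig]])

text \<open>Replaces \<open>x\<close> by a combination of ordered products, on which
  \<open>N_E_pr\<close> describes the idempotent.\<close>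

lemma N_E_sig:
  assumes J: "J \<in> p_classes p r" and x: "homogeneous r x"
  shows "N (E J x) = N (E J (sig (N x)))"
proof (rule N_cong)
  have "E J (x - sig (N x)) \<in> I"
    by (rule place_I[OF e_perms[OF J] sig_N homogeneous_diff[OF x sig_homogeneous[OF N_homogeneous[OF x]]]])
  then show "E J x - E J (sig (N x)) \<in> I" by (simp add: pm_linear_diff[OF pm_linear_bilin2])
qed

text \<open>Let \<tau> be the least type in \<open>N y\<close>. If its partition were not in
  \<open>J\<close>, then \<open>E J\<close> would send the monomials of type \<tau> to larger types,
  and it never lowers types; so \<open>E J y\<close> would have only types above \<tau>, although
  its normal form is that of \<open>y\<close>.\<close>

lemma min_type:
  assumes J: "J \<in> p_classes p r" and y: "homogeneous r y" "y - E J y \<in> I" "y \<notin> I"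
  obtains lam where "lam \<in> J" "\<And>M. M \<in> Poly_Mapping.keys (N y) \<Longrightarrow> mset lam \<le> P.ty M"
    "\<exists>M\<in>Poly_Mapping.keys (N y). P.ty M = mset lam"
proof -
  have ne: "Poly_Mapping.keys (N y) \<noteq> {}" using y(3) by (simp add: N_eq_0_iff)
  define \<tau> where "\<tau> = Min (P.ty ` Poly_Mapping.keys (N y))"
  have le: "\<tau> \<le> P.ty M" if "M \<in> Poly_Mapping.keys (N y)" for M
    unfolding \<tau>_def using that by (intro Min_le) auto
  have "\<tau> \<in> P.ty ` Poly_Mapping.keys (N y)" unfolding \<tau>_def using ne by (intro Min_in) auto
  then obtain M0 where M0: "M0 \<in> Poly_Mapping.keys (N y)" "P.ty M0 = \<tau>" by auto
  let ?lam = "rev (sorted_list_of_multiset \<tau>)"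
  have lm: "mset ?lam = \<tau>" by simp
  have "?lam \<in> J"
  proof (rule ccontr)
    assume nJ: "?lam \<notin> J"
    have "N (E J (sig (N y))) \<in> {s. Poly_Mapping.keys s \<subseteq> {M. \<tau> < P.ty M}}"
    proof (rule pm_linear_in_subspace[OF pm_linear_N_E_sig subspace_keys])
      fix M assume M: "M \<in> Poly_Mapping.keys (N y)"
      then have MB: "set_mset M \<subseteq> B" "sum_mset (P.ty M) = r" using N_homogeneous[OF y(1)] by auto
      let ?c = "if rev (sorted_list_of_multiset (P.ty M)) \<in> J then P.z M else 0"
      have "P.ty M \<noteq> \<tau>" if "rev (sorted_list_of_multiset (P.ty M)) \<in> J" using that nJ by auto
      then have "Poly_Mapping.keys ?c \<subseteq> {M. \<tau> < P.ty M}"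
        using le[OF M] by (cases "rev (sorted_list_of_multiset (P.ty M)) \<in> J") simp_all
      moreover have "Poly_Mapping.keys (N (E J (pr M)) - ?c) \<subseteq> {M. \<tau> < P.ty M}"
        by (rule subset_trans[OF N_E_pr[OF J MB]]) (auto simp: P.gt_def intro: order_le_less_trans[OF le[OF M]])
      ultimately have "Poly_Mapping.keys ((N (E J (pr M)) - ?c) + ?c) \<subseteq> {M. \<tau> < P.ty M}"
        by (intro keys_add_subset)
      then show "N (E J (sig (P.z M))) \<in> {s. Poly_Mapping.keys s \<subseteq> {M. \<tau> < P.ty M}}" by simp
    qed
    then have "Poly_Mapping.keys (N y) \<subseteq> {M. \<tau> < P.ty M}"
      unfolding mem_Collect_eq trans[OF N_cong[OF y(2)] N_E_sig[OF J y(1)], symmetric] .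
    then show False using M0 by auto
  qed
  then show thesis using that[of ?lam] le M0 lm by auto
qed

text \<open>Representatives of elements of the summand of \<open>J\<close>, which \<open>E J\<close>
  fixes modulo the ideal, whose types lie above every type in \<open>X\<close>. The filtration
  arises by putting the partitions in \<open>J\<close> into \<open>X\<close> one after the
  other.\<close>

definition filt :: "nat list set \<Rightarrow> nat multiset set \<Rightarrow> ('v list \<Rightarrow>\<^sub>0 'f) set" where
  "filt J X = {y. homogeneous r y \<and> y - E J y \<in> I \<and> (\<forall>M\<in>Poly_Mapping.keys (N y). \<forall>\<tau>\<in>X. \<tau> < P.ty M)}"

lemma subspace_filt: "pm.subspace (filt J X)"
proof -
  have "filt J X = {y. homogeneous r y} \<inter> {y. y - E J y \<in> I} \<inter>
      {y. N y \<in> {s. Poly_Mapping.keys s \<subseteq> {M. \<forall>\<tau>\<in>X. \<tau> < P.ty M}}}"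
    by (auto simp: filt_def)
  then show ?thesis
    by (simp only: pm.subspace_inter subspace_homogeneous
        pm_linear_subspace_vimage[OF pm_linear_minus[OF pm_linear_id pm_linear_bilin2] subspace_I]
        pm_linear_subspace_vimage[OF pm_linear_N subspace_keys])
qed

lemma filt_homogeneous: "filt J X \<subseteq> {y. homogeneous r y}"
  by (auto simp: filt_def)

lemma filt_mono: "X \<subseteq> Y \<Longrightarrow> filt J Y \<subseteq> filt J X"
  by (auto simp: filt_def)

lemma filt_tw:
  assumes J: "J \<in> p_classes p r" and g: "g \<in> carrier G" and y: "y \<in> filt J X"
  shows "tw g y \<in> filt J X"
proof -
  have y': "homogeneous r y" "y - E J y \<in> I" "\<forall>M\<in>Poly_Mapping.keys (N y). \<forall>\<tau>\<in>X. \<tau> < P.ty M"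
    using y by (simp_all add: filt_def)
  have "tw g (y - E J y) \<in> I" by (rule tw_I[OF g y'(2)])
  then have "tw g y - E J (tw g y) \<in> I"
    by (simp add: pm_linear_diff[OF pm_linear_tw] place_tw[OF e_perms[OF J] y'(1)])
  moreover have "\<tau> < P.ty M" if M: "M \<in> Poly_Mapping.keys (N (tw g y))" and "\<tau> \<in> X" for M \<tau>
  proof -
    obtain M' where "M' \<in> Poly_Mapping.keys (N y)" "P.ty M' \<le> P.ty M" using N_tw_keys[OF g, of y] M by blast
    then show ?thesis using y'(3) \<open>\<tau> \<in> X\<close> by (auto intro: order_less_le_trans)
  qed
  ultimately show ?thesis using tw_homogeneous[OF y'(1)] by (simp add: filt_def)
qed

lemma filt_I: "J \<in> p_classes p r \<Longrightarrow> y \<in> I \<Longrightarrow> homogeneous r y \<Longrightarrow> y \<in> filt J X"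
  using place_I[OF e_perms, of J y] pm.subspace_diff[OF subspace_I, of y "E J y"] N_I[of y]
  by (simp add: filt_def)

lemma filt_empty:
  assumes J: "J \<in> p_classes p r"
  shows "\<pi> ` filt J {} = place_action V r (e J) ` carrier (tensor_power V r)"
  unfolding place_action_carrier[OF e_perms[OF J]]
proof (intro equalityI image_subsetI)
  fix y assume "y \<in> filt J {}"
  then have y: "homogeneous r y" "y - E J y \<in> I" by (simp_all add: filt_def)
  then have "\<pi> y = \<pi> (E J y)" by (simp only: pi_eq)
  then show "\<pi> y \<in> \<pi> ` E J ` {x. homogeneous r x}" using y(1) by blast
next
  fix y assume "y \<in> E J ` {x. homogeneous r x}"
  then obtain x where x: "homogeneous r x" "y = E J x" by blast
  then have "y \<in> filt J {}"
    using E_E[OF J J x(1)] pm.subspace_0[OF subspace_I] by (simp add: filt_def place_homogeneous)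
  then show "\<pi> y \<in> \<pi> ` filt J {}" by (rule imageI)
qed

text \<open>The least type of a nonzero element belongs to a partition in \<open>J\<close>, so it
  cannot lie above all of these.\<close>

lemma filt_full:
  assumes J: "J \<in> p_classes p r"
  shows "\<pi> ` filt J (mset ` J) = {I}"
proof -
  have "y \<in> I" if y: "y \<in> filt J (mset ` J)" for y
  proof (rule ccontr)
    assume "y \<notin> I"
    moreover have "homogeneous r y" "y - E J y \<in> I" using y by (simp_all add: filt_def)
    ultimately obtain lam where "lam \<in> J" "\<exists>M\<in>Poly_Mapping.keys (N y). P.ty M = mset lam"
      using min_type[OF J, of y] by metis
    then show False using y by (fastforce simp: filt_def)
  qed
  moreover have "0 \<in> filt J (mset ` J)" by (rule pm.subspace_0[OF subspace_filt])
  ultimately have "\<pi> ` filt J (mset ` J) = {\<pi> 0}"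
    using pi_eq[of _ 0] by (auto simp: image_iff)
  then show ?thesis by (simp add: elt_set_plus_def)
qed

text \<open>The component of type \<open>mset lam\<close> of the normal form has the next step of
  the filtration as its kernel and takes all polynomials of that type as values. The map
  \<open>hl_ev\<close> has the same image, and its kernel is the set of relations of the higher Lie
  module. Both maps are equivariant for \<open>gam\<close>, so \<open>presents_iso\<close>
  applies.\<close>

lemma quotient_iso:
  assumes J: "J \<in> p_classes p r" and lam: "lam \<in> J"
    and X: "\<And>theta. theta \<in> J \<Longrightarrow> mset theta \<in> X \<or> mset lam \<le> mset theta"
    and Xlam: "\<And>\<tau>. \<tau> \<in> X \<Longrightarrow> \<tau> < mset lam"
  shows "fg_iso G (quot_mod ((tensor_power V r)\<lparr>carrier := \<pi> ` filt J X\<rparr>) (\<pi> ` filt J (insert (mset lam) X)))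
    (higher_lie V lam)"
proof -
  let ?\<tau> = "mset lam" and ?D = "filt J X" and ?D' = "filt J (insert (mset lam) X)"
  have lamp: "lam \<in> partitions r" using p_classes_subset[OF J] lam by blast
  then have lam0: "0 \<notin> set lam" and lamr: "sum_mset ?\<tau> = r"
    by (simp_all add: partitions_def sum_mset_sum_list)
  \<comment> \<open>The least type of \<open>y\<close> belongs to some \<open>theta\<close> in
    \<open>J\<close>. It is not in \<open>X\<close>, since all types of \<open>y\<close> lie above
    \<open>X\<close>; hence it is at least \<open>mset lam\<close>.\<close>
  have ge: "?\<tau> \<le> P.ty M" if y: "y \<in> ?D" and M: "M \<in> Poly_Mapping.keys (N y)" for y M
  proof -
    have "y \<notin> I" using M N_I by auto
    moreover have y': "homogeneous r y" "y - E J y \<in> I" "\<forall>M\<in>Poly_Mapping.keys (N y). \<forall>\<tau>\<in>X. \<tau> < P.ty M"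
      using y by (simp_all add: filt_def)
    ultimately obtain theta where th: "theta \<in> J" "\<And>M. M \<in> Poly_Mapping.keys (N y) \<Longrightarrow> mset theta \<le> P.ty M"
      "\<exists>M\<in>Poly_Mapping.keys (N y). P.ty M = mset theta"
      using min_type[OF J, of y] by metis
    have "mset theta \<notin> X" using th(3) y'(3) by fastforce
    then have "?\<tau> \<le> mset theta" using X[OF th(1)] by blast
    then show ?thesis using th(2)[OF M] by (rule order_trans)
  qed
  have kernel: "cmp ?\<tau> (N y) = 0 \<longleftrightarrow> y \<in> ?D'" if y: "y \<in> ?D" for y
  proof
    assume 0: "cmp ?\<tau> (N y) = 0"
    have "?\<tau> < P.ty M" if M: "M \<in> Poly_Mapping.keys (N y)" for M
    proof -
      have "M \<notin> Poly_Mapping.keys (cmp ?\<tau> (N y))" using 0 by simp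
      then have "P.ty M \<noteq> ?\<tau>" using M by (simp add: keys_cmp)
      then show ?thesis using ge[OF y M] by simp
    qed
    then show "y \<in> ?D'" using y by (simp add: filt_def)
  next
    assume "y \<in> ?D'"
    then show "cmp ?\<tau> (N y) = 0" by (intro cmp_zero) (auto simp: filt_def)
  qed
  have image: "(\<lambda>y. cmp ?\<tau> (N y)) ` ?D = {s. Poly_Mapping.keys s \<subseteq> types ?\<tau>}"
  proof (intro equalityI subsetI)
    fix s assume "s \<in> (\<lambda>y. cmp ?\<tau> (N y)) ` ?D"
    then show "s \<in> {s. Poly_Mapping.keys s \<subseteq> types ?\<tau>}" using N_over by (fastforce simp: keys_cmp types_def dest: subsetD[OF N_over])
  next
    fix s :: "('v list \<Rightarrow>\<^sub>0 'f) multiset \<Rightarrow>\<^sub>0 'f" assume "s \<in> {s. Poly_Mapping.keys s \<subseteq> types ?\<tau>}"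
    then have s: "Poly_Mapping.keys s \<subseteq> types ?\<tau>" by simp
    \<comment> \<open>The combination of ordered products with the coefficients of \<open>s\<close>,
      projected to the summand of \<open>J\<close>. As \<open>lam\<close> is in \<open>J\<close>,
      the projection leaves the leading term \<open>s\<close> and adds only types above that of
      \<open>lam\<close>.\<close>
    let ?y = "E J (sig s)"
    have hs: "homogeneous r (sig s)"
      by (rule sig_homogeneous) (use s lamr in \<open>auto simp: types_def\<close>)
    have hy: "homogeneous r ?y" by (rule place_homogeneous[OF hs])
    have "N (E J (sig s)) - s \<in> {s. Poly_Mapping.keys s \<subseteq> P.gt ?\<tau>}"
    proof (rule pm_linear_in_subspace[of "\<lambda>s. N (E J (sig s)) - s", OF _ subspace_keys])
      show "pm_linear (\<lambda>s. N (E J (sig s)) - s)" by (rule pm_linear_minus[OF pm_linear_N_E_sig pm_linear_id])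
      fix M assume "M \<in> Poly_Mapping.keys s"
      then have M: "set_mset M \<subseteq> B" "P.ty M = ?\<tau>" using s by (auto simp: types_def)
      have "sum_mset (P.ty M) = r" using M(2) lamr by simp
      from N_E_pr[OF J M(1) this] show "N (E J (sig (P.z M))) - P.z M \<in> {s. Poly_Mapping.keys s \<subseteq> P.gt ?\<tau>}"
        by (simp only: M(2) sort_partition[OF lamp] lam sig_z if_True mem_Collect_eq)
    qed
    then have gt: "Poly_Mapping.keys (N ?y - s) \<subseteq> P.gt ?\<tau>" by simp
    have "cmp ?\<tau> ((N ?y - s) + s) = cmp ?\<tau> (N ?y - s) + cmp ?\<tau> s" by (rule pm_linear_add[OF pm_linear_cmp])
    then have c: "cmp ?\<tau> (N ?y) = s" using cmp_gt[OF gt] cmp_types[OF s] by simp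
    have "Poly_Mapping.keys ((N ?y - s) + s) \<subseteq> {M. ?\<tau> \<le> P.ty M}"
      using gt s by (intro keys_add_subset) (auto simp: P.gt_def types_def)
    then have k: "?\<tau> \<le> P.ty M" if "M \<in> Poly_Mapping.keys (N ?y)" for M using that by auto
    have "\<tau> < P.ty M" if "\<tau> \<in> X" "M \<in> Poly_Mapping.keys (N ?y)" for \<tau> M
      using Xlam[OF that(1)] k[OF that(2)] by (rule order_less_le_trans)
    then have "?y \<in> ?D"
      using hy E_E[OF J J hs] pm.subspace_0[OF subspace_I] by (simp add: filt_def)
    then show "s \<in> (\<lambda>y. cmp ?\<tau> (N y)) ` ?D" using c by (auto intro: image_eqI[where x = ?y])
  qed
  have sub: "?D' \<subseteq> ?D" by (rule filt_mono) blast
  have K: "I \<inter> {x. homogeneous r x} \<inter> ?D \<subseteq> ?D'" using filt_I[OF J] by blast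
  have pres: "presents G (quot_mod ((tensor_power V r)\<lparr>carrier := \<pi> ` ?D\<rparr>) (\<pi> ` ?D'))
      (\<lambda>x. \<pi> x +o \<pi> ` ?D') ?D ?D' (\<lambda>x g. tw g x)"
    by (rule presents_quot[OF presents_carrier[OF presents_tensor_power subspace_filt filt_homogeneous filt_tw[OF J]]
          subspace_filt K sub filt_tw[OF J]])
  show ?thesis
  proof (rule presents_iso[OF pres presents_higher_lie _ _ pm_linear_hl_ev hl_ev_kernel[OF lam0], where \<gamma> = gam])
    show "pm_linear (\<lambda>y. cmp ?\<tau> (N y))" by (rule pm_linear_compose[OF pm_linear_cmp pm_linear_N])
    show "cmp ?\<tau> (N y) = 0 \<longleftrightarrow> y \<in> ?D'" if "y \<in> ?D" for y by (rule kernel[OF that])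
    show "(\<lambda>y. cmp ?\<tau> (N y)) ` ?D = hl_ev lam ` hl_gens lam" unfolding image hl_ev_image[OF lam0] ..
    show "cmp ?\<tau> (N (tw g y)) = gam g (cmp ?\<tau> (N y))" if "g \<in> carrier G" "y \<in> ?D" for g y
      by (rule cmp_N_tw[OF that(1)]) (rule ge[OF that(2)])
    show "hl_ev lam (pm_push (\<lambda>xs. map2 (\<lambda>M x. fgmod.act M x g) (hl_mods lam) xs) x) = gam g (hl_ev lam x)"
      if "g \<in> carrier G" "x \<in> hl_gens lam" for g x
      by (rule hl_ev_act[OF that])
  qed
qed

lemma filtration:
  assumes J: "J \<in> p_classes p r" and lams: "set lams = J" "sorted_wrt lex_less lams"
  shows "\<exists>U. U 1 = place_action V r (e J) ` carrier (tensor_power V r) \<and>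
    U (length lams + 1) = {tensor_ideal V} \<and>
    (\<forall>j\<in>{1..length lams + 1}. fg_submodule G (U j) (tensor_power V r)) \<and>
    (\<forall>j\<in>{1..length lams}. U (j + 1) \<subseteq> U j \<and>
       fg_iso G (quot_mod ((tensor_power V r)\<lparr>carrier := U j\<rparr>) (U (j + 1))) (higher_lie V (lams ! (j - 1))))"
proof -
  \<comment> \<open>The steps are numbered from 1: at step \<open>j\<close> the first
    \<open>j - 1\<close> partitions have been passed, none for \<open>U 1\<close> and all of them
    for the last term.\<close>
  define X where "X j = mset ` set (take (j - 1) lams)" for j
  define U where "U j = \<pi> ` filt J (X j)" for j
  have lp: "lam \<in> partitions r" if "lam \<in> set lams" for lam
    using p_classes_subset[OF J] that lams(1) by blast
  have less: "mset (lams ! i) < mset (lams ! j)" if "i < j" "j < length lams" for i j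
    using sorted_wrt_nth_less[OF lams(2) that] that by (intro lex_less_mset[of _ r] lp) auto
  have XS: "X (j + 1) = insert (mset (lams ! (j - 1))) (X j)" if "j \<in> {1..length lams}" for j
  proof -
    have "take j lams = take (j - 1) lams @ [lams ! (j - 1)]"
      using take_Suc_conv_app_nth[of "j - 1" lams] that by (cases j) simp_all
    then show ?thesis by (simp add: X_def)
  qed
  show ?thesis
  proof (intro exI[of _ U] conjI ballI)
    show "U 1 = place_action V r (e J) ` carrier (tensor_power V r)"
      unfolding U_def X_def using filt_empty[OF J] by simp
    show "U (length lams + 1) = {tensor_ideal V}"
      unfolding U_def X_def using filt_full[OF J] lams(1) by simp
  next
    fix j
    show "fg_submodule G (U j) (tensor_power V r)"
      unfolding U_def by (rule presents_submodule[OF presents_tensor_power subspace_filt filt_homogeneous filt_tw[OF J]])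
  next
    fix j assume j: "j \<in> {1..length lams}"
    show "U (j + 1) \<subseteq> U j" unfolding U_def XS[OF j] by (intro image_mono filt_mono) blast
    have jl: "j - 1 < length lams" using j by auto
    show "fg_iso G (quot_mod ((tensor_power V r)\<lparr>carrier := U j\<rparr>) (U (j + 1))) (higher_lie V (lams ! (j - 1)))"
      unfolding U_def XS[OF j]
    proof (rule quotient_iso[OF J])
      show "lams ! (j - 1) \<in> J" using jl lams(1) by auto
      fix theta assume "theta \<in> J"
      then obtain i where i: "i < length lams" "theta = lams ! i" using lams(1) by (auto simp: in_set_conv_nth)
      consider "i < j - 1" | "i = j - 1" | "j - 1 < i" by linarith
      then show "mset theta \<in> X j \<or> mset (lams ! (j - 1)) \<le> mset theta"
      proof cases
        case 1
        then have "lams ! i \<in> set (take (j - 1) lams)" using i(1) by (auto simp: in_set_conv_nth intro!: exI[of _ i])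
        then show ?thesis by (simp add: X_def i(2))
      next
        case 2
        then show ?thesis using i(2) by simp
      next
        case 3
        then show ?thesis using less[OF 3 i(1)] unfolding i(2) by (intro disjI2 less_imp_le)
      qed
    next
      fix \<tau> assume "\<tau> \<in> X j"
      then obtain i where "i < j - 1" "\<tau> = mset (lams ! i)"
        by (auto simp: X_def in_set_conv_nth)
      then show "\<tau> < mset (lams ! (j - 1))" using less jl by blast
    qed
  qed
qed

end

theorem theorem3p4:
  fixes G :: "('g, 'b) monoid_scheme"
    and V :: "('f::field, 'g, 'v::ab_group_add) fgmod"
    and p r :: nat
    and e :: "nat list set \<Rightarrow> ((nat \<Rightarrow> nat) \<Rightarrow>\<^sub>0 'f)"
  assumes "prime p" and "CHAR('f) = p" and "r > 0"
    and "fg_module G V"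
    and primitive: "\<And>J. J \<in> p_classes p r \<Longrightarrow> primitive_idempotent_in (descent_algebra r) (e J)"
    and orthogonal: "\<And>J K. J \<in> p_classes p r \<Longrightarrow> K \<in> p_classes p r \<Longrightarrow> J \<noteq> K \<Longrightarrow>
      perm_mult (e J) (e K) = 0"
    and sum_one: "perm_one = (\<Sum>J\<in>p_classes p r. e J)"
    and vals: "\<And>J lam \<sigma>. J \<in> p_classes p r \<Longrightarrow> lam \<in> partitions r \<Longrightarrow>
      \<sigma> \<in> perms r \<Longrightarrow> cycle_type r \<sigma> = lam \<Longrightarrow>
      descent_hom r (e J) \<sigma> = (if lam \<in> J then 1 else 0)"
  shows "fg_direct_sum G (tensor_power V r) (p_classes p r)
           (\<lambda>J. place_action V r (e J) ` carrier (tensor_power V r)) \<and>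
         (\<forall>J\<in>p_classes p r. \<forall>lams. set lams = J \<and> sorted_wrt lex_less lams \<longrightarrow>
           (\<exists>U. U 1 = place_action V r (e J) ` carrier (tensor_power V r) \<and>
                U (length lams + 1) = {tensor_ideal V} \<and>
                (\<forall>j\<in>{1..length lams + 1}. fg_submodule G (U j) (tensor_power V r)) \<and>
                (\<forall>j\<in>{1..length lams}. U (j + 1) \<subseteq> U j \<and>
                   fg_iso G (quot_mod ((tensor_power V r)\<lparr>carrier := U j\<rparr>) (U (j + 1)))
                            (higher_lie V (lams ! (j - 1))))))"
proof -
  obtain le lt B crd where lb: "lie_basis G V le lt B crd"
    using fg_module.ex_lie_basis[OF \<open>fg_module G V\<close>] by (elim exE)
  have idem: "e J \<in> descent_algebra r \<and> perm_mult (e J) (e J) = e J" if "J \<in> p_classes p r" for J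
    using primitive[OF that] by (simp add: primitive_idempotent_in_def idempotent_in_def)
  interpret descent_idempotents G V le lt B crd p r e
    by (intro descent_idempotents.intro lb descent_idempotents_axioms.intro)
       (use idem orthogonal sum_one vals in blast)+
  show ?thesis using direct_sum filtration by blast
qed

end
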